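(* Let $G$ be a finite group and let $\omega$ be a normalized $3$-cocycle on $G$ with values in $k^\times$. The assignment $(H,B)\mapsto\mathcal{L}_{(H,B)}$ is a bijection from the set of pairs $(H,B)$, where $H$ is a normal Abelian subgroup of $G$ such that $\omega|_{H\times H\times H}$ is cohomologically trivial and $B:H\times H\to k^\times$ is a $G$-invariant alternating $\omega$-bicharacter, onto the set of Lagrangian subcategories of the representation category $\mathrm{Rep}(D^\omega(G))$ of the twisted double $D^\omega(G)$.
   Context: $k$ is an algebraically closed field of characteristic zero; cocycles have values in the trivial module $k^\times$. A $3$-cocycle satisfies $\omega(g_2,g_3,g_4)\omega(g_1,g_2g_3,g_4)\omega(g_1,g_2,g_3)=\omega(g_1g_2,g_3,g_4)\omega(g_1,g_2,g_3g_4)$, and is normalized if $\omega(g,1,l)=1$ for all $g,l$. **The functions $\beta_a$.** For $a,h,g\in G$, $$\beta_a(h,g)=\omega(a,h,g)\,\omega(h,h^{-1}ah,g)^{-1}\,\omega(h,g,(hg)^{-1}ahg).$$ **The category $\mathrm{Rep}(D^\omega(G))$.** $D^\omega(G)$ is the Dijkgraaf–Pasquier–Roche quasi-triangular quasi-Hopf algebra with basis $e(g)x$ ($g,x\in G$), product $(e(g)x)(e(h)y)=\delta_{x^{-1}gx,h}\,\beta_g(x,y)\,e(g)xy$, coproduct $\Delta(e(g)x)=\sum_{hk=g}\gamma_x(h,k)\,e(h)x\otimes e(k)x$ with $\gamma_x(h,k)=\omega(h,k,x)\omega(x,x^{-1}hx,x^{-1}kx)/\omega(h,x,x^{-1}kx)$,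 associator $\sum\omega(g,h,l)^{-1}e(g)\otimes e(h)\otimes e(l)$ (where $e(g)=e(g)1$), and $R$-matrix $\sum_{g,h}e(g)\otimes e(h)g$. Its category of finite-dimensional representations is modular and equivalent to the center of $\mathrm{Vec}_G^\omega$; the dimension $d(V)$ is the vector space dimension, and the twist acts on $e(g)V$ by $e(g)g$. Let $R$ be a set of representatives of the conjugacy classes of $G$, $K_a$ the class of $a$, $C_G(a)$ its centralizer. For a $2$-cocycle $\alpha$ on a group $K$, a (projective) $\alpha$-character is the trace function of a projective representation $\rho$ with $\rho(x)\rho(y)=\alpha(x,y)\rho(xy)$; its degree is $\dim\rho$. The restriction of $\beta_a$ to $C_G(a)$ is a $2$-cocycle. Isomorphism classes of simple objects are identified with the set $\Gamma$ of pairs $(a,\chi)$, $a\in R$, $\chi$ an irreducible $\beta_a$-character of $C_G(a)$ (namely $V$ is supported on $K_a$ and $e(a)V$ affords $\chi$). One has $d(a,\chi)=|K_a|\deg\chi$ and twist $\theta_{(a,\chi)}=\chi(a)/\deg\chi$. **Lagrangian subcategories.** A fusion subcategory of a modular category $\mathcal{C}$ is a full subcategory closed under isomorphism, direct sums, direct summands, tensor products and duals and containing the unit. For a full subcategory $\mathcal{D}$, $\dim(\mathcal{D})=\sum_X d(X)^2$, the sum over isomorphism classes of simple objects of $\mathcal{D}$. A fusion subcategory $\mathcal{D}$ is isotropic if the twist restricts to the identity on $\mathcal{D}$, and Lagrangian if it is isotropic and $\dim(\mathcal{D})^2=\dim(\mathcal{C})$. **Alternating $\omega$-bicharacters.** Let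 $H$ be a normal Abelian subgroup of $G$. A map $B:H\times H\to k^\times$ is an alternating $\omega$-bicharacter on $H$ if for all $h,h_1,h_2\in H$: $B(h_1,h_2)=B(h_2,h_1)^{-1}$; $B(h,h)=1$; and $\dfrac{B(h,h_1)B(h,h_2)}{B(h,h_1h_2)}=\beta_h(h_1,h_2)$. It is $G$-invariant if $$B(x^{-1}ax,h)=\frac{\beta_a(x,h)\,\beta_a(xh,x^{-1})}{\beta_a(x,x^{-1})}\,B(a,xhx^{-1})\quad\text{for all }x\in G,\ a\in H\cap R,\ h\in H.$$ **The subcategory $\mathcal{L}_{(H,B)}$.** It is the full Abelian subcategory of $\mathrm{Rep}(D^\omega(G))$ generated by (finite direct sums of) the simple objects $(a,\chi)\in\Gamma$ with $a\in H\cap R$ and $\chi(h)=B(a,h)\deg\chi$ for all $h\in H$. *)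

theory Defs
  imports
    "HOL-Algebra.Coset"
    "HOL-Computational_Algebra.Polynomial"
    "Jordan_Normal_Form.VS_Connect"
begin

text \<open>
  Conventions.  Cochains on a group with values in \<open>k\<^sup>\<times>\<close> are functions into the field
  type that are nonzero on the carrier; their values elsewhere are irrelevant.
  An object of \<open>Rep(D\<^sup>\<omega>(G))\<close> is a representation on a coordinate space \<open>k\<^sup>n\<close> (zero objects
  included), given by the matrices of the basis elements \<open>e(g)x\<close>; every finite-dimensional
  representation is isomorphic to such a one.  A full subcategory is identified with its class
  of objects.
\<close>

section \<open>Matrices\<close>

definition mat_sum :: "nat \<Rightarrow> nat \<Rightarrow> ('i \<Rightarrow> 'k::field mat) \<Rightarrow> 'i set \<Rightarrow> 'k mat" where
  "mat_sum nr nc A I = mat nr nc (\<lambda>ij. \<Sum>i\<in>I. A i $$ ij)"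

definition mat_trace :: "'k::field mat \<Rightarrow> 'k" where
  "mat_trace A = (\<Sum>i<dim_row A. A $$ (i, i))"

text \<open>
  The Kronecker product, in which the pair of basis indices \<open>(i, j)\<close> is encoded as
  \<open>i * n + j\<close> with \<open>n\<close> the size of the second factor.  It is strictly
  associative, so both bracketings of a triple tensor product live on the same space.
\<close>

definition kronecker :: "'k::field mat \<Rightarrow> 'k mat \<Rightarrow> 'k mat" where
  "kronecker A B = mat (dim_row A * dim_row B) (dim_col A * dim_col B)
     (\<lambda>(i, j). A $$ (i div dim_row B, j div dim_col B) * B $$ (i mod dim_row B, j mod dim_col B))"

definition irreducible_mats :: "nat \<Rightarrow> 'k::field mat set \<Rightarrow> bool" where
  "irreducible_mats n S \<longleftrightarrow> 0 < n \<and>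
     (\<forall>W. VectorSpace.subspace class_ring W (module_vec TYPE('k) n) \<longrightarrow>
          (\<forall>A\<in>S. \<forall>w\<in>W. A *\<^sub>v w \<in> W) \<longrightarrow> W = {0\<^sub>v n} \<or> W = carrier_vec n)"


record ('g, 'k) rep =
  vdim :: nat
  act :: "'g \<Rightarrow> 'g \<Rightarrow> 'k mat"  \<comment> \<open>\<open>act V g x\<close> is the matrix of \<open>e(g)x\<close>\<close>

context
  fixes G :: "('g, 'm) monoid_scheme" (structure)
begin

section \<open>Groups and cocycles\<close>

definition conj_class :: "'g \<Rightarrow> 'g set" where
  "conj_class a = {x \<otimes> a \<otimes> inv x | x. x \<in> carrier G}"

definition centralizer :: "'g \<Rightarrow> 'g set" where
  "centralizer a = {x \<in> carrier G. x \<otimes> a = a \<otimes> x}"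

definition class_representatives :: "'g set \<Rightarrow> bool" where
  "class_representatives R \<longleftrightarrow>
     R \<subseteq> carrier G \<and> (\<forall>g\<in>carrier G. \<exists>!a. a \<in> R \<and> g \<in> conj_class a)"

definition normal_abelian_subgroup :: "'g set \<Rightarrow> bool" where
  "normal_abelian_subgroup H \<longleftrightarrow> H \<lhd> G \<and> (\<forall>h\<in>H. \<forall>h'\<in>H. h \<otimes> h' = h' \<otimes> h)"

definition three_cocycle :: "('g \<Rightarrow> 'g \<Rightarrow> 'g \<Rightarrow> 'k::field) \<Rightarrow> bool" where
  "three_cocycle \<omega> \<longleftrightarrow>
     (\<forall>g1\<in>carrier G. \<forall>g2\<in>carrier G. \<forall>g3\<in>carrier G. \<omega> g1 g2 g3 \<noteq> 0) \<and>
     (\<forall>g1\<in>carrier G. \<forall>g2\<in>carrier G. \<forall>g3\<in>carrier G. \<forall>g4\<in>carrier G.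
        \<omega> g2 g3 g4 * \<omega> g1 (g2 \<otimes> g3) g4 * \<omega> g1 g2 g3 = \<omega> (g1 \<otimes> g2) g3 g4 * \<omega> g1 g2 (g3 \<otimes> g4))"

definition normalized :: "('g \<Rightarrow> 'g \<Rightarrow> 'g \<Rightarrow> 'k::field) \<Rightarrow> bool" where
  "normalized \<omega> \<longleftrightarrow> (\<forall>g\<in>carrier G. \<forall>l\<in>carrier G. \<omega> g \<one> l = 1)"

definition cohomologically_trivial_on :: "'g set \<Rightarrow> ('g \<Rightarrow> 'g \<Rightarrow> 'g \<Rightarrow> 'k::field) \<Rightarrow> bool" where
  "cohomologically_trivial_on H \<omega> \<longleftrightarrow>
     (\<exists>\<eta>. (\<forall>a\<in>H. \<forall>b\<in>H. \<eta> a b \<noteq> 0) \<and>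
          (\<forall>a\<in>H. \<forall>b\<in>H. \<forall>c\<in>H. \<omega> a b c = \<eta> b c * \<eta> a (b \<otimes> c) / (\<eta> (a \<otimes> b) c * \<eta> a b)))"

section \<open>Projective characters\<close>

definition projective_rep ::
  "'g set \<Rightarrow> ('g \<Rightarrow> 'g \<Rightarrow> 'k::field) \<Rightarrow> nat \<Rightarrow> ('g \<Rightarrow> 'k mat) \<Rightarrow> bool" where
  "projective_rep K \<alpha> d \<sigma> \<longleftrightarrow>
     (\<forall>x\<in>K. \<sigma> x \<in> carrier_mat d d \<and> invertible_mat (\<sigma> x)) \<and>
     (\<forall>x\<in>K. \<forall>y\<in>K. \<sigma> x * \<sigma> y = \<alpha> x y \<cdot>\<^sub>m \<sigma> (x \<otimes> y))"

text \<open>Characters are cut off outside their group, so that they are equal iff they agree on it.\<close>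

definition proj_character :: "'g set \<Rightarrow> ('g \<Rightarrow> 'k::field mat) \<Rightarrow> 'g \<Rightarrow> 'k" where
  "proj_character K \<sigma> = restrict (\<lambda>x. mat_trace (\<sigma> x)) K"

definition irr_proj_characters :: "'g set \<Rightarrow> ('g \<Rightarrow> 'g \<Rightarrow> 'k::field) \<Rightarrow> ('g \<Rightarrow> 'k) set" where
  "irr_proj_characters K \<alpha> =
     {proj_character K \<sigma> | d \<sigma>. projective_rep K \<alpha> d \<sigma> \<and> irreducible_mats d (\<sigma> ` K)}"

text \<open>
  In characteristic zero the degree is determined by the character: \<open>\<sigma>(1)\<close> is the scalar
  matrix \<open>\<alpha>(1,1)\<close>, so the character takes the value \<open>\<alpha>(1,1) d\<close> at \<open>1\<close>.
\<close>

definition proj_degree :: "'g set \<Rightarrow> ('g \<Rightarrow> 'g \<Rightarrow> 'k::field) \<Rightarrow> ('g \<Rightarrow> 'k) \<Rightarrow> nat" where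
  "proj_degree K \<alpha> \<chi> = (THE d. \<exists>\<sigma>. projective_rep K \<alpha> d \<sigma> \<and> \<chi> = proj_character K \<sigma>)"

section \<open>Morphisms, direct sums and the unit object\<close>

definition hom_rep :: "('g, 'k::field) rep \<Rightarrow> ('g, 'k) rep \<Rightarrow> 'k mat set" where
  "hom_rep V W = {f \<in> carrier_mat (vdim W) (vdim V).
     \<forall>g\<in>carrier G. \<forall>x\<in>carrier G. f * act V g x = act W g x * f}"

definition iso_rep :: "('g, 'k::field) rep \<Rightarrow> ('g, 'k) rep \<Rightarrow> bool" where
  "iso_rep V W \<longleftrightarrow> (\<exists>f\<in>hom_rep V W. \<exists>f'\<in>hom_rep W V. f' * f = 1\<^sub>m (vdim V) \<and> f * f' = 1\<^sub>m (vdim W))"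

definition direct_sum :: "('g, 'k::field) rep list \<Rightarrow> ('g, 'k) rep" where
  "direct_sum Vs = \<lparr>vdim = sum_list (map vdim Vs), act = (\<lambda>g x. diag_block_mat (map (\<lambda>V. act V g x) Vs))\<rparr>"

text \<open>The unit object is the counit \<open>\<epsilon>(e(g)x) = \<delta>\<^bsub>g,1\<^esub>\<close>.\<close>

definition unit_rep :: "('g, 'k::field) rep" where
  "unit_rep = \<lparr>vdim = 1, act = (\<lambda>g x. if g = \<one> then 1\<^sub>m 1 else 0\<^sub>m 1 1)\<rparr>"

text \<open>The twist acts on \<open>e(g)V\<close> by \<open>e(g)g\<close>, and \<open>V\<close> is the direct sum of the \<open>e(g)V\<close>.\<close>

definition twist :: "('g, 'k::field) rep \<Rightarrow> 'k mat" where
  "twist V = mat_sum (vdim V) (vdim V) (\<lambda>g. act V g g) (carrier G)"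

context
  fixes \<omega> :: "'g \<Rightarrow> 'g \<Rightarrow> 'g \<Rightarrow> 'k::field"
begin

section \<open>The representation category of the twisted double\<close>

definition beta :: "'g \<Rightarrow> 'g \<Rightarrow> 'g \<Rightarrow> 'k" where
  "beta a h g = \<omega> a h g * inverse (\<omega> h (inv h \<otimes> a \<otimes> h) g)
                 * \<omega> h g (inv (h \<otimes> g) \<otimes> a \<otimes> (h \<otimes> g))"

definition gamma :: "'g \<Rightarrow> 'g \<Rightarrow> 'g \<Rightarrow> 'k" where
  "gamma x h k = \<omega> h k x * \<omega> x (inv x \<otimes> h \<otimes> x) (inv x \<otimes> k \<otimes> x) / \<omega> h x (inv x \<otimes> k \<otimes> x)"

text \<open>The unit of the algebra is the sum of all \<open>e(g)1\<close>.\<close>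

definition Rep_double :: "('g, 'k) rep set" where
  "Rep_double = {V.
     (\<forall>g\<in>carrier G. \<forall>x\<in>carrier G. act V g x \<in> carrier_mat (vdim V) (vdim V)) \<and>
     (\<forall>g\<in>carrier G. \<forall>x\<in>carrier G. \<forall>h\<in>carrier G. \<forall>y\<in>carrier G.
        act V g x * act V h y =
          (if inv x \<otimes> g \<otimes> x = h then beta g x y \<cdot>\<^sub>m act V g (x \<otimes> y)
           else 0\<^sub>m (vdim V) (vdim V))) \<and>
     mat_sum (vdim V) (vdim V) (\<lambda>g. act V g \<one>) (carrier G) = 1\<^sub>m (vdim V)}"

definition simple_rep :: "('g, 'k) rep \<Rightarrow> bool" where
  "simple_rep V \<longleftrightarrow> V \<in> Rep_double \<and>
     irreducible_mats (vdim V) {act V g x | g x. g \<in> carrier G \<and> x \<in> carrier G}"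

text \<open>\<open>D\<^sup>\<omega>(G)\<close> acts on a tensor product through the coproduct.\<close>

definition tensor_rep :: "('g, 'k) rep \<Rightarrow> ('g, 'k) rep \<Rightarrow> ('g, 'k) rep" where
  "tensor_rep V W = \<lparr>vdim = vdim V * vdim W,
     act = (\<lambda>g x. mat_sum (vdim V * vdim W) (vdim V * vdim W)
       (\<lambda>(h, k). gamma x h k \<cdot>\<^sub>m kronecker (act V h x) (act W k x))
       {(h, k). h \<in> carrier G \<and> k \<in> carrier G \<and> h \<otimes> k = g})\<rparr>"

text \<open>
  The associativity constraint \<open>(U \<otimes> V) \<otimes> W \<rightarrow> U \<otimes> (V \<otimes> W)\<close> is the action of the associator;
  the \<open>e(g) \<otimes> e(h) \<otimes> e(l)\<close> are orthogonal idempotents, so its inverse has the coefficients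
  \<open>\<omega>(g,h,l)\<close>.
\<close>

definition assoc_mat :: "('g, 'k) rep \<Rightarrow> ('g, 'k) rep \<Rightarrow> ('g, 'k) rep \<Rightarrow> 'k mat" where
  "assoc_mat U V W = mat_sum (vdim U * vdim V * vdim W) (vdim U * vdim V * vdim W)
     (\<lambda>(g, h, l). inverse (\<omega> g h l) \<cdot>\<^sub>m
        kronecker (kronecker (act U g \<one>) (act V h \<one>)) (act W l \<one>))
     (carrier G \<times> carrier G \<times> carrier G)"

definition assoc_inv_mat :: "('g, 'k) rep \<Rightarrow> ('g, 'k) rep \<Rightarrow> ('g, 'k) rep \<Rightarrow> 'k mat" where
  "assoc_inv_mat U V W = mat_sum (vdim U * vdim V * vdim W) (vdim U * vdim V * vdim W)
     (\<lambda>(g, h, l). \<omega> g h l \<cdot>\<^sub>m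
        kronecker (kronecker (act U g \<one>) (act V h \<one>)) (act W l \<one>))
     (carrier G \<times> carrier G \<times> carrier G)"

text \<open>
  \<open>W\<close> is a (left) dual of \<open>V\<close>: there are morphisms \<open>ev : W \<otimes> V \<rightarrow> 1\<close> and
  \<open>coev : 1 \<rightarrow> V \<otimes> W\<close> satisfying the two triangle identities.  The unit constraints are
  identities because \<open>\<omega>\<close> is normalized.
\<close>

definition is_dual :: "('g, 'k) rep \<Rightarrow> ('g, 'k) rep \<Rightarrow> bool" where
  "is_dual V W \<longleftrightarrow>
     (\<exists>ev \<in> hom_rep (tensor_rep W V) unit_rep. \<exists>coev \<in> hom_rep unit_rep (tensor_rep V W).
        kronecker (1\<^sub>m (vdim V)) ev * assoc_mat V W V * kronecker coev (1\<^sub>m (vdim V)) = 1\<^sub>m (vdim V) \<and>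
        kronecker ev (1\<^sub>m (vdim W)) * assoc_inv_mat W V W * kronecker (1\<^sub>m (vdim W)) coev = 1\<^sub>m (vdim W))"

section \<open>Lagrangian subcategories\<close>

definition fusion_subcategory :: "('g, 'k) rep set \<Rightarrow> bool" where
  "fusion_subcategory D \<longleftrightarrow> D \<subseteq> Rep_double \<and>
     (\<forall>V\<in>D. \<forall>W\<in>Rep_double. iso_rep V W \<longrightarrow> W \<in> D) \<and>
     (\<forall>Vs. set Vs \<subseteq> D \<longrightarrow> direct_sum Vs \<in> D) \<and>
     (\<forall>V\<in>Rep_double. \<forall>W\<in>Rep_double. direct_sum [V, W] \<in> D \<longrightarrow> V \<in> D \<and> W \<in> D) \<and>
     (\<forall>V\<in>D. \<forall>W\<in>D. tensor_rep V W \<in> D) \<and>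
     (\<forall>V\<in>D. \<forall>W\<in>Rep_double. is_dual V W \<longrightarrow> W \<in> D) \<and>
     unit_rep \<in> D"

definition iso_rel :: "(('g, 'k) rep \<times> ('g, 'k) rep) set" where
  "iso_rel = {(V, W). V \<in> Rep_double \<and> W \<in> Rep_double \<and> iso_rep V W}"

text \<open>The sum is finite because \<open>D\<^sup>\<omega>(G)\<close> is a finite-dimensional algebra.\<close>

definition cat_dim :: "('g, 'k) rep set \<Rightarrow> nat" where
  "cat_dim D = (\<Sum>X\<in>{V \<in> D. simple_rep V} // iso_rel. (vdim (SOME V. V \<in> X))\<^sup>2)"

definition isotropic :: "('g, 'k) rep set \<Rightarrow> bool" where
  "isotropic D \<longleftrightarrow> fusion_subcategory D \<and> (\<forall>V\<in>D. twist V = 1\<^sub>m (vdim V))"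

definition lagrangian :: "('g, 'k) rep set \<Rightarrow> bool" where
  "lagrangian D \<longleftrightarrow> isotropic D \<and> (cat_dim D)\<^sup>2 = cat_dim Rep_double"

section \<open>Alternating \<open>\<omega>\<close>-bicharacters and the subcategories they define\<close>

text \<open>
  \<open>B\<close> is a function on \<open>H \<times> H\<close>, hence extensional: two bicharacters are equal iff they agree
  on \<open>H \<times> H\<close>.
\<close>

definition alternating_bicharacter :: "'g set \<Rightarrow> ('g \<times> 'g \<Rightarrow> 'k) \<Rightarrow> bool" where
  "alternating_bicharacter H B \<longleftrightarrow> B \<in> H \<times> H \<rightarrow>\<^sub>E UNIV - {0} \<and>
     (\<forall>h1\<in>H. \<forall>h2\<in>H. B (h1, h2) = inverse (B (h2, h1))) \<and>
     (\<forall>h\<in>H. B (h, h) = 1) \<and>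
     (\<forall>h\<in>H. \<forall>h1\<in>H. \<forall>h2\<in>H. B (h, h1) * B (h, h2) / B (h, h1 \<otimes> h2) = beta h h1 h2)"

definition G_invariant :: "'g set \<Rightarrow> 'g set \<Rightarrow> ('g \<times> 'g \<Rightarrow> 'k) \<Rightarrow> bool" where
  "G_invariant R H B \<longleftrightarrow>
     (\<forall>x\<in>carrier G. \<forall>a\<in>H \<inter> R. \<forall>h\<in>H.
        B (inv x \<otimes> a \<otimes> x, h) =
          beta a x h * beta a (x \<otimes> h) (inv x) / beta a x (inv x) * B (a, x \<otimes> h \<otimes> inv x))"

definition Gamma :: "'g set \<Rightarrow> ('g \<times> ('g \<Rightarrow> 'k)) set" where
  "Gamma R = {(a, \<chi>). a \<in> R \<and> \<chi> \<in> irr_proj_characters (centralizer a) (beta a)}"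

text \<open>
  \<open>V\<close> is a simple object labelled \<open>(a,\<chi>)\<close>: it is supported on the class of \<open>a\<close>, and the
  projective representation of the centralizer on \<open>e(a)V\<close>, written in a basis of \<open>e(a)V\<close>
  (the columns of \<open>P\<close>), has the character \<open>\<chi>\<close>.
\<close>

definition simple_of_label :: "'g \<Rightarrow> ('g \<Rightarrow> 'k) \<Rightarrow> ('g, 'k) rep \<Rightarrow> bool" where
  "simple_of_label a \<chi> V \<longleftrightarrow> simple_rep V \<and>
     (\<forall>g \<in> carrier G - conj_class a. act V g \<one> = 0\<^sub>m (vdim V) (vdim V)) \<and>
     (\<exists>d \<sigma> P. projective_rep (centralizer a) (beta a) d \<sigma> \<and>
        P \<in> carrier_mat (vdim V) d \<and>
        inj_on (\<lambda>v. P *\<^sub>v v) (carrier_vec d) \<and>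
        (\<lambda>v. P *\<^sub>v v) ` carrier_vec d = (\<lambda>v. act V a \<one> *\<^sub>v v) ` carrier_vec (vdim V) \<and>
        (\<forall>x\<in>centralizer a. act V a x * P = P * \<sigma> x) \<and>
        \<chi> = proj_character (centralizer a) \<sigma>)"

definition subcat_L :: "'g set \<Rightarrow> 'g set \<Rightarrow> ('g \<times> 'g \<Rightarrow> 'k) \<Rightarrow> ('g, 'k) rep set" where
  "subcat_L R H B = {V \<in> Rep_double. \<exists>Ws.
     (\<forall>W\<in>set Ws. \<exists>(a, \<chi>)\<in>Gamma R. a \<in> H \<inter> R \<and>
        (\<forall>h\<in>H. \<chi> h = B (a, h) * of_nat (proj_degree (centralizer a) (beta a) \<chi>)) \<and>
        simple_of_label a \<chi> W) \<and>
     iso_rep V (direct_sum Ws)}"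

end

end

end

theory Submission
  imports Defs "HOL-Algebra.Multiplicative_Group" "Jordan_Normal_Form.Char_Poly"
begin

text \<open>
  For \<open>(H,B)\<close> as in the theorem, \<open>L(H,B)\<close> consists of the representations \<open>V\<close> with \<open>e(g)V = 0\<close>
  for \<open>g\<close> outside \<open>H\<close> on which \<open>e(a)h\<close> acts as \<open>B(a,h)e(a)\<close> for \<open>a, h\<close> in \<open>H\<close>.  Invariance of \<open>B\<close>
  makes \<open>E = |H|\<^sup>-\<^sup>1 \<Sum> B(a,h)\<^sup>-\<^sup>1 e(a)h\<close> a central idempotent, and \<open>L(H,B)\<close> is the class of
  representations on which \<open>E\<close> acts as the identity.  The trace of \<open>E\<close> on the regular representation
  shows that \<open>L(H,B)\<close> has dimension \<open>|G|\<close>, and that every \<open>a\<close> in \<open>H\<close> occurs in the support of some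
  object; so \<open>L(H,B)\<close> determines \<open>H\<close> and then \<open>B\<close>.

  Conversely let \<open>D\<close> be Lagrangian.  For \<open>V, W\<close> in \<open>D\<close> the twists of \<open>V\<close>, \<open>W\<close> and \<open>V \<otimes> W\<close> are trivial, hence
  so is the double braiding.  Therefore the elements in the supports of objects of \<open>D\<close> commute, and
  \<open>e(h)k\<close> acts by a scalar \<open>B(h,k)\<close> that is the same for all objects.  This gives \<open>(H,B)\<close> with \<open>D\<close> contained
  in \<open>L(H,B)\<close>, and the dimensions agree.

  The values of \<open>B\<close> and \<open>\<omega>\<close> on \<open>H\<close> form an abelian 3-cocycle with trivial quadratic form, and such a
  cocycle has a trivial \<open>\<omega>\<close> (Eilenberg--Mac Lane).  A trivialisation on a subgroup \<open>K\<close>, seen as a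
  commutative algebra with basis \<open>K\<close>, is extended to the subgroup generated by \<open>K\<close> and \<open>x\<close> as a
  quotient of its product with the algebra of powers of \<open>x\<close>.
\<close>

section \<open>Trivialising abelian cocycles\<close>

text \<open>The trace of \<open>E\<close> on the regular representation measures a dimension because
  a simple object \<open>S\<close> occurs there \<open>vdim S\<close> times: the sum of squared
  dimensions over the classes in a subcategory is the total dimension of the constituents of the
  regular representation that lie in it. Characteristic zero turns equal traces into equal numbers.
  For a Lagrangian \<open>D\<close> the properties of \<open>B\<close> have separate sources:
  trivial double braiding makes e(h)k and e(k)h act by inverse scalars, trivial twist gives B(h,h) =
  1, and the product of the double gives the multiplicative law. The obstacle is the triviality of
  \<omega> on \<open>H\<close>, which has to be derived from \<open>B\<close>. Generators are
  adjoined one at a time, so no decomposition of \<open>H\<close> into cyclic factors is used; in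
  return a power x^n may lie in \<open>K\<close> without being 1, and the quotient has to identify
  it with that element of \<open>K\<close>. Compatibility with the braiding is carried along, since
  the extension step relies on it.\<close>

lemma (in group) finite_subgroupI:
  assumes "finite (carrier G)" "K \<subseteq> carrier G" "K \<noteq> {}"
    and closed: "\<And>a b. a \<in> K \<Longrightarrow> b \<in> K \<Longrightarrow> a \<otimes> b \<in> K"
  shows "subgroup K G"
proof (rule subgroupI)
  fix a assume a: "a \<in> K"
  have pw: "a [^] Suc m \<in> K" for m by (induction m) (use a assms in auto)
  have aG: "a \<in> carrier G" using a assms by blast
  \<comment> \<open>\<open>pw\<close> reaches only positive powers, so the inverse is written with
    the exponent 2|G| - 1, which is positive also for the trivial group.\<close>
  have "a [^] (2 * Coset.order G - 1) \<otimes> a = a [^] Suc (2 * Coset.order G - 1)" by simp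
  also have "Suc (2 * Coset.order G - 1) = Coset.order G * 2"
    using assms(1) order_gt_0_iff_finite by simp
  also have "a [^] (Coset.order G * 2) = \<one>"
    using aG by (simp add: nat_pow_pow[symmetric] pow_order_eq_1)
  finally have "inv a = a [^] (2 * Coset.order G - 1)" using aG by (simp add: inv_equality)
  also have "2 * Coset.order G - 1 = Suc (2 * Coset.order G - 2)"
    using assms(1) order_gt_0_iff_finite by simp
  finally show "inv a \<in> K" using pw by simp
qed (use assms in auto)

lemma mult_eq:
  fixes a b c d :: "'a::times"
  shows "a = b \<Longrightarrow> c = d \<Longrightarrow> a * c = b * d"
  by simp

text \<open>The format of the larger cocycle computations: \<open>L = R\<close> is a product of
  instances of known identities, and the last premise is then an equality of monomials, settled by
  commutativity. Proving a relation thus amounts to listing instances and their directions.\<close>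

lemma eq_by_cancel:
  fixes A B L R :: "'a::idom"
  assumes "L = R" "L \<noteq> 0" "A * R = B * L"
  shows "A = B"
  using assms by simp

text \<open>A braided categorical group with underlying group \<open>H\<close>: \<open>w\<close> is
  the associator and \<open>c\<close> the braiding. \<open>hexagon\<close> expands the second
  argument of \<open>c\<close>; through \<open>c_anti\<close> it also governs the first.
  \<open>c_self\<close> is the vanishing of the quadratic form that sends g to
  \<open>c g g\<close>.\<close>

locale abelian_cocycle = comm_group H for H (structure) +
  fixes w :: "'a \<Rightarrow> 'a \<Rightarrow> 'a \<Rightarrow> 'k::field" and c :: "'a \<Rightarrow> 'a \<Rightarrow> 'k"
  assumes w_nz: "\<lbrakk>g1 \<in> carrier H; g2 \<in> carrier H; g3 \<in> carrier H\<rbrakk> \<Longrightarrow> w g1 g2 g3 \<noteq> 0"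
    and c_nz: "\<lbrakk>g1 \<in> carrier H; g2 \<in> carrier H\<rbrakk> \<Longrightarrow> c g1 g2 \<noteq> 0"
    and pentagon: "\<lbrakk>g1 \<in> carrier H; g2 \<in> carrier H; g3 \<in> carrier H; g4 \<in> carrier H\<rbrakk> \<Longrightarrow>
      w g2 g3 g4 * w g1 (g2 \<otimes> g3) g4 * w g1 g2 g3 = w (g1 \<otimes> g2) g3 g4 * w g1 g2 (g3 \<otimes> g4)"
    and w_mid: "\<lbrakk>g1 \<in> carrier H; g2 \<in> carrier H\<rbrakk> \<Longrightarrow> w g1 \<one> g2 = 1"
    and hexagon: "\<lbrakk>h \<in> carrier H; g1 \<in> carrier H; g2 \<in> carrier H\<rbrakk> \<Longrightarrow>
      c h g1 * c h g2 * w g1 h g2 = c h (g1 \<otimes> g2) * (w h g1 g2 * w g1 g2 h)"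
    and c_anti: "\<lbrakk>g1 \<in> carrier H; g2 \<in> carrier H\<rbrakk> \<Longrightarrow> c g1 g2 * c g2 g1 = 1"
    and c_self: "g \<in> carrier H \<Longrightarrow> c g g = 1"
begin

section \<open>Coherence of rebracketing and braiding\<close>

lemma w_one: "\<lbrakk>g1 \<in> carrier H; g2 \<in> carrier H\<rbrakk> \<Longrightarrow> w \<one> g1 g2 = 1"
  using pentagon[of \<one> \<one> g1 g2] by (simp add: w_mid w_nz)

text \<open>The path is (ax)(by), a(x(by)), a((xb)y), a((bx)y), a(b(xy)), (ab)(xy); an associator
  stands in the numerator or the denominator according to the direction in which it is used. The two
  are kept apart so that coherence can be checked without fractions.\<close>

definition interchange_num :: "'a \<Rightarrow> 'a \<Rightarrow> 'a \<Rightarrow> 'a \<Rightarrow> 'k" where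
  "interchange_num a x b y = w a b (x \<otimes> y) * w x b y * c b x"

definition interchange_den :: "'a \<Rightarrow> 'a \<Rightarrow> 'a \<Rightarrow> 'a \<Rightarrow> 'k" where
  "interchange_den a x b y = w a x (b \<otimes> y) * w b x y"

text \<open>The coherence scalar of the rebracketing \<open>(ax)(by) \<rightarrow> (ab)(xy)\<close>.\<close>

definition interchange :: "'a \<Rightarrow> 'a \<Rightarrow> 'a \<Rightarrow> 'a \<Rightarrow> 'k" where
  "interchange a x b y = interchange_num a x b y / interchange_den a x b y"

lemma interchange_nz:
  assumes "a \<in> carrier H" "x \<in> carrier H" "b \<in> carrier H" "y \<in> carrier H"
  shows "interchange_num a x b y \<noteq> 0" "interchange_den a x b y \<noteq> 0" "interchange a x b y \<noteq> 0"
  using assms by (auto simp: interchange_def interchange_num_def interchange_den_def w_nz c_nz)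

text \<open>Both sides are scalars of moves that lead from a product of
  \<open>a \<otimes> x\<close>, \<open>b \<otimes> y\<close>, \<open>d \<otimes> z\<close> to one of
  \<open>a \<otimes> b \<otimes> d\<close> and \<open>x \<otimes> y \<otimes> z\<close>, so
  coherence makes them equal. In terms of algebras: the product of two algebras that are associative
  relative to \<open>w\<close> is again one.\<close>

lemma interchange_cocycle:
  assumes m: "a \<in> carrier H" "b \<in> carrier H" "d \<in> carrier H"
    "x \<in> carrier H" "y \<in> carrier H" "z \<in> carrier H"
  shows "interchange b y d z * interchange a x (b \<otimes> d) (y \<otimes> z) * (w a b d * w x y z) =
    w (a \<otimes> x) (b \<otimes> y) (d \<otimes> z) * (interchange (a \<otimes> b) (x \<otimes> y) d z * interchange a x b y)"
proof -
  note pent = pentagon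
  note pent' = pentagon[symmetric]
  have "interchange_num b y d z * interchange_num a x (b \<otimes> d) (y \<otimes> z) * (w a b d * w x y z) *
      (interchange_den (a \<otimes> b) (x \<otimes> y) d z * interchange_den a x b y) =
    w (a \<otimes> x) (b \<otimes> y) (d \<otimes> z) *
      (interchange_num (a \<otimes> b) (x \<otimes> y) d z * interchange_num a x b y) *
      (interchange_den b y d z * interchange_den a x (b \<otimes> d) (y \<otimes> z))"
    unfolding interchange_num_def interchange_den_def
    \<comment> \<open>The certificate of coherence; an instance or its \<open>symmetric\<close>
      version is taken according to the sign with which it enters. The two hexagons split the
      braidings of d with \<open>x \<otimes> y\<close> and of x with \<open>b \<otimes> d\<close>,
      and the instances of \<open>c_anti\<close> exchange the arguments of braidings.\<close>
    apply (rule eq_by_cancel[OF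
        mult_eq[OF hexagon[of d x y] mult_eq[OF hexagon[of x b d]
        mult_eq[OF pent[of a b d "x \<otimes> y \<otimes> z"]
        mult_eq[OF pent'[of a b "x \<otimes> y" "d \<otimes> z"]
        mult_eq[OF pent[of a x "b \<otimes> y" "d \<otimes> z"]
        mult_eq[OF pent[of b d x "y \<otimes> z"]
        mult_eq[OF pent'[of b x d "y \<otimes> z"]
        mult_eq[OF pent[of b x y "d \<otimes> z"]
        mult_eq[OF pent[of d x y z]
        mult_eq[OF pent[of x b d "y \<otimes> z"]
        mult_eq[OF pent'[of x b y "d \<otimes> z"]
        mult_eq[OF pent'[of x d y z]
        mult_eq[OF pent[of x y d z]
        mult_eq[OF c_anti[of "b \<otimes> d" x]
        mult_eq[OF c_anti[of b x, symmetric] c_anti[of d x, symmetric]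
        ]]]]]]]]]]]]]]]])
    by (simp_all add: m m_closed w_nz c_nz m_ac mult_ac)
  then show ?thesis
    unfolding interchange_def using interchange_nz m by (simp add: field_simps)
qed

text \<open>Two routes that exchange \<open>a \<otimes> x\<close> with \<open>b \<otimes> y\<close>
  agree because the braiding is symmetric, which is what the instances of \<open>c_anti\<close>
  contribute. Hence a product of two commutative algebras is commutative.\<close>

lemma interchange_commute:
  assumes m: "a \<in> carrier H" "b \<in> carrier H" "x \<in> carrier H" "y \<in> carrier H"
  shows "interchange b y a x * (c a b * c x y) = c (a \<otimes> x) (b \<otimes> y) * interchange a x b y"
proof -
  have "interchange_num b y a x * (c a b * c x y) * interchange_den a x b y =
    c (a \<otimes> x) (b \<otimes> y) * interchange_num a x b y * interchange_den b y a x"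
    unfolding interchange_num_def interchange_den_def
    apply (rule eq_by_cancel[OF
        mult_eq[OF hexagon[of a b "x \<otimes> y"]
        mult_eq[OF hexagon[of a x "b \<otimes> y", symmetric]
        mult_eq[OF hexagon[of a y x]
        mult_eq[OF hexagon[of "b \<otimes> y" x a, symmetric]
        mult_eq[OF hexagon[of x b y]
        mult_eq[OF pentagon[of b y x a]
        mult_eq[OF c_anti[of a "b \<otimes> y"]
        mult_eq[OF c_anti[of "b \<otimes> y" x]
        mult_eq[OF c_anti[of b x, symmetric] c_anti[of "a \<otimes> x" "b \<otimes> y", symmetric]
        ]]]]]]]]]])
    by (simp_all add: m m_closed w_nz c_nz m_ac mult_ac)
  then show ?thesis
    unfolding interchange_def using interchange_nz m by (simp add: field_simps)
qed

text \<open>For basis vectors whose product at a and b is \<eta>(a,b) times the one at ab, the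
  second clause is associativity relative to \<open>w\<close> and the first is commutativity
  relative to \<open>c\<close>. Commutativity is part of the notion because the extension step
  passes from the first argument to the second through it.\<close>

definition trivialises :: "'a set \<Rightarrow> ('a \<Rightarrow> 'a \<Rightarrow> 'k) \<Rightarrow> bool" where
  "trivialises K \<eta> \<longleftrightarrow>
     (\<forall>a\<in>K. \<forall>b\<in>K. \<eta> a b \<noteq> 0 \<and> \<eta> b a = c a b * \<eta> a b) \<and>
     (\<forall>a\<in>K. \<forall>b\<in>K. \<forall>d\<in>K. \<eta> b d * \<eta> a (b \<otimes> d) = w a b d * (\<eta> (a \<otimes> b) d * \<eta> a b))"

text \<open>The powers of \<open>x\<close>, normed on the left, form a commutative algebra indexed by the naturals.\<close>

definition power_coeff :: "'a \<Rightarrow> nat \<Rightarrow> nat \<Rightarrow> 'k" where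
  "power_coeff x i j = (\<Prod>m<i. inverse (w x (x [^] m) (x [^] j)))"

lemma power_coeff_nz: "x \<in> carrier H \<Longrightarrow> power_coeff x i j \<noteq> 0"
  by (simp add: power_coeff_def w_nz)

lemma power_coeff_Suc:
  "x \<in> carrier H \<Longrightarrow> power_coeff x (Suc i) j * w x (x [^] i) (x [^] j) = power_coeff x i j"
  by (simp add: power_coeff_def w_nz)

text \<open>Induction on the left exponent: raising \<open>i\<close> by one splits one associator
  off each coefficient that has \<open>i\<close> in its first argument, and the pentagon at x, x^i,
  x^j, x^l balances them.\<close>

lemma power_coeff_cocycle:
  assumes x: "x \<in> carrier H"
  shows "power_coeff x j l * power_coeff x i (j + l) =
    w (x [^] i) (x [^] j) (x [^] l) * (power_coeff x (i + j) l * power_coeff x i j)"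
proof (induction i)
  case 0
  then show ?case using x by (simp add: w_one) (simp add: power_coeff_def)
next
  case (Suc i)
  have p: "w (x [^] i) (x [^] j) (x [^] l) * w x (x [^] (i + j)) (x [^] l) * w x (x [^] i) (x [^] j) =
    w (x [^] Suc i) (x [^] j) (x [^] l) * w x (x [^] i) (x [^] (j + l))"
    using pentagon[of x "x [^] i" "x [^] j" "x [^] l"] x
    by (simp add: nat_pow_mult m_comm[of x "x [^] i"])
  have s: "power_coeff x i (j + l) = power_coeff x (Suc i) (j + l) * w x (x [^] i) (x [^] (j + l))"
    "power_coeff x (i + j) l = power_coeff x (Suc i + j) l * w x (x [^] (i + j)) (x [^] l)"
    "power_coeff x i j = power_coeff x (Suc i) j * w x (x [^] i) (x [^] j)"
    using power_coeff_Suc[OF x] by simp_all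
  show ?case
    by (rule eq_by_cancel[OF mult_eq[OF p Suc.IH]])
      (use x in \<open>simp_all add: w_nz power_coeff_nz s mult_ac\<close>)
qed

text \<open>Here the vanishing of the quadratic form enters. The commutativity defect
  \<open>q\<close> is multiplicative in its second argument by the hexagon, so together with
  \<open>q_anti\<close> it is determined by \<open>q 1 1\<close>, which is the value of
  \<open>c\<close> at x and x.\<close>

lemma power_coeff_commute:
  assumes x: "x \<in> carrier H"
  shows "power_coeff x j i = c (x [^] i) (x [^] j) * power_coeff x i j"
proof -
  define q where "q i j = c (x [^] i) (x [^] j) * power_coeff x i j / power_coeff x j i" for i j
  note nz = power_coeff_nz[OF x]
  have q_add: "q h (i + j) = q h i * q h j" for h i j
  proof -
    have P: "x [^] (m::nat) \<otimes> x [^] (n::nat) = x [^] (m + n)" for m n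
      using x by (simp add: nat_pow_mult)
    have "c (x [^] h) (x [^] (i + j)) * (power_coeff x h (i + j) * (power_coeff x i h * power_coeff x j h)) =
      (c (x [^] h) (x [^] i) * c (x [^] h) (x [^] j)) * (power_coeff x h i * power_coeff x h j * power_coeff x (i + j) h)"
      by (rule eq_by_cancel[OF
            mult_eq[OF hexagon[of "x [^] h" "x [^] i" "x [^] j", symmetric]
            mult_eq[OF power_coeff_cocycle[OF x, of j h i]
            mult_eq[OF power_coeff_cocycle[OF x, of i j h]
            power_coeff_cocycle[OF x, of h j i, symmetric]]]]])
        (use x in simp, use x in simp, use x in simp, use x in \<open>simp add: P w_nz c_nz nz\<close>,
          simp only: P ac_simps)
    then show ?thesis unfolding q_def using nz by (simp add: field_simps)
  qed
  have q11: "q 1 1 = 1" using x by (simp add: q_def c_self nz)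
  have q_anti: "q i j * q j i = 1" for i j
    unfolding q_def using c_anti[of "x [^] i" "x [^] j"] x nz by (simp add: field_simps)
  have q0: "q h 0 = 1" for h
  proof -
    have "q h 0 \<noteq> 0" using x nz by (simp add: q_def c_nz)
    then show ?thesis using q_add[of h 0 0] by simp
  qed
  have pw: "q h j = q h 1 ^ j" for h j
  proof (induction j)
    case (Suc j)
    have "q h (Suc j) = q h j * q h 1" using q_add[of h j 1] by simp
    then show ?case using Suc by simp
  qed (simp add: q0)
  have "q 1 h = 1" for h using pw[of 1 h] q11 by simp
  then have "q h 1 = 1" for h using q_anti[of h 1] by simp
  then have "q i j = 1" using pw[of i j] by simp
  then show ?thesis unfolding q_def using nz by (simp add: field_simps)
qed

text \<open>The pairs of an element of \<open>K\<close> and a natural number carry the product of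
  the algebra on \<open>K\<close> with that of the powers of x. The map from (k, i) to k x^i
  identifies only pairs linked by shifts from (k z, i) to (k, n + i), where z = x^n, because
  \<open>n\<close> is the least positive exponent with x^n in \<open>K\<close>. So it suffices to
  make the structure coefficients invariant under one shift.\<close>

lemma trivialises_extend:
  fixes n :: nat
  assumes K: "subgroup K H" and triv: "trivialises K \<eta>" and x: "x \<in> carrier H"
    and n: "0 < n" "x [^] n \<in> K" "\<And>m. 0 < m \<Longrightarrow> m < n \<Longrightarrow> x [^] m \<notin> K"
  defines "K' \<equiv> {k \<otimes> x [^] i | k (i::nat). k \<in> K}"
  shows "\<exists>\<eta>'. trivialises K' \<eta>'"
proof -
  interpret K: subgroup K H by (rule K)
  have KH: "k \<in> carrier H" if "k \<in> K" for k using that K.subset by blast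
  define z where "z = x [^] n"
  have z: "z \<in> K" using n by (simp add: z_def)
  define P where "P k i = k \<otimes> x [^] i" for k and i :: nat
  have P_closed: "P k i \<in> carrier H" if "k \<in> K" for k i using KH[OF that] x by (simp add: P_def)
  have P_mult: "P k i \<otimes> P l j = P (k \<otimes> l) (i + j)" if "k \<in> K" "l \<in> K" for k l i j
    using KH that x by (simp add: P_def m_ac nat_pow_mult[symmetric])
  \<comment> \<open>The structure coefficient of the product of (k, i) and (l, j);
    \<open>interchange\<close> accounts for moving x^i past l.\<close>
  define \<phi> where "\<phi> k i l j = interchange k (x [^] i) l (x [^] j) * (\<eta> k l * power_coeff x i j)"
    for k i l j
  have \<eta>_nz: "\<eta> k l \<noteq> 0" if "k \<in> K" "l \<in> K" for k l
    using triv that unfolding trivialises_def by blast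
  have \<phi>_nz: "\<phi> k i l j \<noteq> 0" if "k \<in> K" "l \<in> K" for k i l j
    using that KH x by (simp add: \<phi>_def interchange_nz \<eta>_nz power_coeff_nz)
  have \<phi>_cocycle: "\<phi> l j m s * \<phi> k i (l \<otimes> m) (j + s) =
      w (P k i) (P l j) (P m s) * (\<phi> (k \<otimes> l) (i + j) m s * \<phi> k i l j)"
    if klm: "k \<in> K" "l \<in> K" "m \<in> K" for k i l j m s
  proof -
    have e1: "\<eta> l m * \<eta> k (l \<otimes> m) = w k l m * (\<eta> (k \<otimes> l) m * \<eta> k l)"
      using triv klm unfolding trivialises_def by blast
    have e3: "interchange l (x [^] j) m (x [^] s) * interchange k (x [^] i) (l \<otimes> m) (x [^] (j + s)) *
        (w k l m * w (x [^] i) (x [^] j) (x [^] s)) =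
      w (P k i) (P l j) (P m s) * (interchange (k \<otimes> l) (x [^] (i + j)) m (x [^] s) * interchange k (x [^] i) l (x [^] j))"
      using interchange_cocycle[of k l m "x [^] i" "x [^] j" "x [^] s"] klm KH x
      by (simp add: nat_pow_mult P_def)
    have nz: "w k l m * w (x [^] i) (x [^] j) (x [^] s) \<noteq> 0"
      using klm KH x by (simp add: w_nz)
    have "\<phi> l j m s * \<phi> k i (l \<otimes> m) (j + s) * (w k l m * w (x [^] i) (x [^] j) (x [^] s)) =
      (w (P k i) (P l j) (P m s) * (\<phi> (k \<otimes> l) (i + j) m s * \<phi> k i l j)) * (w k l m * w (x [^] i) (x [^] j) (x [^] s))"
      using mult_eq[OF e3 mult_eq[OF e1 power_coeff_cocycle[OF x, of j s i]]]
      unfolding \<phi>_def by (simp only: mult_ac)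
    then show ?thesis using nz by simp
  qed
  have \<phi>_commute: "\<phi> l j k i = c (P k i) (P l j) * \<phi> k i l j" if kl: "k \<in> K" "l \<in> K" for k i l j
  proof -
    have e1: "\<eta> l k = c k l * \<eta> k l" using triv kl unfolding trivialises_def by blast
    have e3: "interchange l (x [^] j) k (x [^] i) * (c k l * c (x [^] i) (x [^] j)) =
      c (P k i) (P l j) * interchange k (x [^] i) l (x [^] j)"
      using interchange_commute[of k l "x [^] i" "x [^] j"] kl KH x by (simp add: P_def)
    have "\<phi> l j k i * (c k l * c (x [^] i) (x [^] j)) =
      c (P k i) (P l j) * \<phi> k i l j * (c k l * c (x [^] i) (x [^] j))"
      using mult_eq[OF e3 mult_eq[OF e1 power_coeff_commute[OF x, of j i]]]
      unfolding \<phi>_def by (simp only: mult_ac)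
    then show ?thesis using kl KH x by (simp add: c_nz)
  qed
  txt \<open>The element \<open>u = (z\<^sup>-\<^sup>1, n)\<close> lies over the unit, and setting it equal to \<open>1\<close> descends the
    algebra from \<open>K \<times> \<nat>\<close> to \<open>K'\<close>; \<open>t\<close> is the resulting change of basis.\<close>
  define u where "u = inv z"
  have u: "u \<in> K" using z by (simp add: u_def)
  have Pu: "P u n = \<one>" using KH[OF z] by (simp add: P_def u_def z_def)
  \<comment> \<open>The scalar collected when the basis vector of (k, i) is reached from that of (k
    z^d, i - d n), with d = i div n, by d multiplications with u. The truncated subtraction is
    exact, since Suc m \<le> d.\<close>
  define t where "t k i = (\<Prod>m<i div n. \<phi> u n (k \<otimes> z [^] Suc m) (i - Suc m * n))" for k i
  have zp: "z [^] (m::nat) \<in> K" for m by (induction m) (use z in auto)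
  have t_nz: "t k i \<noteq> 0" if "k \<in> K" for k i using \<phi>_nz u that zp z by (simp add: t_def)
  have t_shift: "t k (n + i) = t (k \<otimes> z) i * \<phi> u n (k \<otimes> z) i" if "k \<in> K" for k i
  proof -
    have d: "(n + i) div n = Suc (i div n)" using n by simp
    have "t k (n + i) = \<phi> u n (k \<otimes> z) i *
        (\<Prod>m<i div n. \<phi> u n (k \<otimes> z [^] Suc (Suc m)) (n + i - Suc (Suc m) * n))"
      unfolding t_def d by (subst prod.lessThan_Suc_shift) (use KH z in simp)
    also have "(\<Prod>m<i div n. \<phi> u n (k \<otimes> z [^] Suc (Suc m)) (n + i - Suc (Suc m) * n)) = t (k \<otimes> z) i"
      unfolding t_def using KH[OF z] KH[OF that]
      by (intro prod.cong refl) (simp add: m_ac)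
    finally show ?thesis by (simp add: mult_ac)
  qed
  define f where "f k i l j = \<phi> k i l j * t k i * t l j / t (k \<otimes> l) (i + j)" for k i l j
  have f_nz: "f k i l j \<noteq> 0" if "k \<in> K" "l \<in> K" for k i l j
    using that by (simp add: f_def \<phi>_nz t_nz)
  have f_cocycle: "f l j m s * f k i (l \<otimes> m) (j + s) =
      w (P k i) (P l j) (P m s) * (f (k \<otimes> l) (i + j) m s * f k i l j)"
    if klm: "k \<in> K" "l \<in> K" "m \<in> K" for k i l j m s
  proof -
    have kl: "k \<otimes> l \<in> K" "l \<otimes> m \<in> K" using klm by auto
    have a: "k \<otimes> l \<otimes> m = k \<otimes> (l \<otimes> m)" "i + j + s = i + (j + s)" using klm KH by (auto simp: m_assoc)
    show ?thesis
      unfolding f_def a using \<phi>_cocycle[OF klm, of j s i] t_nz klm kl t_nz[OF K.m_closed[OF klm(1) kl(2)]]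
      by (simp add: divide_simps mult_ac)
  qed
  have f_commute: "f l j k i = c (P k i) (P l j) * f k i l j" if kl: "k \<in> K" "l \<in> K" for k i l j
    using \<phi>_commute[OF kl, of j i] kl KH by (simp add: f_def t_nz m_comm[of l k] add.commute)
  have f_shift: "f k (n + i) l j = f (k \<otimes> z) i l j" if kl: "k \<in> K" "l \<in> K" for k i l j
  proof -
    \<comment> \<open>Associativity for u, (k z, i), (l, j): since u lies over \<one>, the
      associator is trivial by \<open>w_one\<close>.\<close>
    have e: "\<phi> (k \<otimes> z) i l j * \<phi> u n (k \<otimes> z \<otimes> l) (i + j) = \<phi> k (n + i) l j * \<phi> u n (k \<otimes> z) i"
    proof -
      have "u \<otimes> (k \<otimes> z) = k" using KH kl z by (simp add: u_def m_ac inv_solve_left')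
      then show ?thesis
        using \<phi>_cocycle[of u "k \<otimes> z" l i j n] Pu u kl z w_one[OF P_closed P_closed, of "k \<otimes> z" l i j] by simp
    qed
    have t1: "t (k \<otimes> l) (n + (i + j)) = t (k \<otimes> z \<otimes> l) (i + j) * \<phi> u n (k \<otimes> z \<otimes> l) (i + j)"
      using t_shift[of "k \<otimes> l" "i + j"] kl KH[OF kl(1)] KH[OF kl(2)] KH[OF z]
      by (simp add: m_ac)
    have kz: "k \<otimes> z \<in> K" "k \<otimes> z \<otimes> l \<in> K" using kl z by auto
    have "f k (n + i) l j = \<phi> k (n + i) l j * (t (k \<otimes> z) i * \<phi> u n (k \<otimes> z) i) * t l j
        / (t (k \<otimes> z \<otimes> l) (i + j) * \<phi> u n (k \<otimes> z \<otimes> l) (i + j))"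
      unfolding f_def using t1 t_shift[OF kl(1)] by (simp add: add.assoc)
    also have "\<dots> = f (k \<otimes> z) i l j"
      unfolding f_def using e t_nz kz \<phi>_nz[OF u kz(2)] by (simp add: field_simps)
    finally show ?thesis .
  qed
  have f_shift_mult: "f k (d * n + i) l j = f (k \<otimes> z [^] d) i l j" if kl: "k \<in> K" "l \<in> K" for k i l j d
    using kl(1)
  proof (induction d arbitrary: k)
    case 0
    then show ?case using KH by simp
  next
    case (Suc d)
    have "k \<otimes> z \<otimes> z [^] d = k \<otimes> z [^] Suc d" using KH[OF Suc.prems] KH[OF z] by (simp add: m_ac)
    then show ?case using Suc f_shift[of k l "d * n + i" j] z kl by (simp add: add.assoc)
  qed
  have le: "f k i m s = f l j m s"
    if kl: "k \<in> K" "l \<in> K" "m \<in> K" and eq: "P k i = P l j" and "i \<le> j" for k i l j m s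
  proof -
    obtain e where j: "j = e + i" using \<open>i \<le> j\<close> by (metis le_add_diff_inverse2)
    have kx: "k = l \<otimes> x [^] e"
    proof -
      have "k \<otimes> x [^] i = (l \<otimes> x [^] e) \<otimes> x [^] i"
        using eq kl KH x by (simp add: P_def j m_assoc nat_pow_mult)
      then show ?thesis using kl KH x by simp
    qed
    \<comment> \<open>Division with remainder: k x^i = l x^j forces x^r into \<open>K\<close>, and
      minimality of n leaves r = 0, so the two pairs differ by d shifts.\<close>
    define d r where "d = e div n" and "r = e mod n"
    have e: "e = d * n + r" by (simp add: d_def r_def)
    have xe: "x [^] e = z [^] d \<otimes> x [^] r"
      using x by (simp add: e z_def nat_pow_mult[symmetric] nat_pow_pow mult.commute)
    have lz: "l \<otimes> z [^] d \<in> K" using kl zp by simp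
    have "k = (l \<otimes> z [^] d) \<otimes> x [^] r" using kx xe kl KH x zp by (simp add: m_assoc)
    then have "x [^] r = inv (l \<otimes> z [^] d) \<otimes> k"
      using inv_solve_left[of "x [^] r" "l \<otimes> z [^] d" k] kl KH lz x by simp
    then have "x [^] r \<in> K" using lz kl by simp
    moreover have "r < n" using n by (simp add: r_def)
    ultimately have "r = 0" using n(3) by blast
    then have "k = l \<otimes> z [^] d" using kx xe KH zp by simp
    then show ?thesis using f_shift_mult[OF kl(2,3), of d i s] e \<open>r = 0\<close> j by simp
  qed
  have f_wd: "f k i m s = f l j m s"
    if "k \<in> K" "l \<in> K" "m \<in> K" "P k i = P l j" for k i l j m s
    using le[of k l m i j s] le[of l k m j i s] that by (cases "i \<le> j") auto
  define rep where "rep g = (SOME p. fst p \<in> K \<and> P (fst p) (snd p) = g)" for g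
  define \<eta>' where "\<eta>' g h = f (fst (rep g)) (snd (rep g)) (fst (rep h)) (snd (rep h))" for g h
  have rep: "fst (rep (P k i)) \<in> K" "P (fst (rep (P k i))) (snd (rep (P k i))) = P k i" if "k \<in> K" for k i
    using someI[of "\<lambda>p. fst p \<in> K \<and> P (fst p) (snd p) = P k i" "(k, i)"] that
    unfolding rep_def[symmetric] by auto
  have \<eta>': "\<eta>' (P k i) (P l j) = f k i l j" if kl: "k \<in> K" "l \<in> K" for k i l j
  proof -
    have "\<eta>' (P k i) (P l j) = f k i (fst (rep (P l j))) (snd (rep (P l j)))"
      unfolding \<eta>'_def using rep kl by (intro f_wd) auto
    \<comment> \<open>Independence of representatives is known in the first argument only;
      exchanging the arguments by \<open>f_commute\<close> gives it in the second.\<close>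
    also have "\<dots> = c (P l j) (P k i) * f (fst (rep (P l j))) (snd (rep (P l j))) k i"
      using f_commute[of "fst (rep (P l j))" k i "snd (rep (P l j))"] rep kl by simp
    also have "f (fst (rep (P l j))) (snd (rep (P l j))) k i = f l j k i"
      using rep kl by (intro f_wd) auto
    also have "c (P l j) (P k i) * \<dots> = f k i l j" using f_commute[OF kl(2,1), of i j] by simp
    finally show ?thesis .
  qed
  have triv1: "\<eta>' (P k i) (P l j) \<noteq> 0 \<and> \<eta>' (P l j) (P k i) = c (P k i) (P l j) * \<eta>' (P k i) (P l j)"
    if "k \<in> K" "l \<in> K" for k l i j
    unfolding \<eta>'[OF that] \<eta>'[OF that(2,1)] using f_nz[OF that] f_commute[OF that] by blast
  have triv2: "\<eta>' (P l j) (P m s) * \<eta>' (P k i) (P l j \<otimes> P m s) =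
      w (P k i) (P l j) (P m s) * (\<eta>' (P k i \<otimes> P l j) (P m s) * \<eta>' (P k i) (P l j))"
    if klm: "k \<in> K" "l \<in> K" "m \<in> K" for k l m i j s
  proof -
    have kl: "k \<otimes> l \<in> K" "l \<otimes> m \<in> K" using klm by auto
    show ?thesis
      unfolding P_mult[OF klm(1,2)] P_mult[OF klm(2,3)] \<eta>'[OF klm(2,3)] \<eta>'[OF klm(1,2)]
        \<eta>'[OF klm(1) kl(2)] \<eta>'[OF kl(1) klm(3)] by (rule f_cocycle[OF klm])
  qed
  have "trivialises K' \<eta>'"
  proof -
    have mem: "\<exists>k i. a = P k i \<and> k \<in> K" if "a \<in> K'" for a using that by (auto simp: K'_def P_def)
    have "\<eta>' a b \<noteq> 0 \<and> \<eta>' b a = c a b * \<eta>' a b" if "a \<in> K'" "b \<in> K'" for a b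
      using mem[OF that(1)] mem[OF that(2)] triv1 by blast
    moreover have "\<eta>' b d * \<eta>' a (b \<otimes> d) = w a b d * (\<eta>' (a \<otimes> b) d * \<eta>' a b)"
      if abd: "a \<in> K'" "b \<in> K'" "d \<in> K'" for a b d
    proof -
      obtain k i l j m s where "a = P k i" "b = P l j" "d = P m s" "k \<in> K" "l \<in> K" "m \<in> K"
        using mem[OF abd(1)] mem[OF abd(2)] mem[OF abd(3)] by blast
      then show ?thesis using triv2 by simp
    qed
    ultimately show ?thesis unfolding trivialises_def by blast
  qed
  then show ?thesis by blast
qed

text \<open>A maximal subgroup carrying a trivialisation absorbs every x: finiteness of
  \<open>H\<close> puts some positive power of x into it, so the extension step applies.\<close>

lemma trivialises_carrier:
  assumes fin: "finite (carrier H)"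
  shows "\<exists>\<eta>. trivialises (carrier H) \<eta>"
proof -
  define S where "S = {K. subgroup K H \<and> (\<exists>\<eta>. trivialises K \<eta>)}"
  have SK: "K \<subseteq> carrier H" if "K \<in> S" for K using that by (simp add: S_def subgroup.subset)
  have finS: "finite S" using fin SK by (meson finite_Pow_iff finite_subset PowI subsetI)
  have "trivialises {\<one>} (\<lambda>_ _. 1)" by (simp add: trivialises_def w_mid c_self)
  then have "{\<one>} \<in> S" using triv_subgroup by (auto simp: S_def)
  then obtain K where K: "K \<in> S" and maxK: "\<And>K'. K' \<in> S \<Longrightarrow> K \<subseteq> K' \<Longrightarrow> K' = K"
    using finite_has_maximal[OF finS] by (metis empty_iff)
  have sK: "subgroup K H" using K by (simp add: S_def)
  interpret K: subgroup K H by (rule sK)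
  have "x \<in> K" if x: "x \<in> carrier H" for x
  proof -
    define n where "n = (LEAST m::nat. 0 < m \<and> x [^] m \<in> K)"
    have "0 < Coset.order H \<and> x [^] Coset.order H \<in> K" using x fin by (simp add: order_gt_0_iff_finite pow_order_eq_1)
    then have n: "0 < n \<and> x [^] n \<in> K" unfolding n_def by (rule LeastI)
    have nm: "x [^] m \<notin> K" if "0 < m" "m < n" for m :: nat
      using not_less_Least[of m "\<lambda>m::nat. 0 < m \<and> x [^] m \<in> K"] that by (auto simp: n_def)
    define K' where "K' = {k \<otimes> x [^] i | k (i::nat). k \<in> K}"
    have KH: "k \<in> carrier H" if "k \<in> K" for k using that by simp
    have "subgroup K' H"
    proof (rule finite_subgroupI)
      show "K' \<subseteq> carrier H" using x KH by (auto simp: K'_def)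
      show "K' \<noteq> {}" using K.one_closed unfolding K'_def by blast
      fix a b assume "a \<in> K'" "b \<in> K'"
      then obtain k i l j where kl: "a = k \<otimes> x [^] (i::nat)" "b = l \<otimes> x [^] (j::nat)" "k \<in> K" "l \<in> K"
        by (auto simp: K'_def)
      then have "a \<otimes> b = (k \<otimes> l) \<otimes> x [^] (i + j)"
        using KH x by (simp add: m_ac nat_pow_mult[symmetric])
      then show "a \<otimes> b \<in> K'" using kl by (auto simp: K'_def)
    qed (use fin in auto)
    moreover obtain \<eta> where "trivialises K \<eta>" using K by (auto simp: S_def)
    then have "\<exists>\<eta>'. trivialises K' \<eta>'"
      unfolding K'_def using trivialises_extend[OF sK _ x, of \<eta> n] n nm by blast
    ultimately have "K' \<in> S" by (simp add: S_def)
    moreover have "K \<subseteq> K'"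
    proof
      fix k assume "k \<in> K"
      then have "k = k \<otimes> x [^] (0::nat)" by simp
      then show "k \<in> K'" using \<open>k \<in> K\<close> unfolding K'_def by blast
    qed
    ultimately have "K' = K" by (rule maxK)
    moreover have "x = \<one> \<otimes> x [^] (1::nat)" using x by simp
    then have "x \<in> K'" using K.one_closed unfolding K'_def by blast
    ultimately show ?thesis by simp
  qed
  then have "K = carrier H" using SK[OF K] by blast
  then show ?thesis using K by (auto simp: S_def)
qed

end

section \<open>Matrices as operators\<close>

text \<open>Operators on sequences receive the matrices of all sizes (\<open>fm\<close>), so that matrix identities become
  identities in one ring, free of dimension side conditions.\<close>

typedef (overloaded) 'k lop = "{F :: (nat \<Rightarrow> 'k::field) \<Rightarrow> nat \<Rightarrow> 'k.
    (\<forall>u v. F (\<lambda>i. u i + v i) = (\<lambda>i. F u i + F v i)) \<and> (\<forall>c u. F (\<lambda>i. c * u i) = (\<lambda>i. c * F u i))}"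
  by (rule exI[of _ "\<lambda>u. u"]) simp

setup_lifting type_definition_lop

instantiation lop :: (field) ring_1
begin

lift_definition zero_lop :: "'a lop" is "\<lambda>u i. 0" by simp
lift_definition one_lop :: "'a lop" is "\<lambda>u. u" by simp
lift_definition plus_lop :: "'a lop \<Rightarrow> 'a lop \<Rightarrow> 'a lop" is "\<lambda>F G u i. F u i + G u i"
  by (auto simp: algebra_simps)
lift_definition uminus_lop :: "'a lop \<Rightarrow> 'a lop" is "\<lambda>F u i. - F u i"
  by (auto simp: algebra_simps)
lift_definition minus_lop :: "'a lop \<Rightarrow> 'a lop \<Rightarrow> 'a lop" is "\<lambda>F G u i. F u i - G u i"
  by (auto simp: algebra_simps)
lift_definition times_lop :: "'a lop \<Rightarrow> 'a lop \<Rightarrow> 'a lop" is "\<lambda>F G u. F (G u)"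
  by simp

instance
proof
  show "(0::'a lop) \<noteq> 1"
    by transfer (auto simp: fun_eq_iff intro!: exI[of _ "\<lambda>_. 1"])
qed (transfer; auto simp: algebra_simps fun_eq_iff)+

end

text \<open>Scalars become central ring elements, so that scalar factors are moved by the same
  rewriting as operators.\<close>

lift_definition scal :: "'k::field \<Rightarrow> 'k lop" is "\<lambda>c u i. c * u i"
  by (auto simp: algebra_simps)

lemma scal_commute: "A * scal c = scal c * A"
  by transfer auto

lemma scal_left_commute: "A * (scal c * B) = scal c * (A * B)"
  by (metis mult.assoc scal_commute)

lemma scal_mult: "scal (c * d) = scal c * scal d"
  by transfer (auto simp: algebra_simps)

lemma scal_scal: "scal c * (scal d * A) = scal (c * d) * A"
  by (simp add: scal_mult mult.assoc)

lemma scal_add: "scal (c + d) = scal c + scal d"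
  by transfer (auto simp: algebra_simps)

lemma scal_1 [simp]: "scal 1 = 1"
  by transfer auto

lemma scal_0 [simp]: "scal 0 = 0"
  by transfer auto

lemma scal_of_nat: "scal (of_nat n) = of_nat n"
  by (induction n) (auto simp: scal_add)

text \<open>Only the first \<open>dim_col\<close> coordinates are read, and those from
  \<open>dim_row\<close> on are set to 0. Hence \<open>fm (1\<^sub>m n)\<close> is the projection to
  the first n coordinates and not 1, which is why the identities below carry such factors.\<close>

lift_definition fm :: "'k::field mat \<Rightarrow> 'k lop" is
  "\<lambda>A u i. if i < dim_row A then \<Sum>j<dim_col A. A $$ (i, j) * u j else 0"
  by (auto simp: fun_eq_iff algebra_simps sum.distrib sum_distrib_left)

lemma fm_mult: "dim_col A = dim_row B \<Longrightarrow> fm (A * B) = fm A * fm B"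
proof (transfer, intro ext, goal_cases)
  case (1 A B u i)
  have "(\<Sum>j<dim_col B. (\<Sum>l<dim_row B. A $$ (i, l) * B $$ (l, j)) * u j) =
    (\<Sum>l<dim_row B. A $$ (i, l) * (\<Sum>j<dim_col B. B $$ (l, j) * u j))"
    by (simp add: sum_distrib_left sum_distrib_right mult.assoc) (rule sum.swap)
  then show ?case using 1
    by (auto simp: scalar_prod_def atLeast0LessThan)
qed

lemma fm_smult: "fm (c \<cdot>\<^sub>m A) = scal c * fm A"
  by transfer (auto simp: fun_eq_iff sum_distrib_left mult.assoc)

lemma fm_add: "A \<in> carrier_mat n m \<Longrightarrow> B \<in> carrier_mat n m \<Longrightarrow> fm (A + B) = fm A + fm B"
  by transfer (auto simp: fun_eq_iff sum.distrib algebra_simps)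

lemma fm_minus: "A \<in> carrier_mat n m \<Longrightarrow> B \<in> carrier_mat n m \<Longrightarrow> fm (A - B) = fm A - fm B"
  by transfer (auto simp: fun_eq_iff sum_subtractf algebra_simps)

lemma fm_zero [simp]: "fm (0\<^sub>m n m) = 0"
  by transfer (auto simp: fun_eq_iff)

text \<open>\<open>fm\<close> forgets sizes, all zero matrices being sent to 0, so the common size
  has to be supplied. An entry is recovered by evaluation at a unit sequence.\<close>

lemma fm_inject:
  assumes "A \<in> carrier_mat n m" "B \<in> carrier_mat n m" "fm A = fm B"
  shows "A = B"
proof (rule eq_matI)
  fix i j assume ij: "i < dim_row B" "j < dim_col B"
  have e: "C $$ (i, j) = Rep_lop (fm C) (\<lambda>l. if l = j then 1 else 0) i" if "C \<in> carrier_mat n m" for C :: "'a mat"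
    using ij that assms(1,2) by (simp add: fm.rep_eq if_distrib cong: if_cong)
  show "A $$ (i, j) = B $$ (i, j)" using e[OF assms(1)] e[OF assms(2)] assms(3) by simp
qed (use assms in auto)

lemma fm_mat_sum:
  assumes "\<And>i. i \<in> I \<Longrightarrow> A i \<in> carrier_mat n m"
  shows "fm (mat_sum n m A I) = (\<Sum>i\<in>I. fm (A i))"
  using assms
proof (induction I rule: infinite_finite_induct)
  case (insert i I)
  have "mat_sum n m A (insert i I) = A i + mat_sum n m A I"
    using insert by (intro eq_matI) (auto simp: mat_sum_def)
  then show ?case
    using insert fm_add[of "A i" n m "mat_sum n m A I"] by (simp add: mat_sum_def)
next
  case (infinite I)
  have "mat_sum n m A I = 0\<^sub>m n m" using infinite by (intro eq_matI) (auto simp: mat_sum_def)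
  then show ?case using infinite by simp
next
  case empty
  have "mat_sum n m A {} = 0\<^sub>m n m" by (intro eq_matI) (auto simp: mat_sum_def)
  then show ?case by simp
qed

lemma mat_sum_carrier [simp]: "mat_sum n m A I \<in> carrier_mat n m"
  by (simp add: mat_sum_def)

lemma fm_one_left: "A \<in> carrier_mat n m \<Longrightarrow> fm (1\<^sub>m n) * fm A = fm A"
  by (metis carrier_matD(1) fm_mult index_one_mat(3) left_mult_one_mat)

lemma fm_one_right: "A \<in> carrier_mat n m \<Longrightarrow> fm A * fm (1\<^sub>m m) = fm A"
  by (metis carrier_matD(2) fm_mult index_one_mat(2) right_mult_one_mat)

lemma fm_mult': "A \<in> carrier_mat n m \<Longrightarrow> B \<in> carrier_mat m l \<Longrightarrow> fm (A * B) = fm A * fm B"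
  by (simp add: fm_mult)

section \<open>Traces and subspaces\<close>

lemma mat_trace_mult_commute:
  assumes "A \<in> carrier_mat n m" "B \<in> carrier_mat m n"
  shows "mat_trace (A * B) = mat_trace (B * A)"
proof -
  have "mat_trace (A * B) = (\<Sum>i<n. \<Sum>l<m. A $$ (i, l) * B $$ (l, i))"
    using assms by (auto simp: mat_trace_def scalar_prod_def atLeast0LessThan intro!: sum.cong)
  also have "\<dots> = (\<Sum>l<m. \<Sum>i<n. B $$ (l, i) * A $$ (i, l))"
    by (subst sum.swap) (simp add: mult.commute)
  also have "\<dots> = mat_trace (B * A)"
    using assms by (auto simp: mat_trace_def scalar_prod_def atLeast0LessThan intro!: sum.cong)
  finally show ?thesis .
qed

lemma mat_trace_smult: "A \<in> carrier_mat n n \<Longrightarrow> mat_trace (c \<cdot>\<^sub>m A) = c * mat_trace A"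
  by (simp add: mat_trace_def sum_distrib_left)

lemma mat_trace_one [simp]: "mat_trace (1\<^sub>m n) = of_nat n"
  by (simp add: mat_trace_def)

lemma mat_trace_mat_sum:
  "(\<And>i. i \<in> I \<Longrightarrow> A i \<in> carrier_mat n n) \<Longrightarrow> mat_trace (mat_sum n n A I) = (\<Sum>i\<in>I. mat_trace (A i))"
  by (subst sum.cong[OF refl, of I _ "\<lambda>i. \<Sum>l<n. A i $$ (l, l)"])
    (auto simp: mat_trace_def mat_sum_def intro: sum.swap)

definition linear_subspace :: "nat \<Rightarrow> 'k::field vec set \<Rightarrow> bool" where
  "linear_subspace n W \<longleftrightarrow> W \<subseteq> carrier_vec n \<and> 0\<^sub>v n \<in> W \<and>
     (\<forall>v\<in>W. \<forall>w\<in>W. v + w \<in> W) \<and> (\<forall>c. \<forall>v\<in>W. c \<cdot>\<^sub>v v \<in> W)"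

lemma subspace_module_vec:
  "VectorSpace.subspace class_ring W (module_vec TYPE('k::field) n) \<longleftrightarrow> linear_subspace n W"
proof -
  interpret vec_space "TYPE('k)" n .
  show ?thesis
    unfolding linear_subspace_def VectorSpace.subspace_def submodule_def
    using module_axioms vectorspace_axioms
    by (auto simp: module_vec_simps class_ring_simps)
qed

text \<open>After padding to square matrices the left inverse is two-sided; but if n < d, row n of
  \<open>P'\<close> is zero, so the entry of \<open>P' * Q'\<close> at (n, n) cannot be 1.\<close>

lemma left_inverse_dim_le:
  fixes P :: "'k::field mat"
  assumes P: "P \<in> carrier_mat n d" and Q: "Q \<in> carrier_mat d n" and QP: "Q * P = 1\<^sub>m d"
  shows "d \<le> n"
proof (rule ccontr)
  assume "\<not> d \<le> n"
  define P' where "P' = mat d d (\<lambda>(i, j). if i < n then P $$ (i, j) else 0)"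
  define Q' where "Q' = mat d d (\<lambda>(i, j). if j < n then Q $$ (i, j) else 0)"
  have c: "P' \<in> carrier_mat d d" "Q' \<in> carrier_mat d d" by (auto simp: P'_def Q'_def)
  have "Q' * P' = 1\<^sub>m d"
  proof (rule eq_matI)
    fix i j assume "i < dim_row (1\<^sub>m d :: 'k mat)" "j < dim_col (1\<^sub>m d :: 'k mat)"
    then have ij: "i < d" "j < d" by auto
    have "(Q' * P') $$ (i, j) = (\<Sum>l<d. if l < n then Q $$ (i, l) * P $$ (l, j) else 0)"
      using ij by (auto simp: P'_def Q'_def scalar_prod_def atLeast0LessThan intro!: sum.cong)
    also have "\<dots> = (\<Sum>l<n. Q $$ (i, l) * P $$ (l, j))"
      using \<open>\<not> d \<le> n\<close> by (intro sum.mono_neutral_cong_right) auto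
    also have "\<dots> = (Q * P) $$ (i, j)"
      using ij P Q by (simp add: scalar_prod_def atLeast0LessThan)
    finally show "(Q' * P') $$ (i, j) = 1\<^sub>m d $$ (i, j)" using QP by simp
  qed (use c in auto)
  then have "P' * Q' = 1\<^sub>m d" using mat_mult_left_right_inverse[OF c(2,1)] by simp
  then have "(P' * Q') $$ (n, n) = 1" using \<open>\<not> d \<le> n\<close> by simp
  moreover have "(P' * Q') $$ (n, n) = 0"
    using \<open>\<not> d \<le> n\<close> by (simp add: P'_def Q'_def scalar_prod_def)
  ultimately show False by simp
qed

text \<open>The columns of \<open>P\<close> are a basis of \<open>U\<close>, and \<open>Q\<close>
  reads off coordinates. Among all maps into \<open>U\<close> with a left inverse, one with
  \<open>d\<close> maximal is taken: \<open>left_inverse_dim_le\<close> bounds \<open>d\<close>, and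
  a vector of \<open>U\<close> outside the column space would allow one more column.\<close>

lemma linear_subspace_split:
  fixes U :: "'k::field vec set"
  assumes U: "linear_subspace n U"
  obtains d P Q where "P \<in> carrier_mat n d" "Q \<in> carrier_mat d n" "Q * P = 1\<^sub>m d"
    "\<And>v. v \<in> carrier_vec d \<Longrightarrow> P *\<^sub>v v \<in> U" "\<And>w. w \<in> U \<Longrightarrow> P *\<^sub>v (Q *\<^sub>v w) = w"
proof -
  define A where "A d P Q \<longleftrightarrow> P \<in> carrier_mat n d \<and> Q \<in> carrier_mat d n \<and> Q * P = 1\<^sub>m d \<and>
    (\<forall>v\<in>carrier_vec d. P *\<^sub>v v \<in> U)" for d and P Q :: "'k mat"
  have UC: "u \<in> carrier_vec n" if "u \<in> U" for u using U that by (auto simp: linear_subspace_def)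
  have "A 0 (0\<^sub>m n 0) (0\<^sub>m 0 n)"
  proof -
    have "0\<^sub>m n 0 *\<^sub>v v = 0\<^sub>v n" if "v \<in> carrier_vec 0" for v :: "'k vec"
      using that by (intro eq_vecI) (auto simp: scalar_prod_def)
    then show ?thesis using U by (auto simp: A_def linear_subspace_def)
  qed
  then have ex: "\<exists>d. \<exists>P Q. A d P Q" by blast
  have bound: "d \<le> n" if "\<exists>P Q. A d P Q" for d
    using that left_inverse_dim_le unfolding A_def by blast
  define d where "d = (GREATEST d. \<exists>P Q. A d P Q)"
  have "\<exists>P Q. A d P Q"
    unfolding d_def using ex bound by (rule GreatestI_ex_nat[where b=n])
  then obtain P Q where A: "A d P Q" by blast
  have max: "\<not> A (Suc d) P' Q'" for P' Q'
    using Greatest_le_nat[of "\<lambda>d. \<exists>P Q. A d P Q" "Suc d" n] bound unfolding d_def[symmetric] by force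
  have P: "P \<in> carrier_mat n d" and Q: "Q \<in> carrier_mat d n" and QP: "Q * P = 1\<^sub>m d"
    and PU: "\<And>v. v \<in> carrier_vec d \<Longrightarrow> P *\<^sub>v v \<in> U" using A by (auto simp: A_def)
  have "P *\<^sub>v (Q *\<^sub>v w) = w" if w: "w \<in> U" for w
  proof (rule ccontr)
    assume ne: "P *\<^sub>v (Q *\<^sub>v w) \<noteq> w"
    have wc: "w \<in> carrier_vec n" using w UC by blast
    \<comment> \<open>The part of w outside the column space of \<open>P\<close>: it lies in
      \<open>U\<close>, is killed by \<open>Q\<close> and is nonzero.\<close>
    define y where "y = w + (-1) \<cdot>\<^sub>v (P *\<^sub>v (Q *\<^sub>v w))"
    have yU: "y \<in> U" using w PU[of "Q *\<^sub>v w"] Q wc U unfolding y_def linear_subspace_def by auto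
    have yc: "y \<in> carrier_vec n" using yU UC by blast
    have PQw: "P *\<^sub>v (Q *\<^sub>v w) \<in> carrier_vec n" using P Q wc by simp
    have "Q *\<^sub>v (P *\<^sub>v (Q *\<^sub>v w)) = Q *\<^sub>v w"
      using assoc_mult_mat_vec[OF Q P, of "Q *\<^sub>v w"] QP Q wc by simp
    then have Qy: "Q *\<^sub>v y = 0\<^sub>v d"
      unfolding y_def using Q wc PQw
      by (simp add: mult_add_distrib_mat_vec[OF Q wc] mult_mat_vec[OF Q PQw]) (intro eq_vecI; simp)
    have "y \<noteq> 0\<^sub>v n"
    proof
      assume y0: "y = 0\<^sub>v n"
      have "P *\<^sub>v (Q *\<^sub>v w) = w"
      proof (rule eq_vecI)
        fix i assume "i < dim_vec w"
        then have i: "i < n" using wc by simp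
        have "y $ i = w $ i - (P *\<^sub>v (Q *\<^sub>v w)) $ i" unfolding y_def using i wc PQw P by simp
        then show "(P *\<^sub>v (Q *\<^sub>v w)) $ i = w $ i" using y0 i by simp
      qed (use wc P in simp)
      then show False using ne by simp
    qed
    then obtain i0 where i0: "i0 < n" "y $ i0 \<noteq> 0" using yc
      by (metis carrier_vecD eq_vecI index_zero_vec(1) index_zero_vec(2))
    \<comment> \<open>A scaled row of the complementary projection 1 - P Q: it vanishes on the
      columns of \<open>P\<close> and takes the value 1 at y, so it is the coordinate function of
      the new column.\<close>
    define q where "q = inverse (y $ i0) \<cdot>\<^sub>v row (1\<^sub>m n - P * Q) i0"
    have qc: "q \<in> carrier_vec n" using P Q by (simp add: q_def carrier_vecI)
    have PQP: "(1\<^sub>m n - P * Q) * P = 0\<^sub>m n d"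
      using P Q QP by (simp add: minus_mult_distrib_mat[of _ n n] assoc_mult_mat[OF P Q P] minus_r_inv_mat)
    have PQy: "(1\<^sub>m n - P * Q) *\<^sub>v y = y"
    proof -
      have "P *\<^sub>v (Q *\<^sub>v y) = 0\<^sub>v n" unfolding Qy using P by (intro eq_vecI) (auto simp: scalar_prod_def)
      then have "(P * Q) *\<^sub>v y = 0\<^sub>v n" using assoc_mult_mat_vec[OF P Q yc] by simp
      then show ?thesis using P Q yc by (simp add: minus_mult_distrib_mat_vec[of _ n n])
    qed
    have qP: "q \<bullet> col P j = 0" if j: "j < d" for j
    proof -
      have "row (1\<^sub>m n - P * Q) i0 \<bullet> col P j = ((1\<^sub>m n - P * Q) * P) $$ (i0, j)"
        using i0 j P Q by simp
      then show ?thesis unfolding PQP q_def using i0 j P Q by simp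
    qed
    have qy: "q \<bullet> y = 1"
    proof -
      have "row (1\<^sub>m n - P * Q) i0 \<bullet> y = ((1\<^sub>m n - P * Q) *\<^sub>v y) $ i0"
        using i0 P Q by simp
      then show ?thesis unfolding PQy q_def using i0 P Q yc by simp
    qed
    define P' where "P' = mat n (Suc d) (\<lambda>(i, j). if j < d then P $$ (i, j) else y $ i)"
    define Q' where "Q' = mat (Suc d) n (\<lambda>(i, j). if i < d then Q $$ (i, j) else q $ j)"
    have cP: "col P' j = (if j < d then col P j else y)" if "j < Suc d" for j
      using that P yc by (intro eq_vecI) (auto simp: P'_def)
    have rQ: "row Q' i = (if i < d then row Q i else q)" if "i < Suc d" for i
      using that Q qc by (intro eq_vecI) (auto simp: Q'_def)
    have "Q' * P' = 1\<^sub>m (Suc d)"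
    proof (rule eq_matI)
      fix i j assume "i < dim_row (1\<^sub>m (Suc d) :: 'k mat)" "j < dim_col (1\<^sub>m (Suc d) :: 'k mat)"
      then have ij: "i < Suc d" "j < Suc d" by auto
      have a: "row Q i \<bullet> col P j = (if i = j then 1 else 0)" if "i < d" "j < d"
        using arg_cong[OF QP, of "\<lambda>M. M $$ (i, j)"] that P Q by simp
      have b: "row Q i \<bullet> y = 0" if "i < d" using arg_cong[OF Qy, of "\<lambda>v. v $ i"] that Q by simp
      show "(Q' * P') $$ (i, j) = 1\<^sub>m (Suc d) $$ (i, j)"
        using ij a b qP qy cP[OF ij(2)] rQ[OF ij(1)] by (auto simp: P'_def Q'_def)
    qed (auto simp: P'_def Q'_def)
    moreover have "P' *\<^sub>v v \<in> U" if v: "v \<in> carrier_vec (Suc d)" for v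
    proof -
      have "P' *\<^sub>v v = P *\<^sub>v vec_first v d + (v $ d) \<cdot>\<^sub>v y"
        using P v yc by (intro eq_vecI)
          (auto simp: P'_def scalar_prod_def vec_first_def mult.commute)
      then show ?thesis using PU[of "vec_first v d"] yU U unfolding linear_subspace_def by auto
    qed
    ultimately have "A (Suc d) P' Q'" by (auto simp: A_def P'_def Q'_def)
    then show False using max by blast
  qed
  then show ?thesis using that P Q QP PU by blast
qed

section \<open>The twisted double\<close>

locale twisted_double = group G for G (structure) +
  fixes w :: "'a \<Rightarrow> 'a \<Rightarrow> 'a \<Rightarrow> 'k::{alg_closed_field, field_char_0}"
  assumes finite_carrier: "finite (carrier G)"
    and cocycle: "three_cocycle G w"
    and norm: "normalized G w"
begin

abbreviation "\<beta> \<equiv> beta G w"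
abbreviation "\<gamma> \<equiv> gamma G w"
abbreviation "Rep \<equiv> Rep_double G w"

text \<open>A right action of \<open>G\<close>. The product of e(g)x and e(h)y is nonzero only if h
  is \<open>cj x g\<close>, so e(g)x can be seen as an arrow between g and
  \<open>cj x g\<close>.\<close>

definition cj :: "'a \<Rightarrow> 'a \<Rightarrow> 'a" where "cj x g = inv x \<otimes> g \<otimes> x"

lemma w_nz [simp]:
  "\<lbrakk>g1 \<in> carrier G; g2 \<in> carrier G; g3 \<in> carrier G\<rbrakk> \<Longrightarrow> w g1 g2 g3 \<noteq> 0"
  using cocycle by (simp add: three_cocycle_def)

lemma pentagon:
  "\<lbrakk>g1 \<in> carrier G; g2 \<in> carrier G; g3 \<in> carrier G; g4 \<in> carrier G\<rbrakk> \<Longrightarrow>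
   w g2 g3 g4 * w g1 (g2 \<otimes> g3) g4 * w g1 g2 g3 = w (g1 \<otimes> g2) g3 g4 * w g1 g2 (g3 \<otimes> g4)"
  using cocycle by (simp add: three_cocycle_def)

lemma w_one [simp]:
  assumes "g \<in> carrier G" "h \<in> carrier G"
  shows "w g \<one> h = 1" "w \<one> g h = 1" "w g h \<one> = 1"
proof -
  have mid: "w g \<one> h = 1" if "g \<in> carrier G" "h \<in> carrier G" for g h
    using norm that by (simp add: normalized_def)
  then show "w g \<one> h = 1" using assms by simp
  show "w \<one> g h = 1" using pentagon[of \<one> \<one> g h] assms by (simp add: mid)
  show "w g h \<one> = 1" using pentagon[of g h \<one> \<one>] assms by (simp add: mid)
qed

lemma cj_closed [simp]: "x \<in> carrier G \<Longrightarrow> g \<in> carrier G \<Longrightarrow> cj x g \<in> carrier G"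
  by (simp add: cj_def)

lemma mult_cj: "x \<in> carrier G \<Longrightarrow> g \<in> carrier G \<Longrightarrow> x \<otimes> cj x g = g \<otimes> x"
  by (simp add: cj_def m_assoc[symmetric])

lemma cj_unique: "\<lbrakk>x \<in> carrier G; g \<in> carrier G; h \<in> carrier G; x \<otimes> h = g \<otimes> x\<rbrakk> \<Longrightarrow> cj x g = h"
  using inv_solve_left[of h x "g \<otimes> x"] by (simp add: cj_def m_assoc)

lemma cj_mult: "\<lbrakk>x \<in> carrier G; y \<in> carrier G; g \<in> carrier G\<rbrakk> \<Longrightarrow> cj (x \<otimes> y) g = cj y (cj x g)"
  by (simp add: cj_def inv_mult_group m_assoc)

lemma cj_one [simp]: "g \<in> carrier G \<Longrightarrow> cj \<one> g = g"
  by (simp add: cj_def)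

lemma cj_arg_one [simp]: "x \<in> carrier G \<Longrightarrow> cj x \<one> = \<one>"
  by (simp add: cj_def)

lemma cj_inv [simp]:
  assumes "x \<in> carrier G" "g \<in> carrier G"
  shows "cj (inv x) (cj x g) = g" "cj x (cj (inv x) g) = g"
  using cj_mult[of x "inv x" g] cj_mult[of "inv x" x g] assms by simp_all

lemma cj_arg_mult: "\<lbrakk>x \<in> carrier G; g \<in> carrier G; h \<in> carrier G\<rbrakk> \<Longrightarrow> cj x (g \<otimes> h) = cj x g \<otimes> cj x h"
  using mult_cj[of x h] by (simp add: cj_def m_assoc)

lemma cj_inject: "\<lbrakk>x \<in> carrier G; g \<in> carrier G; h \<in> carrier G\<rbrakk> \<Longrightarrow> cj x g = cj x h \<longleftrightarrow> g = h"
  by (metis cj_inv(1))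

lemma cj_self [simp]: "g \<in> carrier G \<Longrightarrow> cj g g = g"
  by (simp add: cj_def)

lemma bij_cj: "x \<in> carrier G \<Longrightarrow> bij_betw (cj x) (carrier G) (carrier G)"
  by (rule bij_betwI[where g = "cj (inv x)"]) auto

lemma beta_eq: "\<beta> a h g = w a h g * inverse (w h (cj h a) g) * w h g (cj (h \<otimes> g) a)"
  by (simp add: beta_def cj_def)

lemma gamma_eq: "\<gamma> x h k = w h k x * w x (cj x h) (cj x k) / w h x (cj x k)"
  by (simp add: gamma_def cj_def)

lemma beta_nz [simp]: "\<lbrakk>a \<in> carrier G; h \<in> carrier G; g \<in> carrier G\<rbrakk> \<Longrightarrow> \<beta> a h g \<noteq> 0"
  by (simp add: beta_eq)

lemma gamma_nz [simp]: "\<lbrakk>a \<in> carrier G; h \<in> carrier G; g \<in> carrier G\<rbrakk> \<Longrightarrow> \<gamma> a h g \<noteq> 0"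
  by (simp add: gamma_eq)

lemma beta_one [simp]:
  assumes "a \<in> carrier G" "x \<in> carrier G"
  shows "\<beta> a \<one> x = 1" "\<beta> a x \<one> = 1"
  using assms by (simp_all add: beta_eq)

lemma beta_arg_one [simp]: "x \<in> carrier G \<Longrightarrow> y \<in> carrier G \<Longrightarrow> \<beta> \<one> x y = 1"
  by (simp add: beta_eq)

text \<open>Associativity of the product of the double: \<open>\<beta>\<close> is a 2-cocycle of the
  action groupoid of conjugation. The four pentagons insert a, in its successive conjugates a, b, c,
  d, into the four places of the word x y z.\<close>

lemma beta_cocycle:
  assumes m: "a \<in> carrier G" "x \<in> carrier G" "y \<in> carrier G" "z \<in> carrier G"
  shows "\<beta> a x y * \<beta> a (x \<otimes> y) z = \<beta> (cj x a) y z * \<beta> a x (y \<otimes> z)"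
proof -
  define b where "b = cj x a"
  define c where "c = cj y b"
  define d where "d = cj z c"
  have bcd: "b \<in> carrier G" "c \<in> carrier G" "d \<in> carrier G" using m by (auto simp: b_def c_def d_def)
  have rw: "a \<otimes> x = x \<otimes> b" "b \<otimes> y = y \<otimes> c" "c \<otimes> z = z \<otimes> d"
    using m bcd by (simp_all add: b_def c_def d_def mult_cj)
  have cjs: "cj (x \<otimes> y) a = c" "cj (x \<otimes> y \<otimes> z) a = d" "cj (x \<otimes> (y \<otimes> z)) a = d" "cj (y \<otimes> z) b = d"
    using m bcd by (simp_all add: cj_mult b_def c_def d_def)
  have "w a x y * w x y c * w a (x \<otimes> y) z * w (x \<otimes> y) z d * (w y c z * w x b (y \<otimes> z)) =
    w b y z * w y z d * w a x (y \<otimes> z) * w x (y \<otimes> z) d * (w x b y * w (x \<otimes> y) c z)"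
    by (rule eq_by_cancel[OF
        mult_eq[OF pentagon[of a x y z]
        mult_eq[OF pentagon[of x b y z, symmetric]
        mult_eq[OF pentagon[of x y c z]
        pentagon[of x y z d, symmetric]]]]])
      (use m bcd in \<open>simp_all add: rw ac_simps del: m_assoc\<close>)
  then show ?thesis
    unfolding beta_eq cjs b_def[symmetric] c_def[symmetric]
    using m bcd by (simp add: cjs field_simps)
qed

text \<open>Multiplicativity of the coproduct. The six pentagons correspond to the six shuffles of
  the word h k, suitably conjugated, with the word x y.\<close>

lemma gamma_beta:
  assumes m: "h \<in> carrier G" "k \<in> carrier G" "x \<in> carrier G" "y \<in> carrier G"
  shows "\<gamma> x h k * \<gamma> y (cj x h) (cj x k) * \<beta> h x y * \<beta> k x y = \<beta> (h \<otimes> k) x y * \<gamma> (x \<otimes> y) h k"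
proof -
  define h1 h2 k1 k2 where "h1 = cj x h" and "h2 = cj y h1" and "k1 = cj x k" and "k2 = cj y k1"
  have c: "h1 \<in> carrier G" "h2 \<in> carrier G" "k1 \<in> carrier G" "k2 \<in> carrier G"
    using m by (auto simp: h1_def h2_def k1_def k2_def)
  have rw: "h \<otimes> x = x \<otimes> h1" "h1 \<otimes> y = y \<otimes> h2" "k \<otimes> x = x \<otimes> k1" "k1 \<otimes> y = y \<otimes> k2"
    using m c by (simp_all add: h1_def h2_def k1_def k2_def mult_cj)
  have cjs: "cj (x \<otimes> y) h = h2" "cj (x \<otimes> y) k = k2" "cj y h1 = h2" "cj y k1 = k2"
      "cj (x \<otimes> y) (h \<otimes> k) = h2 \<otimes> k2" "cj x (h \<otimes> k) = h1 \<otimes> k1"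
    using m c by (simp_all add: cj_mult cj_arg_mult h1_def h2_def k1_def k2_def)
  have "w h k x * w x h1 k1 * w h1 k1 y * w y h2 k2 * w h x y * w x y h2 * w k x y * w x y k2
      * (w (x) (h1 \<otimes> k1) y * w h (x \<otimes> y) k2) =
    w (h \<otimes> k) x y * w x y (h2 \<otimes> k2) * w h k (x \<otimes> y) * w (x \<otimes> y) h2 k2
      * (w h x k1 * w h1 y k2 * w x h1 y * w x k1 y)"
    by (rule eq_by_cancel[OF
        mult_eq[OF pentagon[of h k x y]
        mult_eq[OF pentagon[of h x k1 y, symmetric]
        mult_eq[OF pentagon[of x h1 k1 y]
        mult_eq[OF pentagon[of h x y k2]
        mult_eq[OF pentagon[of x h1 y k2, symmetric]
        pentagon[of x y h2 k2]]]]]]])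
      (use m c in \<open>simp_all add: rw ac_simps del: m_assoc\<close>)
  then show ?thesis
    unfolding beta_eq gamma_eq cjs h1_def[symmetric] k1_def[symmetric]
    using m c by (simp add: cjs field_simps)
qed

lemma beta_inv:
  assumes "a \<in> carrier G" "x \<in> carrier G"
  shows "\<beta> (cj x a) (inv x) x = \<beta> a x (inv x)"
  using beta_cocycle[of a x "inv x" x] assms by simp

text \<open>The scalar relation behind the \<open>D\<^sup>\<omega>(G)\<close>-linearity of averaged maps.\<close>

lemma beta_average:
  assumes m: "h \<in> carrier G" "x \<in> carrier G" "y \<in> carrier G"
  shows "\<beta> h y x * \<beta> h (y \<otimes> x) (inv (y \<otimes> x)) =
    \<beta> (cj (y \<otimes> x) h) (inv (y \<otimes> x)) y * \<beta> (cj y h) x (inv x)"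
proof -
  have e: "inv (y \<otimes> x) \<otimes> y = inv x" using m by (simp add: inv_mult_group m_assoc)
  have "\<beta> h (y \<otimes> x) (inv (y \<otimes> x)) = \<beta> (cj (y \<otimes> x) h) (inv (y \<otimes> x)) y * \<beta> h (y \<otimes> x) (inv x)"
    using beta_cocycle[of h "y \<otimes> x" "inv (y \<otimes> x)" y] m e by simp
  moreover have "\<beta> h y x * \<beta> h (y \<otimes> x) (inv x) = \<beta> (cj y h) x (inv x)"
    using beta_cocycle[of h y x "inv x"] m by simp
  ultimately show ?thesis by (simp add: mult.left_commute)
qed

end

section \<open>Representations as families of operators\<close>

lemma scal_triple: "scal c * (A * (scal d * B)) = scal (c * d) * (A * B)"
  by (metis scal_left_commute scal_scal)

context twisted_double
begin

definition ac :: "('a, 'k) rep \<Rightarrow> 'a \<Rightarrow> 'a \<Rightarrow> 'k lop" where "ac V g x = fm (act V g x)"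

lemma Rep_carrier:
  "V \<in> Rep \<Longrightarrow> g \<in> carrier G \<Longrightarrow> x \<in> carrier G \<Longrightarrow> act V g x \<in> carrier_mat (vdim V) (vdim V)"
  by (simp add: Rep_double_def)

lemma ac_one [simp]:
  assumes "V \<in> Rep" "g \<in> carrier G" "x \<in> carrier G"
  shows "fm (1\<^sub>m (vdim V)) * ac V g x = ac V g x" "ac V g x * fm (1\<^sub>m (vdim V)) = ac V g x"
  using Rep_carrier[OF assms] by (simp_all add: ac_def fm_one_left fm_one_right)

lemma ac_mult:
  assumes V: "V \<in> Rep" and m: "g \<in> carrier G" "x \<in> carrier G" "h \<in> carrier G" "y \<in> carrier G"
  shows "ac V g x * ac V h y = (if cj x g = h then scal (\<beta> g x y) * ac V g (x \<otimes> y) else 0)"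
proof -
  have "act V g x * act V h y =
    (if cj x g = h then \<beta> g x y \<cdot>\<^sub>m act V g (x \<otimes> y) else 0\<^sub>m (vdim V) (vdim V))"
    using V m by (simp add: Rep_double_def cj_def)
  from arg_cong[OF this, of fm] show ?thesis
    using fm_mult'[OF Rep_carrier[OF V m(1,2)] Rep_carrier[OF V m(3,4)]]
    by (simp add: ac_def fm_smult if_distrib cong: if_cong)
qed

lemma ac_sum: "V \<in> Rep \<Longrightarrow> (\<Sum>g\<in>carrier G. ac V g \<one>) = fm (1\<^sub>m (vdim V))"
  using fm_mat_sum[of "carrier G" "\<lambda>g. act V g \<one>" "vdim V" "vdim V"]
  by (simp add: Rep_double_def ac_def)

lemma RepI:
  assumes "\<And>g x. g \<in> carrier G \<Longrightarrow> x \<in> carrier G \<Longrightarrow> act V g x \<in> carrier_mat (vdim V) (vdim V)"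
    and "\<And>g x h y. \<lbrakk>g \<in> carrier G; x \<in> carrier G; h \<in> carrier G; y \<in> carrier G\<rbrakk> \<Longrightarrow>
      ac V g x * ac V h y = (if cj x g = h then scal (\<beta> g x y) * ac V g (x \<otimes> y) else 0)"
    and "(\<Sum>g\<in>carrier G. ac V g \<one>) = fm (1\<^sub>m (vdim V))"
  shows "V \<in> Rep"
proof -
  have "act V g x * act V h y =
    (if inv x \<otimes> g \<otimes> x = h then \<beta> g x y \<cdot>\<^sub>m act V g (x \<otimes> y) else 0\<^sub>m (vdim V) (vdim V))"
    if m: "g \<in> carrier G" "x \<in> carrier G" "h \<in> carrier G" "y \<in> carrier G" for g x h y
    using assms(2)[OF m] assms(1) m fm_mult'[OF assms(1)[OF m(1,2)] assms(1)[OF m(3,4)]]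
    by (intro fm_inject[of _ "vdim V" "vdim V"])
      (auto simp: ac_def fm_smult cj_def intro!: mult_carrier_mat[of _ "vdim V" "vdim V"])
  moreover have "mat_sum (vdim V) (vdim V) (\<lambda>g. act V g \<one>) (carrier G) = 1\<^sub>m (vdim V)"
    using assms(1,3) fm_mat_sum[of "carrier G" "\<lambda>g. act V g \<one>" "vdim V" "vdim V"]
    by (intro fm_inject[of _ "vdim V" "vdim V"]) (simp_all add: ac_def)
  ultimately show ?thesis using assms(1) by (simp add: Rep_double_def)
qed

lemma hom_iff:
  assumes "V \<in> Rep" "W \<in> Rep"
  shows "f \<in> hom_rep G V W \<longleftrightarrow> f \<in> carrier_mat (vdim W) (vdim V) \<and>
    (\<forall>g\<in>carrier G. \<forall>x\<in>carrier G. fm f * ac V g x = ac W g x * fm f)"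
proof -
  have "f * act V g x = act W g x * f \<longleftrightarrow> fm f * ac V g x = ac W g x * fm f"
    if f: "f \<in> carrier_mat (vdim W) (vdim V)" and m: "g \<in> carrier G" "x \<in> carrier G" for g x
  proof -
    note cV = Rep_carrier[OF assms(1) m] and cW = Rep_carrier[OF assms(2) m]
    have "f * act V g x = act W g x * f \<longleftrightarrow> fm (f * act V g x) = fm (act W g x * f)"
      using fm_inject[OF mult_carrier_mat[OF f cV] mult_carrier_mat[OF cW f]] by auto
    then show ?thesis by (simp add: fm_mult'[OF f cV] fm_mult'[OF cW f] ac_def)
  qed
  then show ?thesis by (auto simp: hom_rep_def)
qed

lemma homD:
  assumes "V \<in> Rep" "W \<in> Rep" "f \<in> hom_rep G V W"
  shows "f \<in> carrier_mat (vdim W) (vdim V)"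
    "g \<in> carrier G \<Longrightarrow> x \<in> carrier G \<Longrightarrow> fm f * ac V g x = ac W g x * fm f"
  using assms hom_iff by auto

lemma hom_comp:
  assumes "U \<in> Rep" "V \<in> Rep" "W \<in> Rep" "f \<in> hom_rep G V W" "h \<in> hom_rep G U V"
  shows "f * h \<in> hom_rep G U W"
proof -
  note f = homD[OF assms(2,3,4)] and h = homD[OF assms(1,2,5)]
  show ?thesis
    using f h assms unfolding hom_iff[OF assms(1,3)] fm_mult'[OF f(1) h(1)]
    by (simp add: mult.assoc) (simp add: mult.assoc[symmetric])
qed

lemma hom_one: "V \<in> Rep \<Longrightarrow> 1\<^sub>m (vdim V) \<in> hom_rep G V V"
  by (simp add: hom_iff)

section \<open>Averaging and complete reducibility\<close>

text \<open>Maschke averaging. The product of e(g)x and e(cj x g)x^-1 is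
  \<open>\<beta> g x (inv x)\<close> times e(g), so a summand conjugates \<open>F\<close> by e(g)x
  and its inverse between e(g) and e(cj x g). Only |G| is divided out, because the e(g) form a
  partition of the identity.\<close>

definition avg :: "('a, 'k) rep \<Rightarrow> ('a, 'k) rep \<Rightarrow> 'k lop \<Rightarrow> 'k lop" where
  "avg V W F = (\<Sum>g\<in>carrier G. \<Sum>x\<in>carrier G.
     scal (inverse (of_nat (card (carrier G)) * \<beta> g x (inv x))) * (ac W g x * F * ac V (cj x g) (inv x)))"

text \<open>Multiplication by e(h)y leaves the single index g = cj y h on the left and g = h on the
  right. Replacing x by y x matches the two sums, and \<open>beta_average\<close> is the equality of
  their coefficients.\<close>

lemma avg_commute:
  assumes VW: "V \<in> Rep" "W \<in> Rep" and m: "h \<in> carrier G" "y \<in> carrier G"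
  shows "ac W h y * avg V W F = avg V W F * ac V h y"
proof -
  define N where "N = (of_nat (card (carrier G)) :: 'k)"
  define k where "k = cj y h"
  have k: "k \<in> carrier G" using m by (simp add: k_def)
  have "ac W h y * avg V W F = (\<Sum>g\<in>carrier G. if g = k then (\<Sum>x\<in>carrier G.
      scal (inverse (N * \<beta> k x (inv x)) * \<beta> h y x) * (ac W h (y \<otimes> x) * F * ac V (cj x k) (inv x))) else 0)"
    unfolding avg_def sum_distrib_left
  proof (rule sum.cong[OF refl])
    fix g assume g: "g \<in> carrier G"
    have "ac W h y * (scal c * (ac W g x * F * ac V (cj x g) (inv x))) =
       (if g = k then scal (c * \<beta> h y x) * (ac W h (y \<otimes> x) * F * ac V (cj x k) (inv x)) else 0)"
      if x: "x \<in> carrier G" for x c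
    proof -
      have "ac W h y * (scal c * (ac W g x * F * ac V (cj x g) (inv x))) =
        scal c * ((ac W h y * ac W g x) * F * ac V (cj x g) (inv x))"
        by (simp add: scal_left_commute mult.assoc)
      then show ?thesis using ac_mult[OF VW(2) m g x] by (auto simp: k_def scal_mult mult.assoc)
    qed
    then show "(\<Sum>x\<in>carrier G. ac W h y * (scal (inverse (of_nat (card (carrier G)) * \<beta> g x (inv x))) *
          (ac W g x * F * ac V (cj x g) (inv x)))) =
        (if g = k then (\<Sum>x\<in>carrier G.
          scal (inverse (N * \<beta> k x (inv x)) * \<beta> h y x) * (ac W h (y \<otimes> x) * F * ac V (cj x k) (inv x))) else 0)"
      by (simp add: N_def)
  qed
  also have "\<dots> = (\<Sum>x\<in>carrier G.
      scal (inverse (N * \<beta> k x (inv x)) * \<beta> h y x) * (ac W h (y \<otimes> x) * F * ac V (cj x k) (inv x)))"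
    using k finite_carrier by simp
  also have "\<dots> = (\<Sum>x\<in>carrier G.
      scal (inverse (N * \<beta> h (y \<otimes> x) (inv (y \<otimes> x))) * \<beta> (cj (y \<otimes> x) h) (inv (y \<otimes> x)) y) *
        (ac W h (y \<otimes> x) * F * ac V (cj (y \<otimes> x) h) (inv (y \<otimes> x) \<otimes> y)))"
  proof (rule sum.cong[OF refl])
    fix x assume x: "x \<in> carrier G"
    have c: "inverse (N * \<beta> k x (inv x)) * \<beta> h y x =
      inverse (N * \<beta> h (y \<otimes> x) (inv (y \<otimes> x))) * \<beta> (cj (y \<otimes> x) h) (inv (y \<otimes> x)) y"
      using beta_average[OF m(1) x m(2)] m x k
      by (cases "N = 0") (simp_all add: k_def field_simps)
    have i: "inv (y \<otimes> x) \<otimes> y = inv x" using m x by (simp add: inv_mult_group m_assoc)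
    have k': "cj (y \<otimes> x) h = cj x k" using m x by (simp add: k_def cj_mult)
    show "scal (inverse (N * \<beta> k x (inv x)) * \<beta> h y x) * (ac W h (y \<otimes> x) * F * ac V (cj x k) (inv x)) =
      scal (inverse (N * \<beta> h (y \<otimes> x) (inv (y \<otimes> x))) * \<beta> (cj (y \<otimes> x) h) (inv (y \<otimes> x)) y) *
        (ac W h (y \<otimes> x) * F * ac V (cj (y \<otimes> x) h) (inv (y \<otimes> x) \<otimes> y))"
      unfolding c i k' ..
  qed
  also have "\<dots> = (\<Sum>x\<in>carrier G.
      scal (inverse (N * \<beta> h x (inv x)) * \<beta> (cj x h) (inv x) y) *
        (ac W h x * F * ac V (cj x h) (inv x \<otimes> y)))"
    by (rule sum.reindex_bij_betw[where h = "\<lambda>x. y \<otimes> x"],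
        rule bij_betwI[where g = "\<lambda>x. inv y \<otimes> x"]) (use m in \<open>auto simp: m_assoc[symmetric]\<close>)
  also have "\<dots> = (\<Sum>g\<in>carrier G. if g = h then (\<Sum>x\<in>carrier G.
      scal (inverse (N * \<beta> h x (inv x)) * \<beta> (cj x h) (inv x) y) *
        (ac W h x * F * ac V (cj x h) (inv x \<otimes> y))) else 0)"
    using m finite_carrier by simp
  also have "\<dots> = avg V W F * ac V h y"
    unfolding avg_def sum_distrib_right
  proof (rule sum.cong[OF refl])
    fix g assume g: "g \<in> carrier G"
    have "scal c * (ac W g x * F * ac V (cj x g) (inv x)) * ac V h y =
       (if g = h then scal (c * \<beta> (cj x h) (inv x) y) * (ac W h x * F * ac V (cj x h) (inv x \<otimes> y)) else 0)"
      if x: "x \<in> carrier G" for x c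
    proof -
      have "scal c * (ac W g x * F * ac V (cj x g) (inv x)) * ac V h y =
        scal c * (ac W g x * F * (ac V (cj x g) (inv x) * ac V h y))"
        by (simp add: mult.assoc)
      also have "ac V (cj x g) (inv x) * ac V h y =
          (if g = h then scal (\<beta> (cj x g) (inv x) y) * ac V (cj x g) (inv x \<otimes> y) else 0)"
        using ac_mult[OF VW(1), of "cj x g" "inv x" h y] g m x by simp
      finally show ?thesis by (simp add: scal_triple)
    qed
    then show "(if g = h then (\<Sum>x\<in>carrier G.
      scal (inverse (N * \<beta> h x (inv x)) * \<beta> (cj x h) (inv x) y) *
        (ac W h x * F * ac V (cj x h) (inv x \<otimes> y))) else 0) =
      (\<Sum>x\<in>carrier G. scal (inverse (of_nat (card (carrier G)) * \<beta> g x (inv x))) *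
          (ac W g x * F * ac V (cj x g) (inv x)) * ac V h y)"
      by (simp add: N_def)
  qed
  finally show ?thesis .
qed

definition avg_mat :: "('a, 'k) rep \<Rightarrow> ('a, 'k) rep \<Rightarrow> 'k mat \<Rightarrow> 'k mat" where
  "avg_mat V W p = mat_sum (vdim W) (vdim V) (\<lambda>(g, x).
     inverse (of_nat (card (carrier G)) * \<beta> g x (inv x)) \<cdot>\<^sub>m (act W g x * p * act V (cj x g) (inv x)))
     (carrier G \<times> carrier G)"

lemma avg_mat_term:
  assumes "V \<in> Rep" "W \<in> Rep" "p \<in> carrier_mat (vdim W) (vdim V)" "g \<in> carrier G" "x \<in> carrier G"
  shows "act W g x * p * act V (cj x g) (inv x) \<in> carrier_mat (vdim W) (vdim V)"
    "fm (act W g x * p * act V (cj x g) (inv x)) = ac W g x * fm p * ac V (cj x g) (inv x)"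
proof -
  have cW: "act W g x \<in> carrier_mat (vdim W) (vdim W)"
    and cV: "act V (cj x g) (inv x) \<in> carrier_mat (vdim V) (vdim V)"
    using assms Rep_carrier by auto
  note c = mult_carrier_mat[OF cW assms(3)]
  show "act W g x * p * act V (cj x g) (inv x) \<in> carrier_mat (vdim W) (vdim V)"
    by (rule mult_carrier_mat[OF c cV])
  show "fm (act W g x * p * act V (cj x g) (inv x)) = ac W g x * fm p * ac V (cj x g) (inv x)"
    by (simp add: fm_mult'[OF c cV] fm_mult'[OF cW assms(3)] ac_def)
qed

lemma fm_avg_mat:
  assumes "V \<in> Rep" "W \<in> Rep" "p \<in> carrier_mat (vdim W) (vdim V)"
  shows "fm (avg_mat V W p) = avg V W (fm p)"
  unfolding avg_mat_def
  by (subst fm_mat_sum)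
    (use avg_mat_term[OF assms] in \<open>auto simp: avg_def sum.cartesian_product fm_smult intro!: sum.cong\<close>)

lemma avg_mat_hom:
  assumes "V \<in> Rep" "W \<in> Rep" "p \<in> carrier_mat (vdim W) (vdim V)"
  shows "avg_mat V W p \<in> hom_rep G V W"
  using avg_commute[OF assms(1,2)] unfolding hom_iff[OF assms(1,2)] fm_avg_mat[OF assms]
  by (simp add: avg_mat_def)

lemma card_carrier_nz [simp]: "(of_nat (card (carrier G)) :: 'k) \<noteq> 0"
  using finite_carrier by auto

lemma avg_hom:
  assumes VW: "V \<in> Rep" "W \<in> Rep" and f: "f \<in> hom_rep G V W"
  shows "avg V W (fm f) = fm f"
proof -
  have t: "scal (inverse (of_nat (card (carrier G)) * \<beta> g x (inv x))) * (ac W g x * fm f * ac V (cj x g) (inv x)) =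
    scal (inverse (of_nat (card (carrier G)))) * (ac W g \<one> * fm f)"
    if m: "g \<in> carrier G" "x \<in> carrier G" for g x
  proof -
    have "ac W g x * fm f * ac V (cj x g) (inv x) = ac W g x * ac W (cj x g) (inv x) * fm f"
      using homD(2)[OF VW f, of "cj x g" "inv x"] m by (simp add: mult.assoc)
    also have "\<dots> = scal (\<beta> g x (inv x)) * (ac W g \<one> * fm f)"
      using ac_mult[OF VW(2), of g x "cj x g" "inv x"] m by (simp add: mult.assoc)
    finally show ?thesis using m by (simp add: scal_scal mult.assoc)
  qed
  have "avg V W (fm f) = (\<Sum>g\<in>carrier G. \<Sum>x\<in>carrier G. scal (inverse (of_nat (card (carrier G)))) * (ac W g \<one> * fm f))"
    unfolding avg_def using t by (intro sum.cong refl) auto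
  also have "\<dots> = (\<Sum>g\<in>carrier G. ac W g \<one> * fm f)"
    by (simp add: mult.assoc[symmetric] scal_of_nat[symmetric] scal_mult[symmetric]
        right_inverse[OF card_carrier_nz])
  also have "\<dots> = fm f"
    using homD(1)[OF VW f] by (simp add: sum_distrib_right[symmetric] ac_sum[OF VW(2)] fm_one_left)
  finally show ?thesis .
qed

lemma avg_comp_right:
  assumes "U \<in> Rep" "V \<in> Rep" "W \<in> Rep" "h \<in> hom_rep G U V"
  shows "avg V W F * fm h = avg U W (F * fm h)"
proof -
  have "ac W g x * F * ac V (cj x g) (inv x) * fm h = ac W g x * (F * fm h) * ac U (cj x g) (inv x)"
    if "g \<in> carrier G" "x \<in> carrier G" for g x
    using homD(2)[OF assms(1,2,4), of "cj x g" "inv x"] that by (simp add: mult.assoc)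
  then show ?thesis
    unfolding avg_def sum_distrib_right by (intro sum.cong refl) (simp add: mult.assoc)
qed

definition subrep :: "('a, 'k) rep \<Rightarrow> 'k mat \<Rightarrow> 'k mat \<Rightarrow> ('a, 'k) rep" where
  "subrep V P Q = \<lparr>vdim = dim_col P, act = (\<lambda>g x. Q * act V g x * P)\<rparr>"

text \<open>The assumption \<open>inv\<close> says that P Q fixes whatever e(g)x makes of the
  columns of \<open>P\<close>; this lets the inner P Q be cancelled in a product of two compressed
  operators.\<close>

lemma subrep:
  assumes V: "V \<in> Rep" and P: "P \<in> carrier_mat (vdim V) d" and Q: "Q \<in> carrier_mat d (vdim V)"
    and QP: "Q * P = 1\<^sub>m d"
    and inv: "\<forall>g\<in>carrier G. \<forall>x\<in>carrier G. fm P * fm Q * ac V g x * fm P = ac V g x * fm P"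
  shows "subrep V P Q \<in> Rep" "P \<in> hom_rep G (subrep V P Q) V"
    "\<forall>g\<in>carrier G. \<forall>x\<in>carrier G. ac (subrep V P Q) g x = fm Q * ac V g x * fm P"
    "vdim (subrep V P Q) = d"
proof -
  define S where "S = subrep V P Q"
  show d: "vdim (subrep V P Q) = d" using P by (simp add: subrep_def)
  have c: "act S g x \<in> carrier_mat d d" "ac S g x = fm Q * ac V g x * fm P"
    if "g \<in> carrier G" "x \<in> carrier G" for g x
    using Rep_carrier[OF V that] P Q fm_mult'[of "Q * act V g x" d "vdim V" P d] fm_mult'[of Q d "vdim V" "act V g x" "vdim V"]
    by (simp_all add: S_def subrep_def ac_def)
  then show ac: "\<forall>g\<in>carrier G. \<forall>x\<in>carrier G. ac (subrep V P Q) g x = fm Q * ac V g x * fm P"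
    by (simp add: S_def)
  have qp: "fm Q * fm P = fm (1\<^sub>m d)" using fm_mult'[OF Q P] QP by simp
  show S: "subrep V P Q \<in> Rep"
    unfolding S_def[symmetric]
  proof (rule RepI)
    fix g x h y assume m: "g \<in> carrier G" "x \<in> carrier G" "h \<in> carrier G" "y \<in> carrier G"
    have "ac S g x * ac S h y = fm Q * ac V g x * (fm P * fm Q * ac V h y * fm P)"
      using c m by (simp add: mult.assoc)
    also have "\<dots> = fm Q * (ac V g x * ac V h y) * fm P" using inv m by (simp add: mult.assoc)
    finally show "ac S g x * ac S h y = (if cj x g = h then scal (\<beta> g x y) * ac S g (x \<otimes> y) else 0)"
      using ac_mult[OF V m] c m by (simp add: scal_left_commute mult.assoc)
  next
    have "(\<Sum>g\<in>carrier G. ac S g \<one>) = fm Q * (\<Sum>g\<in>carrier G. ac V g \<one>) * fm P"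
      using c by (simp add: sum_distrib_left sum_distrib_right)
    then show "(\<Sum>g\<in>carrier G. ac S g \<one>) = fm (1\<^sub>m (vdim S))"
      using V P Q qp d by (simp add: ac_sum fm_one_right S_def)
  qed (use c d in \<open>auto simp: S_def\<close>)
  show "P \<in> hom_rep G (subrep V P Q) V"
    unfolding hom_iff[OF S V] using P d ac inv by (simp add: mult.assoc)
qed

end

lemma mat_eq_on_vec:
  fixes A B :: "'k::field mat"
  assumes A: "A \<in> carrier_mat n m" and B: "B \<in> carrier_mat n m"
    and eq: "\<And>v. v \<in> carrier_vec m \<Longrightarrow> A *\<^sub>v v = B *\<^sub>v v"
  shows "A = B"
proof (rule eq_matI)
  fix i j assume ij: "i < dim_row B" "j < dim_col B"
  have "C $$ (i, j) = (C *\<^sub>v unit_vec m j) $ i" if "C \<in> carrier_mat n m" for C :: "'k mat"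
    using ij B that by (simp add: row_def)
  then show "A $$ (i, j) = B $$ (i, j)" using eq[of "unit_vec m j"] A B by simp
qed (use A B in auto)

lemma mult_mat_zero_vec: "A \<in> carrier_mat n m \<Longrightarrow> A *\<^sub>v 0\<^sub>v m = 0\<^sub>v n"
  by (intro eq_vecI) auto

lemma sum_lessThan_add: "(\<Sum>i<a + b. f i) = (\<Sum>i<a. f i) + (\<Sum>i<b. f (a + i :: nat) :: 'b::comm_monoid_add)"
  by (induction b) (auto simp: add.assoc)

context twisted_double
begin

text \<open>Maschke's theorem for matrices. The projection P Q0 is the identity on the columns of
  \<open>P\<close> and maps into their span; invariance of \<open>U\<close> preserves both
  properties under averaging, so the average E is an equivariant projection and Q0 E an equivariant
  left inverse of \<open>P\<close>.\<close>

lemma invariant_summand: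
  assumes V: "V \<in> Rep" and U: "linear_subspace (vdim V) U"
    and inv: "\<And>g x u. \<lbrakk>g \<in> carrier G; x \<in> carrier G; u \<in> U\<rbrakk> \<Longrightarrow> act V g x *\<^sub>v u \<in> U"
  obtains S P Q where "S \<in> Rep" "P \<in> hom_rep G S V" "Q \<in> hom_rep G V S" "Q * P = 1\<^sub>m (vdim S)"
    "\<And>v. v \<in> carrier_vec (vdim S) \<Longrightarrow> P *\<^sub>v v \<in> U" "\<And>u. u \<in> U \<Longrightarrow> P *\<^sub>v (Q *\<^sub>v u) = u"
proof -
  define n where "n = vdim V"
  obtain d P Q0 where P: "P \<in> carrier_mat n d" and Q0: "Q0 \<in> carrier_mat d n" and QP: "Q0 * P = 1\<^sub>m d"
    and PU: "\<And>v. v \<in> carrier_vec d \<Longrightarrow> P *\<^sub>v v \<in> U" and PQU: "\<And>u. u \<in> U \<Longrightarrow> P *\<^sub>v (Q0 *\<^sub>v u) = u"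
    using linear_subspace_split[OF U] unfolding n_def by metis
  have UC: "u \<in> carrier_vec n" if "u \<in> U" for u using U that by (auto simp: linear_subspace_def n_def)
  have invP: "fm P * fm Q0 * ac V g x * fm P = ac V g x * fm P" if m: "g \<in> carrier G" "x \<in> carrier G" for g x
  proof -
    have a: "act V g x \<in> carrier_mat n n" using Rep_carrier[OF V m] by (simp add: n_def)
    have c: "P * Q0 \<in> carrier_mat n n" "act V g x * P \<in> carrier_mat n d" using P Q0 a by auto
    have "(P * Q0) * (act V g x * P) = act V g x * P"
    proof (rule mat_eq_on_vec)
      fix v :: "'k vec" assume v: "v \<in> carrier_vec d"
      define u where "u = act V g x *\<^sub>v (P *\<^sub>v v)"
      have u: "u \<in> U" using inv m PU v by (simp add: u_def)
      have "(P * Q0) * (act V g x * P) *\<^sub>v v = (P * Q0) *\<^sub>v ((act V g x * P) *\<^sub>v v)"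
        by (rule assoc_mult_mat_vec[OF c v])
      also have "(act V g x * P) *\<^sub>v v = u" unfolding u_def by (rule assoc_mult_mat_vec[OF a P v])
      also have "(P * Q0) *\<^sub>v u = P *\<^sub>v (Q0 *\<^sub>v u)" by (rule assoc_mult_mat_vec[OF P Q0 UC[OF u]])
      also have "\<dots> = u" by (rule PQU[OF u])
      also have "u = (act V g x * P) *\<^sub>v v" unfolding u_def using assoc_mult_mat_vec[OF a P v] by simp
      finally show "(P * Q0) * (act V g x * P) *\<^sub>v v = act V g x * P *\<^sub>v v" .
    qed (use c in auto)
    from arg_cong[OF this, of fm] show ?thesis
      by (simp add: fm_mult'[OF c] fm_mult'[OF P Q0] fm_mult'[OF a P] ac_def mult.assoc)
  qed
  define S where "S = subrep V P Q0"
  have invP': "\<forall>g\<in>carrier G. \<forall>x\<in>carrier G. fm P * fm Q0 * ac V g x * fm P = ac V g x * fm P"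
    using invP by blast
  note sub = subrep[OF V P[unfolded n_def] Q0[unfolded n_def] QP invP', folded S_def]
  have S: "S \<in> Rep" and PS: "P \<in> hom_rep G S V" and dS: "vdim S = d" using sub by auto
  define E where "E = avg_mat V V (P * Q0)"
  have c: "P * Q0 \<in> carrier_mat (vdim V) (vdim V)" using P Q0 by (simp add: n_def)
  have E: "E \<in> hom_rep G V V" unfolding E_def by (rule avg_mat_hom[OF V V c])
  have fE: "fm E = avg V V (fm P * fm Q0)" by (simp add: E_def fm_avg_mat[OF V V c] fm_mult'[OF P Q0])
  have qp: "fm Q0 * fm P = fm (1\<^sub>m d)" using fm_mult'[OF Q0 P] QP by simp
  have EP: "fm E * fm P = fm P"
  proof -
    have "fm P * fm Q0 * fm P = fm P" using qp fm_one_right[OF P] by (simp add: mult.assoc)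
    then show ?thesis unfolding fE avg_comp_right[OF S V V PS] by (simp add: avg_hom[OF S V PS])
  qed
  have PQE: "fm P * fm Q0 * fm E = fm E"
  proof -
    have "fm P * (fm Q0 * (ac V g x * (fm P * F))) = ac V g x * (fm P * F)" if "g \<in> carrier G" "x \<in> carrier G" for g x F
      using arg_cong[OF invP[OF that], of "\<lambda>z. z * F"] by (simp add: mult.assoc)
    then show ?thesis unfolding fE avg_def by (simp add: sum_distrib_left scal_left_commute mult.assoc)
  qed
  define Q where "Q = Q0 * E"
  have Ec: "E \<in> carrier_mat n n" using homD(1)[OF V V E] by (simp add: n_def)
  have fQ: "fm Q = fm Q0 * fm E" unfolding Q_def by (rule fm_mult'[OF Q0 Ec])
  have Qc: "Q \<in> carrier_mat d n" using Q0 Ec by (simp add: Q_def)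
  have Q: "Q \<in> hom_rep G V S"
    unfolding hom_iff[OF V S]
  proof (intro conjI ballI)
    fix g x assume m: "g \<in> carrier G" "x \<in> carrier G"
    have "fm Q * ac V g x = fm Q0 * ac V g x * fm E"
      using homD(2)[OF V V E m] by (simp add: fQ mult.assoc)
    also have "\<dots> = fm Q0 * ac V g x * (fm P * fm Q0 * fm E)" by (simp add: PQE)
    also have "\<dots> = ac S g x * fm Q" using sub(3) m by (simp add: fQ mult.assoc)
    finally show "fm Q * ac V g x = ac S g x * fm Q" .
  qed (use Qc dS n_def in auto)
  have QP1: "Q * P = 1\<^sub>m (vdim S)"
    by (rule fm_inject[of _ d d]) (use Qc P dS qp EP in \<open>auto simp: fm_mult'[OF Qc P] fQ mult.assoc\<close>)
  have "P *\<^sub>v (Q *\<^sub>v u) = u" if u: "u \<in> U" for u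
  proof -
    define v where "v = Q0 *\<^sub>v u"
    have v: "v \<in> carrier_vec d" using Q0 UC[OF u] by (simp add: v_def)
    have uP: "u = P *\<^sub>v v" using PQU[OF u] by (simp add: v_def)
    have "Q *\<^sub>v u = (Q * P) *\<^sub>v v" unfolding uP by (rule assoc_mult_mat_vec[OF Qc P v, symmetric])
    then show ?thesis using QP1 v dS uP by simp
  qed
  then show ?thesis using that[OF S PS Q QP1] PU dS by auto
qed

text \<open>Direct sums are expressed by inclusions and projections rather than by block matrices,
  so that they can be composed and transported along isomorphisms as identities of
  operators.\<close>

definition split_rep :: "('a, 'k) rep \<Rightarrow> ('a, 'k) rep \<Rightarrow> ('a, 'k) rep \<Rightarrow> bool" where
  "split_rep V S T \<longleftrightarrow> (\<exists>P Q P' Q'. P \<in> hom_rep G S V \<and> Q \<in> hom_rep G V S \<and> P' \<in> hom_rep G T V \<and> Q' \<in> hom_rep G V T \<and>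
     fm Q * fm P = fm (1\<^sub>m (vdim S)) \<and> fm Q' * fm P' = fm (1\<^sub>m (vdim T)) \<and>
     fm Q * fm P' = 0 \<and> fm Q' * fm P = 0 \<and> fm P * fm Q + fm P' * fm Q' = fm (1\<^sub>m (vdim V)))"

definition decomp :: "('a, 'k) rep \<Rightarrow> ('a, 'k) rep list \<Rightarrow> bool" where
  "decomp V Ws \<longleftrightarrow> (\<exists>P Q. (\<forall>i<length Ws. P i \<in> hom_rep G (Ws ! i) V \<and> Q i \<in> hom_rep G V (Ws ! i)) \<and>
     (\<forall>i<length Ws. \<forall>j<length Ws. fm (Q i) * fm (P j) = (if i = j then fm (1\<^sub>m (vdim (Ws ! i))) else 0)) \<and>
     (\<Sum>i<length Ws. fm (P i) * fm (Q i)) = fm (1\<^sub>m (vdim V)))"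

lemma invariant_split:
  assumes V: "V \<in> Rep" and U: "linear_subspace (vdim V) U"
    and inv: "\<And>g x u. \<lbrakk>g \<in> carrier G; x \<in> carrier G; u \<in> U\<rbrakk> \<Longrightarrow> act V g x *\<^sub>v u \<in> U"
    and U0: "U \<noteq> {0\<^sub>v (vdim V)}" and U1: "U \<noteq> carrier_vec (vdim V)"
  obtains S T where "S \<in> Rep" "T \<in> Rep" "split_rep V S T" "0 < vdim S" "0 < vdim T"
proof -
  define n where "n = vdim V"
  obtain S P Q where S: "S \<in> Rep" and P: "P \<in> hom_rep G S V" and Q: "Q \<in> hom_rep G V S" and QP: "Q * P = 1\<^sub>m (vdim S)"
    and PU: "\<And>v. v \<in> carrier_vec (vdim S) \<Longrightarrow> P *\<^sub>v v \<in> U" and PQU: "\<And>u. u \<in> U \<Longrightarrow> P *\<^sub>v (Q *\<^sub>v u) = u"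
    using invariant_summand[OF V U inv] by blast
  have Pc: "P \<in> carrier_mat n (vdim S)" and Qc: "Q \<in> carrier_mat (vdim S) n"
    using homD(1)[OF S V P] homD(1)[OF V S Q] by (auto simp: n_def)
  \<comment> \<open>The complement is the kernel of the equivariant projection \<open>Q\<close>,
    hence invariant.\<close>
  define K where "K = {v \<in> carrier_vec n. Q *\<^sub>v v = 0\<^sub>v (vdim S)}"
  have K: "linear_subspace (vdim V) K"
    unfolding linear_subspace_def K_def n_def[symmetric]
    using Qc by (auto simp: mult_add_distrib_mat_vec[OF Qc] mult_mat_vec[OF Qc])
  have Kinv: "act V g x *\<^sub>v u \<in> K" if m: "g \<in> carrier G" "x \<in> carrier G" and u: "u \<in> K" for g x u
  proof -
    have a: "act V g x \<in> carrier_mat n n" "act S g x \<in> carrier_mat (vdim S) (vdim S)"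
      using Rep_carrier[OF V m] Rep_carrier[OF S m] by (auto simp: n_def)
    have uc: "u \<in> carrier_vec n" "Q *\<^sub>v u = 0\<^sub>v (vdim S)" using u by (auto simp: K_def)
    have "Q *\<^sub>v (act V g x *\<^sub>v u) = (Q * act V g x) *\<^sub>v u" using assoc_mult_mat_vec[OF Qc a(1) uc(1)] by simp
    also have "Q * act V g x = act S g x * Q" using Q m by (simp add: hom_rep_def)
    also have "(act S g x * Q) *\<^sub>v u = act S g x *\<^sub>v (Q *\<^sub>v u)" by (rule assoc_mult_mat_vec[OF a(2) Qc uc(1)])
    finally show ?thesis using a uc mult_mat_zero_vec[OF a(2)] by (simp add: K_def)
  qed
  obtain T P' Q0 where T: "T \<in> Rep" and P': "P' \<in> hom_rep G T V" and Q0: "Q0 \<in> hom_rep G V T" and QP': "Q0 * P' = 1\<^sub>m (vdim T)"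
    and PK: "\<And>v. v \<in> carrier_vec (vdim T) \<Longrightarrow> P' *\<^sub>v v \<in> K" and PQK: "\<And>u. u \<in> K \<Longrightarrow> P' *\<^sub>v (Q0 *\<^sub>v u) = u"
    using invariant_summand[OF V K Kinv] by blast
  have P'c: "P' \<in> carrier_mat n (vdim T)" and Q0c: "Q0 \<in> carrier_mat (vdim T) n"
    using homD(1)[OF T V P'] homD(1)[OF V T Q0] by (auto simp: n_def)
  define C where "C = 1\<^sub>m n - P * Q"
  have Cc: "C \<in> carrier_mat n n" unfolding C_def by (rule minus_carrier_mat[OF mult_carrier_mat[OF Pc Qc]])
  have fC: "fm C = fm (1\<^sub>m n) - fm P * fm Q"
    unfolding C_def using fm_minus[of "1\<^sub>m n" n n "P * Q"] Pc Qc by (simp add: fm_mult'[OF Pc Qc])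
  have qp: "fm Q * fm P = fm (1\<^sub>m (vdim S))" using fm_mult'[OF Qc Pc] QP by simp
  have "Q * P' = 0\<^sub>m (vdim S) (vdim T)"
  proof (rule mat_eq_on_vec)
    fix v :: "'k vec" assume v: "v \<in> carrier_vec (vdim T)"
    have "Q * P' *\<^sub>v v = Q *\<^sub>v (P' *\<^sub>v v)" by (rule assoc_mult_mat_vec[OF Qc P'c v])
    also have "\<dots> = 0\<^sub>v (vdim S)" using PK[OF v] by (simp add: K_def)
    finally show "Q * P' *\<^sub>v v = 0\<^sub>m (vdim S) (vdim T) *\<^sub>v v" using v by (auto intro!: eq_vecI)
  qed (use Qc P'c in auto)
  then have qp'0: "fm Q * fm P' = 0" using fm_mult'[OF Qc P'c] by simp
  have PQC: "fm P' * fm Q0 * fm C = fm C"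
  proof -
    have "(P' * Q0) * C = C"
    proof (rule mat_eq_on_vec[of _ n n])
      fix v :: "'k vec" assume v: "v \<in> carrier_vec n"
      have Cv: "C *\<^sub>v v \<in> carrier_vec n" using Cc v by simp
      have "Q * C = 0\<^sub>m (vdim S) n"
        using qp by (intro fm_inject[of _ "vdim S" n])
          (use Qc Cc in \<open>auto simp: fm_mult'[OF Qc Cc] fC right_diff_distrib mult.assoc[symmetric] fm_one_right fm_one_left\<close>)
      then have "Q *\<^sub>v (C *\<^sub>v v) = 0\<^sub>m (vdim S) n *\<^sub>v v" using assoc_mult_mat_vec[OF Qc Cc v] by simp
      also have "\<dots> = 0\<^sub>v (vdim S)" using v by (auto intro!: eq_vecI)
      finally have "C *\<^sub>v v \<in> K" using Cv by (simp add: K_def)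
      from PQK[OF this] show "P' * Q0 * C *\<^sub>v v = C *\<^sub>v v"
        using assoc_mult_mat_vec[OF mult_carrier_mat[OF P'c Q0c] Cc v] assoc_mult_mat_vec[OF P'c Q0c Cv] by simp
    qed (use P'c Q0c Cc in auto)
    from arg_cong[OF this, of fm] show ?thesis
      by (simp add: fm_mult'[OF mult_carrier_mat[OF P'c Q0c] Cc] fm_mult'[OF P'c Q0c])
  qed
  have C: "C \<in> hom_rep G V V"
    unfolding hom_iff[OF V V]
  proof (intro conjI ballI)
    fix g x assume m: "g \<in> carrier G" "x \<in> carrier G"
    have "fm P * fm Q * ac V g x = ac V g x * (fm P * fm Q)"
      using homD(2)[OF V S Q m] homD(2)[OF S V P m] by (simp add: mult.assoc) (simp add: mult.assoc[symmetric])
    then show "fm C * ac V g x = ac V g x * fm C"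
      using V m by (simp add: fC left_diff_distrib right_diff_distrib n_def)
  qed (use Cc n_def in auto)
  \<comment> \<open>\<open>Q0\<close> inverts \<open>P'\<close> but need not vanish on the image of
    \<open>P\<close>; composing with C = 1 - P Q corrects this.\<close>
  define Q' where "Q' = Q0 * C"
  have Q': "Q' \<in> hom_rep G V T" unfolding Q'_def by (rule hom_comp[OF V V T Q0 C])
  have fQ': "fm Q' = fm Q0 * fm C" unfolding Q'_def by (rule fm_mult'[OF Q0c Cc])
  have q'p': "fm Q' * fm P' = fm (1\<^sub>m (vdim T))"
    using qp'0 fm_mult'[OF Q0c P'c] QP' fm_one_left[OF P'c]
    by (simp add: fQ' fC mult.assoc left_diff_distrib)
  have q'p: "fm Q' * fm P = 0"
    using qp fm_one_left[OF Pc] fm_one_right[OF Pc] by (simp add: fQ' fC mult.assoc left_diff_distrib)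
  have sum1: "fm P * fm Q + fm P' * fm Q' = fm (1\<^sub>m (vdim V))"
    using PQC by (simp add: fQ' mult.assoc[symmetric] fC n_def)
  have dS: "0 < vdim S"
  proof (rule ccontr)
    assume "\<not> 0 < vdim S"
    then have z: "vdim S = 0" by simp
    have "u = 0\<^sub>v n" if "u \<in> U" for u
    proof -
      have "P *\<^sub>v (Q *\<^sub>v u) = 0\<^sub>v n" using Pc Qc z by (intro eq_vecI) (auto simp: scalar_prod_def)
      then show ?thesis using PQU[OF that] by simp
    qed
    moreover have "0\<^sub>v n \<in> U" using U by (simp add: linear_subspace_def n_def)
    ultimately have "U = {0\<^sub>v n}" by blast
    then show False using U0 by (simp add: n_def)
  qed
  have dT: "0 < vdim T"
  proof (rule ccontr)
    assume "\<not> 0 < vdim T"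
    then have z: "vdim T = 0" by simp
    have "fm P' = 0"
    proof -
      have "P' = 0\<^sub>m n 0" using P'c z by (intro eq_matI) auto
      then show ?thesis by simp
    qed
    then have "fm (P * Q) = fm (1\<^sub>m n)" using sum1 by (simp add: fm_mult'[OF Pc Qc] n_def)
    then have PQ1: "P * Q = 1\<^sub>m n" using fm_inject[of "P * Q" n n "1\<^sub>m n"] Pc Qc by auto
    have "v \<in> U" if v: "v \<in> carrier_vec n" for v
    proof -
      have "v = P *\<^sub>v (Q *\<^sub>v v)" using assoc_mult_mat_vec[OF Pc Qc v] PQ1 v by simp
      then show ?thesis using PU[of "Q *\<^sub>v v"] Qc v by simp
    qed
    then have "U = carrier_vec n" using U by (auto simp: linear_subspace_def n_def)
    then show False using U1 by (simp add: n_def)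
  qed
  have "split_rep V S T"
    unfolding split_rep_def using P Q P' Q' qp q'p' qp'0 q'p sum1 by blast
  then show ?thesis using that S T dS dT by blast
qed

text \<open>Dimensions are read off traces: P Q has the trace of Q P, which is the identity of the
  summand. In characteristic zero equality in the field is equality of numbers.\<close>

lemma split_rep_vdim:
  assumes "V \<in> Rep" "S \<in> Rep" "T \<in> Rep" "split_rep V S T"
  shows "vdim V = vdim S + vdim T"
proof -
  obtain P Q P' Q' where h: "P \<in> hom_rep G S V" "Q \<in> hom_rep G V S" "P' \<in> hom_rep G T V" "Q' \<in> hom_rep G V T"
    and e: "fm Q * fm P = fm (1\<^sub>m (vdim S))" "fm Q' * fm P' = fm (1\<^sub>m (vdim T))"
     "fm P * fm Q + fm P' * fm Q' = fm (1\<^sub>m (vdim V))"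
    using assms(4) unfolding split_rep_def by blast
  note c = homD(1)[OF assms(2,1) h(1)] homD(1)[OF assms(1,2) h(2)] homD(1)[OF assms(3,1) h(3)] homD(1)[OF assms(1,3) h(4)]
  have QP: "Q * P = 1\<^sub>m (vdim S)" "Q' * P' = 1\<^sub>m (vdim T)"
    using e c by (auto intro!: fm_inject[of "Q * P" "vdim S" "vdim S"] fm_inject[of "Q' * P'" "vdim T" "vdim T"]
        simp: fm_mult'[OF c(2,1)] fm_mult'[OF c(4,3)])
  have PQc: "P * Q \<in> carrier_mat (vdim V) (vdim V)" "P' * Q' \<in> carrier_mat (vdim V) (vdim V)" using c by auto
  have "P * Q + P' * Q' = 1\<^sub>m (vdim V)"
    using e(3) PQc by (intro fm_inject[of _ "vdim V" "vdim V"])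
      (auto simp: fm_add[OF PQc] fm_mult'[OF c(1,2)] fm_mult'[OF c(3,4)])
  then have "of_nat (vdim V) = mat_trace (P * Q + P' * Q')" by (metis mat_trace_one)
  also have "\<dots> = mat_trace (P * Q) + mat_trace (P' * Q')"
    using PQc c by (simp add: mat_trace_def sum.distrib)
  also have "\<dots> = (of_nat (vdim S + vdim T) :: 'k)"
    using QP mat_trace_mult_commute[OF c(1,2)] mat_trace_mult_commute[OF c(3,4)] by simp
  finally show ?thesis by (simp only: of_nat_eq_iff)
qed

lemma decomp_append:
  assumes R: "V \<in> Rep" "S \<in> Rep" "T \<in> Rep" "set As \<subseteq> Rep" "set Bs \<subseteq> Rep"
    and "split_rep V S T" "decomp S As" "decomp T Bs"
  shows "decomp V (As @ Bs)"
proof -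
  define a b where "a = length As" and "b = length Bs"
  obtain P Q P' Q' where h: "P \<in> hom_rep G S V" "Q \<in> hom_rep G V S" "P' \<in> hom_rep G T V" "Q' \<in> hom_rep G V T"
    and e: "fm Q * fm P = fm (1\<^sub>m (vdim S))" "fm Q' * fm P' = fm (1\<^sub>m (vdim T))" "fm Q * fm P' = 0" "fm Q' * fm P = 0"
     "fm P * fm Q + fm P' * fm Q' = fm (1\<^sub>m (vdim V))"
    using assms(6) unfolding split_rep_def by blast
  note c = homD(1)[OF R(2,1) h(1)] homD(1)[OF R(1,2) h(2)] homD(1)[OF R(3,1) h(3)] homD(1)[OF R(1,3) h(4)]
  obtain PA QA where A: "\<And>i. i < a \<Longrightarrow> PA i \<in> hom_rep G (As ! i) S" "\<And>i. i < a \<Longrightarrow> QA i \<in> hom_rep G S (As ! i)"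
    "\<And>i j. i < a \<Longrightarrow> j < a \<Longrightarrow> fm (QA i) * fm (PA j) = (if i = j then fm (1\<^sub>m (vdim (As ! i))) else 0)"
    "(\<Sum>i<a. fm (PA i) * fm (QA i)) = fm (1\<^sub>m (vdim S))"
    using assms(7) unfolding decomp_def a_def by blast
  obtain PB QB where B: "\<And>i. i < b \<Longrightarrow> PB i \<in> hom_rep G (Bs ! i) T" "\<And>i. i < b \<Longrightarrow> QB i \<in> hom_rep G T (Bs ! i)"
    "\<And>i j. i < b \<Longrightarrow> j < b \<Longrightarrow> fm (QB i) * fm (PB j) = (if i = j then fm (1\<^sub>m (vdim (Bs ! i))) else 0)"
    "(\<Sum>i<b. fm (PB i) * fm (QB i)) = fm (1\<^sub>m (vdim T))"
    using assms(8) unfolding decomp_def b_def by blast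
  have RA: "As ! i \<in> Rep" if "i < a" for i using R(4) that by (auto simp: a_def)
  have RB: "Bs ! i \<in> Rep" if "i < b" for i using R(5) that by (auto simp: b_def)
  note cA = homD(1)[OF RA R(2) A(1)] homD(1)[OF R(2) RA A(2)]
  note cB = homD(1)[OF RB R(3) B(1)] homD(1)[OF R(3) RB B(2)]
  define PP where "PP i = (if i < a then P * PA i else P' * PB (i - a))" for i
  define QQ where "QQ i = (if i < a then QA i * Q else QB (i - a) * Q')" for i
  have lt: "i - a < b" if "i < a + b" "\<not> i < a" for i using that by simp
  have fP: "fm (PP i) = (if i < a then fm P * fm (PA i) else fm P' * fm (PB (i - a)))" if "i < a + b" for i
    using that cA(1)[of i] cB(1)[of "i - a"] lt[of i] c by (cases "i < a") (auto simp: PP_def fm_mult)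
  have fQ: "fm (QQ i) = (if i < a then fm (QA i) * fm Q else fm (QB (i - a)) * fm Q')" if "i < a + b" for i
    using that cA(2)[of i] cB(2)[of "i - a"] lt[of i] c by (cases "i < a") (auto simp: QQ_def fm_mult)
  have nth: "(As @ Bs) ! i = (if i < a then As ! i else Bs ! (i - a))" for i
    by (simp add: nth_append a_def)
  have "PP i \<in> hom_rep G ((As @ Bs) ! i) V \<and> QQ i \<in> hom_rep G V ((As @ Bs) ! i)" if i: "i < a + b" for i
  proof (cases "i < a")
    case True
    then show ?thesis using hom_comp[OF RA R(2,1) h(1) A(1)] hom_comp[OF R(1,2) RA A(2) h(2)]
      by (simp add: PP_def QQ_def nth)
  next
    case False
    then have "i - a < b" using i by simp
    then show ?thesis using False hom_comp[OF RB R(3,1) h(3) B(1)] hom_comp[OF R(1,3) RB B(2) h(4)]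
      by (simp add: PP_def QQ_def nth)
  qed
  moreover have "fm (QQ i) * fm (PP j) = (if i = j then fm (1\<^sub>m (vdim ((As @ Bs) ! i))) else 0)"
    if ij: "i < a + b" "j < a + b" for i j
  proof -
    have z1: "fm Q * (fm P' * F) = 0" "fm Q' * (fm P * F) = 0" for F
      using e(3,4) by (simp_all add: mult.assoc[symmetric])
    have z2: "fm Q * (fm P * fm (PA j)) = fm (PA j)" if "j < a"
      using e(1) fm_one_left[OF cA(1)[of j]] that by (simp add: mult.assoc[symmetric])
    have z3: "fm Q' * (fm P' * fm (PB (j - a))) = fm (PB (j - a))" if "\<not> j < a"
      using e(2) fm_one_left[OF cB(1)[of "j - a"]] that lt[of j] ij by (simp add: mult.assoc[symmetric])
    show ?thesis using ij z1 z2 z3 A(3)[of i j] B(3)[of "i - a" "j - a"]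
      by (cases "i < a"; cases "j < a") (simp_all add: fP fQ nth mult.assoc, auto)
  qed
  moreover have "(\<Sum>i<a + b. fm (PP i) * fm (QQ i)) = fm (1\<^sub>m (vdim V))"
  proof -
    have "(\<Sum>i<a + b. fm (PP i) * fm (QQ i)) =
      (\<Sum>i<a. fm P * (fm (PA i) * fm (QA i)) * fm Q) + (\<Sum>i<b. fm P' * (fm (PB i) * fm (QB i)) * fm Q')"
      unfolding sum_lessThan_add by (simp add: fP fQ mult.assoc)
    also have "\<dots> = fm P * fm Q + fm P' * fm Q'"
      unfolding sum_distrib_left[symmetric] sum_distrib_right[symmetric] A(4) B(4)
      using fm_one_right[OF c(1)] fm_one_right[OF c(3)] by simp
    finally show ?thesis using e by simp
  qed
  ultimately have "(\<forall>i<a + b. PP i \<in> hom_rep G ((As @ Bs) ! i) V \<and> QQ i \<in> hom_rep G V ((As @ Bs) ! i)) \<and>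
     (\<forall>i<a + b. \<forall>j<a + b. fm (QQ i) * fm (PP j) = (if i = j then fm (1\<^sub>m (vdim ((As @ Bs) ! i))) else 0)) \<and>
     (\<Sum>i<a + b. fm (PP i) * fm (QQ i)) = fm (1\<^sub>m (vdim V))" by blast
  then show ?thesis unfolding decomp_def length_append a_def[symmetric] b_def[symmetric] by blast
qed

lemma decomp_single: "V \<in> Rep \<Longrightarrow> decomp V [V]"
  unfolding decomp_def
  by (intro exI[of _ "\<lambda>_. 1\<^sub>m (vdim V)"]) (auto simp: hom_one fm_one_left[of _ "vdim V" "vdim V"])

lemma decomp_Nil: "vdim V = 0 \<Longrightarrow> decomp V []"
proof -
  assume "vdim V = 0"
  moreover have "1\<^sub>m 0 = (0\<^sub>m 0 0 :: 'k mat)" by auto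
  ultimately show ?thesis by (simp add: decomp_def)
qed

lemma complete_reducibility:
  assumes "V \<in> Rep"
  shows "\<exists>Ws. (\<forall>W\<in>set Ws. simple_rep G w W) \<and> decomp V Ws"
  using assms
proof (induction "vdim V" arbitrary: V rule: less_induct)
  case less
  show ?case
  proof (cases "vdim V = 0 \<or> simple_rep G w V")
    case True
    then show ?thesis using decomp_Nil[of V] decomp_single[OF less.prems]
      by (metis empty_iff empty_set list.set_intros(1) set_ConsD)
  next
    case False
    then obtain U where U0: "linear_subspace (vdim V) U"
      "\<forall>A\<in>{act V g x |g x. g \<in> carrier G \<and> x \<in> carrier G}. \<forall>u\<in>U. A *\<^sub>v u \<in> U"
      "U \<noteq> {0\<^sub>v (vdim V)}" "U \<noteq> carrier_vec (vdim V)"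
      using less.prems unfolding simple_rep_def irreducible_mats_def subspace_module_vec by auto
    have U: "\<And>g x u. \<lbrakk>g \<in> carrier G; x \<in> carrier G; u \<in> U\<rbrakk> \<Longrightarrow> act V g x *\<^sub>v u \<in> U"
      using U0(2) by blast
    obtain S T where ST: "S \<in> Rep" "T \<in> Rep" "split_rep V S T" "0 < vdim S" "0 < vdim T"
      using invariant_split[OF less.prems U0(1) U U0(3,4)] by blast
    have d: "vdim V = vdim S + vdim T" by (rule split_rep_vdim[OF less.prems ST(1-3)])
    obtain As Bs where AB: "\<forall>W\<in>set As. simple_rep G w W" "decomp S As" "\<forall>W\<in>set Bs. simple_rep G w W" "decomp T Bs"
      using less.hyps[of S] less.hyps[of T] d ST by auto
    moreover have "decomp V (As @ Bs)"
      using decomp_append[OF less.prems ST(1,2) _ _ ST(3) AB(2,4)] AB(1,3) by (auto simp: simple_rep_def)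
    ultimately show ?thesis by (metis Un_iff set_append)
  qed
qed

section \<open>Direct sums and isomorphisms\<close>

lemma split_rep_block:
  assumes S: "S \<in> Rep" and T: "T \<in> Rep" and d: "vdim V = vdim S + vdim T"
    and block: "\<And>g x. g \<in> carrier G \<Longrightarrow> x \<in> carrier G \<Longrightarrow> act V g x =
      four_block_mat (act S g x) (0\<^sub>m (vdim S) (vdim T)) (0\<^sub>m (vdim T) (vdim S)) (act T g x)"
  shows "V \<in> Rep" "split_rep V S T"
proof -
  define m n where "m = vdim S" and "n = vdim T"
  define P where "P = mat (m + n) m (\<lambda>(i, j). if i = j then 1 else 0 :: 'k)"
  define Q where "Q = mat m (m + n) (\<lambda>(i, j). if i = j then 1 else 0 :: 'k)"
  define P' where "P' = mat (m + n) n (\<lambda>(i, j). if i = m + j then 1 else 0 :: 'k)"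
  define Q' where "Q' = mat n (m + n) (\<lambda>(i, j). if j = m + i then 1 else 0 :: 'k)"
  have c: "P \<in> carrier_mat (m + n) m" "Q \<in> carrier_mat m (m + n)" "P' \<in> carrier_mat (m + n) n" "Q' \<in> carrier_mat n (m + n)"
    by (auto simp: P_def Q_def P'_def Q'_def)
  \<comment> \<open>On sequences the inclusions and projections are truncations and shifts by m, so
    their relations hold coordinatewise.\<close>
  have rP: "Rep_lop (fm P) u = (\<lambda>i. if i < m then u i else 0)"
    and rQ: "Rep_lop (fm Q) u = (\<lambda>i. if i < m then u i else 0)" for u
    by (auto simp: fm.rep_eq P_def Q_def fun_eq_iff if_distrib[of "\<lambda>z. z * _"] cong: if_cong)
  have rP': "Rep_lop (fm P') u = (\<lambda>i. if m \<le> i \<and> i < m + n then u (i - m) else 0)" for u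
  proof
    fix i
    show "Rep_lop (fm P') u i = (if m \<le> i \<and> i < m + n then u (i - m) else 0)"
    proof (cases "m \<le> i \<and> i < m + n")
      case True
      then obtain l where "i = m + l" "l < n" using le_Suc_ex by fastforce
      then show ?thesis by (simp add: fm.rep_eq P'_def if_distrib[of "\<lambda>z. z * _"] cong: if_cong)
    next
      case False
      then show ?thesis by (auto simp: fm.rep_eq P'_def intro!: sum.neutral)
    qed
  qed
  have rQ': "Rep_lop (fm Q') u = (\<lambda>i. if i < n then u (m + i) else 0)" for u
    by (auto simp: fm.rep_eq Q'_def fun_eq_iff if_distrib[of "\<lambda>z. z * _"] cong: if_cong)
  have r1: "Rep_lop (fm (1\<^sub>m l)) u = (\<lambda>i. if i < l then u i else 0)" for l and u :: "nat \<Rightarrow> 'k"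
    by (auto simp: fm.rep_eq fun_eq_iff if_distrib[of "\<lambda>z. z * _"] cong: if_cong)
  have e: "fm Q * fm P = fm (1\<^sub>m m)" "fm Q' * fm P' = fm (1\<^sub>m n)" "fm Q * fm P' = 0" "fm Q' * fm P = 0"
    "fm P * fm Q + fm P' * fm Q' = fm (1\<^sub>m (m + n))"
    by (auto simp: Rep_lop_inject[symmetric] times_lop.rep_eq zero_lop.rep_eq plus_lop.rep_eq rP rQ rP' rQ' r1 fun_eq_iff)
  have ac: "ac V g x = fm P * ac S g x * fm Q + fm P' * ac T g x * fm Q'"
    if gx: "g \<in> carrier G" "x \<in> carrier G" for g x
  proof -
    have a: "act S g x \<in> carrier_mat m m" "act T g x \<in> carrier_mat n n"
      using Rep_carrier[OF S gx] Rep_carrier[OF T gx] by (auto simp: m_def n_def)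
    have rS: "Rep_lop (fm (act S g x)) u = (\<lambda>i. if i < m then \<Sum>j<m. act S g x $$ (i, j) * u j else 0)"
      and rT: "Rep_lop (fm (act T g x)) u = (\<lambda>i. if i < n then \<Sum>j<n. act T g x $$ (i, j) * u j else 0)" for u
      using a by (auto simp: fm.rep_eq)
    have rV: "Rep_lop (fm (act V g x)) u = (\<lambda>i. if i < m then \<Sum>j<m. act S g x $$ (i, j) * u j else
        if i < m + n then \<Sum>j<n. act T g x $$ (i - m, j) * u (m + j) else 0)" for u
      unfolding block[OF gx] m_def[symmetric] n_def[symmetric]
      using a by (auto simp: fm.rep_eq fun_eq_iff sum_lessThan_add intro!: sum.cong)
    show ?thesis
      unfolding ac_def
      by (auto simp: Rep_lop_inject[symmetric] times_lop.rep_eq plus_lop.rep_eq rP rQ rP' rQ' rS rT rV fun_eq_iff)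
  qed
  have z: "fm Q * (fm P * F) = fm (1\<^sub>m m) * F" "fm Q' * (fm P' * F) = fm (1\<^sub>m n) * F"
    "fm Q * (fm P' * F) = 0" "fm Q' * (fm P * F) = 0" for F
    using e(1-4) by (simp_all add: mult.assoc[symmetric])
  have oST: "fm (1\<^sub>m m) * (ac S g x * F) = ac S g x * F" "fm (1\<^sub>m n) * (ac T g x * F) = ac T g x * F"
    if "g \<in> carrier G" "x \<in> carrier G" for g x F
    using S T that by (simp_all add: m_def n_def mult.assoc[symmetric])
  show V: "V \<in> Rep"
  proof (rule RepI)
    fix g x assume gx: "g \<in> carrier G" "x \<in> carrier G"
    show "act V g x \<in> carrier_mat (vdim V) (vdim V)"
      unfolding block[OF gx] d using Rep_carrier[OF S gx] Rep_carrier[OF T gx] by auto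
    fix h y assume hy: "h \<in> carrier G" "y \<in> carrier G"
    have "ac V g x * ac V h y = fm P * (ac S g x * ac S h y) * fm Q + fm P' * (ac T g x * ac T h y) * fm Q'"
      using gx hy by (simp add: ac distrib_left distrib_right mult.assoc z oST)
    also have "\<dots> = (if cj x g = h then scal (\<beta> g x y) * ac V g (x \<otimes> y) else 0)"
      using ac_mult[OF S gx hy] ac_mult[OF T gx hy] gx hy
      by (simp add: ac scal_left_commute mult.assoc distrib_left)
    finally show "ac V g x * ac V h y = (if cj x g = h then scal (\<beta> g x y) * ac V g (x \<otimes> y) else 0)" .
  next
    have "(\<Sum>g\<in>carrier G. ac V g \<one>) = fm P * (\<Sum>g\<in>carrier G. ac S g \<one>) * fm Q + fm P' * (\<Sum>g\<in>carrier G. ac T g \<one>) * fm Q'"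
      by (simp add: ac sum.distrib sum_distrib_left sum_distrib_right)
    then show "(\<Sum>g\<in>carrier G. ac V g \<one>) = fm (1\<^sub>m (vdim V))"
      using e(5) fm_one_right[OF c(1)] fm_one_right[OF c(3)] d by (simp add: ac_sum[OF S] ac_sum[OF T] m_def n_def)
  qed
  have o: "ac S g x * fm (1\<^sub>m m) = ac S g x" "ac T g x * fm (1\<^sub>m n) = ac T g x"
     "fm (1\<^sub>m m) * ac S g x = ac S g x" "fm (1\<^sub>m n) * ac T g x = ac T g x"
    if "g \<in> carrier G" "x \<in> carrier G" for g x using S T that by (simp_all add: m_def n_def)
  have "P \<in> hom_rep G S V" "Q \<in> hom_rep G V S" "P' \<in> hom_rep G T V" "Q' \<in> hom_rep G V T"
    unfolding hom_iff[OF S V] hom_iff[OF V S] hom_iff[OF T V] hom_iff[OF V T]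
    using c d by (auto simp: ac distrib_left distrib_right mult.assoc z oST o e m_def[symmetric] n_def[symmetric])
  then show "split_rep V S T"
    unfolding split_rep_def using e d m_def n_def by auto
qed

lemma direct_sum_decomp:
  assumes "set Ws \<subseteq> Rep"
  shows "direct_sum Ws \<in> Rep \<and> decomp (direct_sum Ws) Ws"
  using assms
proof (induction Ws)
  case Nil
  have "1\<^sub>m 0 = (0\<^sub>m 0 0 :: 'k mat)" by auto
  then have "direct_sum [] \<in> Rep"
    by (intro RepI) (auto simp: direct_sum_def ac_def)
  then show ?case by (simp add: decomp_Nil direct_sum_def)
next
  case (Cons W Ws)
  define D where "D = direct_sum Ws"
  have W: "W \<in> Rep" and D: "D \<in> Rep" "decomp D Ws" using Cons by (auto simp: D_def)
  have block: "act (direct_sum (W # Ws)) g x =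
      four_block_mat (act W g x) (0\<^sub>m (vdim W) (vdim D)) (0\<^sub>m (vdim D) (vdim W)) (act D g x)"
    if "g \<in> carrier G" "x \<in> carrier G" for g x
    using Rep_carrier[OF W that] Rep_carrier[OF D(1) that] by (simp add: direct_sum_def D_def Let_def)
  have d: "vdim (direct_sum (W # Ws)) = vdim W + vdim D" by (simp add: direct_sum_def D_def)
  note s = split_rep_block[OF W D(1) d block]
  show ?case
    using s(1) decomp_append[OF s(1) W D(1) _ _ s(2) decomp_single[OF W] D(2)] Cons.prems W by simp
qed

lemma iso_rep_iff:
  assumes V: "V \<in> Rep" and W: "W \<in> Rep"
  shows "iso_rep G V W \<longleftrightarrow> (\<exists>f\<in>hom_rep G V W. \<exists>f'\<in>hom_rep G W V.
    fm f' * fm f = fm (1\<^sub>m (vdim V)) \<and> fm f * fm f' = fm (1\<^sub>m (vdim W)))"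
proof -
  have "f' * f = 1\<^sub>m (vdim V) \<longleftrightarrow> fm f' * fm f = fm (1\<^sub>m (vdim V))"
    "f * f' = 1\<^sub>m (vdim W) \<longleftrightarrow> fm f * fm f' = fm (1\<^sub>m (vdim W))"
    if "f \<in> hom_rep G V W" "f' \<in> hom_rep G W V" for f f'
  proof -
    note c = homD(1)[OF V W that(1)] homD(1)[OF W V that(2)]
    show "f' * f = 1\<^sub>m (vdim V) \<longleftrightarrow> fm f' * fm f = fm (1\<^sub>m (vdim V))"
      using fm_mult'[OF c(2,1)] fm_inject[OF mult_carrier_mat[OF c(2,1)], of "1\<^sub>m (vdim V)"] by auto
    show "f * f' = 1\<^sub>m (vdim W) \<longleftrightarrow> fm f * fm f' = fm (1\<^sub>m (vdim W))"
      using fm_mult'[OF c(1,2)] fm_inject[OF mult_carrier_mat[OF c(1,2)], of "1\<^sub>m (vdim W)"] by auto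
  qed
  then show ?thesis unfolding iso_rep_def by blast
qed

lemma iso_refl: "V \<in> Rep \<Longrightarrow> iso_rep G V V"
  unfolding iso_rep_def
  by (rule bexI[of _ "1\<^sub>m (vdim V)"], rule bexI[of _ "1\<^sub>m (vdim V)"]) (auto simp: hom_one)

lemma iso_sym: "iso_rep G V W \<Longrightarrow> iso_rep G W V"
  by (auto simp: iso_rep_def)

lemma iso_trans:
  assumes U: "U \<in> Rep" and V: "V \<in> Rep" and W: "W \<in> Rep" and i: "iso_rep G U V" "iso_rep G V W"
  shows "iso_rep G U W"
proof -
  obtain f f' where f: "f \<in> hom_rep G U V" "f' \<in> hom_rep G V U" "fm f' * fm f = fm (1\<^sub>m (vdim U))" "fm f * fm f' = fm (1\<^sub>m (vdim V))"
    using i(1) iso_rep_iff[OF U V] by blast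
  obtain h h' where h: "h \<in> hom_rep G V W" "h' \<in> hom_rep G W V" "fm h' * fm h = fm (1\<^sub>m (vdim V))" "fm h * fm h' = fm (1\<^sub>m (vdim W))"
    using i(2) iso_rep_iff[OF V W] by blast
  note c = homD(1)[OF U V f(1)] homD(1)[OF V U f(2)] homD(1)[OF V W h(1)] homD(1)[OF W V h(2)]
  have "fm f' * fm h' * (fm h * fm f) = fm f' * (fm h' * fm h) * fm f" by (simp add: mult.assoc)
  also have "\<dots> = fm (1\<^sub>m (vdim U))" using h f fm_one_right[OF c(2)] by simp
  finally have 1: "fm (f' * h') * fm (h * f) = fm (1\<^sub>m (vdim U))" using c by (simp add: fm_mult)
  have "fm h * fm f * (fm f' * fm h') = fm h * (fm f * fm f') * fm h'" by (simp add: mult.assoc)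
  also have "\<dots> = fm (1\<^sub>m (vdim W))" using h f fm_one_right[OF c(3)] by simp
  finally have 2: "fm (h * f) * fm (f' * h') = fm (1\<^sub>m (vdim W))" using c by (simp add: fm_mult)
  show ?thesis unfolding iso_rep_iff[OF U W]
    using hom_comp[OF U V W h(1) f(1)] hom_comp[OF W V U f(2) h(2)] 1 2 by blast
qed

lemma iso_vdim:
  assumes "V \<in> Rep" "W \<in> Rep" "iso_rep G V W"
  shows "vdim V = vdim W"
proof -
  obtain f f' where f: "f \<in> hom_rep G V W" "f' \<in> hom_rep G W V" "f' * f = 1\<^sub>m (vdim V)" "f * f' = 1\<^sub>m (vdim W)"
    using assms(3) by (auto simp: iso_rep_def)
  note c = homD(1)[OF assms(1,2) f(1)] homD(1)[OF assms(2,1) f(2)]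
  have "of_nat (vdim V) = mat_trace (f' * f)" using f by simp
  also have "\<dots> = (of_nat (vdim W) :: 'k)" using mat_trace_mult_commute[OF c(2,1)] f by simp
  finally show ?thesis by simp
qed

text \<open>The isomorphism is the sum over all summands of the projection from \<open>V\<close>
  followed by the inclusion into \<open>V'\<close>; orthogonality makes the two such sums inverse to
  each other.\<close>

lemma decomp_iso:
  assumes V: "V \<in> Rep" and V': "V' \<in> Rep" and Ws: "set Ws \<subseteq> Rep"
    and dec: "decomp V Ws" "decomp V' Ws"
  shows "iso_rep G V V'"
proof -
  define a where "a = length Ws"
  have RW: "Ws ! i \<in> Rep" if "i < a" for i using Ws that by (auto simp: a_def)
  define D where "D U P Q \<longleftrightarrow> (\<forall>i<a. P i \<in> hom_rep G (Ws ! i) U \<and> Q i \<in> hom_rep G U (Ws ! i)) \<and>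
     (\<forall>i<a. \<forall>j<a. fm (Q i) * fm (P j) = (if i = j then fm (1\<^sub>m (vdim (Ws ! i))) else 0)) \<and>
     (\<Sum>i<a. fm (P i) * fm (Q i)) = fm (1\<^sub>m (vdim U))" for U P Q
  obtain P Q P' Q' where DV: "D V P Q" "D V' P' Q'"
    using dec unfolding decomp_def D_def a_def by blast
  define f where "f U U' P Q = mat_sum (vdim U') (vdim U) (\<lambda>i. P i * Q i :: 'k mat) {..<a}" for U U' :: "('a, 'k) rep" and P Q
  have key: "f U U' P' Q \<in> hom_rep G U U' \<and> fm (f U' U P Q') * fm (f U U' P' Q) = fm (1\<^sub>m (vdim U))"
    if UU: "U \<in> Rep" "U' \<in> Rep" and D1: "D U P Q" and D2: "D U' P' Q'" for U U' P Q P' Q'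
  proof -
    have h: "P i \<in> hom_rep G (Ws ! i) U" "Q i \<in> hom_rep G U (Ws ! i)"
      "P' i \<in> hom_rep G (Ws ! i) U'" "Q' i \<in> hom_rep G U' (Ws ! i)" if "i < a" for i
      using D1 D2 that by (auto simp: D_def)
    have c: "P i \<in> carrier_mat (vdim U) (vdim (Ws ! i))" "Q i \<in> carrier_mat (vdim (Ws ! i)) (vdim U)"
      "P' i \<in> carrier_mat (vdim U') (vdim (Ws ! i))" "Q' i \<in> carrier_mat (vdim (Ws ! i)) (vdim U')" if "i < a" for i
      using homD(1)[OF RW UU(1) h(1)] homD(1)[OF UU(1) RW h(2)] homD(1)[OF RW UU(2) h(3)] homD(1)[OF UU(2) RW h(4)] that by auto
    have f1: "fm (f U U' P' Q) = (\<Sum>i<a. fm (P' i) * fm (Q i))"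
      unfolding f_def by (subst fm_mat_sum) (simp_all add: mult_carrier_mat[OF c(3,2)] fm_mult'[OF c(3,2)])
    have f2: "fm (f U' U P Q') = (\<Sum>i<a. fm (P i) * fm (Q' i))"
      unfolding f_def by (subst fm_mat_sum) (simp_all add: mult_carrier_mat[OF c(1,4)] fm_mult'[OF c(1,4)])
    have "f U U' P' Q \<in> hom_rep G U U'"
      unfolding hom_iff[OF UU]
    proof (intro conjI ballI)
      fix g x assume m: "g \<in> carrier G" "x \<in> carrier G"
      have "fm (P' i) * fm (Q i) * ac U g x = ac U' g x * (fm (P' i) * fm (Q i))" if i: "i < a" for i
        using homD(2)[OF UU(1) RW[OF i] h(2)[OF i] m] homD(2)[OF RW[OF i] UU(2) h(3)[OF i] m]
        by (simp add: mult.assoc) (simp add: mult.assoc[symmetric])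
      then show "fm (f U U' P' Q) * ac U g x = ac U' g x * fm (f U U' P' Q)"
        unfolding f1 by (simp add: sum_distrib_left sum_distrib_right)
    qed (simp add: f_def)
    moreover have "fm (f U' U P Q') * fm (f U U' P' Q) = fm (1\<^sub>m (vdim U))"
    proof -
      have t: "fm (P i) * fm (Q' i) * (fm (P' j) * fm (Q j)) = (if i = j then fm (P i) * fm (Q i) else 0)"
        if ij: "i < a" "j < a" for i j
      proof -
        have "fm (P i) * fm (Q' i) * (fm (P' j) * fm (Q j)) = fm (P i) * (fm (Q' i) * fm (P' j)) * fm (Q j)"
          by (simp add: mult.assoc)
        then show ?thesis using D2 ij fm_one_right[OF c(1)[OF ij(1)]] by (auto simp: D_def)
      qed
      have "fm (f U' U P Q') * fm (f U U' P' Q) = (\<Sum>i<a. \<Sum>j<a. if i = j then fm (P i) * fm (Q i) else 0)"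
        unfolding f1 f2 sum_product using t by (intro sum.cong refl) auto
      also have "\<dots> = (\<Sum>i<a. fm (P i) * fm (Q i))" by simp
      finally show ?thesis using D1 by (simp add: D_def)
    qed
    ultimately show ?thesis by blast
  qed
  show ?thesis
    unfolding iso_rep_iff[OF V V'] using key[OF V V' DV] key[OF V' V DV(2,1)] by blast
qed

lemma decomp_transport:
  assumes V: "V \<in> Rep" and V': "V' \<in> Rep" and Ws: "set Ws \<subseteq> Rep" and iso: "iso_rep G V V'" and dec: "decomp V' Ws"
  shows "decomp V Ws"
proof -
  obtain f f' where f: "f \<in> hom_rep G V V'" "f' \<in> hom_rep G V' V" "fm f' * fm f = fm (1\<^sub>m (vdim V))" "fm f * fm f' = fm (1\<^sub>m (vdim V'))"
    using iso iso_rep_iff[OF V V'] by blast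
  note c = homD(1)[OF V V' f(1)] homD(1)[OF V' V f(2)]
  obtain P Q where h: "\<And>i. i < length Ws \<Longrightarrow> P i \<in> hom_rep G (Ws ! i) V'" "\<And>i. i < length Ws \<Longrightarrow> Q i \<in> hom_rep G V' (Ws ! i)"
    and o: "\<forall>i<length Ws. \<forall>j<length Ws. fm (Q i) * fm (P j) = (if i = j then fm (1\<^sub>m (vdim (Ws ! i))) else 0)"
    and s: "(\<Sum>i<length Ws. fm (P i) * fm (Q i)) = fm (1\<^sub>m (vdim V'))"
    using dec unfolding decomp_def by blast
  have RW: "Ws ! i \<in> Rep" if "i < length Ws" for i using Ws that by auto
  have ch: "P i \<in> carrier_mat (vdim V') (vdim (Ws ! i))" "Q i \<in> carrier_mat (vdim (Ws ! i)) (vdim V')" if "i < length Ws" for i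
    using homD(1)[OF RW V' h(1)] homD(1)[OF V' RW h(2)] that by auto
  have fP: "fm (f' * P i) = fm f' * fm (P i)" "fm (Q i * f) = fm (Q i) * fm f" if "i < length Ws" for i
    using ch[OF that] c by (auto simp: fm_mult)
  have "f' * P i \<in> hom_rep G (Ws ! i) V \<and> Q i * f \<in> hom_rep G V (Ws ! i)" if "i < length Ws" for i
    using hom_comp[OF RW V' V f(2) h(1)] hom_comp[OF V V' RW h(2) f(1)] that by auto
  moreover have "fm (Q i * f) * fm (f' * P j) = (if i = j then fm (1\<^sub>m (vdim (Ws ! i))) else 0)"
    if ij: "i < length Ws" "j < length Ws" for i j
  proof -
    have "fm (Q i * f) * fm (f' * P j) = fm (Q i) * (fm f * fm f') * fm (P j)" using ij by (simp add: fP mult.assoc)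
    also have "\<dots> = fm (Q i) * fm (P j)" using f(4) fm_one_right[OF ch(2)[OF ij(1)]] by simp
    finally show ?thesis using o ij by auto
  qed
  moreover have "(\<Sum>i<length Ws. fm (f' * P i) * fm (Q i * f)) = fm (1\<^sub>m (vdim V))"
  proof -
    have "(\<Sum>i<length Ws. fm (f' * P i) * fm (Q i * f)) = fm f' * (\<Sum>i<length Ws. fm (P i) * fm (Q i)) * fm f"
      by (simp add: fP sum_distrib_left sum_distrib_right mult.assoc)
    then show ?thesis using s f(3) fm_one_right[OF c(2)] by simp
  qed
  ultimately have main: "(\<forall>i<length Ws. f' * P i \<in> hom_rep G (Ws ! i) V \<and> Q i * f \<in> hom_rep G V (Ws ! i)) \<and>
     (\<forall>i<length Ws. \<forall>j<length Ws. fm (Q i * f) * fm (f' * P j) = (if i = j then fm (1\<^sub>m (vdim (Ws ! i))) else 0)) \<and>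
     (\<Sum>i<length Ws. fm (f' * P i) * fm (Q i * f)) = fm (1\<^sub>m (vdim V))" by blast
  show ?thesis
    unfolding decomp_def by (rule exI[of _ "\<lambda>i. f' * P i"], rule exI[of _ "\<lambda>i. Q i * f"]) (rule main)
qed

lemma iso_direct_sum_iff:
  assumes "V \<in> Rep" "set Ws \<subseteq> Rep"
  shows "iso_rep G V (direct_sum Ws) \<longleftrightarrow> decomp V Ws"
  using assms direct_sum_decomp[OF assms(2)] decomp_iso[of V "direct_sum Ws" Ws] decomp_transport[of V "direct_sum Ws" Ws] by blast

section \<open>Schur's lemma\<close>

lemma simpleD: "simple_rep G w V \<Longrightarrow> V \<in> Rep" "simple_rep G w V \<Longrightarrow> 0 < vdim V"
  by (auto simp: simple_rep_def irreducible_mats_def)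

lemma simple_subspace:
  assumes "simple_rep G w V" "linear_subspace (vdim V) U"
    and "\<And>g x u. \<lbrakk>g \<in> carrier G; x \<in> carrier G; u \<in> U\<rbrakk> \<Longrightarrow> act V g x *\<^sub>v u \<in> U"
  shows "U = {0\<^sub>v (vdim V)} \<or> U = carrier_vec (vdim V)"
  using assms unfolding simple_rep_def irreducible_mats_def subspace_module_vec by blast

lemma schur_zero:
  assumes V: "simple_rep G w V" and W: "W \<in> Rep" and f: "f \<in> hom_rep G V W"
    and v: "v \<in> carrier_vec (vdim V)" "v \<noteq> 0\<^sub>v (vdim V)" "f *\<^sub>v v = 0\<^sub>v (vdim W)"
  shows "f = 0\<^sub>m (vdim W) (vdim V)"
proof -
  note fc = homD(1)[OF simpleD(1)[OF V] W f]
  define K where "K = {v \<in> carrier_vec (vdim V). f *\<^sub>v v = 0\<^sub>v (vdim W)}"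
  have K: "linear_subspace (vdim V) K"
    unfolding linear_subspace_def K_def
    using fc by (auto simp: mult_add_distrib_mat_vec[OF fc] mult_mat_vec[OF fc])
  have Kinv: "act V g x *\<^sub>v u \<in> K" if m: "g \<in> carrier G" "x \<in> carrier G" and u: "u \<in> K" for g x u
  proof -
    note a = Rep_carrier[OF simpleD(1)[OF V] m] Rep_carrier[OF W m]
    have uc: "u \<in> carrier_vec (vdim V)" "f *\<^sub>v u = 0\<^sub>v (vdim W)" using u by (auto simp: K_def)
    have "f *\<^sub>v (act V g x *\<^sub>v u) = (f * act V g x) *\<^sub>v u" using assoc_mult_mat_vec[OF fc a(1) uc(1)] by simp
    also have "f * act V g x = act W g x * f" using f m by (simp add: hom_rep_def)
    also have "(act W g x * f) *\<^sub>v u = act W g x *\<^sub>v (f *\<^sub>v u)" by (rule assoc_mult_mat_vec[OF a(2) fc uc(1)])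
    finally show ?thesis using a uc mult_mat_zero_vec[OF a(2)] by (simp add: K_def)
  qed
  have "v \<in> K" using v by (simp add: K_def)
  then have "K = carrier_vec (vdim V)" using simple_subspace[OF V K Kinv] v by blast
  then have "f *\<^sub>v u = 0\<^sub>v (vdim W)" if "u \<in> carrier_vec (vdim V)" for u using that by (auto simp: K_def)
  then show ?thesis by (intro mat_eq_on_vec[OF fc]) (auto intro!: eq_vecI)
qed

lemma schur_iso:
  assumes V: "simple_rep G w V" and W: "simple_rep G w W" and f: "f \<in> hom_rep G V W"
    and nz: "f \<noteq> 0\<^sub>m (vdim W) (vdim V)"
  shows "iso_rep G V W"
proof -
  define n m where "n = vdim V" and "m = vdim W"
  note RV = simpleD(1)[OF V] and RW = simpleD(1)[OF W]
  have fc: "f \<in> carrier_mat m n" using homD(1)[OF RV RW f] by (simp add: n_def m_def)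
  define U where "U = (\<lambda>v. f *\<^sub>v v) ` carrier_vec n"
  have U: "linear_subspace (vdim W) U"
    unfolding linear_subspace_def
  proof (intro conjI ballI allI)
    show "U \<subseteq> carrier_vec (vdim W)" using fc by (auto simp: U_def m_def)
    show "0\<^sub>v (vdim W) \<in> U" using mult_mat_zero_vec[OF fc] unfolding U_def m_def
      by (metis imageI zero_carrier_vec)
    fix u assume "u \<in> U"
    then obtain v where v: "v \<in> carrier_vec n" "u = f *\<^sub>v v" by (auto simp: U_def)
    show "c \<cdot>\<^sub>v u \<in> U" for c
      using v mult_mat_vec[OF fc v(1), of c] unfolding U_def by (metis imageI smult_carrier_vec)
    fix u' assume "u' \<in> U"
    then obtain v' where v': "v' \<in> carrier_vec n" "u' = f *\<^sub>v v'" by (auto simp: U_def)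
    show "u + u' \<in> U"
      using v v' mult_add_distrib_mat_vec[OF fc v(1) v'(1)] unfolding U_def by (metis imageI add_carrier_vec)
  qed
  have Uinv: "act W g x *\<^sub>v u \<in> U" if gx: "g \<in> carrier G" "x \<in> carrier G" and u: "u \<in> U" for g x u
  proof -
    have a: "act V g x \<in> carrier_mat n n" "act W g x \<in> carrier_mat m m"
      using Rep_carrier[OF RV gx] Rep_carrier[OF RW gx] by (auto simp: n_def m_def)
    obtain v where v: "v \<in> carrier_vec n" "u = f *\<^sub>v v" using u by (auto simp: U_def)
    have "act W g x *\<^sub>v u = (act W g x * f) *\<^sub>v v" using assoc_mult_mat_vec[OF a(2) fc v(1)] v by simp
    also have "act W g x * f = f * act V g x" using f gx by (simp add: hom_rep_def)
    also have "(f * act V g x) *\<^sub>v v = f *\<^sub>v (act V g x *\<^sub>v v)" by (rule assoc_mult_mat_vec[OF fc a(1) v(1)])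
    finally show ?thesis using a v by (auto simp: U_def)
  qed
  have "U \<noteq> {0\<^sub>v m}"
  proof
    assume "U = {0\<^sub>v m}"
    then have "f *\<^sub>v v = 0\<^sub>v m" if "v \<in> carrier_vec n" for v using that by (auto simp: U_def)
    then have "f = 0\<^sub>m m n" by (intro mat_eq_on_vec[OF fc]) (auto intro!: eq_vecI)
    then show False using nz by (simp add: n_def m_def)
  qed
  then have "U = carrier_vec m" using simple_subspace[OF W U Uinv] by (simp add: m_def)
  then have "\<forall>j. \<exists>v. v \<in> carrier_vec n \<and> f *\<^sub>v v = unit_vec m j"
    unfolding U_def by (metis (no_types, lifting) image_iff unit_vec_carrier)
  then obtain s where s: "\<And>j. s j \<in> carrier_vec n" "\<And>j. f *\<^sub>v s j = unit_vec m j" by metis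
  \<comment> \<open>Preimages of the unit vectors, taken as columns, form a right inverse of
    \<open>f\<close>.\<close>
  define f' where "f' = mat n m (\<lambda>(i, j). s j $ i)"
  have f'c: "f' \<in> carrier_mat n m" by (simp add: f'_def)
  have "f * f' = 1\<^sub>m m"
  proof (rule eq_matI)
    fix i j assume "i < dim_row (1\<^sub>m m :: 'k mat)" "j < dim_col (1\<^sub>m m :: 'k mat)"
    then have ij: "i < m" "j < m" by auto
    have "s j \<in> carrier_vec n" by (rule s(1))
    then have "col f' j = s j" using ij by (intro eq_vecI) (auto simp: f'_def)
    then have "(f * f') $$ (i, j) = (f *\<^sub>v s j) $ i" using ij fc f'c by simp
    then show "(f * f') $$ (i, j) = 1\<^sub>m m $$ (i, j)" using ij s(2) by simp
  qed (use fc f'c in auto)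
  then have ff': "fm f * fm f' = fm (1\<^sub>m m)" using fm_mult'[OF fc f'c] by simp
  have "f' * f = 1\<^sub>m n"
  proof (rule mat_eq_on_vec)
    fix v :: "'k vec" assume v: "v \<in> carrier_vec n"
    \<comment> \<open>\<open>f\<close> kills the difference of \<open>f' * f *\<^sub>v v\<close> and
      v; if it were nonzero, \<open>schur_zero\<close> would make \<open>f\<close> zero.\<close>
    define u where "u = (f' * f) *\<^sub>v v + (-1) \<cdot>\<^sub>v v"
    have u': "(f' * f) *\<^sub>v v \<in> carrier_vec n" using fc f'c v by simp
    have uc: "u \<in> carrier_vec n" using u' v by (simp add: u_def)
    have "f *\<^sub>v ((f' * f) *\<^sub>v v) = (f * (f' * f)) *\<^sub>v v"
      using assoc_mult_mat_vec[OF fc mult_carrier_mat[OF f'c fc] v] by simp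
    also have "f * (f' * f) = f"
      by (rule fm_inject[of _ m n]) (use fc f'c ff' fm_one_left[OF fc] in \<open>auto simp: fm_mult mult.assoc[symmetric]\<close>)
    finally have "f *\<^sub>v u = 0\<^sub>v m"
      unfolding u_def using fc v u' by (simp add: mult_add_distrib_mat_vec[OF fc u'] mult_mat_vec[OF fc v]) (intro eq_vecI; simp)
    then have "u = 0\<^sub>v n" using schur_zero[OF V RW f, of u] uc nz by (auto simp: n_def m_def)
    show "f' * f *\<^sub>v v = 1\<^sub>m n *\<^sub>v v"
    proof (rule eq_vecI)
      fix i assume "i < dim_vec (1\<^sub>m n *\<^sub>v v)"
      then have i: "i < n" by simp
      have "u $ i = ((f' * f) *\<^sub>v v) $ i - v $ i" unfolding u_def using i v u' f'c by simp
      then show "(f' * f *\<^sub>v v) $ i = (1\<^sub>m n *\<^sub>v v) $ i" using \<open>u = 0\<^sub>v n\<close> i v by simp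
    qed (use fc f'c in auto)
  qed (use fc f'c in auto)
  then have f'f: "fm f' * fm f = fm (1\<^sub>m n)" using fm_mult'[OF f'c fc] by simp
  have "f' \<in> hom_rep G W V"
    unfolding hom_iff[OF RW RV]
  proof (intro conjI ballI)
    fix g x assume gx: "g \<in> carrier G" "x \<in> carrier G"
    have "fm f' * ac W g x = fm f' * ac W g x * (fm f * fm f')" using RW gx by (simp add: ff' m_def mult.assoc)
    also have "\<dots> = fm f' * (ac W g x * fm f) * fm f'" by (simp add: mult.assoc)
    also have "\<dots> = (fm f' * fm f) * ac V g x * fm f'" using homD(2)[OF RV RW f gx] by (simp add: mult.assoc)
    also have "\<dots> = ac V g x * fm f'" using RV gx by (simp add: f'f n_def)
    finally show "fm f' * ac W g x = ac V g x * fm f'" .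
  qed (use f'c n_def m_def in auto)
  then show ?thesis unfolding iso_rep_iff[OF RV RW] using f f'f ff' n_def m_def by blast
qed

lemma schur_scalar:
  assumes V: "simple_rep G w V" and f: "f \<in> hom_rep G V V"
  shows "\<exists>c. f = c \<cdot>\<^sub>m 1\<^sub>m (vdim V)"
proof -
  define n where "n = vdim V"
  note RV = simpleD(1)[OF V]
  have fc: "f \<in> carrier_mat n n" using homD(1)[OF RV RV f] by (simp add: n_def)
  have "0 < degree (char_poly f)" using degree_monic_char_poly[OF fc] simpleD(2)[OF V] by (simp add: n_def)
  then obtain c where "poly (char_poly f) c = 0" using alg_closed_imp_poly_has_root by blast
  then have "eigenvalue f c" using eigenvalue_root_char_poly[OF fc] by simp
  then obtain v where v: "v \<in> carrier_vec n" "v \<noteq> 0\<^sub>v n" "f *\<^sub>v v = c \<cdot>\<^sub>v v"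
    using fc by (auto simp: eigenvalue_def eigenvector_def)
  define h where "h = f - c \<cdot>\<^sub>m 1\<^sub>m n"
  have hc: "h \<in> carrier_mat n n" unfolding h_def by (intro minus_carrier_mat) simp
  have fh: "fm h = fm f - scal c * fm (1\<^sub>m n)"
    unfolding h_def using fm_minus[OF fc, of "c \<cdot>\<^sub>m 1\<^sub>m n"] by (simp add: fm_smult)
  have h: "h \<in> hom_rep G V V"
    unfolding hom_iff[OF RV RV]
    using homD(2)[OF RV RV f] hc RV
    by (auto simp: fh left_diff_distrib right_diff_distrib n_def mult.assoc scal_left_commute)
  have "h *\<^sub>v v = 0\<^sub>v n"
  proof -
    have "(c \<cdot>\<^sub>m 1\<^sub>m n) *\<^sub>v v = c \<cdot>\<^sub>v (1\<^sub>m n *\<^sub>v v)" using v(1)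
      by (intro eq_vecI) (auto simp: scalar_prod_def if_distrib[of "\<lambda>z. z * _"] if_distrib[of "\<lambda>z. c * z"] cong: if_cong)
    then have "(c \<cdot>\<^sub>m 1\<^sub>m n) *\<^sub>v v = c \<cdot>\<^sub>v v" using v(1) by simp
    then have "h *\<^sub>v v = c \<cdot>\<^sub>v v - c \<cdot>\<^sub>v v"
      unfolding h_def using fc v by (subst minus_mult_distrib_mat_vec[of _ n n]) auto
    then show ?thesis using v by simp
  qed
  then have "h = 0\<^sub>m n n" using schur_zero[OF V RV h] v by (simp add: n_def)
  then have "fm f = fm (c \<cdot>\<^sub>m 1\<^sub>m n)" using fh by (simp add: fm_smult)
  then have "f = c \<cdot>\<^sub>m 1\<^sub>m n" using fc by (intro fm_inject[of _ n n]) auto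
  then show ?thesis by (auto simp: n_def)
qed

end

section \<open>Characters and the regular representation\<close>

text \<open>Summed over i and j this yields the product of the traces of \<open>A\<close> and
  \<open>B\<close>, which is how characters are connected with averages.\<close>

lemma elementary_mat_entry:
  fixes A B :: "'k::field mat"
  assumes A: "A \<in> carrier_mat n n" and B: "B \<in> carrier_mat m m" and ij: "i < n" "j < m"
  shows "(A * mat n m (\<lambda>p. if p = (i, j) then 1 else 0) * B) $$ (i, j) = A $$ (i, i) * B $$ (j, j)"
proof -
  define E where "E = mat n m (\<lambda>p. if p = (i, j) then 1 else 0 :: 'k)"
  have "(A * E) $$ (i, l) = (if l = j then A $$ (i, i) else 0)" if l: "l < m" for l
  proof -
    show ?thesis
      using A ij l by (auto simp: E_def scalar_prod_def atLeast0LessThan if_distrib[of "\<lambda>z. _ * z"] cong: if_cong)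
  qed
  moreover have "(A * E * B) $$ (i, j) = (\<Sum>l<m. (A * E) $$ (i, l) * B $$ (l, j))"
    using A B ij by (simp add: E_def scalar_prod_def atLeast0LessThan)
  ultimately have "(A * E * B) $$ (i, j) = (\<Sum>l<m. if l = j then A $$ (i, i) * B $$ (j, j) else 0)"
    by (simp add: if_distrib[of "\<lambda>z. z * _"] cong: if_cong)
  then show ?thesis using ij by (simp add: E_def)
qed

context twisted_double
begin

definition chr :: "('a, 'k) rep \<Rightarrow> 'a \<Rightarrow> 'a \<Rightarrow> 'k" where "chr V g x = mat_trace (act V g x)"

text \<open>The character of \<open>W\<close> is evaluated at the normalised inverse of e(g)x. The
  result is the trace of the averaging projection \<open>avg W S\<close> from matrices onto
  morphisms from \<open>W\<close> to \<open>S\<close>; \<open>ip_avg\<close> writes this trace in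
  the basis of elementary matrices.\<close>

definition ip :: "('a, 'k) rep \<Rightarrow> ('a, 'k) rep \<Rightarrow> 'k" where
  "ip S W = (\<Sum>(g, x)\<in>carrier G \<times> carrier G.
     inverse (of_nat (card (carrier G)) * \<beta> g x (inv x)) * (chr S g x * chr W (cj x g) (inv x)))"

lemma chr_iso:
  assumes V: "V \<in> Rep" and W: "W \<in> Rep" and iso: "iso_rep G V W" and m: "g \<in> carrier G" "x \<in> carrier G"
  shows "chr V g x = chr W g x"
proof -
  obtain f f' where f: "f \<in> hom_rep G V W" "f' \<in> hom_rep G W V" "fm f' * fm f = fm (1\<^sub>m (vdim V))" "fm f * fm f' = fm (1\<^sub>m (vdim W))"
    using iso iso_rep_iff[OF V W] by blast
  note c = homD(1)[OF V W f(1)] homD(1)[OF W V f(2)]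
  note a = Rep_carrier[OF V m] Rep_carrier[OF W m]
  note c2 = mult_carrier_mat[OF a(1) c(2)]
  have "fm (act V g x * f' * f) = ac V g x * (fm f' * fm f)"
    by (simp only: fm_mult'[OF c2 c(1)] fm_mult'[OF a(1) c(2)] ac_def mult.assoc)
  then have 1: "act V g x * f' * f = act V g x"
    using V m f(3) by (intro fm_inject[OF mult_carrier_mat[OF c2 c(1)] a(1)]) (simp add: ac_def[symmetric])
  have "fm (f * (act V g x * f')) = fm f * ac V g x * fm f'"
    by (simp only: fm_mult'[OF c(1) c2] fm_mult'[OF a(1) c(2)] ac_def mult.assoc)
  also have "\<dots> = ac W g x * (fm f * fm f')" using homD(2)[OF V W f(1) m] by (simp add: mult.assoc)
  finally have 2: "f * (act V g x * f') = act W g x"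
    using W m f(4) by (intro fm_inject[OF mult_carrier_mat[OF c(1) c2] a(2)]) (simp add: ac_def[symmetric])
  show ?thesis unfolding chr_def using mat_trace_mult_commute[OF c2 c(1)] 1 2 by simp
qed

lemma chr_decomp:
  assumes V: "V \<in> Rep" and Ws: "set Ws \<subseteq> Rep" and dec: "decomp V Ws" and m: "g \<in> carrier G" "x \<in> carrier G"
  shows "chr V g x = (\<Sum>i<length Ws. chr (Ws ! i) g x)"
proof -
  obtain P Q where h: "\<And>i. i < length Ws \<Longrightarrow> P i \<in> hom_rep G (Ws ! i) V" "\<And>i. i < length Ws \<Longrightarrow> Q i \<in> hom_rep G V (Ws ! i)"
    and o: "\<forall>i<length Ws. \<forall>j<length Ws. fm (Q i) * fm (P j) = (if i = j then fm (1\<^sub>m (vdim (Ws ! i))) else 0)"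
    and s: "(\<Sum>i<length Ws. fm (P i) * fm (Q i)) = fm (1\<^sub>m (vdim V))"
    using dec unfolding decomp_def by blast
  define n where "n = vdim V"
  have RW: "Ws ! i \<in> Rep" if "i < length Ws" for i using Ws that by auto
  have c: "P i \<in> carrier_mat n (vdim (Ws ! i))" "Q i \<in> carrier_mat (vdim (Ws ! i)) n"
      "act (Ws ! i) g x \<in> carrier_mat (vdim (Ws ! i)) (vdim (Ws ! i))" if "i < length Ws" for i
    using homD(1)[OF RW V h(1)] homD(1)[OF V RW h(2)] Rep_carrier[OF RW m] that by (auto simp: n_def)
  note c2 = mult_carrier_mat[OF c(1,3)]
  have t: "act V g x = mat_sum n n (\<lambda>i. P i * act (Ws ! i) g x * Q i) {..<length Ws}"
  proof (rule fm_inject[of _ n n])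
    have "fm (mat_sum n n (\<lambda>i. P i * act (Ws ! i) g x * Q i) {..<length Ws}) =
      (\<Sum>i<length Ws. fm (P i) * ac (Ws ! i) g x * fm (Q i))"
      by (subst fm_mat_sum) (simp_all add: mult_carrier_mat[OF c2 c(2)] fm_mult'[OF c2 c(2)] fm_mult'[OF c(1,3)] ac_def)
    also have "\<dots> = (\<Sum>i<length Ws. ac V g x * (fm (P i) * fm (Q i)))"
      using homD(2)[OF RW V h(1)] m by (intro sum.cong refl) (simp add: mult.assoc[symmetric])
    finally show "fm (act V g x) = fm (mat_sum n n (\<lambda>i. P i * act (Ws ! i) g x * Q i) {..<length Ws})"
      using V m by (simp add: sum_distrib_left[symmetric] s ac_def[symmetric])
  qed (use Rep_carrier[OF V m] n_def in auto)
  have "mat_trace (P i * act (Ws ! i) g x * Q i) = chr (Ws ! i) g x" if i: "i < length Ws" for i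
  proof -
    have "Q i * (P i * act (Ws ! i) g x) = act (Ws ! i) g x"
    proof (rule fm_inject)
      have "fm (Q i * (P i * act (Ws ! i) g x)) = fm (Q i) * fm (P i) * fm (act (Ws ! i) g x)"
        by (simp add: fm_mult'[OF c(2)[OF i] c2[OF i i]] fm_mult'[OF c(1,3)[OF i]] mult.assoc)
      then show "fm (Q i * (P i * act (Ws ! i) g x)) = fm (act (Ws ! i) g x)"
        using o i fm_one_left[OF c(3)[OF i]] by simp
    qed (use c[OF i] in auto)
    then show ?thesis using mat_trace_mult_commute[OF c2[OF i i] c(2)[OF i]] by (simp add: chr_def)
  qed
  then show ?thesis
    unfolding chr_def t by (subst mat_trace_mat_sum) (auto simp: mult_carrier_mat[OF c2 c(2)] chr_def)
qed

lemma ip_avg: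
  assumes S: "S \<in> Rep" and W: "W \<in> Rep"
  shows "ip S W = (\<Sum>i<vdim S. \<Sum>j<vdim W.
    avg_mat W S (mat (vdim S) (vdim W) (\<lambda>p. if p = (i, j) then 1 else 0)) $$ (i, j))"
proof -
  define c where "c g x = inverse (of_nat (card (carrier G)) * \<beta> g x (inv x))" for g x
  define I where "I = carrier G \<times> carrier G"
  have e: "avg_mat W S (mat (vdim S) (vdim W) (\<lambda>p. if p = (i, j) then 1 else 0)) $$ (i, j) =
      (\<Sum>(g, x)\<in>I. c g x * (act S g x $$ (i, i) * act W (cj x g) (inv x) $$ (j, j)))"
    if ij: "i < vdim S" "j < vdim W" for i j
  proof -
    have "(c g x \<cdot>\<^sub>m (act S g x * mat (vdim S) (vdim W) (\<lambda>p. if p = (i, j) then 1 else 0) * act W (cj x g) (inv x))) $$ (i, j) =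
      c g x * (act S g x $$ (i, i) * act W (cj x g) (inv x) $$ (j, j))"
      if m: "g \<in> carrier G" "x \<in> carrier G" for g x
      using elementary_mat_entry[OF Rep_carrier[OF S m] Rep_carrier[OF W, of "cj x g" "inv x"] ij]
        Rep_carrier[OF S m] Rep_carrier[OF W, of "cj x g" "inv x"] m ij by simp
    then show ?thesis
      unfolding avg_mat_def mat_sum_def using ij by (auto simp: c_def I_def intro!: sum.cong)
  qed
  have "ip S W = (\<Sum>(g, x)\<in>I. c g x * (\<Sum>i<vdim S. \<Sum>j<vdim W. act S g x $$ (i, i) * act W (cj x g) (inv x) $$ (j, j)))"
    unfolding ip_def I_def[symmetric] c_def
  proof (rule sum.cong[OF refl], clarify)
    fix g x assume "(g, x) \<in> I"
    then have m: "g \<in> carrier G" "x \<in> carrier G" by (auto simp: I_def)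
    show "inverse (of_nat (card (carrier G)) * \<beta> g x (inv x)) * (chr S g x * chr W (cj x g) (inv x)) =
      inverse (of_nat (card (carrier G)) * \<beta> g x (inv x)) * (\<Sum>i<vdim S. \<Sum>j<vdim W. act S g x $$ (i, i) * act W (cj x g) (inv x) $$ (j, j))"
      using Rep_carrier[OF S m] Rep_carrier[OF W, of "cj x g" "inv x"] m
      by (simp add: chr_def mat_trace_def sum_product)
  qed
  also have "\<dots> = (\<Sum>p\<in>I. \<Sum>i<vdim S. \<Sum>j<vdim W. case p of (g, x) \<Rightarrow> c g x * (act S g x $$ (i, i) * act W (cj x g) (inv x) $$ (j, j)))"
    by (intro sum.cong refl) (auto simp: sum_distrib_left)
  also have "\<dots> = (\<Sum>i<vdim S. \<Sum>p\<in>I. \<Sum>j<vdim W. case p of (g, x) \<Rightarrow> c g x * (act S g x $$ (i, i) * act W (cj x g) (inv x) $$ (j, j)))"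
    by (rule sum.swap)
  also have "\<dots> = (\<Sum>i<vdim S. \<Sum>j<vdim W. \<Sum>p\<in>I. case p of (g, x) \<Rightarrow> c g x * (act S g x $$ (i, i) * act W (cj x g) (inv x) $$ (j, j)))"
    by (intro sum.cong refl sum.swap)
  also have "\<dots> = (\<Sum>i<vdim S. \<Sum>j<vdim W.
    avg_mat W S (mat (vdim S) (vdim W) (\<lambda>p. if p = (i, j) then 1 else 0)) $$ (i, j))"
    by (intro sum.cong refl) (use e in auto)
  finally show ?thesis .
qed

text \<open>By cyclicity of the trace and \<open>beta_inv\<close> the term at g, x contributes the
  trace of e(cj x g) p divided by |G|; for fixed x the e(cj x g) sum to the identity.\<close>

lemma mat_trace_avg:
  assumes V: "V \<in> Rep" and p: "p \<in> carrier_mat (vdim V) (vdim V)"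
  shows "mat_trace (avg_mat V V p) = mat_trace p"
proof -
  define n where "n = vdim V"
  define N where "N = (of_nat (card (carrier G)) :: 'k)"
  note pc = p[folded n_def]
  have a: "act V g x \<in> carrier_mat n n" if "g \<in> carrier G" "x \<in> carrier G" for g x
    using Rep_carrier[OF V that] by (simp add: n_def)
  have t: "mat_trace (inverse (N * \<beta> g x (inv x)) \<cdot>\<^sub>m (act V g x * p * act V (cj x g) (inv x))) =
    inverse N * mat_trace (act V (cj x g) \<one> * p)" if m: "g \<in> carrier G" "x \<in> carrier G" for g x
  proof -
    have m': "cj x g \<in> carrier G" "inv x \<in> carrier G" using m by auto
    note c = a[OF m] a[OF m'] a[OF m'(1) one_closed]
    have "mat_trace (act V g x * p * act V (cj x g) (inv x)) = mat_trace (act V (cj x g) (inv x) * (act V g x * p))"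
      by (rule mat_trace_mult_commute[OF mult_carrier_mat[OF c(1) pc] c(2)])
    also have "act V (cj x g) (inv x) * (act V g x * p) = \<beta> g x (inv x) \<cdot>\<^sub>m (act V (cj x g) \<one> * p)"
    proof (rule fm_inject[of _ n n])
      have "fm (act V (cj x g) (inv x) * (act V g x * p)) = ac V (cj x g) (inv x) * ac V g x * fm p"
        by (simp add: fm_mult'[OF c(2) mult_carrier_mat[OF c(1) pc]] fm_mult'[OF c(1) pc] ac_def mult.assoc)
      also have "\<dots> = scal (\<beta> g x (inv x)) * (ac V (cj x g) \<one> * fm p)"
        using ac_mult[OF V m' m] m beta_inv[OF m] by (simp add: mult.assoc)
      also have "\<dots> = fm (\<beta> g x (inv x) \<cdot>\<^sub>m (act V (cj x g) \<one> * p))"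
        by (simp add: fm_smult fm_mult'[OF c(3) pc] ac_def)
      finally show "fm (act V (cj x g) (inv x) * (act V g x * p)) = fm (\<beta> g x (inv x) \<cdot>\<^sub>m (act V (cj x g) \<one> * p))" .
    qed (use c pc in auto)
    also have "mat_trace \<dots> = \<beta> g x (inv x) * mat_trace (act V (cj x g) \<one> * p)"
      by (rule mat_trace_smult[OF mult_carrier_mat[OF c(3) pc]])
    finally have "mat_trace (act V g x * p * act V (cj x g) (inv x)) = \<beta> g x (inv x) * mat_trace (act V (cj x g) \<one> * p)" .
    then show ?thesis
      using mat_trace_smult[OF mult_carrier_mat[OF mult_carrier_mat[OF c(1) pc] c(2)], of "inverse (N * \<beta> g x (inv x))"] m
      by simp
  qed
  have "mat_trace (avg_mat V V p) = (\<Sum>q\<in>carrier G \<times> carrier G. mat_trace (case q of (g, x) \<Rightarrow>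
      inverse (N * \<beta> g x (inv x)) \<cdot>\<^sub>m (act V g x * p * act V (cj x g) (inv x))))"
    unfolding avg_mat_def n_def[symmetric] N_def[symmetric]
    by (rule mat_trace_mat_sum) (auto intro!: smult_carrier_mat mult_carrier_mat[of _ n n] a pc)
  also have "\<dots> = (\<Sum>(g, x)\<in>carrier G \<times> carrier G. inverse N * mat_trace (act V (cj x g) \<one> * p))"
    by (intro sum.cong refl, clarify) (rule t)
  also have "\<dots> = (\<Sum>x\<in>carrier G. \<Sum>g\<in>carrier G. inverse N * mat_trace (act V (cj x g) \<one> * p))"
    unfolding sum.cartesian_product[symmetric] by (rule sum.swap)
  also have "\<dots> = (\<Sum>x\<in>carrier G. \<Sum>g\<in>carrier G. inverse N * mat_trace (act V g \<one> * p))"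
    by (rule sum.cong[OF refl]) (rule sum.reindex_bij_betw[OF bij_cj])
  also have "\<dots> = (\<Sum>g\<in>carrier G. mat_trace (act V g \<one> * p))"
    using card_carrier_nz by (simp add: N_def sum_distrib_left[symmetric] mult.assoc[symmetric] right_inverse[OF card_carrier_nz])
  also have "\<dots> = mat_trace (mat_sum n n (\<lambda>g. act V g \<one> * p) (carrier G))"
    using a pc by (subst mat_trace_mat_sum) (auto intro!: mult_carrier_mat[of _ n n])
  also have "mat_sum n n (\<lambda>g. act V g \<one> * p) (carrier G) = p"
  proof (rule fm_inject[of _ n n])
    have "fm (mat_sum n n (\<lambda>g. act V g \<one> * p) (carrier G)) = (\<Sum>g\<in>carrier G. ac V g \<one> * fm p)"
      by (subst fm_mat_sum) (auto simp: fm_mult'[OF a pc] ac_def intro!: mult_carrier_mat[OF a pc])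
    then show "fm (mat_sum n n (\<lambda>g. act V g \<one> * p) (carrier G)) = fm p"
      using fm_one_left[OF pc] by (simp add: sum_distrib_right[symmetric] ac_sum[OF V] n_def)
  qed (use pc in auto)
  finally show ?thesis .
qed

lemma ip_not_iso:
  assumes S: "simple_rep G w S" and W: "simple_rep G w W" and ni: "\<not> iso_rep G S W"
  shows "ip S W = 0"
proof -
  note R = simpleD(1)[OF S] simpleD(1)[OF W]
  have "avg_mat W S p = 0\<^sub>m (vdim S) (vdim W)" if "p \<in> carrier_mat (vdim S) (vdim W)" for p
    using schur_iso[OF W S avg_mat_hom[OF R(2,1) that]] ni iso_sym by blast
  then show ?thesis unfolding ip_avg[OF R] by simp
qed

text \<open>By Schur's lemma the average of an elementary matrix is a scalar matrix of the same
  trace, so the one at (i, j) contributes 1/n if i = j and 0 otherwise.\<close>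

lemma ip_self:
  assumes S: "simple_rep G w S"
  shows "ip S S = 1"
proof -
  define n where "n = vdim S"
  note R = simpleD(1)[OF S]
  have n: "(of_nat n :: 'k) \<noteq> 0" using simpleD(2)[OF S] by (simp add: n_def)
  have "avg_mat S S (mat n n (\<lambda>p. if p = (i, j) then 1 else 0)) $$ (i, j) = (if i = j then inverse (of_nat n) else 0)"
    if ij: "i < n" "j < n" for i j
  proof -
    define E where "E = mat n n (\<lambda>p. if p = (i, j) then 1 else 0 :: 'k)"
    have E: "E \<in> carrier_mat (vdim S) (vdim S)" by (simp add: E_def n_def)
    obtain c where c: "avg_mat S S E = c \<cdot>\<^sub>m 1\<^sub>m n"
      using schur_scalar[OF S avg_mat_hom[OF R R E]] by (auto simp: n_def)
    have "c * of_nat n = mat_trace (avg_mat S S E)" unfolding c by (simp add: mat_trace_smult[of _ n])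
    also have "\<dots> = mat_trace E" by (rule mat_trace_avg[OF R E])
    also have "\<dots> = (\<Sum>l<n. if l = i then (if i = j then 1 else 0) else 0)"
      unfolding mat_trace_def by (auto simp: E_def intro!: sum.cong)
    also have "\<dots> = (if i = j then 1 else 0)" using ij by simp
    finally have "c * of_nat n = (if i = j then 1 else 0)" .
    then show ?thesis using ij n by (auto simp: E_def[symmetric] c field_simps)
  qed
  then have "ip S S = (\<Sum>i<n. \<Sum>j<n. if i = j then inverse (of_nat n) else 0)"
    unfolding ip_avg[OF R R] n_def[symmetric] by (intro sum.cong refl) auto
  also have "\<dots> = 1" using n by simp
  finally show ?thesis .
qed

lemma ip_simple:
  assumes S: "simple_rep G w S" and W: "simple_rep G w W"
  shows "ip S W = (if iso_rep G S W then 1 else 0)"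
proof (cases "iso_rep G S W")
  case True
  have "ip S W = ip S S"
    unfolding ip_def using chr_iso[OF simpleD(1)[OF S] simpleD(1)[OF W] True]
    by (intro sum.cong refl) auto
  then show ?thesis using True ip_self[OF S] by simp
qed (use ip_not_iso[OF S W] in simp)

section \<open>The regular representation and the dimension of a subcategory\<close>

definition enum_pair :: "nat \<Rightarrow> 'a \<times> 'a" where
  "enum_pair = (SOME e. bij_betw e {..<card (carrier G \<times> carrier G)} (carrier G \<times> carrier G))"

lemma enum_pair: "bij_betw enum_pair {..<card (carrier G \<times> carrier G)} (carrier G \<times> carrier G)"
  unfolding enum_pair_def
  using someI_ex[OF ex_bij_betw_nat_finite[of "carrier G \<times> carrier G"]] finite_carrier
  by (simp add: atLeast0LessThan)

text \<open>The matrix coefficients of left multiplication by e(g)x on the standard basis of the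
  double, a pair (h, y) standing for e(h)y.\<close>

definition reg_coeff :: "'a \<Rightarrow> 'a \<Rightarrow> 'a \<times> 'a \<Rightarrow> 'a \<times> 'a \<Rightarrow> 'k" where
  "reg_coeff g x p q = (if cj x g = fst q \<and> p = (g, x \<otimes> snd q) then \<beta> g x (snd q) else 0)"

definition Reg :: "('a, 'k) rep" where
  "Reg = (let n = card (carrier G \<times> carrier G) in
     \<lparr>vdim = n, act = (\<lambda>g x. mat n n (\<lambda>(i, j). reg_coeff g x (enum_pair i) (enum_pair j)))\<rparr>)"

lemma vdim_Reg: "vdim Reg = (card (carrier G))\<^sup>2"
  by (simp add: Reg_def Let_def card_cartesian_product power2_eq_square)

lemma Reg_Rep: "Reg \<in> Rep"
proof -
  define n where "n = card (carrier G \<times> carrier G)"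
  have vd: "vdim Reg = n" by (simp add: Reg_def n_def Let_def)
  have act: "act Reg g x = mat n n (\<lambda>(i, j). reg_coeff g x (enum_pair i) (enum_pair j))" for g x
    by (simp add: Reg_def n_def Let_def)
  have en: "enum_pair i \<in> carrier G \<times> carrier G" if "i < n" for i
    using enum_pair that unfolding n_def[symmetric] bij_betw_def by auto
  have "act Reg g x * act Reg h y = (if cj x g = h then \<beta> g x y \<cdot>\<^sub>m act Reg g (x \<otimes> y) else 0\<^sub>m n n)"
    if m: "g \<in> carrier G" "x \<in> carrier G" "h \<in> carrier G" "y \<in> carrier G" for g x h y
  proof (rule eq_matI)
    fix i j assume "i < dim_row (if cj x g = h then \<beta> g x y \<cdot>\<^sub>m act Reg g (x \<otimes> y) else 0\<^sub>m n n)"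
      "j < dim_col (if cj x g = h then \<beta> g x y \<cdot>\<^sub>m act Reg g (x \<otimes> y) else 0\<^sub>m n n)"
    then have ij: "i < n" "j < n" by (auto simp: act split: if_splits)
    define p r where "p = enum_pair i" and "r = enum_pair j"
    obtain r1 r2 where r: "r = (r1, r2)" "r1 \<in> carrier G" "r2 \<in> carrier G" using en[OF ij(2)] by (auto simp: r_def)
    have "(act Reg g x * act Reg h y) $$ (i, j) = (\<Sum>l<n. reg_coeff g x p (enum_pair l) * reg_coeff h y (enum_pair l) r)"
      using ij by (simp add: act scalar_prod_def atLeast0LessThan p_def r_def)
    also have "\<dots> = (\<Sum>q\<in>carrier G \<times> carrier G. reg_coeff g x p q * reg_coeff h y q r)"
      unfolding n_def by (rule sum.reindex_bij_betw[OF enum_pair])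
    also have "\<dots> = (\<Sum>q\<in>carrier G \<times> carrier G. if q = (h, y \<otimes> r2) then
        reg_coeff g x p (h, y \<otimes> r2) * (if cj y h = r1 then \<beta> h y r2 else 0) else 0)"
      by (rule sum.cong) (auto simp: r reg_coeff_def)
    also have "\<dots> = reg_coeff g x p (h, y \<otimes> r2) * (if cj y h = r1 then \<beta> h y r2 else 0)"
      using m r finite_carrier by simp
    also have "\<dots> = (if cj x g = h then \<beta> g x y * reg_coeff g (x \<otimes> y) p r else 0)"
      using beta_cocycle[of g x y r2] m r by (auto simp: reg_coeff_def cj_mult m_assoc mult.commute)
    finally show "(act Reg g x * act Reg h y) $$ (i, j) =
      (if cj x g = h then \<beta> g x y \<cdot>\<^sub>m act Reg g (x \<otimes> y) else 0\<^sub>m n n) $$ (i, j)"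
      using ij by (simp add: act p_def r_def)
  qed (auto simp: act)
  moreover have "mat_sum n n (\<lambda>g. act Reg g \<one>) (carrier G) = 1\<^sub>m n"
  proof (rule eq_matI)
    fix i j assume "i < dim_row (1\<^sub>m n :: 'k mat)" "j < dim_col (1\<^sub>m n :: 'k mat)"
    then have ij: "i < n" "j < n" by auto
    obtain q1 q2 where q: "enum_pair j = (q1, q2)" "q1 \<in> carrier G" "q2 \<in> carrier G" using en[OF ij(2)] by auto
    have "mat_sum n n (\<lambda>g. act Reg g \<one>) (carrier G) $$ (i, j) = (\<Sum>g\<in>carrier G. reg_coeff g \<one> (enum_pair i) (q1, q2))"
      using ij q by (simp add: mat_sum_def act)
    also have "\<dots> = (\<Sum>g\<in>carrier G. if g = q1 then (if enum_pair i = enum_pair j then 1 else 0) else 0)"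
      by (rule sum.cong) (use q in \<open>auto simp: reg_coeff_def\<close>)
    also have "\<dots> = (if enum_pair i = enum_pair j then 1 else 0)" using q finite_carrier by simp
    also have "\<dots> = 1\<^sub>m n $$ (i, j)"
      using ij enum_pair unfolding n_def bij_betw_def inj_on_def by auto
    finally show "mat_sum n n (\<lambda>g. act Reg g \<one>) (carrier G) $$ (i, j) = 1\<^sub>m n $$ (i, j)" .
  qed (auto simp: mat_sum_def)
  ultimately show ?thesis by (auto simp: Rep_double_def vd cj_def) (auto simp: act)
qed

lemma chr_Reg:
  assumes m: "g \<in> carrier G" "x \<in> carrier G"
  shows "chr Reg g x = (if x = \<one> then of_nat (card (carrier G)) else 0)"
proof -
  have "chr Reg g x = (\<Sum>i<card (carrier G \<times> carrier G). reg_coeff g x (enum_pair i) (enum_pair i))"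
    by (simp add: chr_def mat_trace_def Reg_def Let_def)
  also have "\<dots> = (\<Sum>q\<in>carrier G \<times> carrier G. reg_coeff g x q q)"
    by (rule sum.reindex_bij_betw[OF enum_pair])
  also have "\<dots> = (\<Sum>a\<in>carrier G. \<Sum>s\<in>carrier G. if a = g then (if x = \<one> then 1 else 0) else 0)"
    unfolding sum.cartesian_product
  proof (rule sum.cong[OF refl], clarify)
    fix a s assume as: "a \<in> carrier G" "s \<in> carrier G"
    have "s = x \<otimes> s \<longleftrightarrow> x = \<one>" using as m by (metis l_one r_cancel_one')
    then show "reg_coeff g x (a, s) (a, s) = (if a = g then (if x = \<one> then 1 else 0) else 0)"
      using m as by (auto simp: reg_coeff_def)
  qed
  also have "\<dots> = (\<Sum>a\<in>carrier G. if a = g then (if x = \<one> then of_nat (card (carrier G)) else 0) else 0)"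
    by (intro sum.cong refl) auto
  also have "\<dots> = (if x = \<one> then of_nat (card (carrier G)) else 0)"
    using m finite_carrier by simp
  finally show ?thesis .
qed

lemma sum_chr_one: "V \<in> Rep \<Longrightarrow> (\<Sum>g\<in>carrier G. chr V g \<one>) = of_nat (vdim V)"
  using mat_trace_mat_sum[of "carrier G" "\<lambda>g. act V g \<one>" "vdim V"] Rep_carrier[of V _ \<one>]
  by (simp add: chr_def Rep_double_def)

lemma ip_Reg:
  assumes S: "S \<in> Rep"
  shows "ip S Reg = of_nat (vdim S)"
proof -
  have "ip S Reg = (\<Sum>g\<in>carrier G. \<Sum>x\<in>carrier G. if x = \<one> then chr S g \<one> else 0)"
    unfolding ip_def sum.cartesian_product
  proof (rule sum.cong[OF refl], clarify)
    fix g x assume m: "g \<in> carrier G" "x \<in> carrier G"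
    show "inverse (of_nat (card (carrier G)) * \<beta> g x (inv x)) * (chr S g x * chr Reg (cj x g) (inv x)) =
      (if x = \<one> then chr S g \<one> else 0)"
    proof (cases "x = \<one>")
      case True
      then show ?thesis using m chr_Reg[of g \<one>] left_inverse[OF card_carrier_nz]
        by (simp add: mult.left_commute[of _ "chr S g \<one>"])
    next
      case False
      then show ?thesis using m chr_Reg[of "cj x g" "inv x"] by (simp add: inv_eq_1_iff)
    qed
  qed
  also have "\<dots> = (\<Sum>g\<in>carrier G. chr S g \<one>)" using finite_carrier by simp
  finally show ?thesis using sum_chr_one[OF S] by simp
qed

text \<open>Pairing the character of \<open>S\<close> with that of \<open>Reg\<close> counts the
  constituents isomorphic to \<open>S\<close>; evaluated directly it is \<open>vdim S\<close>, since
  the character of \<open>Reg\<close> is concentrated at x = \<one>.\<close>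

lemma multiplicity_Reg:
  assumes Ws: "\<forall>W\<in>set Ws. simple_rep G w W" and dec: "decomp Reg Ws" and S: "simple_rep G w S"
  shows "card {i. i < length Ws \<and> iso_rep G S (Ws ! i)} = vdim S"
proof -
  have RW: "set Ws \<subseteq> Rep" using Ws simpleD(1) by blast
  have "of_nat (vdim S) = ip S Reg" using ip_Reg[OF simpleD(1)[OF S]] by simp
  also have "\<dots> = (\<Sum>p\<in>carrier G \<times> carrier G. \<Sum>i<length Ws. case p of (g, x) \<Rightarrow>
     inverse (of_nat (card (carrier G)) * \<beta> g x (inv x)) * (chr S g x * chr (Ws ! i) (cj x g) (inv x)))"
    unfolding ip_def
    by (intro sum.cong refl) (auto simp: chr_decomp[OF Reg_Rep RW dec] sum_distrib_left)
  also have "\<dots> = (\<Sum>i<length Ws. ip S (Ws ! i))"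
    unfolding ip_def by (rule sum.swap)
  also have "\<dots> = (\<Sum>i<length Ws. if iso_rep G S (Ws ! i) then 1 else 0)"
    by (intro sum.cong refl ip_simple[OF S]) (use Ws in auto)
  also have "\<dots> = (\<Sum>i\<in>{i. i < length Ws \<and> iso_rep G S (Ws ! i)}. 1)"
    by (simp add: sum.inter_filter[symmetric] lessThan_def)
  also have "\<dots> = (of_nat (card {i. i < length Ws \<and> iso_rep G S (Ws ! i)}) :: 'k)" by simp
  finally show ?thesis by (simp only: of_nat_eq_iff)
qed

text \<open>Each simple \<open>S\<close> occurs \<open>vdim S\<close> times among the constituents
  \<open>Ws\<close> of \<open>Reg\<close>, so grouping these by isomorphism class turns the sum of
  their dimensions into a sum of squares. Dimensions of subcategories thereby become accessible to
  traces.\<close>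

lemma cat_dim_eq:
  assumes D: "D \<subseteq> Rep" and closed: "\<And>V W. V \<in> D \<Longrightarrow> W \<in> Rep \<Longrightarrow> iso_rep G V W \<Longrightarrow> W \<in> D"
    and Ws: "\<forall>W\<in>set Ws. simple_rep G w W" and dec: "decomp Reg Ws"
  shows "cat_dim G w D = (\<Sum>i | i < length Ws \<and> Ws ! i \<in> D. vdim (Ws ! i))"
proof -
  define I where "I = {i. i < length Ws \<and> Ws ! i \<in> D}"
  define \<phi> where "\<phi> i = iso_rel G w `` {Ws ! i}" for i
  define C where "C = {V \<in> D. simple_rep G w V} // iso_rel G w"
  have sim: "simple_rep G w (Ws ! i)" if "i < length Ws" for i using Ws that by auto
  have cls: "iso_rel G w `` {V} = {W \<in> Rep. iso_rep G V W}" if "V \<in> Rep" for V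
    using that by (auto simp: iso_rel_def)
  have \<phi>C: "\<phi> i \<in> C" if "i \<in> I" for i
    using that sim by (auto simp: \<phi>_def C_def I_def intro!: quotientI)
  have main: "(\<Sum>i | i \<in> I \<and> \<phi> i = X. vdim (Ws ! i)) = (vdim (SOME V. V \<in> X))\<^sup>2 \<and> X \<in> \<phi> ` I" if X: "X \<in> C" for X
  proof -
    obtain V where V: "V \<in> D" "simple_rep G w V" "X = iso_rel G w `` {V}"
      using X by (auto simp: C_def elim: quotientE)
    have RV: "V \<in> Rep" using V D by auto
    have Xc: "X = {W \<in> Rep. iso_rep G V W}" using V cls[OF RV] by simp
    have "(SOME V. V \<in> X) \<in> X" using iso_refl[OF RV] RV Xc by (metis (mono_tags, lifting) mem_Collect_eq someI)
    then have dX: "vdim (SOME V. V \<in> X) = vdim V" using iso_vdim[OF RV] Xc by auto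
    have set: "{i. i \<in> I \<and> \<phi> i = X} = {i. i < length Ws \<and> iso_rep G V (Ws ! i)}"
    proof (intro equalityI subsetI)
      fix i assume "i \<in> {i. i \<in> I \<and> \<phi> i = X}"
      then have i: "i \<in> I" "X = \<phi> i" by auto
      then have il: "i < length Ws" by (simp add: I_def)
      have "Ws ! i \<in> X" unfolding i(2) \<phi>_def cls[OF simpleD(1)[OF sim[OF il]]]
        using simpleD(1)[OF sim[OF il]] iso_refl by simp
      then show "i \<in> {i. i < length Ws \<and> iso_rep G V (Ws ! i)}" using il Xc by simp
    next
      fix i assume "i \<in> {i. i < length Ws \<and> iso_rep G V (Ws ! i)}"
      then have i: "i < length Ws" "iso_rep G V (Ws ! i)" by auto
      note RWi = simpleD(1)[OF sim[OF i(1)]]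
      have "\<phi> i = X"
        unfolding \<phi>_def cls[OF RWi] Xc using iso_trans iso_sym i(2) RV RWi by blast
      then show "i \<in> {i. i \<in> I \<and> \<phi> i = X}" using i closed[OF V(1) RWi i(2)] by (simp add: I_def)
    qed
    have card: "card {i. i < length Ws \<and> iso_rep G V (Ws ! i)} = vdim V" by (rule multiplicity_Reg[OF Ws dec V(2)])
    have "(\<Sum>i | i \<in> I \<and> \<phi> i = X. vdim (Ws ! i)) = (\<Sum>i | i < length Ws \<and> iso_rep G V (Ws ! i). vdim V)"
      unfolding set using iso_vdim[OF RV simpleD(1)[OF sim], symmetric] by (intro sum.cong refl) simp
    also have "\<dots> = vdim V * vdim V" using card by simp
    finally have 1: "(\<Sum>i | i \<in> I \<and> \<phi> i = X. vdim (Ws ! i)) = (vdim (SOME V. V \<in> X))\<^sup>2"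
      by (simp add: dX power2_eq_square)
    have "{i. i \<in> I \<and> \<phi> i = X} \<noteq> {}"
      using card simpleD(2)[OF V(2)] unfolding set by (metis card.empty less_irrefl)
    then show ?thesis using 1 by auto
  qed
  have C: "C = \<phi> ` I" using main \<phi>C by auto
  have finI: "finite I" by (simp add: I_def)
  have "(\<Sum>i\<in>I. vdim (Ws ! i)) = (\<Sum>X\<in>C. \<Sum>i | i \<in> I \<and> \<phi> i = X. vdim (Ws ! i))"
    by (rule sum.group[symmetric]) (use finI C in auto)
  also have "\<dots> = (\<Sum>X\<in>C. (vdim (SOME V. V \<in> X))\<^sup>2)" using main by (intro sum.cong refl) auto
  finally show ?thesis unfolding cat_dim_def C_def[symmetric] I_def by simp
qed

lemma cat_dim_Rep: "cat_dim G w Rep = (card (carrier G))\<^sup>2"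
proof -
  obtain Ws where Ws: "\<forall>W\<in>set Ws. simple_rep G w W" "decomp Reg Ws"
    using complete_reducibility[OF Reg_Rep] by blast
  have RW: "Ws ! i \<in> Rep" if "i < length Ws" for i using Ws simpleD(1) that by auto
  have "(of_nat (\<Sum>i<length Ws. vdim (Ws ! i)) :: 'k) = (\<Sum>i<length Ws. \<Sum>g\<in>carrier G. chr (Ws ! i) g \<one>)"
    using RW sum_chr_one by (simp add: of_nat_sum)
  also have "\<dots> = (\<Sum>g\<in>carrier G. chr Reg g \<one>)"
    using chr_decomp[OF Reg_Rep _ Ws(2)] Ws(1) simpleD(1) by (subst sum.swap) (simp add: subset_iff)
  also have "\<dots> = of_nat ((card (carrier G))\<^sup>2)" using sum_chr_one[OF Reg_Rep] vdim_Reg by simp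
  finally have "(\<Sum>i<length Ws. vdim (Ws ! i)) = (card (carrier G))\<^sup>2" by (simp only: of_nat_eq_iff)
  moreover have "{i. i < length Ws \<and> Ws ! i \<in> Rep} = {..<length Ws}" using RW by auto
  ultimately show ?thesis using cat_dim_eq[of Rep Ws] Ws by simp
qed

end

section \<open>The subcategory of an invariant bicharacter\<close>

locale invariant_bicharacter = twisted_double G w for G (structure)
    and w :: "'a \<Rightarrow> 'a \<Rightarrow> 'a \<Rightarrow> 'k::{alg_closed_field, field_char_0}" +
  fixes R :: "'a set" and H :: "'a set" and B :: "'a \<times> 'a \<Rightarrow> 'k"
  assumes reps: "class_representatives G R"
    and H: "normal_abelian_subgroup G H"
    and alt: "alternating_bicharacter G w H B"
    and inv: "G_invariant G w R H B"
begin

sublocale H: normal H G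
  using H by (simp add: normal_abelian_subgroup_def)

lemma H_comm: "h \<in> H \<Longrightarrow> k \<in> H \<Longrightarrow> h \<otimes> k = k \<otimes> h"
  using H by (auto simp: normal_abelian_subgroup_def)

lemma H_cj: "x \<in> carrier G \<Longrightarrow> a \<in> H \<Longrightarrow> cj x a \<in> H"
  using H.inv_op_closed1[of x a] by (simp add: cj_def)

lemma H_cj_iff: "x \<in> carrier G \<Longrightarrow> g \<in> carrier G \<Longrightarrow> cj x g \<in> H \<longleftrightarrow> g \<in> H"
  using H_cj[of "inv x" "cj x g"] H_cj[of x g] by auto

lemma cj_H [simp]: "h \<in> H \<Longrightarrow> a \<in> H \<Longrightarrow> cj h a = a"
  by (rule cj_unique) (auto simp: H_comm)

lemma B_nz [simp]: "a \<in> H \<Longrightarrow> b \<in> H \<Longrightarrow> B (a, b) \<noteq> 0"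
proof -
  assume "a \<in> H" "b \<in> H"
  moreover have "B \<in> H \<times> H \<rightarrow>\<^sub>E UNIV - {0}" using alt unfolding alternating_bicharacter_def by blast
  ultimately show ?thesis using PiE_mem[of B "H \<times> H" "\<lambda>_. UNIV - {0}" "(a, b)"] by simp
qed

lemma B_anti: "a \<in> H \<Longrightarrow> b \<in> H \<Longrightarrow> B (a, b) * B (b, a) = 1"
proof -
  assume ab: "a \<in> H" "b \<in> H"
  then have "B (a, b) = inverse (B (b, a))" using alt unfolding alternating_bicharacter_def by blast
  then show ?thesis using B_nz[OF ab(2,1)] by simp
qed

lemma B_self: "a \<in> H \<Longrightarrow> B (a, a) = 1"
  using alt unfolding alternating_bicharacter_def by blast

lemma B_mult: "\<lbrakk>a \<in> H; h \<in> H; k \<in> H\<rbrakk> \<Longrightarrow> B (a, h) * B (a, k) = \<beta> a h k * B (a, h \<otimes> k)"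
proof -
  assume m: "a \<in> H" "h \<in> H" "k \<in> H"
  then have "B (a, h) * B (a, k) / B (a, h \<otimes> k) = \<beta> a h k"
    using alt unfolding alternating_bicharacter_def by blast
  then show ?thesis using B_nz[of a "h \<otimes> k"] m by (simp add: field_simps)
qed

lemma B_one [simp]: "a \<in> H \<Longrightarrow> B (a, \<one>) = 1" "a \<in> H \<Longrightarrow> B (\<one>, a) = 1"
proof -
  show 1: "B (a, \<one>) = 1" if "a \<in> H" for a using B_mult[of a \<one> \<one>] that by simp
  show "a \<in> H \<Longrightarrow> B (\<one>, a) = 1" using B_anti[of \<one> a] 1[of a] by simp
qed

text \<open>Invariance in the form that compares moving h past x with first conjugating it to x h
  x^-1. The quotient of values of \<open>\<beta>\<close> in the definition is eliminated by the
  cocycle identity at x h, x^-1, x.\<close>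

lemma inv_rep:
  assumes x: "x \<in> carrier G" and a: "a \<in> H" "a \<in> R" and h: "h \<in> H"
  shows "B (cj x a, h) * \<beta> a (cj (inv x) h) x = \<beta> a x h * B (a, cj (inv x) h)"
proof -
  define k where "k = cj (inv x) h"
  have k: "k \<in> H" using x h by (simp add: k_def H_cj)
  have kx: "x \<otimes> h \<otimes> inv x = k" using x h by (simp add: k_def cj_def)
  have ac: "a \<in> carrier G" "h \<in> carrier G" "k \<in> carrier G" using a h k by auto
  have "B (cj x a, h) = \<beta> a x h * \<beta> a (x \<otimes> h) (inv x) / \<beta> a x (inv x) * B (a, k)"
    using inv x a h kx by (simp add: G_invariant_def cj_def)
  moreover have "\<beta> a (x \<otimes> h) (inv x) * \<beta> a k x = \<beta> a x (inv x)"
    using beta_cocycle[of a "x \<otimes> h" "inv x" x] x ac kx h a H_cj[OF x a(1)] beta_inv[of a x] by (simp add: cj_mult)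
  ultimately have "B (cj x a, h) * \<beta> a k x = \<beta> a x h * \<beta> a (x \<otimes> h) (inv x) / (\<beta> a (x \<otimes> h) (inv x) * \<beta> a k x) * B (a, k) * \<beta> a k x"
    by simp
  also have "\<dots> = \<beta> a x h * B (a, k)" using ac x by simp
  finally show ?thesis by (simp add: k_def)
qed

lemma ex_rep:
  assumes "g \<in> carrier G"
  shows "\<exists>r\<in>R. \<exists>y\<in>carrier G. g = cj y r \<and> r \<in> carrier G"
proof -
  have "\<exists>!r. r \<in> R \<and> g \<in> conj_class G r" "R \<subseteq> carrier G"
    using reps assms by (simp_all add: class_representatives_def)
  then obtain r where r: "r \<in> R" "g \<in> conj_class G r" "r \<in> carrier G" by blast
  then obtain x where "x \<in> carrier G" "g = x \<otimes> r \<otimes> inv x" by (auto simp: conj_class_def)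
  then have "g = cj (inv x) r" "inv x \<in> carrier G" by (auto simp: cj_def)
  then show ?thesis using r by blast
qed

text \<open>The invariance condition is imposed at the class representatives only, but propagates.\<close>

lemma B_invariant:
  assumes z: "z \<in> carrier G" and a: "a \<in> H" and h: "h \<in> H"
  shows "B (cj z a, h) * \<beta> a (cj (inv z) h) z = \<beta> a z h * B (a, cj (inv z) h)"
proof -
  obtain r y where r: "r \<in> R" "r \<in> carrier G" and y: "y \<in> carrier G" "a = cj y r"
    using ex_rep[OF H.mem_carrier[OF a]] by blast
  have rH: "r \<in> H" using a y r H_cj_iff by simp
  define k where "k = cj (inv z) h"
  define l where "l = cj (inv y) k"
  have kl: "k \<in> H" "l \<in> H" using z y h by (simp_all add: k_def l_def H_cj)
  have c: "k \<in> carrier G" "l \<in> carrier G" "h \<in> carrier G" "a \<in> carrier G" using kl h a by auto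
  have zh: "z \<otimes> h = k \<otimes> z" and yk: "y \<otimes> k = l \<otimes> y"
    using mult_cj[of z k] mult_cj[of y l] z y c h by (auto simp: k_def l_def)
  have l': "cj (inv (y \<otimes> z)) h = l"
    using z y h c by (simp add: inv_mult_group cj_mult k_def l_def)
  \<comment> \<open>Both \<open>cj z a\<close> and \<open>a\<close> are conjugates of r, by y z and
    by y. The claim is the quotient of the invariance at r along these two elements, and e3 to e5
    balance the values of \<open>\<beta>\<close>.\<close>
  have e1: "B (cj z a, h) * \<beta> r l (y \<otimes> z) = \<beta> r (y \<otimes> z) h * B (r, l)"
    using inv_rep[of "y \<otimes> z" r h] z y r rH h l' by (simp add: cj_mult)
  have e2: "B (a, k) * \<beta> r l y = \<beta> r y k * B (r, l)"
    using inv_rep[of y r k] y r rH kl by (simp add: l_def)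
  have e3: "\<beta> r y z * \<beta> r (y \<otimes> z) h = \<beta> a z h * \<beta> r y (k \<otimes> z)"
    using beta_cocycle[of r y z h] r y z c zh by simp
  have e4: "\<beta> r y k * \<beta> r (l \<otimes> y) z = \<beta> a k z * \<beta> r y (k \<otimes> z)"
    using beta_cocycle[of r y k z] r y z c yk by simp
  have e5: "\<beta> r l y * \<beta> r (l \<otimes> y) z = \<beta> r y z * \<beta> r l (y \<otimes> z)"
    using beta_cocycle[of r l y z] r y z c rH kl by simp
  show ?thesis
    unfolding k_def[symmetric]
    by (rule eq_by_cancel[OF mult_eq[OF e1 mult_eq[OF e2[symmetric] mult_eq[OF e3 mult_eq[OF e4[symmetric] e5]]]]])
      (use r y z c rH kl h a in \<open>simp_all add: H_cj ac_simps\<close>)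
qed

text \<open>This form mentions neither representatives nor simple objects, so closure properties
  become identities between operators; \<open>subcat_L_eq\<close> identifies it with the category
  generated by labels.\<close>

definition L :: "('a, 'k) rep set" where
  "L = {V \<in> Rep. (\<forall>g\<in>carrier G - H. ac V g \<one> = 0) \<and> (\<forall>a\<in>H. \<forall>h\<in>H. ac V a h = scal (B (a, h)) * ac V a \<one>)}"

lemma L_conj:
  "V \<in> L \<longleftrightarrow> V \<in> Rep \<and> (\<forall>g\<in>carrier G - H. ac V g \<one> = 0) \<and>
     (\<forall>a\<in>H. \<forall>h\<in>H. ac V a h = scal (B (a, h)) * ac V a \<one>)"
  unfolding L_def by (rule mem_Collect_eq)

lemma L_D:
  assumes "V \<in> L"
  shows "V \<in> Rep" "g \<in> carrier G \<Longrightarrow> g \<notin> H \<Longrightarrow> ac V g \<one> = 0"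
    "a \<in> H \<Longrightarrow> h \<in> H \<Longrightarrow> ac V a h = scal (B (a, h)) * ac V a \<one>"
proof -
  note c = assms[unfolded L_conj]
  show "V \<in> Rep" by (rule conjunct1[OF c])
  show "ac V g \<one> = 0" if "g \<in> carrier G" "g \<notin> H"
    by (rule bspec[OF conjunct1[OF conjunct2[OF c]] DiffI[OF that]])
  show "ac V a h = scal (B (a, h)) * ac V a \<one>" if "a \<in> H" "h \<in> H"
    by (rule bspec[OF bspec[OF conjunct2[OF conjunct2[OF c]] that(1)] that(2)])
qed

lemma L_I:
  assumes "V \<in> Rep" "\<And>g. g \<in> carrier G \<Longrightarrow> g \<notin> H \<Longrightarrow> ac V g \<one> = 0"
    "\<And>a h. a \<in> H \<Longrightarrow> h \<in> H \<Longrightarrow> ac V a h = scal (B (a, h)) * ac V a \<one>"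
  shows "V \<in> L"
  unfolding L_conj by (intro conjI ballI assms) auto

text \<open>For each a the inner sum projects onto the part of e(a)V on which \<open>H\<close> acts
  through the one-dimensional projective character that sends h to B(a, h).\<close>

definition E :: "('a, 'k) rep \<Rightarrow> 'k lop" where
  "E V = (\<Sum>a\<in>H. \<Sum>h\<in>H. scal (inverse (of_nat (card H) * B (a, h))) * ac V a h)"

lemma finite_H: "finite H"
  using finite_carrier H.subset finite_subset by blast

lemma card_H_nz [simp]: "(of_nat (card H) :: 'k) \<noteq> 0"
  using finite_H H.one_closed by (metis card_0_eq empty_iff of_nat_eq_0_iff)

lemma ac_E_out:
  assumes V: "V \<in> Rep" and g: "g \<in> carrier G" "g \<notin> H"
  shows "ac V g \<one> * E V = 0"
proof -
  have "ac V g \<one> * (scal c * ac V a h) = 0" if "a \<in> H" "h \<in> H" for a h c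
    using ac_mult[OF V g(1) one_closed, of a h] that g by (auto simp: scal_left_commute)
  then show ?thesis unfolding E_def sum_distrib_left by (intro sum.neutral ballI) auto
qed

text \<open>Translating the summation variable by h absorbs e(a)h, and the multiplicative law
  \<open>B_mult\<close> converts the factor \<open>\<beta>\<close> into
  \<open>B (a, h)\<close>.\<close>

lemma ac_E:
  assumes V: "V \<in> Rep" and a: "a \<in> H" and h: "h \<in> H"
  shows "ac V a h * E V = scal (B (a, h)) * (\<Sum>k\<in>H. scal (inverse (of_nat (card H) * B (a, k))) * ac V a k)"
proof -
  define N where "N = (of_nat (card H) :: 'k)"
  have "ac V a h * E V = (\<Sum>b\<in>H. if b = a then (\<Sum>k\<in>H. scal (inverse (N * B (a, k)) * \<beta> a h k) * ac V a (h \<otimes> k)) else 0)"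
    unfolding E_def N_def sum_distrib_left
  proof (rule sum.cong[OF refl])
    fix b assume b: "b \<in> H"
    have "ac V a h * (scal c * ac V b k) = (if b = a then scal (c * \<beta> a h k) * ac V a (h \<otimes> k) else 0)"
      if k: "k \<in> H" for k c
      using ac_mult[OF V, of a h b k] a b h k by (auto simp: scal_left_commute[of "ac V a h"] scal_scal)
    then show "(\<Sum>k\<in>H. ac V a h * (scal (inverse (of_nat (card H) * B (b, k))) * ac V b k)) =
      (if b = a then (\<Sum>k\<in>H. scal (inverse (of_nat (card H) * B (a, k)) * \<beta> a h k) * ac V a (h \<otimes> k)) else 0)"
      by simp
  qed
  also have "\<dots> = (\<Sum>k\<in>H. scal (inverse (N * B (a, k)) * \<beta> a h k) * ac V a (h \<otimes> k))"
    using a finite_H by simp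
  also have "\<dots> = (\<Sum>k\<in>H. scal (B (a, h)) * (scal (inverse (N * B (a, h \<otimes> k))) * ac V a (h \<otimes> k)))"
  proof (rule sum.cong[OF refl])
    fix k assume k: "k \<in> H"
    have c: "inverse (N * B (a, k)) * \<beta> a h k = B (a, h) * inverse (N * B (a, h \<otimes> k))"
      using B_mult[OF a h k] a h k card_H_nz by (simp add: N_def field_simps)
    then show "scal (inverse (N * B (a, k)) * \<beta> a h k) * ac V a (h \<otimes> k) =
      scal (B (a, h)) * (scal (inverse (N * B (a, h \<otimes> k))) * ac V a (h \<otimes> k))"
      by (simp only: c scal_scal)
  qed
  also have "\<dots> = (\<Sum>k\<in>H. scal (B (a, h)) * (scal (inverse (N * B (a, k))) * ac V a k))"
    by (rule sum.reindex_bij_betw[where h = "\<lambda>k. h \<otimes> k"],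
        rule bij_betwI[where g = "\<lambda>k. inv h \<otimes> k"]) (use h in \<open>auto simp: m_assoc[symmetric]\<close>)
  finally show ?thesis by (simp add: N_def sum_distrib_left)
qed

text \<open>For g outside \<open>H\<close> both products vanish, as \<open>H\<close> is stable under
  conjugation. For g in \<open>H\<close>, carrying e(g)x across \<open>E\<close> replaces h by x h
  x^-1, and \<open>B_invariant\<close> says that the coefficients agree.\<close>

lemma E_central:
  assumes V: "V \<in> Rep" and m: "g \<in> carrier G" "x \<in> carrier G"
  shows "E V * ac V g x = ac V g x * E V"
proof (cases "g \<in> H")
  case False
  have "scal c * ac V a h * ac V g x = 0" if "a \<in> H" "h \<in> H" for a h c
    using ac_mult[OF V, of a h g x] that m False by (auto simp: mult.assoc)
  then have "E V * ac V g x = 0" unfolding E_def sum_distrib_right by (intro sum.neutral ballI) auto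
  moreover have "ac V g x * (scal c * ac V a h) = 0" if "a \<in> H" "h \<in> H" for a h c
    using ac_mult[OF V m, of a h] that m False H_cj_iff[OF m(2,1)] by (auto simp: scal_left_commute[of "ac V g x"])
  then have "ac V g x * E V = 0" unfolding E_def sum_distrib_left by (intro sum.neutral ballI) auto
  ultimately show ?thesis by simp
next
  case True
  define N where "N = (of_nat (card H) :: 'k)"
  define a where "a = cj x g"
  have a: "a \<in> H" using True m by (simp add: a_def H_cj)
  have "ac V g x * E V = (\<Sum>b\<in>H. if b = a then (\<Sum>h\<in>H. scal (inverse (N * B (a, h)) * \<beta> g x h) * ac V g (x \<otimes> h)) else 0)"
    unfolding E_def N_def sum_distrib_left
  proof (rule sum.cong[OF refl])
    fix b assume b: "b \<in> H"
    have "ac V g x * (scal c * ac V b h) = (if b = a then scal (c * \<beta> g x h) * ac V g (x \<otimes> h) else 0)"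
      if h: "h \<in> H" for h c
      using ac_mult[OF V m, of b h] b h by (auto simp: scal_left_commute[of "ac V g x"] scal_scal a_def)
    then show "(\<Sum>h\<in>H. ac V g x * (scal (inverse (of_nat (card H) * B (b, h))) * ac V b h)) =
      (if b = a then (\<Sum>h\<in>H. scal (inverse (of_nat (card H) * B (a, h)) * \<beta> g x h) * ac V g (x \<otimes> h)) else 0)"
      by simp
  qed
  also have "\<dots> = (\<Sum>h\<in>H. scal (inverse (N * B (a, h)) * \<beta> g x h) * ac V g (x \<otimes> h))"
    using a finite_H by simp
  also have "\<dots> = (\<Sum>h\<in>H. scal (inverse (N * B (g, cj (inv x) h)) * \<beta> g (cj (inv x) h) x) * ac V g (cj (inv x) h \<otimes> x))"
  proof (rule sum.cong[OF refl])
    fix h assume h: "h \<in> H"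
    define k where "k = cj (inv x) h"
    have k: "k \<in> H" using m h by (simp add: k_def H_cj)
    have xh: "x \<otimes> h = k \<otimes> x" using mult_cj[of x k] m h k by (auto simp: k_def)
    have "B (a, h) * \<beta> g k x = \<beta> g x h * B (g, k)" using B_invariant[OF m(2) True h] by (simp add: a_def k_def)
    then have c: "inverse (N * B (a, h)) * \<beta> g x h = inverse (N * B (g, k)) * \<beta> g k x"
      using a h k True card_H_nz by (simp add: N_def field_simps)
    then show "scal (inverse (N * B (a, h)) * \<beta> g x h) * ac V g (x \<otimes> h) =
      scal (inverse (N * B (g, cj (inv x) h)) * \<beta> g (cj (inv x) h) x) * ac V g (cj (inv x) h \<otimes> x)"
      unfolding k_def[symmetric] xh by (simp only: c)
  qed
  also have "\<dots> = (\<Sum>k\<in>H. scal (inverse (N * B (g, k)) * \<beta> g k x) * ac V g (k \<otimes> x))"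
    by (rule sum.reindex_bij_betw, rule bij_betwI[where g = "cj x"]) (use m H_cj in auto)
  also have "\<dots> = (\<Sum>b\<in>H. if b = g then (\<Sum>k\<in>H. scal (inverse (N * B (g, k)) * \<beta> g k x) * ac V g (k \<otimes> x)) else 0)"
    using True finite_H by simp
  also have "\<dots> = E V * ac V g x"
    unfolding E_def N_def sum_distrib_right
  proof (rule sum.cong[OF refl])
    fix b assume b: "b \<in> H"
    have "scal c * ac V b k * ac V g x = (if b = g then scal (c * \<beta> g k x) * ac V g (k \<otimes> x) else 0)"
      if k: "k \<in> H" for k c
      using ac_mult[OF V, of b k g x] b k m by (auto simp: scal_scal mult.assoc)
    then show "(if b = g then (\<Sum>k\<in>H. scal (inverse (of_nat (card H) * B (g, k)) * \<beta> g k x) * ac V g (k \<otimes> x)) else 0) =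
      (\<Sum>k\<in>H. scal (inverse (of_nat (card H) * B (b, k))) * ac V b k * ac V g x)"
      by simp
  qed
  finally show ?thesis by simp
qed

text \<open>Once \<open>E\<close> is the identity, its products with e(g) and e(a)h in
  \<open>ac_E_out\<close> and \<open>ac_E\<close> turn into the defining relations of
  \<open>L\<close>.\<close>

lemma L_iff:
  assumes V: "V \<in> Rep"
  shows "V \<in> L \<longleftrightarrow> E V = fm (1\<^sub>m (vdim V))"
proof
  assume L: "V \<in> L"
  have "(\<Sum>h\<in>H. scal (inverse (of_nat (card H) * B (a, h))) * ac V a h) = ac V a \<one>" if a: "a \<in> H" for a
  proof -
    have "scal (inverse (of_nat (card H) * B (a, h))) * ac V a h = scal (inverse (of_nat (card H))) * ac V a \<one>"
      if h: "h \<in> H" for h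
    proof -
      have "ac V a h = scal (B (a, h)) * ac V a \<one>" by (rule L_D(3)[OF L a h])
      then show ?thesis using a h by (simp add: scal_scal mult.assoc)
    qed
    then have "(\<Sum>h\<in>H. scal (inverse (of_nat (card H) * B (a, h))) * ac V a h) =
      of_nat (card H) * (scal (inverse (of_nat (card H))) * ac V a \<one>)" by simp
    then show ?thesis by (simp add: scal_of_nat[symmetric] scal_scal right_inverse[OF card_H_nz])
  qed
  then have "E V = (\<Sum>a\<in>H. ac V a \<one>)" by (simp add: E_def)
  also have "\<dots> = (\<Sum>a\<in>carrier G. ac V a \<one>)"
    using L_D(2)[OF L] finite_carrier H.subset by (intro sum.mono_neutral_left) auto
  finally show "E V = fm (1\<^sub>m (vdim V))" using ac_sum[OF V] by simp
next
  assume E: "E V = fm (1\<^sub>m (vdim V))"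
  show "V \<in> L"
  proof (rule L_I[OF V])
    show "ac V g \<one> = 0" if "g \<in> carrier G" "g \<notin> H" for g
      using ac_E_out[OF V that] V that by (simp add: E)
    show "ac V a h = scal (B (a, h)) * ac V a \<one>" if "a \<in> H" "h \<in> H" for a h
      using ac_E[OF V that] ac_E[OF V that(1) H.one_closed] that V by (simp add: E)
  qed
qed

lemma E_idem:
  assumes V: "V \<in> Rep"
  shows "E V * E V = E V"
proof -
  have s: "(\<Sum>a\<in>H. ac V a \<one> * E V) = E V"
  proof -
    have "(\<Sum>a\<in>H. ac V a \<one> * E V) = (\<Sum>a\<in>carrier G. ac V a \<one> * E V)"
      using finite_carrier H.subset ac_E_out[OF V] by (intro sum.mono_neutral_left) auto
    also have "\<dots> = fm (1\<^sub>m (vdim V)) * E V" by (simp add: sum_distrib_right[symmetric] ac_sum[OF V])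
    also have "\<dots> = E V" using V by (simp add: E_def sum_distrib_left scal_left_commute[of "fm _"])
    finally show ?thesis .
  qed
  have "scal (inverse (of_nat (card H) * B (a, h))) * ac V a h * E V = scal (inverse (of_nat (card H))) * (ac V a \<one> * E V)"
    if "a \<in> H" "h \<in> H" for a h
    using ac_E[OF V that] ac_E[OF V that(1) H.one_closed] that
    by (simp add: mult.assoc scal_scal)
  then have "E V * E V = (\<Sum>a\<in>H. \<Sum>h\<in>H. scal (inverse (of_nat (card H))) * (ac V a \<one> * E V))"
    unfolding E_def[of V] sum_distrib_right by (intro sum.cong refl) (simp add: E_def[symmetric])
  also have "\<dots> = (\<Sum>a\<in>H. ac V a \<one> * E V)"
    by (simp add: scal_of_nat[symmetric] scal_scal right_inverse[OF card_H_nz])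
  finally show ?thesis using s by simp
qed

lemma ex_fm_E:
  assumes V: "V \<in> Rep"
  shows "\<exists>M\<in>hom_rep G V V. fm M = E V"
proof -
  define M where "M = mat_sum (vdim V) (vdim V) (\<lambda>(a, h). inverse (of_nat (card H) * B (a, h)) \<cdot>\<^sub>m act V a h) (H \<times> H)"
  have "fm M = (\<Sum>(a, h)\<in>H \<times> H. scal (inverse (of_nat (card H) * B (a, h))) * ac V a h)"
    unfolding M_def by (subst fm_mat_sum)
      (use Rep_carrier[OF V] in \<open>auto simp: fm_smult ac_def intro!: sum.cong\<close>)
  then have f: "fm M = E V" by (simp add: E_def sum.cartesian_product)
  have "M \<in> hom_rep G V V" unfolding hom_iff[OF V V] using E_central[OF V] by (simp add: f) (simp add: M_def)
  then show ?thesis using f by blast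
qed

lemma E_simple:
  assumes W: "simple_rep G w W" and n: "W \<notin> L"
  shows "E W = 0"
proof -
  note RW = simpleD(1)[OF W]
  obtain M where M: "M \<in> hom_rep G W W" "fm M = E W" using ex_fm_E[OF RW] by blast
  obtain c where c: "M = c \<cdot>\<^sub>m 1\<^sub>m (vdim W)" using schur_scalar[OF W M(1)] by blast
  have e: "E W = scal c * fm (1\<^sub>m (vdim W))" using M(2) by (simp add: c fm_smult)
  have "fm (1\<^sub>m (vdim W)) * fm (1\<^sub>m (vdim W)) = (fm (1\<^sub>m (vdim W)) :: 'k lop)"
    by (rule fm_one_left[OF one_carrier_mat])
  then have "E W * E W = scal (c * c) * fm (1\<^sub>m (vdim W))" by (simp add: e mult.assoc scal_triple)
  then have "scal (c * c) * fm (1\<^sub>m (vdim W)) = scal c * fm (1\<^sub>m (vdim W))" using E_idem[OF RW] e by simp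
  then have "fm ((c * c) \<cdot>\<^sub>m 1\<^sub>m (vdim W)) = fm (c \<cdot>\<^sub>m 1\<^sub>m (vdim W))" by (simp add: fm_smult)
  then have "(c * c) \<cdot>\<^sub>m 1\<^sub>m (vdim W) = c \<cdot>\<^sub>m 1\<^sub>m (vdim W)" by (intro fm_inject[of _ "vdim W" "vdim W"]) auto
  then have "((c * c) \<cdot>\<^sub>m 1\<^sub>m (vdim W)) $$ (0, 0) = (c \<cdot>\<^sub>m 1\<^sub>m (vdim W)) $$ (0, 0)" by simp
  then have "c * c = c" using simpleD(2)[OF W] by simp
  then have "c = 0 \<or> c = 1" by simp
  moreover have "c \<noteq> 1" using n L_iff[OF RW] e by auto
  ultimately show ?thesis using e by simp
qed

text \<open>The left side is the trace of e(a) E, and \<open>E\<close> is 1 or 0 on a simple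
  object.\<close>

lemma trace_E:
  assumes W: "simple_rep G w W" and a: "a \<in> H"
  shows "(\<Sum>h\<in>H. inverse (of_nat (card H) * B (a, h)) * chr W a h) = (if W \<in> L then chr W a \<one> else 0)"
proof -
  note RW = simpleD(1)[OF W]
  define n where "n = vdim W"
  have c: "act W a h \<in> carrier_mat n n" if "h \<in> H" for h using Rep_carrier[OF RW, of a h] a that by (simp add: n_def)
  define M where "M = mat_sum n n (\<lambda>h. inverse (of_nat (card H) * B (a, h)) \<cdot>\<^sub>m act W a h) H"
  have "fm M = (\<Sum>h\<in>H. scal (inverse (of_nat (card H) * B (a, h))) * ac W a h)"
    unfolding M_def by (subst fm_mat_sum) (auto simp: fm_smult ac_def c)
  also have "\<dots> = ac W a \<one> * E W" using ac_E[OF RW a H.one_closed] a by simp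
  finally have fM: "fm M = ac W a \<one> * E W" .
  have "mat_trace M = (\<Sum>h\<in>H. inverse (of_nat (card H) * B (a, h)) * chr W a h)"
    unfolding M_def chr_def by (subst mat_trace_mat_sum) (auto simp: c mat_trace_smult[OF c])
  moreover have "M = (if W \<in> L then act W a \<one> else 0\<^sub>m n n)"
  proof (rule fm_inject[of _ n n])
    show "fm M = fm (if W \<in> L then act W a \<one> else 0\<^sub>m n n)"
      using fM E_simple[OF W] L_iff[OF RW] RW a by (auto simp: ac_def[symmetric])
  qed (use c[OF H.one_closed] in \<open>auto simp: M_def\<close>)
  ultimately show ?thesis by (auto simp: chr_def mat_trace_def)
qed

text \<open>This is the trace of e(a) E on \<open>Reg\<close>, where only h = \<one> contributes.
  The value is nonzero and independent of a, which gives both the dimension of \<open>L\<close> and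
  its support.\<close>

lemma sum_chr_L:
  assumes Ws: "\<forall>W\<in>set Ws. simple_rep G w W" and dec: "decomp Reg Ws" and a: "a \<in> H"
  shows "(\<Sum>i | i < length Ws \<and> Ws ! i \<in> L. chr (Ws ! i) a \<one>) = of_nat (card (carrier G)) * inverse (of_nat (card H))"
proof -
  have RW: "set Ws \<subseteq> Rep" using Ws simpleD(1) by blast
  have "(\<Sum>i | i < length Ws \<and> Ws ! i \<in> L. chr (Ws ! i) a \<one>) = (\<Sum>i<length Ws. if Ws ! i \<in> L then chr (Ws ! i) a \<one> else 0)"
    by (simp add: sum.inter_filter[symmetric] lessThan_def)
  also have "\<dots> = (\<Sum>i<length Ws. \<Sum>h\<in>H. inverse (of_nat (card H) * B (a, h)) * chr (Ws ! i) a h)"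
    by (intro sum.cong refl trace_E[symmetric] a) (use Ws in auto)
  also have "\<dots> = (\<Sum>h\<in>H. inverse (of_nat (card H) * B (a, h)) * chr Reg a h)"
    by (subst sum.swap) (use a in \<open>simp add: chr_decomp[OF Reg_Rep RW dec] sum_distrib_left\<close>)
  also have "\<dots> = (\<Sum>h\<in>H. if h = \<one> then of_nat (card (carrier G)) * inverse (of_nat (card H)) else 0)"
    by (intro sum.cong refl) (use a chr_Reg in \<open>auto simp: mult.commute\<close>)
  also have "\<dots> = of_nat (card (carrier G)) * inverse (of_nat (card H))" using finite_H by simp
  finally show ?thesis .
qed

lemma L_iso:
  assumes V: "V \<in> L" and W: "W \<in> Rep" and iso: "iso_rep G V W"
  shows "W \<in> L"
proof -
  note RV = L_D(1)[OF V]
  obtain f f' where f: "f \<in> hom_rep G V W" "f' \<in> hom_rep G W V" "fm f' * fm f = fm (1\<^sub>m (vdim V))" "fm f * fm f' = fm (1\<^sub>m (vdim W))"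
    using iso iso_rep_iff[OF RV W] by blast
  have e: "ac W g x = fm f * ac V g x * fm f'" if "g \<in> carrier G" "x \<in> carrier G" for g x
    using homD(2)[OF RV W f(1) that] f(4) W that by (simp add: mult.assoc)
  show ?thesis
  proof (rule L_I[OF W])
    fix g assume "g \<in> carrier G" "g \<notin> H"
    then show "ac W g \<one> = 0" using L_D(2)[OF V] by (simp add: e)
  next
    fix a h assume ah: "a \<in> H" "h \<in> H"
    show "ac W a h = scal (B (a, h)) * ac W a \<one>"
      using L_D(3)[OF V ah] ah by (simp add: e scal_left_commute[of "fm f"] mult.assoc)
  qed
qed

lemma cat_dim_L: "cat_dim G w L = card (carrier G)"
proof -
  obtain Ws where Ws: "\<forall>W\<in>set Ws. simple_rep G w W" "decomp Reg Ws"
    using complete_reducibility[OF Reg_Rep] by blast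
  define I where "I = {i. i < length Ws \<and> Ws ! i \<in> L}"
  have IL: "Ws ! i \<in> L" if "i \<in> I" for i using that by (simp add: I_def)
  have "(of_nat (\<Sum>i\<in>I. vdim (Ws ! i)) :: 'k) = (\<Sum>i\<in>I. \<Sum>a\<in>H. chr (Ws ! i) a \<one>)"
    unfolding of_nat_sum
  proof (rule sum.cong[OF refl])
    fix i assume i: "i \<in> I"
    note RW = L_D(1)[OF IL[OF i]]
    have "chr (Ws ! i) a \<one> = 0" if a: "a \<in> carrier G - H" for a
    proof -
      have "fm (act (Ws ! i) a \<one>) = fm (0\<^sub>m (vdim (Ws ! i)) (vdim (Ws ! i)))"
        using L_D(2)[OF IL[OF i], of a] a by (simp add: ac_def)
      then have "act (Ws ! i) a \<one> = 0\<^sub>m (vdim (Ws ! i)) (vdim (Ws ! i))"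
        using Rep_carrier[OF RW, of a \<one>] a by (intro fm_inject[of _ "vdim (Ws ! i)" "vdim (Ws ! i)"]) auto
      then show ?thesis by (simp add: chr_def mat_trace_def)
    qed
    then have "(\<Sum>a\<in>H. chr (Ws ! i) a \<one>) = (\<Sum>a\<in>carrier G. chr (Ws ! i) a \<one>)"
      using finite_carrier H.subset by (intro sum.mono_neutral_left) auto
    then show "of_nat (vdim (Ws ! i)) = (\<Sum>a\<in>H. chr (Ws ! i) a \<one>)" using sum_chr_one[OF RW] by simp
  qed
  also have "\<dots> = (\<Sum>a\<in>H. \<Sum>i\<in>I. chr (Ws ! i) a \<one>)" by (rule sum.swap)
  also have "\<dots> = (\<Sum>a\<in>H. of_nat (card (carrier G)) * inverse (of_nat (card H)))"
    unfolding I_def using sum_chr_L[OF Ws] by (intro sum.cong refl) auto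
  also have "\<dots> = of_nat (card H) * (of_nat (card (carrier G)) * inverse (of_nat (card H)))"
    by (rule sum_constant)
  also have "\<dots> = of_nat (card (carrier G))"
    using right_inverse[OF card_H_nz] by (metis mult.left_commute mult.right_neutral)
  finally have "(\<Sum>i\<in>I. vdim (Ws ! i)) = card (carrier G)" by (simp only: of_nat_eq_iff)
  moreover have "cat_dim G w L = (\<Sum>i\<in>I. vdim (Ws ! i))"
    unfolding I_def
  proof (rule cat_dim_eq[OF _ _ Ws])
    show "L \<subseteq> Rep" using L_D(1) by (rule subsetI)
  qed (rule L_iso)
  ultimately show ?thesis by simp
qed

lemma ex_L_support:
  assumes a: "a \<in> H"
  shows "\<exists>V\<in>L. ac V a \<one> \<noteq> 0"
proof (rule ccontr)
  assume n: "\<not> (\<exists>V\<in>L. ac V a \<one> \<noteq> 0)"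
  obtain Ws where Ws: "\<forall>W\<in>set Ws. simple_rep G w W" "decomp Reg Ws"
    using complete_reducibility[OF Reg_Rep] by blast
  have "chr (Ws ! i) a \<one> = 0" if i: "i < length Ws \<and> Ws ! i \<in> L" for i
  proof -
    have RW: "Ws ! i \<in> Rep" using L_D(1) i by blast
    have "act (Ws ! i) a \<one> = 0\<^sub>m (vdim (Ws ! i)) (vdim (Ws ! i))"
      using Rep_carrier[OF RW, of a \<one>] a n i by (intro fm_inject[of _ "vdim (Ws ! i)" "vdim (Ws ! i)"]) (auto simp: ac_def)
    then show ?thesis by (simp add: chr_def mat_trace_def)
  qed
  then have "(\<Sum>i | i < length Ws \<and> Ws ! i \<in> L. chr (Ws ! i) a \<one>) = 0" by simp
  then show False using sum_chr_L[OF Ws a] card_carrier_nz card_H_nz by simp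
qed

end

section \<open>Linear algebra of images and idempotents\<close>

lemma smult_mat_mult_vec:
  fixes A :: "'k::field mat"
  shows "A \<in> carrier_mat n m \<Longrightarrow> v \<in> carrier_vec m \<Longrightarrow> (c \<cdot>\<^sub>m A) *\<^sub>v v = c \<cdot>\<^sub>v (A *\<^sub>v v)"
  by (intro eq_vecI) (auto simp: scalar_prod_def sum_distrib_left mult.assoc)

lemma zero_mat_mult_vec:
  fixes v :: "'k::field vec"
  shows "v \<in> carrier_vec m \<Longrightarrow> 0\<^sub>m n m *\<^sub>v v = 0\<^sub>v n"
  by (intro eq_vecI) auto

lemma linear_subspace_image:
  fixes M :: "'k::field mat"
  assumes M: "M \<in> carrier_mat n m"
  shows "linear_subspace n ((\<lambda>v. M *\<^sub>v v) ` carrier_vec m)"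
  unfolding linear_subspace_def
proof (intro conjI ballI allI)
  show "(\<lambda>v. M *\<^sub>v v) ` carrier_vec m \<subseteq> carrier_vec n" using M by auto
  show "0\<^sub>v n \<in> (\<lambda>v. M *\<^sub>v v) ` carrier_vec m"
    using mult_mat_zero_vec[OF M] by (metis imageI zero_carrier_vec)
  fix u assume "u \<in> (\<lambda>v. M *\<^sub>v v) ` carrier_vec m"
  then obtain v where v: "v \<in> carrier_vec m" "u = M *\<^sub>v v" by auto
  show "c \<cdot>\<^sub>v u \<in> (\<lambda>v. M *\<^sub>v v) ` carrier_vec m" for c
    using v mult_mat_vec[OF M v(1), of c] by (metis imageI smult_carrier_vec)
  fix u' assume "u' \<in> (\<lambda>v. M *\<^sub>v v) ` carrier_vec m"
  then obtain v' where v': "v' \<in> carrier_vec m" "u' = M *\<^sub>v v'" by auto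
  show "u + u' \<in> (\<lambda>v. M *\<^sub>v v) ` carrier_vec m"
    using v v' mult_add_distrib_mat_vec[OF M v(1) v'(1)] by (metis imageI add_carrier_vec)
qed

text \<open>An idempotent factors through its image as P (Q M) with Q M P = 1, so its trace is its
  rank, and trace d means full rank.\<close>

lemma idempotent_full_trace:
  fixes M :: "'k::{field, ring_char_0} mat"
  assumes M: "M \<in> carrier_mat d d" and idem: "M * M = M" and tr: "mat_trace M = of_nat d"
  shows "M = 1\<^sub>m d"
proof -
  define U where "U = (\<lambda>v. M *\<^sub>v v) ` carrier_vec d"
  obtain r P Q where P: "P \<in> carrier_mat d r" and Q: "Q \<in> carrier_mat r d" and QP: "Q * P = 1\<^sub>m r"
    and PU: "\<And>v. v \<in> carrier_vec r \<Longrightarrow> P *\<^sub>v v \<in> U" and PQU: "\<And>u. u \<in> U \<Longrightarrow> P *\<^sub>v (Q *\<^sub>v u) = u"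
    using linear_subspace_split[OF linear_subspace_image[OF M]] unfolding U_def by metis
  have fixU: "M *\<^sub>v u = u" if "u \<in> U" for u
    using that idem assoc_mult_mat_vec[OF M M] by (auto simp: U_def)
  have MP: "M * P = P"
    by (rule mat_eq_on_vec[of _ d r]) (use M P fixU[OF PU] assoc_mult_mat_vec[OF M P] in auto)
  have PQM: "P * (Q * M) = M"
  proof (rule mat_eq_on_vec[of _ d d])
    fix v :: "'k vec" assume v: "v \<in> carrier_vec d"
    have "P * (Q * M) *\<^sub>v v = P *\<^sub>v (Q *\<^sub>v (M *\<^sub>v v))"
      using assoc_mult_mat_vec[OF P mult_carrier_mat[OF Q M] v] assoc_mult_mat_vec[OF Q M v] by simp
    also have "\<dots> = M *\<^sub>v v" using v by (intro PQU) (auto simp: U_def)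
    finally show "P * (Q * M) *\<^sub>v v = M *\<^sub>v v" .
  qed (use P Q M in auto)
  have "of_nat d = mat_trace (P * (Q * M))" using tr PQM by simp
  also have "\<dots> = mat_trace ((Q * M) * P)" by (rule mat_trace_mult_commute[OF P mult_carrier_mat[OF Q M]])
  also have "(Q * M) * P = 1\<^sub>m r" using assoc_mult_mat[OF Q M P] MP QP by simp
  finally have "d = r" by simp
  then have "P * Q = 1\<^sub>m d" using mat_mult_left_right_inverse[of Q d P] P Q QP by simp
  show ?thesis
  proof (rule mat_eq_on_vec[OF M])
    fix v :: "'k vec" assume v: "v \<in> carrier_vec d"
    have "v = P *\<^sub>v (Q *\<^sub>v v)" using assoc_mult_mat_vec[OF P Q v] \<open>P * Q = 1\<^sub>m d\<close> v by simp
    then have "v \<in> U" using PU[of "Q *\<^sub>v v"] Q v by simp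
    then show "M *\<^sub>v v = 1\<^sub>m d *\<^sub>v v" using fixU v by simp
  qed simp
qed

section \<open>Labels of simple objects\<close>

context twisted_double
begin

lemma proj_rep_one:
  assumes \<sigma>: "projective_rep G K \<alpha> d \<sigma>" and K: "\<one> \<in> K" and \<alpha>: "\<alpha> \<one> \<one> = 1"
  shows "\<sigma> \<one> = 1\<^sub>m d"
proof -
  have c: "\<sigma> \<one> \<in> carrier_mat d d" "invertible_mat (\<sigma> \<one>)" and e: "\<sigma> \<one> * \<sigma> \<one> = \<sigma> \<one>"
    using \<sigma> K \<alpha> by (auto simp: projective_rep_def)
  obtain C where C: "\<sigma> \<one> * C = 1\<^sub>m d" "C * \<sigma> \<one> = 1\<^sub>m (dim_row C)"
    using c by (auto simp: invertible_mat_def inverts_mat_def)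
  have Cc: "C \<in> carrier_mat d d"
    using arg_cong[OF C(1), of dim_col] arg_cong[OF C(2), of dim_col] c(1) by auto
  have "\<sigma> \<one> = \<sigma> \<one> * (\<sigma> \<one> * C)" using c C by simp
  also have "\<dots> = \<sigma> \<one> * \<sigma> \<one> * C" by (rule assoc_mult_mat[OF c(1) c(1) Cc, symmetric])
  also have "\<dots> = 1\<^sub>m d" using e C by simp
  finally show ?thesis .
qed

lemma one_centralizer: "a \<in> carrier G \<Longrightarrow> \<one> \<in> centralizer G a"
  by (simp add: centralizer_def)

text \<open>\<open>\<sigma> \<one>\<close> is invertible and idempotent, hence the identity, so the
  value of the character at \<one> determines the degree in characteristic zero.\<close>

lemma proj_degree_eq:
  assumes a: "a \<in> carrier G" and \<sigma>: "projective_rep G (centralizer G a) (\<beta> a) d \<sigma>"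
    and \<chi>: "\<chi> = proj_character (centralizer G a) \<sigma>"
  shows "proj_degree G (centralizer G a) (\<beta> a) \<chi> = d"
proof -
  have deg: "\<chi> \<one> = of_nat d'"
    if "projective_rep G (centralizer G a) (\<beta> a) d' \<sigma>'" "\<chi> = proj_character (centralizer G a) \<sigma>'" for d' \<sigma>'
    using proj_rep_one[OF that(1) one_centralizer[OF a]] that(2) a
    by (simp add: proj_character_def one_centralizer)
  show ?thesis
    unfolding proj_degree_def
  proof (rule the_equality)
    show "\<exists>\<sigma>'. projective_rep G (centralizer G a) (\<beta> a) d \<sigma>' \<and> \<chi> = proj_character (centralizer G a) \<sigma>'"
      using \<sigma> \<chi> by blast
    fix d' assume "\<exists>\<sigma>'. projective_rep G (centralizer G a) (\<beta> a) d' \<sigma>' \<and> \<chi> = proj_character (centralizer G a) \<sigma>'"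
    then have "(of_nat d' :: 'k) = of_nat d" using deg \<sigma> \<chi> by metis
    then show "d' = d" by simp
  qed
qed

text \<open>Up to a nonzero scalar e(cj y a) is the product of e(cj y a)y^-1 and e(a)y, and e(a)y =
  e(a) e(a)y.\<close>

lemma ac_conj_zero:
  assumes V: "V \<in> Rep" and m: "a \<in> carrier G" "y \<in> carrier G" and z: "ac V a \<one> = 0"
  shows "ac V (cj y a) \<one> = 0"
proof -
  have "ac V a y = ac V a \<one> * ac V a y" using ac_mult[OF V m(1) one_closed m] m by simp
  then have "ac V a y = 0" using z by simp
  then have "scal (\<beta> (cj y a) (inv y) y) * ac V (cj y a) \<one> = 0"
    using ac_mult[OF V, of "cj y a" "inv y" a y] m by simp
  then have "scal (inverse (\<beta> (cj y a) (inv y) y)) * (scal (\<beta> (cj y a) (inv y) y) * ac V (cj y a) \<one>) = 0" by simp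
  then show ?thesis using m by (simp add: scal_scal)
qed

lemma act_mult_vec:
  assumes V: "V \<in> Rep" and m: "h \<in> carrier G" "x \<in> carrier G" "k \<in> carrier G" "y \<in> carrier G"
    and v: "v \<in> carrier_vec (vdim V)"
  shows "act V h x *\<^sub>v (act V k y *\<^sub>v v) =
    (if cj x h = k then \<beta> h x y \<cdot>\<^sub>v (act V h (x \<otimes> y) *\<^sub>v v) else 0\<^sub>v (vdim V))"
proof -
  have e: "act V h x * act V k y = (if cj x h = k then \<beta> h x y \<cdot>\<^sub>m act V h (x \<otimes> y) else 0\<^sub>m (vdim V) (vdim V))"
    using V m by (simp add: Rep_double_def cj_def)
  have "act V h x *\<^sub>v (act V k y *\<^sub>v v) = (act V h x * act V k y) *\<^sub>v v"
    by (rule assoc_mult_mat_vec[OF Rep_carrier[OF V m(1,2)] Rep_carrier[OF V m(3,4)] v, symmetric])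
  then show ?thesis
    using smult_mat_mult_vec[OF Rep_carrier[OF V m(1), of "x \<otimes> y"] v] zero_mat_mult_vec[OF v] m by (simp add: e)
qed

lemma fm_zero_iff: "M \<in> carrier_mat n m \<Longrightarrow> fm M = 0 \<longleftrightarrow> M = 0\<^sub>m n m"
  using fm_inject[of M n m "0\<^sub>m n m"] by auto

lemma ex_ac_nonzero:
  assumes "V \<in> Rep" "0 < vdim V"
  shows "\<exists>g\<in>carrier G. ac V g \<one> \<noteq> 0"
proof (rule ccontr)
  assume "\<not> ?thesis"
  then have "fm (1\<^sub>m (vdim V)) = (0 :: 'k lop)" using ac_sum[OF assms(1)] by simp
  then have "1\<^sub>m (vdim V) = (0\<^sub>m (vdim V) (vdim V) :: 'k mat)" using fm_zero_iff[of "1\<^sub>m (vdim V)" "vdim V" "vdim V"] by auto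
  then have "(1\<^sub>m (vdim V) :: 'k mat) $$ (0, 0) = 0\<^sub>m (vdim V) (vdim V) $$ (0, 0)" by simp
  then show False using assms(2) by simp
qed

text \<open>The vectors killed by all e(h) with h outside the class of \<open>a\<close> form a
  subrepresentation, since the complement of a class is stable under conjugation. It contains the
  nonzero image of e(a), so it is everything.\<close>

lemma simple_one_class:
  assumes W: "simple_rep G w W" and a: "a \<in> carrier G" and nz: "ac W a \<one> \<noteq> 0"
    and g: "g \<in> carrier G" "\<And>y. y \<in> carrier G \<Longrightarrow> g \<noteq> cj y a"
  shows "act W g \<one> = 0\<^sub>m (vdim W) (vdim W)"
proof -
  define n where "n = vdim W"
  note RW = simpleD(1)[OF W]
  have c: "act W h x \<in> carrier_mat n n" if "h \<in> carrier G" "x \<in> carrier G" for h x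
    using Rep_carrier[OF RW that] by (simp add: n_def)
  define N where "N = {h \<in> carrier G. \<forall>y\<in>carrier G. h \<noteq> cj y a}"
  have N: "cj x h \<in> N" if "h \<in> N" "x \<in> carrier G" for h x
  proof -
    have "h = cj (y \<otimes> inv x) a" if "cj x h = cj y a" "y \<in> carrier G" for y
      using that \<open>h \<in> N\<close> \<open>x \<in> carrier G\<close> a cj_inv(1)[of x h] by (simp add: cj_mult N_def)
    then show ?thesis using that unfolding N_def by fastforce
  qed
  define U where "U = {v \<in> carrier_vec n. \<forall>h\<in>N. act W h \<one> *\<^sub>v v = 0\<^sub>v n}"
  have NG: "h \<in> carrier G" if "h \<in> N" for h using that by (simp add: N_def)
  have U: "linear_subspace (vdim W) U"
    unfolding linear_subspace_def U_def n_def[symmetric]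
    using c NG by (auto simp: mult_add_distrib_mat_vec[OF c[OF NG one_closed]] mult_mat_vec[OF c[OF NG one_closed]] mult_mat_zero_vec[OF c[OF NG one_closed]])
  note vec_mult = act_mult_vec[OF RW, folded n_def]
  have inv: "act W h x *\<^sub>v v \<in> U" if m: "h \<in> carrier G" "x \<in> carrier G" and v: "v \<in> U" for h x v
  proof -
    have vc: "v \<in> carrier_vec n" using v by (simp add: U_def)
    have "act W k \<one> *\<^sub>v (act W h x *\<^sub>v v) = 0\<^sub>v n" if k: "k \<in> N" for k
    proof (cases "k = h")
      case True
      have "act W (cj x k) \<one> *\<^sub>v v = 0\<^sub>v n" using v N[OF k m(2)] by (simp add: U_def)
      moreover have "act W h x *\<^sub>v (act W (cj x k) \<one> *\<^sub>v v) = act W h x *\<^sub>v v"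
        using vec_mult[of h x "cj x k" \<one> v] m vc True c[OF m] by simp
      ultimately have "act W h x *\<^sub>v v = 0\<^sub>v n" using mult_mat_zero_vec[OF c[OF m]] by simp
      then show ?thesis using mult_mat_zero_vec[OF c[OF NG[OF k] one_closed]] by simp
    next
      case False
      then show ?thesis using vec_mult[of k \<one> h x v] NG[OF k] m vc by simp
    qed
    then show ?thesis using c[OF m] vc by (simp add: U_def)
  qed
  have "\<exists>v\<in>carrier_vec n. act W a \<one> *\<^sub>v v \<noteq> 0\<^sub>v n"
  proof (rule ccontr)
    assume "\<not> ?thesis"
    then have "act W a \<one> = 0\<^sub>m n n" by (intro mat_eq_on_vec[OF c[OF a one_closed]]) (auto intro!: eq_vecI)
    then show False using nz by (simp add: ac_def)
  qed
  then obtain v where v: "v \<in> carrier_vec n" "act W a \<one> *\<^sub>v v \<noteq> 0\<^sub>v n" by blast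
  have "act W a \<one> *\<^sub>v v \<in> U"
  proof -
    have "act W h \<one> *\<^sub>v (act W a \<one> *\<^sub>v v) = 0\<^sub>v n" if h: "h \<in> N" for h
    proof -
      have "h \<noteq> cj \<one> a" using h one_closed unfolding N_def by blast
      then have "h \<noteq> a" using a by simp
      then show ?thesis using vec_mult[of h \<one> a \<one> v] NG[OF h] a v by simp
    qed
    then show ?thesis using c[OF a one_closed] v by (simp add: U_def)
  qed
  then have "U = carrier_vec n" using simple_subspace[OF W U inv] v by (auto simp: n_def)
  moreover have "g \<in> N" using g by (simp add: N_def)
  ultimately have "act W g \<one> *\<^sub>v v = 0\<^sub>v n" if "v \<in> carrier_vec n" for v using that unfolding U_def by blast
  then show ?thesis unfolding n_def[symmetric]
    by (intro mat_eq_on_vec[OF c[OF g(1) one_closed]]) (auto intro!: eq_vecI)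
qed

text \<open>The columns of \<open>P\<close> form a basis of \<open>e(a)W\<close>.\<close>

lemma simple_label:
  assumes W: "simple_rep G w W" and a: "a \<in> carrier G" and nz: "ac W a \<one> \<noteq> 0"
  obtains d \<sigma> P Q where "projective_rep G (centralizer G a) (\<beta> a) d \<sigma>"
    "irreducible_mats d (\<sigma> ` centralizer G a)"
    "simple_of_label G w a (proj_character (centralizer G a) \<sigma>) W"
    "P \<in> carrier_mat (vdim W) d" "Q \<in> carrier_mat d (vdim W)" "Q * P = 1\<^sub>m d" "act W a \<one> * P = P"
    "\<And>x. \<sigma> x = Q * act W a x * P"
proof -
  define n where "n = vdim W"
  note RW = simpleD(1)[OF W]
  have c: "act W h x \<in> carrier_mat n n" if "h \<in> carrier G" "x \<in> carrier G" for h x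
    using Rep_carrier[OF RW that] by (simp add: n_def)
  note c1 = c[OF a one_closed]
  define U where "U = (\<lambda>v. act W a \<one> *\<^sub>v v) ` carrier_vec n"
  obtain d P Q where P: "P \<in> carrier_mat n d" and Q: "Q \<in> carrier_mat d n" and QP: "Q * P = 1\<^sub>m d"
    and PU: "\<And>v. v \<in> carrier_vec d \<Longrightarrow> P *\<^sub>v v \<in> U" and PQU: "\<And>u. u \<in> U \<Longrightarrow> P *\<^sub>v (Q *\<^sub>v u) = u"
    using linear_subspace_split[OF linear_subspace_image[OF c1]] unfolding U_def by metis
  define \<sigma> where "\<sigma> x = Q * act W a x * P" for x
  define K where "K = centralizer G a"
  have K: "x \<in> carrier G" "cj x a = a" if "x \<in> K" for x
    using that a by (auto simp: K_def centralizer_def intro: cj_unique)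
  have KI: "x \<in> K" if "x \<in> carrier G" "cj x a = a" for x
    using that a mult_cj[of x a] by (simp add: K_def centralizer_def)
  have K_inv: "inv x \<in> K" if "x \<in> K" for x
    using K[OF that] cj_inv(1)[of x a] a by (intro KI) simp_all
  have \<sigma>c: "\<sigma> x \<in> carrier_mat d d" if "x \<in> carrier G" for x using P Q c[OF a that] by (simp add: \<sigma>_def)
  have f\<sigma>: "fm (\<sigma> x) = fm Q * ac W a x * fm P" if "x \<in> carrier G" for x
    using fm_mult'[OF mult_carrier_mat[OF Q c[OF a that]] P] fm_mult'[OF Q c[OF a that]] by (simp add: \<sigma>_def ac_def)
  have idem: "ac W a \<one> * ac W a x = ac W a x" if "x \<in> carrier G" for x
    using ac_mult[OF RW a one_closed a that] a that by simp
  have fixU: "act W a \<one> *\<^sub>v u = u" if "u \<in> U" for u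
  proof -
    have "act W a \<one> * act W a \<one> = act W a \<one>"
      using idem[OF one_closed] c1 by (intro fm_inject[of _ n n]) (auto simp: fm_mult'[OF c1 c1] ac_def)
    then show ?thesis using that assoc_mult_mat_vec[OF c1 c1] by (auto simp: U_def)
  qed
  have aP: "act W a \<one> * P = P"
    by (rule mat_eq_on_vec[of _ n d]) (use c1 P fixU[OF PU] assoc_mult_mat_vec[OF c1 P] in auto)
  have PQa: "fm P * fm Q * ac W a \<one> = ac W a \<one>"
  proof -
    have "(P * Q) * act W a \<one> = act W a \<one>"
    proof (rule mat_eq_on_vec[of _ n n])
      fix v :: "'k vec" assume v: "v \<in> carrier_vec n"
      have "act W a \<one> *\<^sub>v v \<in> U" using v by (simp add: U_def)
      then show "P * Q * act W a \<one> *\<^sub>v v = act W a \<one> *\<^sub>v v"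
        using assoc_mult_mat_vec[OF mult_carrier_mat[OF P Q] c1 v] assoc_mult_mat_vec[OF P Q, of "act W a \<one> *\<^sub>v v"] PQU c1 v by simp
    qed (use P Q c1 in auto)
    from arg_cong[OF this, of fm] show ?thesis
      by (simp add: fm_mult'[OF mult_carrier_mat[OF P Q] c1] fm_mult'[OF P Q] ac_def)
  qed
  have PQax: "fm P * (fm Q * (ac W a x * F)) = ac W a x * F" if "x \<in> carrier G" for x F
  proof -
    have "fm P * (fm Q * (ac W a x * F)) = fm P * fm Q * ac W a \<one> * ac W a x * F"
      using idem[OF that] by (simp add: mult.assoc)
    then show ?thesis using idem[OF that] by (simp add: PQa)
  qed
  have aPs: "act W a x * P = P * \<sigma> x" if x: "x \<in> carrier G" for x
    using PQax[OF x, of "fm P"] c[OF a x] P \<sigma>c[OF x]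
    by (intro fm_inject[of _ n d])
      (auto simp: fm_mult'[OF c[OF a x] P] fm_mult'[OF P \<sigma>c[OF x]] f\<sigma>[OF x] ac_def[symmetric] mult.assoc)
  have \<sigma>_mult: "\<sigma> x * \<sigma> y = \<beta> a x y \<cdot>\<^sub>m \<sigma> (x \<otimes> y)" if xy: "x \<in> K" "y \<in> K" for x y
  proof (rule fm_inject[of _ d d])
    have m: "x \<in> carrier G" "y \<in> carrier G" using K xy by auto
    have "fm (\<sigma> x * \<sigma> y) = fm Q * (ac W a x * ac W a y) * fm P"
      by (simp add: fm_mult'[OF \<sigma>c[OF m(1)] \<sigma>c[OF m(2)]] f\<sigma> m mult.assoc PQax)
    also have "\<dots> = scal (\<beta> a x y) * (fm Q * ac W a (x \<otimes> y) * fm P)"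
      using ac_mult[OF RW a m(1) a m(2)] K(2)[OF xy(1)] by (simp add: scal_left_commute[of "fm Q"] mult.assoc)
    finally show "fm (\<sigma> x * \<sigma> y) = fm (\<beta> a x y \<cdot>\<^sub>m \<sigma> (x \<otimes> y))" using m by (simp add: fm_smult f\<sigma>)
  qed (use mult_carrier_mat[OF \<sigma>c \<sigma>c] \<sigma>c K xy in auto)
  have \<sigma>1: "\<sigma> \<one> = 1\<^sub>m d"
    unfolding \<sigma>_def using assoc_mult_mat[OF Q c1 P] aP QP by simp
  have \<sigma>_inv: "invertible_mat (\<sigma> x)" if x: "x \<in> K" for x
  proof -
    define C where "C = inverse (\<beta> a x (inv x)) \<cdot>\<^sub>m \<sigma> (inv x)"
    have xc: "x \<in> carrier G" "inv x \<in> carrier G" using K x by auto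
    have Cc: "C \<in> carrier_mat d d" using \<sigma>c[OF xc(2)] by (simp add: C_def)
    have "\<sigma> x * C = inverse (\<beta> a x (inv x)) \<cdot>\<^sub>m (\<sigma> x * \<sigma> (inv x))"
      unfolding C_def by (rule mult_smult_distrib[OF \<sigma>c[OF xc(1)] \<sigma>c[OF xc(2)]])
    also have "\<dots> = 1\<^sub>m d" using \<sigma>_mult[OF x K_inv[OF x]] xc a \<sigma>1 by (auto intro!: eq_matI)
    finally have 1: "\<sigma> x * C = 1\<^sub>m d" .
    have 2: "C * \<sigma> x = 1\<^sub>m d" by (rule mat_mult_left_right_inverse[OF \<sigma>c[OF xc(1)] Cc 1])
    show ?thesis unfolding invertible_mat_def inverts_mat_def using 1 2 Cc \<sigma>c[OF xc(1)] by auto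
  qed
  have pr: "projective_rep G (centralizer G a) (\<beta> a) d \<sigma>"
    unfolding projective_rep_def K_def[symmetric] using \<sigma>c K \<sigma>_inv \<sigma>_mult by blast
  have inj: "inj_on (\<lambda>v. P *\<^sub>v v) (carrier_vec d)"
  proof (rule inj_onI)
    fix u v :: "'k vec" assume uv: "u \<in> carrier_vec d" "v \<in> carrier_vec d" "P *\<^sub>v u = P *\<^sub>v v"
    then have "Q *\<^sub>v (P *\<^sub>v u) = Q *\<^sub>v (P *\<^sub>v v)" by simp
    then show "u = v" using assoc_mult_mat_vec[OF Q P uv(1)] assoc_mult_mat_vec[OF Q P uv(2)] QP uv by simp
  qed
  have img: "(\<lambda>v. P *\<^sub>v v) ` carrier_vec d = U"
  proof (intro equalityI subsetI)
    fix u assume u: "u \<in> U"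
    then have "u \<in> carrier_vec n" using c1 by (auto simp: U_def)
    then have "Q *\<^sub>v u \<in> carrier_vec d" using Q by simp
    then show "u \<in> (\<lambda>v. P *\<^sub>v v) ` carrier_vec d" using PQU[OF u] by (metis imageI)
  qed (use PU in auto)
  have supp: "act W g \<one> = 0\<^sub>m (vdim W) (vdim W)" if g: "g \<in> carrier G - conj_class G a" for g
  proof (rule simple_one_class[OF W a nz])
    show "g \<noteq> cj y a" if "y \<in> carrier G" for y
    proof
      assume "g = cj y a"
      then have "g = inv y \<otimes> a \<otimes> inv (inv y)" using that by (simp add: cj_def)
      then have "g \<in> conj_class G a" using that unfolding conj_class_def by blast
      then show False using g by blast
    qed
  qed (use g in auto)
  have lab: "simple_of_label G w a (proj_character (centralizer G a) \<sigma>) W"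
    unfolding simple_of_label_def
  proof (intro conjI ballI)
    show "\<exists>d' \<sigma>' P'. projective_rep G (centralizer G a) (\<beta> a) d' \<sigma>' \<and> P' \<in> carrier_mat (vdim W) d' \<and>
        inj_on (\<lambda>v. P' *\<^sub>v v) (carrier_vec d') \<and>
        (\<lambda>v. P' *\<^sub>v v) ` carrier_vec d' = (\<lambda>v. act W a \<one> *\<^sub>v v) ` carrier_vec (vdim W) \<and>
        (\<forall>x\<in>centralizer G a. act W a x * P' = P' * \<sigma>' x) \<and>
        proj_character (centralizer G a) \<sigma> = proj_character (centralizer G a) \<sigma>'"
      by (rule exI[of _ d], rule exI[of _ \<sigma>], rule exI[of _ P])
        (use pr P inj img aPs K(1) in \<open>simp add: U_def n_def K_def\<close>)
  qed (use W supp in auto)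
  have "irreducible_mats d (\<sigma> ` K)"
    unfolding irreducible_mats_def subspace_module_vec
  proof (intro conjI allI impI)
    show "0 < d"
    proof (rule ccontr)
      assume "\<not> 0 < d"
      then have "P = 0\<^sub>m n d" using P by (intro eq_matI) auto
      then have "ac W a \<one> = 0" using PQa by simp
      then show False using nz by simp
    qed
    fix U0 :: "'k vec set" assume U0: "linear_subspace d U0" and inv0: "\<forall>A\<in>\<sigma> ` K. \<forall>u\<in>U0. A *\<^sub>v u \<in> U0"
    have U0c: "u \<in> carrier_vec d" if "u \<in> U0" for u using U0 that by (auto simp: linear_subspace_def)
    define PU0 where "PU0 = (\<lambda>v. P *\<^sub>v v) ` U0"
    have PU0: "0\<^sub>v n \<in> PU0" "\<And>c u. u \<in> PU0 \<Longrightarrow> c \<cdot>\<^sub>v u \<in> PU0" "\<And>u v. u \<in> PU0 \<Longrightarrow> v \<in> PU0 \<Longrightarrow> u + v \<in> PU0"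
    proof -
      show "0\<^sub>v n \<in> PU0" using mult_mat_zero_vec[OF P] U0 unfolding PU0_def linear_subspace_def by (metis imageI)
      show "c \<cdot>\<^sub>v u \<in> PU0" if "u \<in> PU0" for c u
      proof -
        obtain v where v: "v \<in> U0" "u = P *\<^sub>v v" using \<open>u \<in> PU0\<close> by (auto simp: PU0_def)
        have "c \<cdot>\<^sub>v v \<in> U0" using U0 v by (simp add: linear_subspace_def)
        then show ?thesis using mult_mat_vec[OF P U0c[OF v(1)], of c] v(2) unfolding PU0_def by (metis imageI)
      qed
      show "u + v \<in> PU0" if uv: "u \<in> PU0" "v \<in> PU0" for u v
      proof -
        obtain u' v' where v: "u' \<in> U0" "u = P *\<^sub>v u'" "v' \<in> U0" "v = P *\<^sub>v v'" using uv by (auto simp: PU0_def)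
        have "u' + v' \<in> U0" using U0 v by (simp add: linear_subspace_def)
        then show ?thesis using mult_add_distrib_mat_vec[OF P U0c[OF v(1)] U0c[OF v(3)]] v unfolding PU0_def by (metis imageI)
      qed
    qed
    \<comment> \<open>The largest subrepresentation whose part in e(a)W lies in the image of
      \<open>U0\<close>. Simplicity of \<open>W\<close> makes it zero or everything, and
      \<open>U0\<close> follows suit.\<close>
    define X where "X = {v \<in> carrier_vec n. \<forall>x\<in>carrier G. act W a x *\<^sub>v v \<in> PU0}"
    have X: "linear_subspace (vdim W) X"
      unfolding linear_subspace_def X_def n_def[symmetric]
      using PU0 by (auto simp: mult_add_distrib_mat_vec[OF c[OF a]] mult_mat_vec[OF c[OF a]] mult_mat_zero_vec[OF c[OF a]])
    note vec_mult = act_mult_vec[OF RW, folded n_def]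
    have Xinv: "act W g y *\<^sub>v v \<in> X" if m: "g \<in> carrier G" "y \<in> carrier G" and v: "v \<in> X" for g y v
    proof -
      have vc: "v \<in> carrier_vec n" using v by (simp add: X_def)
      have "act W a x *\<^sub>v (act W g y *\<^sub>v v) \<in> PU0" if x: "x \<in> carrier G" for x
        using vec_mult[OF a x m vc] PU0 v m x by (simp add: X_def)
      then show ?thesis using c[OF m] vc by (simp add: X_def)
    qed
    consider "X = {0\<^sub>v n}" | "X = carrier_vec n" using simple_subspace[OF W X Xinv] by (auto simp: n_def)
    then show "U0 = {0\<^sub>v d} \<or> U0 = carrier_vec d"
    proof cases
      case 1
      have "u = 0\<^sub>v d" if u: "u \<in> U0" for u
      proof -
        note uc = U0c[OF u]
        have Pu: "P *\<^sub>v u \<in> carrier_vec n" using P uc by simp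
        have "act W a x *\<^sub>v (P *\<^sub>v u) \<in> PU0" if x: "x \<in> carrier G" for x
        proof (cases "x \<in> K")
          case True
          have "act W a x *\<^sub>v (P *\<^sub>v u) = (act W a x * P) *\<^sub>v u" by (rule assoc_mult_mat_vec[OF c[OF a x] P uc, symmetric])
          also have "\<dots> = P *\<^sub>v (\<sigma> x *\<^sub>v u)" unfolding aPs[OF x] by (rule assoc_mult_mat_vec[OF P \<sigma>c[OF x] uc])
          finally show ?thesis using inv0 True u by (auto simp: PU0_def)
        next
          case False
          have "act W a x *\<^sub>v (act W a \<one> *\<^sub>v (P *\<^sub>v u)) = 0\<^sub>v n"
            using vec_mult[OF a x a one_closed Pu] False KI[OF x] by auto
          moreover have "act W a \<one> *\<^sub>v (P *\<^sub>v u) = P *\<^sub>v u" by (rule fixU[OF PU[OF uc]])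
          ultimately show ?thesis using PU0(1) by simp
        qed
        then have "P *\<^sub>v u \<in> X" using Pu by (simp add: X_def)
        then have "P *\<^sub>v u = P *\<^sub>v 0\<^sub>v d" using 1 mult_mat_zero_vec[OF P] by simp
        then show ?thesis using inj uc by (auto dest: inj_onD)
      qed
      then show ?thesis using U0 by (auto simp: linear_subspace_def)
    next
      case 2
      have "u \<in> U0" if u: "u \<in> carrier_vec d" for u
      proof -
        have "P *\<^sub>v u \<in> X" using 2 P u by simp
        then have "act W a \<one> *\<^sub>v (P *\<^sub>v u) \<in> PU0" by (simp add: X_def)
        then have "P *\<^sub>v u \<in> PU0" using fixU[OF PU[OF u]] by simp
        then obtain u' where "u' \<in> U0" "P *\<^sub>v u = P *\<^sub>v u'" by (auto simp: PU0_def)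
        then show ?thesis using inj_onD[OF inj, of u u'] u U0c by auto
      qed
      then show ?thesis using U0c by auto
    qed
  qed
  then show ?thesis
    using that[OF pr _ lab _ _ QP aP \<sigma>_def] P Q by (simp add: n_def K_def)
qed

text \<open>In this form a property that is linear in the operators of the action passes between an
  object and its summands.\<close>

lemma decomp_ac:
  assumes V: "V \<in> Rep" and Ws: "set Ws \<subseteq> Rep" and dec: "decomp V Ws"
  obtains P Q where
    "\<And>g x. g \<in> carrier G \<Longrightarrow> x \<in> carrier G \<Longrightarrow> ac V g x = (\<Sum>i<length Ws. P i * ac (Ws ! i) g x * Q i)"
    "\<And>i g x. i < length Ws \<Longrightarrow> g \<in> carrier G \<Longrightarrow> x \<in> carrier G \<Longrightarrow> ac (Ws ! i) g x = Q i * ac V g x * P i"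
proof -
  obtain P Q where h: "\<And>i. i < length Ws \<Longrightarrow> P i \<in> hom_rep G (Ws ! i) V" "\<And>i. i < length Ws \<Longrightarrow> Q i \<in> hom_rep G V (Ws ! i)"
    and o: "\<forall>i<length Ws. \<forall>j<length Ws. fm (Q i) * fm (P j) = (if i = j then fm (1\<^sub>m (vdim (Ws ! i))) else 0)"
    and s: "(\<Sum>i<length Ws. fm (P i) * fm (Q i)) = fm (1\<^sub>m (vdim V))"
    using dec unfolding decomp_def by blast
  have RW: "Ws ! i \<in> Rep" if "i < length Ws" for i using Ws that by auto
  have "ac V g x = (\<Sum>i<length Ws. fm (P i) * ac (Ws ! i) g x * fm (Q i))" if m: "g \<in> carrier G" "x \<in> carrier G" for g x
  proof -
    have "ac V g x = ac V g x * (\<Sum>i<length Ws. fm (P i) * fm (Q i))" using s V m by simp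
    also have "\<dots> = (\<Sum>i<length Ws. fm (P i) * ac (Ws ! i) g x * fm (Q i))"
      unfolding sum_distrib_left using homD(2)[OF RW V h(1)] m by (intro sum.cong refl) (simp add: mult.assoc[symmetric])
    finally show ?thesis .
  qed
  moreover have "ac (Ws ! i) g x = fm (Q i) * ac V g x * fm (P i)"
    if i: "i < length Ws" and m: "g \<in> carrier G" "x \<in> carrier G" for i g x
  proof -
    have "fm (Q i) * ac V g x * fm (P i) = fm (Q i) * fm (P i) * ac (Ws ! i) g x"
      using homD(2)[OF RW[OF i] V h(1)[OF i] m] by (simp add: mult.assoc)
    then show ?thesis using o i RW[OF i] m by simp
  qed
  ultimately show ?thesis by (rule that)
qed

end

section \<open>Agreement of the labelled and the intrinsic description\<close>

context invariant_bicharacter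
begin

lemma L_decomp:
  assumes V: "V \<in> Rep" and Ws: "set Ws \<subseteq> Rep" and dec: "decomp V Ws"
  shows "V \<in> L \<longleftrightarrow> set Ws \<subseteq> L"
proof -
  obtain P Q where
    1: "\<And>g x. g \<in> carrier G \<Longrightarrow> x \<in> carrier G \<Longrightarrow> ac V g x = (\<Sum>i<length Ws. P i * ac (Ws ! i) g x * Q i)"
    and 2: "\<And>i g x. i < length Ws \<Longrightarrow> g \<in> carrier G \<Longrightarrow> x \<in> carrier G \<Longrightarrow> ac (Ws ! i) g x = Q i * ac V g x * P i"
    using decomp_ac[OF assms] by blast
  show ?thesis
  proof
    assume VL: "V \<in> L"
    show "set Ws \<subseteq> L"
    proof
      fix W assume "W \<in> set Ws"
      then obtain i where i: "i < length Ws" "W = Ws ! i" by (metis in_set_conv_nth)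
      show "W \<in> L"
      proof (rule L_I)
        show "W \<in> Rep" using Ws \<open>W \<in> set Ws\<close> by blast
        show "ac W g \<one> = 0" if "g \<in> carrier G" "g \<notin> H" for g
          using L_D(2)[OF VL that] that by (simp add: i 2)
        show "ac W a h = scal (B (a, h)) * ac W a \<one>" if "a \<in> H" "h \<in> H" for a h
          using L_D(3)[OF VL that] that by (simp add: i 2 scal_left_commute[of "Q i"] mult.assoc)
      qed
    qed
  next
    assume "set Ws \<subseteq> L"
    then have WL: "Ws ! i \<in> L" if "i < length Ws" for i using that by auto
    show "V \<in> L"
    proof (rule L_I[OF V])
      show "ac V g \<one> = 0" if "g \<in> carrier G" "g \<notin> H" for g
        using L_D(2)[OF WL that] that by (simp add: 1)
      show "ac V a h = scal (B (a, h)) * ac V a \<one>" if ah: "a \<in> H" "h \<in> H" for a h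
      proof -
        have "P i * ac (Ws ! i) a h * Q i = scal (B (a, h)) * (P i * ac (Ws ! i) a \<one> * Q i)" if "i < length Ws" for i
          using L_D(3)[OF WL[OF that] ah] by (simp add: scal_left_commute[of "P i"] mult.assoc)
        then show ?thesis using ah by (simp add: 1 sum_distrib_left)
      qed
    qed
  qed
qed

lemma H_centralizer: "a \<in> H \<Longrightarrow> h \<in> H \<Longrightarrow> h \<in> centralizer G a"
  by (simp add: centralizer_def H_comm)

text \<open>The label prescribes only traces at one element. The averaging projector
  \<open>M\<close> over \<open>H\<close> then has the full trace d, so it is the identity, and
  \<open>\<sigma> h\<close> is the scalar B(a, h) for h in \<open>H\<close>. Hence e(a) E = e(a) is
  nonzero, and \<open>E_simple\<close> leaves only the case that \<open>W\<close> lies in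
  \<open>L\<close>, which covers the other elements of \<open>H\<close> as well.\<close>

lemma label_L:
  assumes a: "a \<in> H" and \<chi>: "\<And>h. h \<in> H \<Longrightarrow> \<chi> h = B (a, h) * of_nat (proj_degree G (centralizer G a) (\<beta> a) \<chi>)"
    and lab: "simple_of_label G w a \<chi> W"
  shows "W \<in> L"
proof -
  define n where "n = vdim W"
  define K where "K = centralizer G a"
  define N where "N = (of_nat (card H) :: 'k)"
  have aG: "a \<in> carrier G" using a by simp
  have W: "simple_rep G w W" and supp: "\<And>g. g \<in> carrier G - conj_class G a \<Longrightarrow> act W g \<one> = 0\<^sub>m (vdim W) (vdim W)"
    using lab by (auto simp: simple_of_label_def)
  obtain d \<sigma> P where \<sigma>: "projective_rep G K (\<beta> a) d \<sigma>" and P: "P \<in> carrier_mat n d"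
    and img: "(\<lambda>v. P *\<^sub>v v) ` carrier_vec d = (\<lambda>v. act W a \<one> *\<^sub>v v) ` carrier_vec n"
    and aP: "\<And>x. x \<in> K \<Longrightarrow> act W a x * P = P * \<sigma> x" and \<chi>\<sigma>: "\<chi> = proj_character K \<sigma>"
    using lab unfolding simple_of_label_def K_def n_def by blast
  note RW = simpleD(1)[OF W]
  have HK: "h \<in> K" if "h \<in> H" for h using H_centralizer[OF a that] by (simp add: K_def)
  have c: "\<sigma> h \<in> carrier_mat d d" if "h \<in> H" for h using \<sigma> HK[OF that] by (simp add: projective_rep_def)
  have f\<sigma>: "fm (\<sigma> h) * fm (\<sigma> k) = scal (\<beta> a h k) * fm (\<sigma> (h \<otimes> k))" if hk: "h \<in> H" "k \<in> H" for h k
  proof -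
    have "\<sigma> h * \<sigma> k = \<beta> a h k \<cdot>\<^sub>m \<sigma> (h \<otimes> k)" using \<sigma> HK hk by (simp add: projective_rep_def)
    from arg_cong[OF this, of fm] show ?thesis by (simp add: fm_mult'[OF c[OF hk(1)] c[OF hk(2)]] fm_smult)
  qed
  have deg: "proj_degree G K (\<beta> a) \<chi> = d" using proj_degree_eq[OF aG] \<sigma> \<chi>\<sigma> by (simp add: K_def)
  have tr: "mat_trace (\<sigma> h) = B (a, h) * of_nat d" if h: "h \<in> H" for h
    using \<chi>[OF h] deg HK[OF h] unfolding \<chi>\<sigma> K_def[symmetric] by (simp add: proj_character_def)
  define M where "M = mat_sum d d (\<lambda>h. inverse (N * B (a, h)) \<cdot>\<^sub>m \<sigma> h) H"
  have fM: "fm M = (\<Sum>h\<in>H. scal (inverse (N * B (a, h))) * fm (\<sigma> h))"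
    unfolding M_def by (subst fm_mat_sum) (simp_all add: c fm_smult)
  have \<sigma>M: "fm (\<sigma> h) * fm M = scal (B (a, h)) * fm M" if h: "h \<in> H" for h
  proof -
    have "fm (\<sigma> h) * fm M = (\<Sum>k\<in>H. scal (B (a, h)) * (scal (inverse (N * B (a, h \<otimes> k))) * fm (\<sigma> (h \<otimes> k))))"
      unfolding fM sum_distrib_left
    proof (rule sum.cong[OF refl])
      fix k assume k: "k \<in> H"
      have e: "inverse (N * B (a, k)) * \<beta> a h k = B (a, h) * inverse (N * B (a, h \<otimes> k))"
        using B_mult[OF a h k] a h k card_H_nz by (simp add: N_def field_simps)
      show "fm (\<sigma> h) * (scal (inverse (N * B (a, k))) * fm (\<sigma> k)) =
        scal (B (a, h)) * (scal (inverse (N * B (a, h \<otimes> k))) * fm (\<sigma> (h \<otimes> k)))"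
        by (simp only: scal_left_commute[of "fm (\<sigma> h)"] f\<sigma>[OF h k] scal_scal e)
    qed
    also have "\<dots> = (\<Sum>k\<in>H. scal (B (a, h)) * (scal (inverse (N * B (a, k))) * fm (\<sigma> k)))"
      by (rule sum.reindex_bij_betw[where h = "\<lambda>k. h \<otimes> k"],
          rule bij_betwI[where g = "\<lambda>k. inv h \<otimes> k"]) (use h in \<open>auto simp: m_assoc[symmetric]\<close>)
    finally show ?thesis by (simp only: fM sum_distrib_left)
  qed
  have Mc: "M \<in> carrier_mat d d" by (simp add: M_def)
  have "M = 1\<^sub>m d"
  proof (rule idempotent_full_trace[OF Mc])
    have "scal (inverse (N * B (a, h))) * fm (\<sigma> h) * fm M = scal (inverse N) * fm M" if h: "h \<in> H" for h
    proof -
      have "inverse (N * B (a, h)) * B (a, h) = inverse N" using a h by simp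
      then show ?thesis using \<sigma>M[OF h] by (simp only: mult.assoc scal_scal)
    qed
    then have "(\<Sum>h\<in>H. scal (inverse (N * B (a, h))) * fm (\<sigma> h) * fm M) = (\<Sum>h\<in>H. scal (inverse N) * fm M)"
      by (intro sum.cong refl)
    then have "fm M * fm M = (\<Sum>h\<in>H. scal (inverse N) * fm M)"
      unfolding sum_distrib_right[symmetric] fM[symmetric] .
    also have "\<dots> = scal (N * inverse N) * fm M"
      by (simp add: N_def scal_mult scal_of_nat mult.assoc)
    also have "N * inverse N = 1" unfolding N_def by (rule right_inverse[OF card_H_nz])
    finally have "fm (M * M) = fm M" by (simp add: fm_mult'[OF Mc Mc])
    then show "M * M = M" using Mc by (intro fm_inject[of _ d d]) auto
    have "mat_trace M = (\<Sum>h\<in>H. inverse (N * B (a, h)) * mat_trace (\<sigma> h))"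
      unfolding M_def by (subst mat_trace_mat_sum) (simp_all add: c mat_trace_smult[OF c])
    also have "\<dots> = (\<Sum>h\<in>H. inverse N * of_nat d)"
      using tr a by (intro sum.cong refl) simp
    also have "\<dots> = (N * inverse N) * of_nat d" by (simp add: N_def)
    also have "N * inverse N = 1" unfolding N_def by (rule right_inverse[OF card_H_nz])
    finally show "mat_trace M = of_nat d" by simp
  qed
  then have \<sigma>B: "fm (\<sigma> h) = scal (B (a, h)) * fm (1\<^sub>m d)" if "h \<in> H" for h
    using \<sigma>M[OF that] fm_one_right[OF c[OF that]] by simp
  have acB: "ac W a h = scal (B (a, h)) * ac W a \<one>" if h: "h \<in> H" for h
  proof -
    have hG: "h \<in> carrier G" using h by simp
    have ch: "act W a h \<in> carrier_mat n n" "act W a \<one> \<in> carrier_mat n n"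
      using Rep_carrier[OF RW aG] hG by (auto simp: n_def)
    have hP: "act W a h * P = B (a, h) \<cdot>\<^sub>m P"
      using aP[OF HK[OF h]] \<sigma>B[OF h] fm_one_right[OF P] ch P mult_carrier_mat[OF P c[OF h]]
      by (intro fm_inject[of _ n d]) (auto simp: fm_mult'[OF P c[OF h]] fm_smult scal_left_commute[of "fm P"])
    have "act W a h * act W a \<one> = B (a, h) \<cdot>\<^sub>m act W a \<one>"
    proof (rule mat_eq_on_vec[of _ n n])
      fix v :: "'k vec" assume v: "v \<in> carrier_vec n"
      then have "act W a \<one> *\<^sub>v v \<in> (\<lambda>v. P *\<^sub>v v) ` carrier_vec d" unfolding img by blast
      then obtain u where u: "u \<in> carrier_vec d" "act W a \<one> *\<^sub>v v = P *\<^sub>v u" by auto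
      have "act W a h * act W a \<one> *\<^sub>v v = act W a h *\<^sub>v (P *\<^sub>v u)" using assoc_mult_mat_vec[OF ch v] u by simp
      also have "\<dots> = (act W a h * P) *\<^sub>v u" by (rule assoc_mult_mat_vec[OF ch(1) P u(1), symmetric])
      also have "\<dots> = B (a, h) \<cdot>\<^sub>v (P *\<^sub>v u)" unfolding hP using P u
        by (intro eq_vecI) (auto simp: scalar_prod_def sum_distrib_left mult.assoc)
      also have "\<dots> = (B (a, h) \<cdot>\<^sub>m act W a \<one>) *\<^sub>v v" unfolding u(2)[symmetric] using ch v
        by (intro eq_vecI) (auto simp: scalar_prod_def sum_distrib_left mult.assoc)
      finally show "act W a h * act W a \<one> *\<^sub>v v = B (a, h) \<cdot>\<^sub>m act W a \<one> *\<^sub>v v" .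
    qed (use ch in auto)
    then have "fm (act W a h * act W a \<one>) = scal (B (a, h)) * ac W a \<one>" by (simp add: fm_smult ac_def)
    then show ?thesis
      using ac_mult[OF RW aG hG aG one_closed] a h aG hG by (simp add: fm_mult'[OF ch] ac_def[symmetric])
  qed
  \<comment> \<open>If e(a) vanished on \<open>W\<close>, so would e(g) for all conjugates g of a,
    and the support condition excludes the other g.\<close>
  have nz: "ac W a \<one> \<noteq> 0"
  proof
    assume z: "ac W a \<one> = 0"
    obtain g where g: "g \<in> carrier G" "ac W g \<one> \<noteq> 0" using ex_ac_nonzero[OF RW simpleD(2)[OF W]] by blast
    then have "g \<in> conj_class G a" using supp[of g] by (cases "g \<in> conj_class G a") (auto simp: ac_def)
    then obtain x where x: "x \<in> carrier G" "g = x \<otimes> a \<otimes> inv x" by (auto simp: conj_class_def)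
    then have "g = cj (inv x) a" by (simp add: cj_def)
    then show False using ac_conj_zero[OF RW aG _ z, of "inv x"] x g by simp
  qed
  have "ac W a \<one> * E W = (\<Sum>k\<in>H. scal (inverse (N * B (a, k))) * ac W a k)"
    using ac_E[OF RW a H.one_closed] a by (simp add: N_def)
  also have "\<dots> = (\<Sum>k\<in>H. scal (inverse N) * ac W a \<one>)"
  proof (rule sum.cong[OF refl])
    fix k assume k: "k \<in> H"
    have "inverse (N * B (a, k)) * B (a, k) = inverse N" using a k by simp
    then show "scal (inverse (N * B (a, k))) * ac W a k = scal (inverse N) * ac W a \<one>"
      by (simp only: acB[OF k] scal_scal)
  qed
  also have "\<dots> = scal (N * inverse N) * ac W a \<one>" by (simp add: N_def scal_mult scal_of_nat mult.assoc)
  also have "N * inverse N = 1" unfolding N_def by (rule right_inverse[OF card_H_nz])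
  finally have "ac W a \<one> * E W \<noteq> 0" using nz by simp
  then show "W \<in> L" using E_simple[OF W] by (metis mult_zero_right)
qed

text \<open>The representative is taken in the class of some g with e(g) nonzero on
  \<open>W\<close>. Since h in \<open>H\<close> acts on e(a)W by the scalar B(a, h), its trace is
  this scalar times the degree.\<close>

lemma simple_L_label:
  assumes W: "simple_rep G w W" and WL: "W \<in> L"
  shows "\<exists>(a, \<chi>)\<in>Gamma G w R. a \<in> H \<inter> R \<and>
    (\<forall>h\<in>H. \<chi> h = B (a, h) * of_nat (proj_degree G (centralizer G a) (\<beta> a) \<chi>)) \<and> simple_of_label G w a \<chi> W"
proof -
  note RW = simpleD(1)[OF W]
  obtain g where g: "g \<in> carrier G" "ac W g \<one> \<noteq> 0" using ex_ac_nonzero[OF RW simpleD(2)[OF W]] by blast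
  have gH: "g \<in> H" using L_D(2)[OF WL g(1)] g(2) by blast
  obtain a y where a: "a \<in> R" "a \<in> carrier G" and y: "y \<in> carrier G" "g = cj y a" using ex_rep[OF g(1)] by blast
  have aH: "a \<in> H" using gH y a H_cj_iff by simp
  have nz: "ac W a \<one> \<noteq> 0" using ac_conj_zero[OF RW a(2) y(1)] g y by auto
  obtain d \<sigma> P Q where pr: "projective_rep G (centralizer G a) (\<beta> a) d \<sigma>"
    and irr: "irreducible_mats d (\<sigma> ` centralizer G a)"
    and lab: "simple_of_label G w a (proj_character (centralizer G a) \<sigma>) W"
    and P: "P \<in> carrier_mat (vdim W) d" and Q: "Q \<in> carrier_mat d (vdim W)" and QP: "Q * P = 1\<^sub>m d" and aP: "act W a \<one> * P = P"
    and \<sigma>: "\<And>x. \<sigma> x = Q * act W a x * P"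
    using simple_label[OF W a(2) nz] by blast
  define \<chi> where "\<chi> = proj_character (centralizer G a) \<sigma>"
  have deg: "proj_degree G (centralizer G a) (\<beta> a) \<chi> = d" by (rule proj_degree_eq[OF a(2) pr \<chi>_def])
  have "\<chi> h = B (a, h) * of_nat d" if h: "h \<in> H" for h
  proof -
    have hG: "h \<in> carrier G" using h by simp
    note c = Rep_carrier[OF RW a(2) hG] Rep_carrier[OF RW a(2) one_closed]
    have "fm (act W a h) = fm (B (a, h) \<cdot>\<^sub>m act W a \<one>)" using L_D(3)[OF WL aH h] by (simp add: fm_smult ac_def)
    then have e: "act W a h = B (a, h) \<cdot>\<^sub>m act W a \<one>" using c by (intro fm_inject[of _ "vdim W" "vdim W"]) auto
    have "\<sigma> h = B (a, h) \<cdot>\<^sub>m 1\<^sub>m d"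
    proof (rule fm_inject[of _ d d])
      have "fm (\<sigma> h) = fm Q * fm (act W a h) * fm P"
        unfolding \<sigma> using fm_mult'[OF mult_carrier_mat[OF Q c(1)] P] fm_mult'[OF Q c(1)] by simp
      also have "\<dots> = scal (B (a, h)) * (fm Q * (fm (act W a \<one>) * fm P))"
        unfolding e by (simp add: fm_smult scal_left_commute[of "fm Q"] mult.assoc)
      also have "fm (act W a \<one>) * fm P = fm P" using fm_mult'[OF c(2) P] aP by simp
      also have "fm Q * fm P = fm (1\<^sub>m d)" using fm_mult'[OF Q P] QP by simp
      finally show "fm (\<sigma> h) = fm (B (a, h) \<cdot>\<^sub>m 1\<^sub>m d)" by (simp add: fm_smult)
    qed (use P Q c in \<open>auto simp: \<sigma>\<close>)
    then show ?thesis using H_centralizer[OF aH h] by (simp add: \<chi>_def proj_character_def mat_trace_smult[of _ d])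
  qed
  moreover have "(a, \<chi>) \<in> Gamma G w R"
    using a pr irr unfolding Gamma_def irr_proj_characters_def \<chi>_def by blast
  ultimately show ?thesis using aH a lab deg unfolding \<chi>_def[symmetric] by (intro bexI[of _ "(a, \<chi>)"]) auto
qed

lemma subcat_L_eq: "subcat_L G w R H B = L"
proof (intro equalityI subsetI)
  fix V assume "V \<in> subcat_L G w R H B"
  then obtain Ws where V: "V \<in> Rep" and Ws: "\<forall>W\<in>set Ws. \<exists>(a, \<chi>)\<in>Gamma G w R. a \<in> H \<inter> R \<and>
        (\<forall>h\<in>H. \<chi> h = B (a, h) * of_nat (proj_degree G (centralizer G a) (\<beta> a) \<chi>)) \<and> simple_of_label G w a \<chi> W"
    and iso: "iso_rep G V (direct_sum Ws)"
    unfolding subcat_L_def by blast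
  have WL: "set Ws \<subseteq> L"
  proof
    fix W assume "W \<in> set Ws"
    then obtain a \<chi> where "a \<in> H" "\<forall>h\<in>H. \<chi> h = B (a, h) * of_nat (proj_degree G (centralizer G a) (\<beta> a) \<chi>)"
      "simple_of_label G w a \<chi> W" using Ws by blast
    then show "W \<in> L" by (intro label_L[of a \<chi>]) auto
  qed
  have WR: "set Ws \<subseteq> Rep" using WL L_D(1) by (meson subset_iff)
  show "V \<in> L" using iso_direct_sum_iff[OF V WR] iso L_decomp[OF V WR] WL by simp
next
  fix V assume VL: "V \<in> L"
  note V = L_D(1)[OF VL]
  obtain Ws where Ws: "\<forall>W\<in>set Ws. simple_rep G w W" and dec: "decomp V Ws" using complete_reducibility[OF V] by blast
  have WR: "set Ws \<subseteq> Rep" using Ws simpleD(1) by blast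
  have WL: "set Ws \<subseteq> L" using L_decomp[OF V WR dec] VL by simp
  have "\<forall>W\<in>set Ws. \<exists>(a, \<chi>)\<in>Gamma G w R. a \<in> H \<inter> R \<and>
        (\<forall>h\<in>H. \<chi> h = B (a, h) * of_nat (proj_degree G (centralizer G a) (\<beta> a) \<chi>)) \<and> simple_of_label G w a \<chi> W"
  proof
    fix W assume "W \<in> set Ws"
    then have "simple_rep G w W" "W \<in> L" using Ws WL by auto
    then show "\<exists>(a, \<chi>)\<in>Gamma G w R. a \<in> H \<inter> R \<and>
        (\<forall>h\<in>H. \<chi> h = B (a, h) * of_nat (proj_degree G (centralizer G a) (\<beta> a) \<chi>)) \<and> simple_of_label G w a \<chi> W"
      by (rule simple_L_label)
  qed
  moreover have "iso_rep G V (direct_sum Ws)" using iso_direct_sum_iff[OF V WR] dec by simp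
  ultimately show "V \<in> subcat_L G w R H B" using V unfolding subcat_L_def by blast
qed

end

section \<open>Tensor products\<close>

lemma kronecker_carrier:
  "A \<in> carrier_mat n m \<Longrightarrow> B \<in> carrier_mat n' m' \<Longrightarrow> kronecker A B \<in> carrier_mat (n * n') (m * m')"
  by (auto simp: kronecker_def)

lemma div_mod_less:
  fixes i n n' :: nat
  assumes "i < n * n'"
  shows "i div n' < n" "i mod n' < n'"
proof -
  show "i div n' < n" using assms by (simp add: less_mult_imp_div_less)
  have "0 < n'" using assms by (cases n') auto
  then show "i mod n' < n'" by simp
qed

lemma kronecker_index:
  assumes "A \<in> carrier_mat n m" "B \<in> carrier_mat n' m'" "i < n * n'" "j < m * m'"
  shows "kronecker A B $$ (i, j) = A $$ (i div n', j div m') * B $$ (i mod n', j mod m')"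
  using assms by (auto simp: kronecker_def)

lemma sum_div_mod:
  "(\<Sum>k<m * m'. f (k div m') (k mod m')) = (\<Sum>a<m. \<Sum>b<m'. f a (b :: nat) :: 'b::comm_monoid_add)"
proof -
  have "(\<Sum>a<m. \<Sum>b<m'. f a b) = (\<Sum>(a, b)\<in>{..<m} \<times> {..<m'}. f a b)" by (rule sum.cartesian_product)
  also have "\<dots> = (\<Sum>k<m * m'. f (k div m') (k mod m'))"
  proof (rule sum.reindex_bij_witness[where i = "\<lambda>k. (k div m', k mod m')" and j = "\<lambda>(a, b). a * m' + b"])
    fix p assume "p \<in> {..<m} \<times> {..<m'}"
    then obtain a b where p: "p = (a, b)" "a < m" "b < m'" by auto
    have "a * m' + b < Suc a * m'" using p by simp
    also have "\<dots> \<le> m * m'" using p by (intro mult_le_mono1) simp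
    finally show "(case p of (a, b) \<Rightarrow> a * m' + b) \<in> {..<m * m'}" using p by simp
    show "((case p of (a, b) \<Rightarrow> a * m' + b) div m', (case p of (a, b) \<Rightarrow> a * m' + b) mod m') = p"
      using p by simp
    show "f ((case p of (a, b) \<Rightarrow> a * m' + b) div m') ((case p of (a, b) \<Rightarrow> a * m' + b) mod m') = (case p of (a, b) \<Rightarrow> f a b)"
      using p by simp
  next
    fix k assume "k \<in> {..<m * m'}"
    then show "(k div m', k mod m') \<in> {..<m} \<times> {..<m'}" using div_mod_less[of k m m'] by simp
  qed simp
  finally show ?thesis by simp
qed

lemma kronecker_mult:
  fixes A B C D :: "'k::field mat"
  assumes A: "A \<in> carrier_mat n m" and C: "C \<in> carrier_mat m l"
    and B: "B \<in> carrier_mat n' m'" and D: "D \<in> carrier_mat m' l'"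
  shows "kronecker A B * kronecker C D = kronecker (A * C) (B * D)"
proof (rule eq_matI)
  fix i j assume "i < dim_row (kronecker (A * C) (B * D))" "j < dim_col (kronecker (A * C) (B * D))"
  then have ij: "i < n * n'" "j < l * l'" using assms by (auto simp: kronecker_def)
  note d = div_mod_less[OF ij(1)] div_mod_less[OF ij(2)]
  have "(kronecker A B * kronecker C D) $$ (i, j) = (\<Sum>k<m * m'. kronecker A B $$ (i, k) * kronecker C D $$ (k, j))"
    using ij kronecker_carrier[OF A B] kronecker_carrier[OF C D] by (auto simp: scalar_prod_def atLeast0LessThan)
  also have "\<dots> = (\<Sum>k<m * m'. (A $$ (i div n', k div m') * B $$ (i mod n', k mod m')) * (C $$ (k div m', j div l') * D $$ (k mod m', j mod l')))"
    using ij by (intro sum.cong refl) (simp add: kronecker_index[OF A B] kronecker_index[OF C D])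
  also have "\<dots> = (\<Sum>a<m. \<Sum>b<m'. (A $$ (i div n', a) * B $$ (i mod n', b)) * (C $$ (a, j div l') * D $$ (b, j mod l')))"
    by (rule sum_div_mod)
  also have "\<dots> = (\<Sum>a<m. A $$ (i div n', a) * C $$ (a, j div l')) * (\<Sum>b<m'. B $$ (i mod n', b) * D $$ (b, j mod l'))"
    unfolding sum_product by (intro sum.cong refl) (simp add: mult_ac)
  also have "\<dots> = (A * C) $$ (i div n', j div l') * (B * D) $$ (i mod n', j mod l')"
    using d A B C D by (simp add: scalar_prod_def atLeast0LessThan)
  also have "\<dots> = kronecker (A * C) (B * D) $$ (i, j)"
    using kronecker_index[OF mult_carrier_mat[OF A C] mult_carrier_mat[OF B D] ij] by simp
  finally show "(kronecker A B * kronecker C D) $$ (i, j) = kronecker (A * C) (B * D) $$ (i, j)" .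
qed (use assms in \<open>auto simp: kronecker_def\<close>)

lemma kronecker_smult:
  fixes A B :: "'k::field mat"
  shows "kronecker (c \<cdot>\<^sub>m A) B = c \<cdot>\<^sub>m kronecker A B" "kronecker A (c \<cdot>\<^sub>m B) = c \<cdot>\<^sub>m kronecker A B"
proof -
  have idx: "i div dim_row B < dim_row A" "i mod dim_row B < dim_row B" "j div dim_col B < dim_col A" "j mod dim_col B < dim_col B"
    if "i < dim_row A * dim_row B" "j < dim_col A * dim_col B" for i j
    using div_mod_less[OF that(1)] div_mod_less[OF that(2)] by auto
  show "kronecker (c \<cdot>\<^sub>m A) B = c \<cdot>\<^sub>m kronecker A B" "kronecker A (c \<cdot>\<^sub>m B) = c \<cdot>\<^sub>m kronecker A B"
    by (rule eq_matI; simp add: kronecker_def idx)+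
qed

lemma kronecker_mat_sum:
  fixes A :: "'i \<Rightarrow> 'k::field mat" and B :: "'j \<Rightarrow> 'k mat"
  assumes A: "\<And>i. i \<in> I \<Longrightarrow> A i \<in> carrier_mat n m" and B: "\<And>j. j \<in> J \<Longrightarrow> B j \<in> carrier_mat n' m'"
  shows "kronecker (mat_sum n m A I) (mat_sum n' m' B J) =
    mat_sum (n * n') (m * m') (\<lambda>(i, j). kronecker (A i) (B j)) (I \<times> J)"
proof (rule eq_matI)
  fix r s assume "r < dim_row (mat_sum (n * n') (m * m') (\<lambda>(i, j). kronecker (A i) (B j)) (I \<times> J))"
    "s < dim_col (mat_sum (n * n') (m * m') (\<lambda>(i, j). kronecker (A i) (B j)) (I \<times> J))"
  then have rs: "r < n * n'" "s < m * m'" by (auto simp: mat_sum_def)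
  note d = div_mod_less[OF rs(1)] div_mod_less[OF rs(2)]
  have "kronecker (mat_sum n m A I) (mat_sum n' m' B J) $$ (r, s) =
    (\<Sum>i\<in>I. A i $$ (r div n', s div m')) * (\<Sum>j\<in>J. B j $$ (r mod n', s mod m'))"
    using rs d by (simp add: kronecker_index[of _ n m _ n' m'] mat_sum_def)
  also have "\<dots> = (\<Sum>(i, j)\<in>I \<times> J. kronecker (A i) (B j) $$ (r, s))"
    unfolding sum_product sum.cartesian_product
    by (rule sum.cong[OF refl]) (use rs in \<open>auto simp: kronecker_index[OF A B]\<close>)
  also have "\<dots> = mat_sum (n * n') (m * m') (\<lambda>(i, j). kronecker (A i) (B j)) (I \<times> J) $$ (r, s)"
    using rs by (auto simp: mat_sum_def intro!: sum.cong)
  finally show "kronecker (mat_sum n m A I) (mat_sum n' m' B J) $$ (r, s) =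
    mat_sum (n * n') (m * m') (\<lambda>(i, j). kronecker (A i) (B j)) (I \<times> J) $$ (r, s)" .
qed (auto simp: mat_sum_def kronecker_def)

lemma kronecker_one: "kronecker (1\<^sub>m n) (1\<^sub>m m) = (1\<^sub>m (n * m) :: 'k::field mat)"
proof (rule eq_matI)
  fix i j assume "i < dim_row (1\<^sub>m (n * m) :: 'k mat)" "j < dim_col (1\<^sub>m (n * m) :: 'k mat)"
  then have ij: "i < n * m" "j < n * m" by auto
  have "i = j \<longleftrightarrow> i div m = j div m \<and> i mod m = j mod m" by (metis div_mult_mod_eq)
  then show "kronecker (1\<^sub>m n) (1\<^sub>m m) $$ (i, j) = (1\<^sub>m (n * m) :: 'k mat) $$ (i, j)"
    using ij div_mod_less[OF ij(1)] div_mod_less[OF ij(2)] by (auto simp: kronecker_index[of _ n n _ m m])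
qed (auto simp: kronecker_def)

lemma kronecker_zero:
  fixes A :: "'k::field mat"
  shows "A \<in> carrier_mat n' m' \<Longrightarrow> kronecker (0\<^sub>m n m) A = 0\<^sub>m (n * n') (m * m')"
    "A \<in> carrier_mat n' m' \<Longrightarrow> kronecker A (0\<^sub>m n m) = 0\<^sub>m (n' * n) (m' * m)"
  by (auto simp: kronecker_def div_mod_less intro!: eq_matI)

lemma kronecker_assoc:
  fixes A B C :: "'k::field mat"
  shows "kronecker (kronecker A B) C = kronecker A (kronecker B C)"
proof (rule eq_matI)
  fix i j assume "i < dim_row (kronecker A (kronecker B C))" "j < dim_col (kronecker A (kronecker B C))"
  then have ij: "i < dim_row A * (dim_row B * dim_row C)" "j < dim_col A * (dim_col B * dim_col C)"
    by (auto simp: kronecker_def)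
  then have ij': "i < dim_row A * dim_row B * dim_row C" "j < dim_col A * dim_col B * dim_col C" by (auto simp: mult.assoc)
  have dm: "p div c div b = p div (b * c)" "(p div c) mod b = (p mod (b * c)) div c" "p mod c = (p mod (b * c)) mod c" for p b c :: nat
    by (cases "c = 0"; simp add: div_mult2_eq mod_mult2_eq mult.commute[of b c])+
  show "kronecker (kronecker A B) C $$ (i, j) = kronecker A (kronecker B C) $$ (i, j)"
    using ij ij' div_mod_less[OF ij(1)] div_mod_less[OF ij(2)] div_mod_less[OF ij'(1)] div_mod_less[OF ij'(2)]
      dm[of i "dim_row C" "dim_row B"] dm[of j "dim_col C" "dim_col B"]
    by (simp add: kronecker_def mult.assoc)
qed (auto simp: kronecker_def mult.assoc)

lemma sum_pair_delta:
  "finite S \<Longrightarrow> (\<Sum>(a, b)\<in>S. if (a, b) = p then c else 0) = (if p \<in> S then c else 0)"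
  by (simp add: case_prod_unfold)

context twisted_double
begin

lemma tensor_carrier:
  assumes V: "V \<in> Rep" and W: "W \<in> Rep" and m: "h \<in> carrier G" "x \<in> carrier G" "k \<in> carrier G" "y \<in> carrier G"
  shows "kronecker (act V h x) (act W k y) \<in> carrier_mat (vdim V * vdim W) (vdim V * vdim W)"
  by (rule kronecker_carrier[OF Rep_carrier[OF V m(1,2)] Rep_carrier[OF W m(3,4)]])

definition pairs :: "'a \<Rightarrow> ('a \<times> 'a) set" where
  "pairs g = {(h, k). h \<in> carrier G \<and> k \<in> carrier G \<and> h \<otimes> k = g}"

lemma pairs_D: "(h, k) \<in> pairs g \<Longrightarrow> h \<in> carrier G \<and> k \<in> carrier G \<and> h \<otimes> k = g"
  by (simp add: pairs_def)

lemma finite_pairs: "finite (pairs g)"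
  by (rule finite_subset[of _ "carrier G \<times> carrier G"]) (auto simp: pairs_def finite_carrier)

definition kr :: "('a, 'k) rep \<Rightarrow> ('a, 'k) rep \<Rightarrow> 'a \<Rightarrow> 'a \<Rightarrow> 'a \<Rightarrow> 'a \<Rightarrow> 'k lop" where
  "kr V W h x k y = fm (kronecker (act V h x) (act W k y))"

lemma ac_tensor:
  assumes V: "V \<in> Rep" and W: "W \<in> Rep" and x: "x \<in> carrier G"
  shows "ac (tensor_rep G w V W) g x = (\<Sum>(h, k)\<in>pairs g. scal (\<gamma> x h k) * kr V W h x k x)"
proof -
  have "ac (tensor_rep G w V W) g x = fm (mat_sum (vdim V * vdim W) (vdim V * vdim W)
       (\<lambda>(h, k). \<gamma> x h k \<cdot>\<^sub>m kronecker (act V h x) (act W k x)) (pairs g))"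
    by (simp add: ac_def tensor_rep_def pairs_def)
  also have "\<dots> = (\<Sum>p\<in>pairs g. fm (case p of (h, k) \<Rightarrow> \<gamma> x h k \<cdot>\<^sub>m kronecker (act V h x) (act W k x)))"
    by (rule fm_mat_sum) (use tensor_carrier[OF V W _ x _ x] in \<open>auto simp: pairs_def\<close>)
  also have "\<dots> = (\<Sum>(h, k)\<in>pairs g. scal (\<gamma> x h k) * kr V W h x k x)"
    by (intro sum.cong refl) (auto simp: fm_smult kr_def)
  finally show ?thesis .
qed

lemma kr_mult:
  assumes V: "V \<in> Rep" and W: "W \<in> Rep"
    and m: "h \<in> carrier G" "x \<in> carrier G" "k \<in> carrier G" "y \<in> carrier G"
      "h' \<in> carrier G" "x' \<in> carrier G" "k' \<in> carrier G" "y' \<in> carrier G"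
  shows "kr V W h x k y * kr V W h' x' k' y' =
    (if cj x h = h' \<and> cj y k = k' then scal (\<beta> h x x' * \<beta> k y y') * kr V W h (x \<otimes> x') k (y \<otimes> y') else 0)"
proof -
  note c = Rep_carrier[OF V m(1,2)] Rep_carrier[OF V m(5,6)] Rep_carrier[OF W m(3,4)] Rep_carrier[OF W m(7,8)]
  have eV: "act V h x * act V h' x' = (if cj x h = h' then \<beta> h x x' \<cdot>\<^sub>m act V h (x \<otimes> x') else 0\<^sub>m (vdim V) (vdim V))"
    using V m by (simp add: Rep_double_def cj_def)
  have eW: "act W k y * act W k' y' = (if cj y k = k' then \<beta> k y y' \<cdot>\<^sub>m act W k (y \<otimes> y') else 0\<^sub>m (vdim W) (vdim W))"
    using W m by (simp add: Rep_double_def cj_def)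
  have "kr V W h x k y * kr V W h' x' k' y' = fm (kronecker (act V h x * act V h' x') (act W k y * act W k' y'))"
    unfolding kr_def fm_mult'[OF kronecker_carrier[OF c(1,3)] kronecker_carrier[OF c(2,4)], symmetric]
    by (simp add: kronecker_mult[OF c])
  also have "\<dots> = (if cj x h = h' \<and> cj y k = k' then scal (\<beta> h x x' * \<beta> k y y') * kr V W h (x \<otimes> x') k (y \<otimes> y') else 0)"
    using Rep_carrier[OF V m(1), of "x \<otimes> x'"] Rep_carrier[OF W m(3), of "y \<otimes> y'"] m
    unfolding eV eW by (auto simp: kronecker_smult fm_smult scal_scal kr_def kronecker_zero[of _ "vdim W" "vdim W"]
        kronecker_zero[of _ "vdim V" "vdim V"] mult.commute[of "\<beta> k y y'"])
  finally show ?thesis .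
qed

lemma gamma_one [simp]: "h \<in> carrier G \<Longrightarrow> k \<in> carrier G \<Longrightarrow> \<gamma> \<one> h k = 1"
  by (simp add: gamma_eq)

text \<open>In a product of two coproducts only the terms with h', k' conjugate to h, k by x
  survive, and \<open>gamma_beta\<close> compares their coefficients. For the unit, the pairs (h, k)
  are grouped by their product.\<close>

lemma tensor_Rep:
  assumes V: "V \<in> Rep" and W: "W \<in> Rep"
  shows "tensor_rep G w V W \<in> Rep"
proof (rule RepI)
  define T where "T = tensor_rep G w V W"
  have vd: "vdim (tensor_rep G w V W) = vdim V * vdim W" by (simp add: tensor_rep_def)
  show "act (tensor_rep G w V W) g x \<in> carrier_mat (vdim (tensor_rep G w V W)) (vdim (tensor_rep G w V W))" for g x
    unfolding vd by (simp add: tensor_rep_def)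
  show "ac (tensor_rep G w V W) g x * ac (tensor_rep G w V W) g' y =
      (if cj x g = g' then scal (\<beta> g x y) * ac (tensor_rep G w V W) g (x \<otimes> y) else 0)"
    if m: "g \<in> carrier G" "x \<in> carrier G" "g' \<in> carrier G" "y \<in> carrier G" for g x g' y
  proof -
    have t: "scal (\<gamma> x h k) * kr V W h x k x * (scal (\<gamma> y h' k') * kr V W h' y k' y) =
      (if (h', k') = (cj x h, cj x k) then scal (\<beta> g x y) * (scal (\<gamma> (x \<otimes> y) h k) * kr V W h (x \<otimes> y) k (x \<otimes> y)) else 0)"
      if hk: "(h, k) \<in> pairs g" and hk': "(h', k') \<in> pairs g'" for h k h' k'
    proof -
      have c: "h \<in> carrier G" "k \<in> carrier G" "h \<otimes> k = g" "h' \<in> carrier G" "k' \<in> carrier G" using pairs_D[OF hk] pairs_D[OF hk'] by auto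
      have "scal (\<gamma> x h k) * kr V W h x k x * (scal (\<gamma> y h' k') * kr V W h' y k' y) =
        scal (\<gamma> x h k * \<gamma> y h' k') * (kr V W h x k x * kr V W h' y k' y)"
        by (simp only: mult.assoc scal_triple)
      also have "\<dots> = (if (h', k') = (cj x h, cj x k) then
          scal (\<gamma> x h k * \<gamma> y (cj x h) (cj x k) * (\<beta> h x y * \<beta> k x y)) * kr V W h (x \<otimes> y) k (x \<otimes> y) else 0)"
        using kr_mult[OF V W c(1) m(2) c(2) m(2) c(4) m(4) c(5) m(4)] by (auto simp: scal_scal)
      also have "\<gamma> x h k * \<gamma> y (cj x h) (cj x k) * (\<beta> h x y * \<beta> k x y) = \<beta> g x y * \<gamma> (x \<otimes> y) h k"
        using gamma_beta[OF c(1,2) m(2,4)] c(3) by (simp add: mult_ac)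
      finally show ?thesis by (simp only: scal_scal)
    qed
    have "ac (tensor_rep G w V W) g x * ac (tensor_rep G w V W) g' y =
      (\<Sum>(h, k)\<in>pairs g. \<Sum>(h', k')\<in>pairs g'. if (h', k') = (cj x h, cj x k) then
         scal (\<beta> g x y) * (scal (\<gamma> (x \<otimes> y) h k) * kr V W h (x \<otimes> y) k (x \<otimes> y)) else 0)"
      unfolding ac_tensor[OF V W m(2)] ac_tensor[OF V W m(4)] sum_product
    proof (rule sum.cong[OF refl])
      fix p assume p: "p \<in> pairs g"
      obtain h k where hk: "p = (h, k)" by (cases p)
      show "(\<Sum>j\<in>pairs g'. (case p of (h, k) \<Rightarrow> scal (\<gamma> x h k) * kr V W h x k x) *
          (case j of (h, k) \<Rightarrow> scal (\<gamma> y h k) * kr V W h y k y)) =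
        (case p of (h, k) \<Rightarrow> \<Sum>(h', k')\<in>pairs g'. if (h', k') = (cj x h, cj x k) then
           scal (\<beta> g x y) * (scal (\<gamma> (x \<otimes> y) h k) * kr V W h (x \<otimes> y) k (x \<otimes> y)) else 0)"
        unfolding hk prod.case
      proof (rule sum.cong[OF refl])
        fix q assume q: "q \<in> pairs g'"
        obtain h' k' where hk': "q = (h', k')" by (cases q)
        show "scal (\<gamma> x h k) * kr V W h x k x * (case q of (h, k) \<Rightarrow> scal (\<gamma> y h k) * kr V W h y k y) =
          (case q of (h', k') \<Rightarrow> if (h', k') = (cj x h, cj x k) then
             scal (\<beta> g x y) * (scal (\<gamma> (x \<otimes> y) h k) * kr V W h (x \<otimes> y) k (x \<otimes> y)) else 0)"
          using t[of h k h' k'] p q unfolding hk hk' prod.case by blast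
      qed
    qed
    also have "\<dots> = (\<Sum>(h, k)\<in>pairs g. if cj x g = g' then
         scal (\<beta> g x y) * (scal (\<gamma> (x \<otimes> y) h k) * kr V W h (x \<otimes> y) k (x \<otimes> y)) else 0)"
    proof (intro sum.cong refl, clarify)
      fix h k assume "(h, k) \<in> pairs g"
      then have c: "h \<in> carrier G" "k \<in> carrier G" "h \<otimes> k = g" using pairs_D by auto
      have "(cj x h, cj x k) \<in> pairs g' \<longleftrightarrow> cj x g = g'"
        using c m cj_arg_mult[of x h k] by (auto simp: pairs_def)
      then show "(\<Sum>(h', k')\<in>pairs g'. if (h', k') = (cj x h, cj x k) then
         scal (\<beta> g x y) * (scal (\<gamma> (x \<otimes> y) h k) * kr V W h (x \<otimes> y) k (x \<otimes> y)) else 0) =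
         (if cj x g = g' then scal (\<beta> g x y) * (scal (\<gamma> (x \<otimes> y) h k) * kr V W h (x \<otimes> y) k (x \<otimes> y)) else 0)"
        unfolding sum_pair_delta[OF finite_pairs] by simp
    qed
    also have "\<dots> = (if cj x g = g' then scal (\<beta> g x y) * ac (tensor_rep G w V W) g (x \<otimes> y) else 0)"
      using m by (simp add: ac_tensor[OF V W] sum_distrib_left case_prod_unfold)
    finally show ?thesis .
  qed
  show "(\<Sum>g\<in>carrier G. ac (tensor_rep G w V W) g \<one>) = fm (1\<^sub>m (vdim (tensor_rep G w V W)))"
  proof -
    note cV = Rep_carrier[OF V _ one_closed] and cW = Rep_carrier[OF W _ one_closed]
    have "(\<Sum>g\<in>carrier G. ac (tensor_rep G w V W) g \<one>) =
      (\<Sum>g\<in>carrier G. \<Sum>p | p \<in> carrier G \<times> carrier G \<and> fst p \<otimes> snd p = g. kr V W (fst p) \<one> (snd p) \<one>)"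
    proof (rule sum.cong[OF refl])
      fix g assume g: "g \<in> carrier G"
      have "pairs g = {p. p \<in> carrier G \<times> carrier G \<and> fst p \<otimes> snd p = g}" by (auto simp: pairs_def)
      then show "ac (tensor_rep G w V W) g \<one> =
        (\<Sum>p | p \<in> carrier G \<times> carrier G \<and> fst p \<otimes> snd p = g. kr V W (fst p) \<one> (snd p) \<one>)"
        unfolding ac_tensor[OF V W one_closed] by (intro sum.cong) auto
    qed
    also have "\<dots> = (\<Sum>p\<in>carrier G \<times> carrier G. kr V W (fst p) \<one> (snd p) \<one>)"
      by (rule sum.group) (auto simp: finite_carrier)
    also have "\<dots> = fm (mat_sum (vdim V * vdim W) (vdim V * vdim W) (\<lambda>(h, k). kronecker (act V h \<one>) (act W k \<one>)) (carrier G \<times> carrier G))"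
      by (subst fm_mat_sum) (auto simp: kr_def case_prod_unfold intro!: kronecker_carrier cV cW)
    also have "\<dots> = fm (kronecker (mat_sum (vdim V) (vdim V) (\<lambda>g. act V g \<one>) (carrier G)) (mat_sum (vdim W) (vdim W) (\<lambda>g. act W g \<one>) (carrier G)))"
      using kronecker_mat_sum[of "carrier G" "\<lambda>g. act V g \<one>" "vdim V" "vdim V" "carrier G" "\<lambda>g. act W g \<one>" "vdim W" "vdim W"] cV cW by simp
    also have "\<dots> = fm (1\<^sub>m (vdim V * vdim W))"
      using V W by (simp add: Rep_double_def kronecker_one)
    finally show ?thesis by (simp add: vd)
  qed
qed

lemma ac_unit: "ac unit g x = (if g = \<one> then fm (1\<^sub>m 1) else 0)" if "unit = unit_rep G" for unit :: "('a, 'k) rep"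
  by (simp add: that ac_def unit_rep_def)

lemma unit_Rep: "unit_rep G \<in> Rep"
proof (rule RepI)
  show "act (unit_rep G) g x \<in> carrier_mat (vdim (unit_rep G)) (vdim (unit_rep G))" for g x
    by (simp add: unit_rep_def)
  have one: "fm (1\<^sub>m 1) * fm (1\<^sub>m 1) = (fm (1\<^sub>m 1) :: 'k lop)" by (rule fm_one_left[OF one_carrier_mat])
  show "ac (unit_rep G) g x * ac (unit_rep G) h y = (if cj x g = h then scal (\<beta> g x y) * ac (unit_rep G) g (x \<otimes> y) else 0)"
    if m: "g \<in> carrier G" "x \<in> carrier G" "h \<in> carrier G" "y \<in> carrier G" for g x h y
  proof (cases "g = \<one>")
    case True
    then show ?thesis using m one by (auto simp: ac_unit[OF refl])
  next
    case False
    then have "cj x g \<noteq> \<one>" using m cj_inject[of x g \<one>] by auto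
    then show ?thesis using m False by (auto simp: ac_unit[OF refl])
  qed
  have "(\<Sum>g\<in>carrier G. ac (unit_rep G) g \<one>) = (fm (1\<^sub>m 1) :: 'k lop)"
    using finite_carrier by (simp add: ac_unit[OF refl])
  then show "(\<Sum>g\<in>carrier G. ac (unit_rep G) g \<one>) = (fm (1\<^sub>m (vdim (unit_rep G :: ('a, 'k) rep))) :: 'k lop)"
    by (simp add: unit_rep_def)
qed

end

section \<open>Duals\<close>

context twisted_double
begin

text \<open>In the triangle identity for \<open>W\<close>, M moves from the right of 1 \<otimes>
  coev to the first factor of W \<otimes> V \<otimes> W, then past the associator, a combination of
  the e(g) that commutes with M, and finally reaches ev, where it gives 0. Relations on a dual can
  thus be tested against ev.\<close>

lemma dual_zero:
  fixes M :: "'k mat"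
  assumes V: "V \<in> Rep" and W: "W \<in> Rep"
    and ev: "ev \<in> carrier_mat 1 (vdim W * vdim V)" and coev: "coev \<in> carrier_mat (vdim V * vdim W) 1"
    and tri: "kronecker ev (1\<^sub>m (vdim W)) * assoc_inv_mat G w W V W * kronecker (1\<^sub>m (vdim W)) coev = 1\<^sub>m (vdim W)"
    and M: "M \<in> carrier_mat (vdim W) (vdim W)"
    and comm: "\<And>g. g \<in> carrier G \<Longrightarrow> fm M * ac W g \<one> = ac W g \<one> * fm M"
    and z: "fm ev * fm (kronecker M (1\<^sub>m (vdim V))) = 0"
  shows "M = 0\<^sub>m (vdim W) (vdim W)"
proof -
  define m n where "m = vdim W" and "n = vdim V"
  define A where "A = assoc_inv_mat G w W V W"
  have evc: "ev \<in> carrier_mat 1 (m * n)" and cc: "coev \<in> carrier_mat (n * m) 1" and Mc: "M \<in> carrier_mat m m"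
    using ev coev M by (auto simp: m_def n_def)
  have aW: "act W g \<one> \<in> carrier_mat m m" and aV: "act V g \<one> \<in> carrier_mat n n" if "g \<in> carrier G" for g
    using Rep_carrier[OF W that one_closed] Rep_carrier[OF V that one_closed] by (auto simp: m_def n_def)
  have Ac: "A \<in> carrier_mat (m * n * m) (m * n * m)" by (simp add: A_def assoc_inv_mat_def m_def n_def)
  define M3 where "M3 = kronecker (kronecker M (1\<^sub>m n)) (1\<^sub>m m)"
  have M2c: "kronecker M (1\<^sub>m n) \<in> carrier_mat (m * n) (m * n)" by (rule kronecker_carrier[OF Mc one_carrier_mat])
  have M3c: "M3 \<in> carrier_mat (m * n * m) (m * n * m)" unfolding M3_def by (rule kronecker_carrier[OF M2c one_carrier_mat])
  define e3 where "e3 = kronecker ev (1\<^sub>m m)"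
  define c3 where "c3 = kronecker (1\<^sub>m m) coev"
  have e3c: "e3 \<in> carrier_mat m (m * n * m)" unfolding e3_def using kronecker_carrier[OF evc one_carrier_mat, of m] by simp
  have c3c: "c3 \<in> carrier_mat (m * n * m) m" unfolding c3_def using kronecker_carrier[OF one_carrier_mat cc, of m] by (simp add: mult.assoc)
  have eM: "fm e3 * fm M3 = 0"
  proof -
    have "ev * kronecker M (1\<^sub>m n) = 0\<^sub>m 1 (m * n)"
    proof (rule fm_inject[OF mult_carrier_mat[OF evc M2c]])
      show "fm (ev * kronecker M (1\<^sub>m n)) = fm (0\<^sub>m 1 (m * n))"
        using z unfolding n_def[symmetric] fm_mult'[OF evc M2c] by (simp only: fm_zero)
    qed simp
    then have "e3 * M3 = kronecker (0\<^sub>m 1 (m * n)) (1\<^sub>m m)"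
      unfolding e3_def M3_def by (simp add: kronecker_mult[OF evc M2c one_carrier_mat one_carrier_mat])
    also have "\<dots> = 0\<^sub>m (1 * m) (m * n * m)" by (rule kronecker_zero(1)[OF one_carrier_mat])
    finally show ?thesis using fm_mult'[OF e3c M3c] by simp
  qed
  have cM: "fm c3 * fm M = fm M3 * fm c3"
  proof -
    have M1: "kronecker M (1\<^sub>m 1) = M" using Mc by (auto simp: kronecker_def intro!: eq_matI)
    have "c3 * M = kronecker (1\<^sub>m m) coev * kronecker M (1\<^sub>m 1)" by (simp only: c3_def M1)
    also have "\<dots> = kronecker M coev"
      using kronecker_mult[OF one_carrier_mat Mc cc one_carrier_mat] Mc cc by simp
    also have "\<dots> = kronecker M (1\<^sub>m (n * m)) * kronecker (1\<^sub>m m) coev"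
      using kronecker_mult[OF Mc one_carrier_mat one_carrier_mat cc] Mc cc by simp
    also have "kronecker M (1\<^sub>m (n * m)) = M3"
      unfolding M3_def by (simp add: kronecker_assoc kronecker_one)
    finally show ?thesis using fm_mult'[OF c3c Mc] fm_mult'[OF M3c c3c] by (simp add: c3_def)
  qed
  have AM: "fm A * fm M3 = fm M3 * fm A"
  proof -
    have Wc: "act W g \<one> * M = M * act W g \<one>" if "g \<in> carrier G" for g
      using comm[OF that] aW[OF that] Mc
      by (intro fm_inject[of _ m m]) (auto simp: fm_mult'[OF aW[OF that] Mc] fm_mult'[OF Mc aW[OF that]] ac_def)
    define t where "t = (\<lambda>(g, h, l). w g h l \<cdot>\<^sub>m kronecker (kronecker (act W g \<one>) (act V h \<one>)) (act W l \<one>))"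
    have tc: "t p \<in> carrier_mat (m * n * m) (m * n * m)" if "p \<in> carrier G \<times> carrier G \<times> carrier G" for p
      using that by (auto simp: t_def intro!: smult_carrier_mat kronecker_carrier aW aV)
    have fA: "fm A = (\<Sum>p\<in>carrier G \<times> carrier G \<times> carrier G. fm (t p))"
      unfolding A_def assoc_inv_mat_def m_def[symmetric] n_def[symmetric] t_def[symmetric]
      by (rule fm_mat_sum) (rule tc)
    have "fm (t p) * fm M3 = fm M3 * fm (t p)" if p: "p \<in> carrier G \<times> carrier G \<times> carrier G" for p
    proof -
      obtain g h l where ghl: "p = (g, h, l)" "g \<in> carrier G" "h \<in> carrier G" "l \<in> carrier G" using p by auto
      note c1 = kronecker_carrier[OF aW[OF ghl(2)] aV[OF ghl(3)]]
      note c2 = kronecker_carrier[OF c1 aW[OF ghl(4)]]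
      have 1: "kronecker (kronecker (act W g \<one>) (act V h \<one>)) (act W l \<one>) * M3 =
        kronecker (kronecker (act W g \<one> * M) (act V h \<one>)) (act W l \<one>)"
        unfolding M3_def kronecker_mult[OF c1 M2c aW[OF ghl(4)] one_carrier_mat]
          kronecker_mult[OF aW[OF ghl(2)] Mc aV[OF ghl(3)] one_carrier_mat]
        using aV[OF ghl(3)] aW[OF ghl(4)] by simp
      have 2: "M3 * kronecker (kronecker (act W g \<one>) (act V h \<one>)) (act W l \<one>) =
        kronecker (kronecker (M * act W g \<one>) (act V h \<one>)) (act W l \<one>)"
        unfolding M3_def kronecker_mult[OF M2c c1 one_carrier_mat aW[OF ghl(4)]]
          kronecker_mult[OF Mc aW[OF ghl(2)] one_carrier_mat aV[OF ghl(3)]]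
        using aV[OF ghl(3)] aW[OF ghl(4)] by simp
      have "fm (kronecker (kronecker (act W g \<one>) (act V h \<one>)) (act W l \<one>)) * fm M3 =
        fm M3 * fm (kronecker (kronecker (act W g \<one>) (act V h \<one>)) (act W l \<one>))"
        using fm_mult'[OF c2 M3c] fm_mult'[OF M3c c2] 1 2 Wc[OF ghl(2)] by simp
      then show ?thesis unfolding ghl t_def prod.case fm_smult
        by (simp add: mult.assoc scal_left_commute[of "fm M3"])
    qed
    then show ?thesis unfolding fA sum_distrib_left sum_distrib_right by (intro sum.cong refl)
  qed
  have "fm M = fm (1\<^sub>m m) * fm M" using fm_one_left[OF Mc] by simp
  also have "fm (1\<^sub>m m) = fm e3 * fm A * fm c3"
  proof -
    have "1\<^sub>m m = e3 * A * c3" using tri by (simp add: e3_def A_def c3_def m_def)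
    from arg_cong[OF this, of fm] show ?thesis
      by (simp only: fm_mult'[OF mult_carrier_mat[OF e3c Ac] c3c] fm_mult'[OF e3c Ac])
  qed
  also have "fm e3 * fm A * fm c3 * fm M = fm e3 * fm A * (fm c3 * fm M)" by (simp only: mult.assoc)
  also have "\<dots> = fm e3 * (fm A * fm M3) * fm c3" unfolding cM by (simp only: mult.assoc)
  also have "\<dots> = fm e3 * fm M3 * fm A * fm c3" unfolding AM by (simp only: mult.assoc)
  also have "\<dots> = 0" unfolding eM by simp
  finally show ?thesis using fm_zero_iff[OF Mc] by (simp add: m_def)
qed

text \<open>Equivariance of ev under e(k h)x, cut down to one component by an idempotent on the
  right. For x = \<one> it says that ev pairs the component of k only with that of k^-1.\<close>

lemma ev_kr:
  assumes V: "V \<in> Rep" and W: "W \<in> Rep" and ev: "ev \<in> hom_rep G (tensor_rep G w W V) (unit_rep G)"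
    and m: "k \<in> carrier G" "h \<in> carrier G" "x \<in> carrier G"
  shows "scal (\<gamma> x k h) * (fm ev * kr W V k x h x) =
    (if k \<otimes> h = \<one> then fm ev * kr W V (cj x k) \<one> (cj x h) \<one> else 0)"
proof -
  define g where "g = k \<otimes> h"
  have g: "g \<in> carrier G" using m by (simp add: g_def)
  note R = tensor_Rep[OF W V] unit_Rep
  have hom: "fm ev * ac (tensor_rep G w W V) g x = ac (unit_rep G) g x * fm ev"
    by (rule homD(2)[OF R ev g m(3)])
  have t: "scal (\<gamma> x k' h') * kr W V k' x h' x * kr W V (cj x k) \<one> (cj x h) \<one> =
     (if (k', h') = (k, h) then scal (\<gamma> x k h) * kr W V k x h x else 0)" if "(k', h') \<in> pairs g" for k' h'
  proof -
    have c: "k' \<in> carrier G" "h' \<in> carrier G" using pairs_D[OF that] by auto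
    show ?thesis
      using kr_mult[OF W V c(1) m(3) c(2) m(3) cj_closed[OF m(3,1)] one_closed cj_closed[OF m(3,2)] one_closed] m c
      by (auto simp: cj_inject mult.assoc)
  qed
  have "ac (tensor_rep G w W V) g x * kr W V (cj x k) \<one> (cj x h) \<one> =
    (\<Sum>(k', h')\<in>pairs g. if (k', h') = (k, h) then scal (\<gamma> x k h) * kr W V k x h x else 0)"
    unfolding ac_tensor[OF W V m(3)] sum_distrib_right by (rule sum.cong[OF refl]) (use t in \<open>auto split: prod.splits\<close>)
  also have "\<dots> = scal (\<gamma> x k h) * kr W V k x h x"
    unfolding sum_pair_delta[OF finite_pairs] using m by (simp add: pairs_def g_def)
  finally have e: "ac (tensor_rep G w W V) g x * kr W V (cj x k) \<one> (cj x h) \<one> = scal (\<gamma> x k h) * kr W V k x h x" .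
  have "scal (\<gamma> x k h) * (fm ev * kr W V k x h x) = fm ev * (scal (\<gamma> x k h) * kr W V k x h x)"
    by (simp only: scal_left_commute)
  also have "\<dots> = fm ev * ac (tensor_rep G w W V) g x * kr W V (cj x k) \<one> (cj x h) \<one>"
    unfolding e[symmetric] by (simp only: mult.assoc)
  also have "\<dots> = ac (unit_rep G) g x * fm ev * kr W V (cj x k) \<one> (cj x h) \<one>" unfolding hom ..
  also have "\<dots> = (if k \<otimes> h = \<one> then fm ev * kr W V (cj x k) \<one> (cj x h) \<one> else 0)"
  proof -
    have "ev \<in> carrier_mat 1 (vdim (tensor_rep G w W V))"
      using homD(1)[OF R ev] by (simp add: unit_rep_def)
    from fm_one_left[OF this] show ?thesis by (simp only: ac_unit[OF refl] g_def if_distrib split: if_split) simp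
  qed
  finally show ?thesis .
qed

lemma kr_one_sum:
  assumes V: "V \<in> Rep" and W: "W \<in> Rep" and m: "k \<in> carrier G" "x \<in> carrier G"
  shows "fm (kronecker (act W k x) (1\<^sub>m (vdim V))) = (\<Sum>h\<in>carrier G. kr W V k x h \<one>)"
proof -
  have "kronecker (mat_sum (vdim W) (vdim W) (\<lambda>_. act W k x) {()}) (mat_sum (vdim V) (vdim V) (\<lambda>h. act V h \<one>) (carrier G)) =
    mat_sum (vdim W * vdim V) (vdim W * vdim V) (\<lambda>(i, h). kronecker (act W k x) (act V h \<one>)) ({()} \<times> carrier G)"
    using kronecker_mat_sum[of "{()}" "\<lambda>_. act W k x" "vdim W" "vdim W" "carrier G" "\<lambda>h. act V h \<one>" "vdim V" "vdim V"]
      Rep_carrier[OF W m] Rep_carrier[OF V _ one_closed] by simp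
  moreover have "mat_sum (vdim W) (vdim W) (\<lambda>_. act W k x) {()} = act W k x"
    using Rep_carrier[OF W m] by (auto simp: mat_sum_def intro!: eq_matI)
  moreover have "mat_sum (vdim V) (vdim V) (\<lambda>h. act V h \<one>) (carrier G) = 1\<^sub>m (vdim V)"
    using V by (simp add: Rep_double_def)
  ultimately have "fm (kronecker (act W k x) (1\<^sub>m (vdim V))) =
     fm (mat_sum (vdim W * vdim V) (vdim W * vdim V) (\<lambda>(i, h). kronecker (act W k x) (act V h \<one>)) ({()} \<times> carrier G))"
    by simp
  also have "\<dots> = (\<Sum>p\<in>{()} \<times> carrier G. fm (case p of (i, h) \<Rightarrow> kronecker (act W k x) (act V h \<one>)))"
    by (rule fm_mat_sum) (use tensor_carrier[OF W V m _ one_closed] in auto)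
  also have "\<dots> = (\<Sum>h\<in>carrier G. kr W V k x h \<one>)"
    unfolding sum.cartesian_product' by (simp add: kr_def)
  finally show ?thesis .
qed

end

section \<open>Closure under tensor products and duals\<close>

context invariant_bicharacter
begin

lemma act_L_zero:
  assumes V: "V \<in> L" and g: "g \<in> carrier G" "g \<notin> H" and x: "x \<in> carrier G"
  shows "act V g x = 0\<^sub>m (vdim V) (vdim V)"
proof -
  note RV = L_D(1)[OF V]
  have "ac V g x = ac V g \<one> * ac V g x" using ac_mult[OF RV g(1) one_closed g(1) x] g x by simp
  then have "ac V g x = 0" using L_D(2)[OF V g] by simp
  then show ?thesis using fm_zero_iff[OF Rep_carrier[OF RV g(1) x]] by (simp add: ac_def)
qed

lemma act_L:
  assumes V: "V \<in> L" and ah: "a \<in> H" "h \<in> H"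
  shows "act V a h = B (a, h) \<cdot>\<^sub>m act V a \<one>"
proof -
  have c: "act V a x \<in> carrier_mat (vdim V) (vdim V)" if "x \<in> H" for x
    using Rep_carrier[OF L_D(1)[OF V], of a x] ah that by simp
  have "fm (act V a h) = fm (B (a, h) \<cdot>\<^sub>m act V a \<one>)" using L_D(3)[OF V ah] by (simp add: fm_smult ac_def)
  then show ?thesis using c[OF ah(2)] c[OF H.one_closed] by (intro fm_inject[of _ "vdim V" "vdim V"]) auto
qed

text \<open>On the commutative group \<open>H\<close> conjugation is trivial and
  \<open>\<gamma>\<close> becomes a value of \<open>\<beta>\<close>; the multiplicative law of
  \<open>B\<close> in its second argument is carried to the first by \<open>B_anti\<close>.\<close>

lemma gamma_B:
  assumes "h \<in> H" "k \<in> H" "x \<in> H"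
  shows "\<gamma> x h k * (B (h, x) * B (k, x)) = B (h \<otimes> k, x)"
proof -
  have "\<gamma> x h k = \<beta> x h k" using assms by (simp add: gamma_eq beta_eq field_simps)
  then have e: "B (x, h) * B (x, k) = \<gamma> x h k * B (x, h \<otimes> k)" using B_mult[of x h k] assms by simp
  show ?thesis
    by (rule eq_by_cancel[OF mult_eq[OF e[symmetric] mult_eq[OF B_anti[of h x] mult_eq[OF B_anti[of k x] B_anti[of "h \<otimes> k" x, symmetric]]]]])
      (use assms in \<open>simp_all add: mult_ac\<close>)
qed

lemma L_tensor:
  assumes V: "V \<in> L" and W: "W \<in> L"
  shows "tensor_rep G w V W \<in> L"
proof (rule L_I)
  note RV = L_D(1)[OF V] and RW = L_D(1)[OF W]
  show "tensor_rep G w V W \<in> Rep" by (rule tensor_Rep[OF RV RW])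
  have kr0: "kr V W h x k x = 0" if "h \<in> carrier G" "k \<in> carrier G" "x \<in> carrier G" "h \<notin> H \<or> k \<notin> H" for h k x
    using that act_L_zero[OF V] act_L_zero[OF W] Rep_carrier[OF RV] Rep_carrier[OF RW]
    by (auto simp: kr_def kronecker_zero[of _ "vdim V" "vdim V"] kronecker_zero[of _ "vdim W" "vdim W"])
  show "ac (tensor_rep G w V W) g \<one> = 0" if g: "g \<in> carrier G" "g \<notin> H" for g
    unfolding ac_tensor[OF RV RW one_closed]
  proof (intro sum.neutral ballI, clarify)
    fix h k assume "(h, k) \<in> pairs g"
    then have c: "h \<in> carrier G" "k \<in> carrier G" "h \<otimes> k = g" using pairs_D by auto
    then have "h \<notin> H \<or> k \<notin> H" using g H.m_closed by auto
    then show "scal (\<gamma> \<one> h k) * kr V W h \<one> k \<one> = 0" using kr0 c by simp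
  qed
  show "ac (tensor_rep G w V W) a x = scal (B (a, x)) * ac (tensor_rep G w V W) a \<one>" if ax: "a \<in> H" "x \<in> H" for a x
    unfolding ac_tensor[OF RV RW one_closed] ac_tensor[OF RV RW H.mem_carrier[OF ax(2)]] sum_distrib_left
  proof (intro sum.cong refl, clarify)
    fix h k assume "(h, k) \<in> pairs a"
    then have c: "h \<in> carrier G" "k \<in> carrier G" "h \<otimes> k = a" using pairs_D by auto
    have xG: "x \<in> carrier G" using ax by simp
    show "scal (\<gamma> x h k) * kr V W h x k x = scal (B (a, x)) * (scal (\<gamma> \<one> h k) * kr V W h \<one> k \<one>)"
    proof (cases "h \<in> H \<and> k \<in> H")
      case True
      have "kr V W h x k x = scal (B (h, x) * B (k, x)) * kr V W h \<one> k \<one>"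
        unfolding kr_def using act_L[OF V, of h x] act_L[OF W, of k x] True ax
        by (simp add: kronecker_smult fm_smult scal_scal mult.commute[of "B (k, x)"])
      then show ?thesis using gamma_B[of h k x] True ax c by (simp add: scal_scal)
    next
      case False
      then show ?thesis using kr0[OF c(1,2) xG] kr0[OF c(1,2) one_closed] by simp
    qed
  qed
qed

lemma unit_L: "unit_rep G \<in> L"
proof (rule L_I[OF unit_Rep])
  show "ac (unit_rep G) g \<one> = 0" if "g \<in> carrier G" "g \<notin> H" for g
    using that H.one_closed by (auto simp: ac_unit[OF refl])
  show "ac (unit_rep G) a h = scal (B (a, h)) * ac (unit_rep G) a \<one>" if "a \<in> H" "h \<in> H" for a h
    using that by (simp add: ac_unit[OF refl])
qed

text \<open>\<open>dual_zero\<close> is applied to e(k) for k outside \<open>H\<close> and to e(k)x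
  - B(k, x) e(k) for k in \<open>H\<close>. Through ev only the component of \<open>V\<close> at h =
  k^-1 contributes, and there \<open>gamma_B\<close> with B(\<one>, x) = 1 makes the scalar of x on
  \<open>W\<close> inverse, up to \<open>\<gamma>\<close>, to that on \<open>V\<close>.\<close>

lemma L_dual:
  assumes V: "V \<in> L" and W: "W \<in> Rep" and dual: "is_dual G w V W"
  shows "W \<in> L"
proof -
  note RV = L_D(1)[OF V]
  obtain ev coev where ev: "ev \<in> hom_rep G (tensor_rep G w W V) (unit_rep G)"
    and coev: "coev \<in> hom_rep G (unit_rep G) (tensor_rep G w V W)"
    and tri: "kronecker ev (1\<^sub>m (vdim W)) * assoc_inv_mat G w W V W * kronecker (1\<^sub>m (vdim W)) coev = 1\<^sub>m (vdim W)"
    using dual unfolding is_dual_def by blast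
  have evc: "ev \<in> carrier_mat 1 (vdim W * vdim V)" and coevc: "coev \<in> carrier_mat (vdim V * vdim W) 1"
    using homD(1)[OF tensor_Rep[OF W RV] unit_Rep ev] homD(1)[OF unit_Rep tensor_Rep[OF RV W] coev]
    by (simp_all add: tensor_rep_def unit_rep_def)
  note dz = dual_zero[OF RV W evc coevc tri]
  have e1: "fm ev * kr W V k \<one> h \<one> = 0" if "k \<in> carrier G" "h \<in> carrier G" "k \<otimes> h \<noteq> \<one>" for k h
    using ev_kr[OF RV W ev that(1,2) one_closed] that by simp
  have out: "k \<otimes> h = \<one> \<Longrightarrow> k \<in> H \<longleftrightarrow> h \<in> H" if "k \<in> carrier G" "h \<in> carrier G" for k h
    using that by (metis H.m_inv_closed inv_equality inv_inv)
  show ?thesis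
  proof (rule L_I[OF W])
    fix k assume k: "k \<in> carrier G" "k \<notin> H"
    have "act W k \<one> = 0\<^sub>m (vdim W) (vdim W)"
    proof (rule dz[OF Rep_carrier[OF W k(1) one_closed]])
      show "fm (act W k \<one>) * ac W g \<one> = ac W g \<one> * fm (act W k \<one>)" if "g \<in> carrier G" for g
        using ac_mult[OF W k(1) one_closed that one_closed] ac_mult[OF W that one_closed k(1) one_closed] k that
        by (auto simp: ac_def)
      have "fm ev * kr W V k \<one> h \<one> = 0" if h: "h \<in> carrier G" for h
      proof (cases "k \<otimes> h = \<one>")
        case True
        then have "h \<notin> H" using out[OF k(1) h] k by simp
        then show ?thesis using act_L_zero[OF V h _ one_closed] Rep_carrier[OF W k(1) one_closed]
          by (simp add: kr_def kronecker_zero)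
      qed (use e1[OF k(1) h] in simp)
      then show "fm ev * fm (kronecker (act W k \<one>) (1\<^sub>m (vdim V))) = 0"
        unfolding kr_one_sum[OF RV W k(1) one_closed] sum_distrib_left by (intro sum.neutral ballI)
    qed
    then show "ac W k \<one> = 0" by (simp add: ac_def)
  next
    fix k x assume kx: "k \<in> H" "x \<in> H"
    then have c: "k \<in> carrier G" "x \<in> carrier G" by auto
    define M where "M = act W k x - B (k, x) \<cdot>\<^sub>m act W k \<one>"
    note cx = Rep_carrier[OF W c] and c1 = Rep_carrier[OF W c(1) one_closed]
    have fM: "fm M = ac W k x - scal (B (k, x)) * ac W k \<one>"
      unfolding M_def using fm_minus[OF cx, of "B (k, x) \<cdot>\<^sub>m act W k \<one>"] c1 by (simp add: fm_smult ac_def)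
    have Mc: "M \<in> carrier_mat (vdim W) (vdim W)" unfolding M_def using c1 by (intro minus_carrier_mat) simp
    have "M = 0\<^sub>m (vdim W) (vdim W)"
    proof (rule dz[OF Mc])
      show "fm M * ac W g \<one> = ac W g \<one> * fm M" if g: "g \<in> carrier G" for g
        unfolding fM using ac_mult[OF W c g one_closed] ac_mult[OF W g one_closed c]
          ac_mult[OF W c(1) one_closed g one_closed] ac_mult[OF W g one_closed c(1) one_closed] c g kx
        by (auto simp: left_diff_distrib right_diff_distrib mult.assoc scal_left_commute[of "ac W g \<one>"])
      have "fm ev * kr W V k x h \<one> = scal (B (k, x)) * (fm ev * kr W V k \<one> h \<one>)" if h: "h \<in> carrier G" for h
      proof (cases "k \<otimes> h = \<one>")
        case True
        then have hH: "h \<in> H" using out[OF c(1) h] kx by simp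
        have "kr W V k x h x = scal (B (h, x)) * kr W V k x h \<one>"
          unfolding kr_def act_L[OF V hH kx(2)] by (simp add: kronecker_smult fm_smult)
        then have "scal (\<gamma> x k h * B (h, x)) * (fm ev * kr W V k x h \<one>) = fm ev * kr W V k \<one> h \<one>"
          using ev_kr[OF RV W ev c(1) h c(2)] True kx hH by (simp add: scal_left_commute[of "fm ev"] scal_scal)
        moreover have "\<gamma> x k h * B (h, x) * B (k, x) = 1"
          using gamma_B[OF kx(1) hH kx(2)] True kx by (simp add: mult_ac)
        ultimately have "scal (B (k, x)) * (fm ev * kr W V k \<one> h \<one>) = scal 1 * (fm ev * kr W V k x h \<one>)"
          by (metis mult.commute scal_scal)
        then show ?thesis by simp
      next
        case False
        have "kr W V k \<one> h \<one> * kr W V k x h \<one> = kr W V k x h \<one>"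
          using kr_mult[OF W RV c(1) one_closed h one_closed c h one_closed] c h by simp
        then have "fm ev * kr W V k x h \<one> = fm ev * kr W V k \<one> h \<one> * kr W V k x h \<one>" by (simp add: mult.assoc)
        then show ?thesis using e1[OF c(1) h False] by simp
      qed
      then have s: "fm ev * (\<Sum>h\<in>carrier G. kr W V k x h \<one>) = scal (B (k, x)) * (fm ev * (\<Sum>h\<in>carrier G. kr W V k \<one> h \<one>))"
        unfolding sum_distrib_left by (intro sum.cong refl)
      have "kronecker M (1\<^sub>m (vdim V)) = kronecker (act W k x) (1\<^sub>m (vdim V)) - B (k, x) \<cdot>\<^sub>m kronecker (act W k \<one>) (1\<^sub>m (vdim V))"
        using cx c1 div_mod_less
        by (intro eq_matI) (auto simp: kronecker_def M_def algebra_simps)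
      then have "fm (kronecker M (1\<^sub>m (vdim V))) = (\<Sum>h\<in>carrier G. kr W V k x h \<one>) - scal (B (k, x)) * (\<Sum>h\<in>carrier G. kr W V k \<one> h \<one>)"
        using fm_minus[OF kronecker_carrier[OF cx one_carrier_mat[of "vdim V"]], of "B (k, x) \<cdot>\<^sub>m kronecker (act W k \<one>) (1\<^sub>m (vdim V))"]
          kronecker_carrier[OF c1 one_carrier_mat[of "vdim V"]]
        by (simp add: fm_smult kr_one_sum[OF RV W c] kr_one_sum[OF RV W c(1) one_closed])
      then show "fm ev * fm (kronecker M (1\<^sub>m (vdim V))) = 0"
        using s by (simp add: right_diff_distrib scal_left_commute[of "fm ev"])
    qed
    then have "fm M = 0" by simp
    then show "ac W k x = scal (B (k, x)) * ac W k \<one>" using fM by simp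
  qed
qed

lemma L_fusion: "fusion_subcategory G w L"
  unfolding fusion_subcategory_def
proof (intro conjI ballI allI impI)
  show "L \<subseteq> Rep" using L_D(1) by (rule subsetI)
  show "W \<in> L" if "V \<in> L" "W \<in> Rep" "iso_rep G V W" for V W using L_iso that by blast
  show "direct_sum Vs \<in> L" if Vs: "set Vs \<subseteq> L" for Vs
  proof -
    have R: "set Vs \<subseteq> Rep" using Vs L_D(1) by (meson subset_iff)
    show ?thesis using direct_sum_decomp[OF R] L_decomp[OF _ R] Vs by blast
  qed
  show "V \<in> L" "W \<in> L" if VW: "V \<in> Rep" "W \<in> Rep" and s: "direct_sum [V, W] \<in> L" for V W
  proof -
    have R: "set [V, W] \<subseteq> Rep" using VW by simp
    have "set [V, W] \<subseteq> L" using direct_sum_decomp[OF R] L_decomp[OF _ R] s by blast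
    then show "V \<in> L" "W \<in> L" by auto
  qed
  show "tensor_rep G w V W \<in> L" if "V \<in> L" "W \<in> L" for V W using L_tensor that by blast
  show "W \<in> L" if "V \<in> L" "W \<in> Rep" "is_dual G w V W" for V W using L_dual that by blast
  show "unit_rep G \<in> L" by (rule unit_L)
qed

lemma L_twist:
  assumes V: "V \<in> L"
  shows "twist G V = 1\<^sub>m (vdim V)"
proof (rule fm_inject[of _ "vdim V" "vdim V"])
  note RV = L_D(1)[OF V]
  have "fm (twist G V) = (\<Sum>g\<in>carrier G. ac V g g)"
    unfolding twist_def by (subst fm_mat_sum) (use Rep_carrier[OF RV] in \<open>auto simp: ac_def\<close>)
  also have "\<dots> = (\<Sum>g\<in>carrier G. ac V g \<one>)"
  proof (rule sum.cong[OF refl])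
    fix g assume g: "g \<in> carrier G"
    show "ac V g g = ac V g \<one>"
    proof (cases "g \<in> H")
      case True
      then show ?thesis using L_D(3)[OF V True True] B_self by simp
    next
      case False
      then show ?thesis using act_L_zero[OF V g False] g by (simp add: ac_def)
    qed
  qed
  finally show "fm (twist G V) = fm (1\<^sub>m (vdim V))" using ac_sum[OF RV] by simp
qed (auto simp: twist_def)

lemma L_lagrangian: "lagrangian G w L"
  unfolding lagrangian_def isotropic_def cat_dim_L cat_dim_Rep
  using L_fusion L_twist by blast

end

section \<open>The bicharacter of a Lagrangian subcategory\<close>

text \<open>Comparison at a fixed nonzero entry of one factor exhibits the other factors as
  proportional. That the two scalars are inverse to each other becomes the antisymmetry of the
  bicharacter.\<close>

lemma kronecker_proportional:
  fixes X Y U Z :: "'k::field mat"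
  assumes c: "X \<in> carrier_mat n n" "U \<in> carrier_mat n n" "Y \<in> carrier_mat m m" "Z \<in> carrier_mat m m"
    and eq: "kronecker X Y = kronecker U Z" and nz: "U \<noteq> 0\<^sub>m n n" "Z \<noteq> 0\<^sub>m m m"
  shows "\<exists>c. c \<noteq> 0 \<and> X = c \<cdot>\<^sub>m U \<and> Y = inverse c \<cdot>\<^sub>m Z"
proof -
  have e: "X $$ (i, j) * Y $$ (p, q) = U $$ (i, j) * Z $$ (p, q)"
    if "i < n" "j < n" "p < m" "q < m" for i j p q
  proof -
    have l: "a * m + b < n * m" if "a < n" "b < m" for a b
    proof -
      have "a * m + b < Suc a * m" using that by simp
      also have "\<dots> \<le> n * m" using that by (intro mult_le_mono1) simp
      finally show ?thesis .
    qed
    have "kronecker X Y $$ (i * m + p, j * m + q) = kronecker U Z $$ (i * m + p, j * m + q)" using eq by simp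
    then show ?thesis
      using kronecker_index[OF c(1,3) l[OF that(1,3)] l[OF that(2,4)]]
        kronecker_index[OF c(2,4) l[OF that(1,3)] l[OF that(2,4)]] that by simp
  qed
  obtain i j where ij: "i < n" "j < n" "U $$ (i, j) \<noteq> 0"
    using nz(1) c(2) by (metis carrier_matD eq_matI index_zero_mat)
  obtain p q where pq: "p < m" "q < m" "Z $$ (p, q) \<noteq> 0"
    using nz(2) c(4) by (metis carrier_matD eq_matI index_zero_mat)
  have ne: "X $$ (i, j) \<noteq> 0" "Y $$ (p, q) \<noteq> 0" using e[OF ij(1,2) pq(1,2)] ij pq by auto
  define r where "r = Z $$ (p, q) / Y $$ (p, q)"
  have X: "X = r \<cdot>\<^sub>m U"
  proof (rule eq_matI)
    fix a b assume "a < dim_row (r \<cdot>\<^sub>m U)" "b < dim_col (r \<cdot>\<^sub>m U)"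
    then have "a < n" "b < n" using c by auto
    then show "X $$ (a, b) = (r \<cdot>\<^sub>m U) $$ (a, b)" using e[of a b p q] pq ne c by (simp add: r_def field_simps)
  qed (use c in auto)
  have "Y = inverse r \<cdot>\<^sub>m Z"
  proof (rule eq_matI)
    fix a b assume "a < dim_row (inverse r \<cdot>\<^sub>m Z)" "b < dim_col (inverse r \<cdot>\<^sub>m Z)"
    then have ab: "a < m" "b < m" using c by auto
    have "X $$ (i, j) = r * U $$ (i, j)" using X ij c by simp
    then have "r * Y $$ (a, b) = Z $$ (a, b)" using e[OF ij(1,2) ab] ij by simp
    then show "Y $$ (a, b) = (inverse r \<cdot>\<^sub>m Z) $$ (a, b)"
      using ab c pq ne by (simp add: r_def field_simps)
  qed (use c in auto)
  moreover have "r \<noteq> 0" using pq ne by (simp add: r_def)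
  ultimately show ?thesis using X by blast
qed

lemma kronecker_nonzero:
  fixes U Z :: "'k::field mat"
  assumes "U \<in> carrier_mat n n" "Z \<in> carrier_mat m m" "U \<noteq> 0\<^sub>m n n" "Z \<noteq> 0\<^sub>m m m"
  shows "kronecker U Z \<noteq> 0\<^sub>m (n * m) (n * m)"
proof
  assume "kronecker U Z = 0\<^sub>m (n * m) (n * m)"
  then have "kronecker (0\<^sub>m n n) Z = kronecker U Z" using kronecker_zero(1)[OF assms(2), of n n] by simp
  from kronecker_proportional[OF _ assms(1,2,2) this assms(3,4)]
  obtain c where "c \<noteq> 0" "0\<^sub>m n n = c \<cdot>\<^sub>m U" by auto
  then have "U = 0\<^sub>m n n" using assms(1)
    by (intro eq_matI) (auto dest: arg_cong[of _ _ "\<lambda>M. M $$ _"] simp: mat_eq_iff)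
  then show False using assms(3) by simp
qed

context twisted_double
begin

lemma ac_nz_iff: "V \<in> Rep \<Longrightarrow> g \<in> carrier G \<Longrightarrow> x \<in> carrier G \<Longrightarrow> ac V g x \<noteq> 0 \<longleftrightarrow> act V g x \<noteq> 0\<^sub>m (vdim V) (vdim V)"
  using fm_zero_iff[OF Rep_carrier] by (simp add: ac_def)

lemma scal_ac_cancel:
  assumes V: "V \<in> Rep" and m: "g \<in> carrier G" "x \<in> carrier G" and nz: "ac V g x \<noteq> 0"
    and e: "scal c * ac V g x = scal d * ac V g x"
  shows "c = d"
proof (rule ccontr)
  assume "c \<noteq> d"
  then have "ac V g x = scal (inverse (c - d)) * (scal (c - d) * ac V g x)" by (simp add: scal_scal)
  also have "scal (c - d) * ac V g x = 0"
  proof -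
    have "scal (c - d) * ac V g x + scal d * ac V g x = scal c * ac V g x"
      by (simp add: distrib_right[symmetric] scal_add[symmetric])
    then show ?thesis using e by simp
  qed
  finally show False using nz by simp
qed

text \<open>Multiplying the twist by e(h) on the left isolates its component on e(h)V.\<close>

lemma twist_ac:
  assumes V: "V \<in> Rep" and tw: "twist G V = 1\<^sub>m (vdim V)" and h: "h \<in> carrier G"
  shows "ac V h h = ac V h \<one>"
proof -
  have "fm (twist G V) = (\<Sum>g\<in>carrier G. ac V g g)"
    unfolding twist_def by (subst fm_mat_sum) (use Rep_carrier[OF V] in \<open>auto simp: ac_def\<close>)
  then have s: "(\<Sum>g\<in>carrier G. ac V g g) = fm (1\<^sub>m (vdim V))" using tw by simp
  have "ac V h \<one> = ac V h \<one> * (\<Sum>g\<in>carrier G. ac V g g)" using V h by (simp add: s)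
  also have "\<dots> = (\<Sum>g\<in>carrier G. if g = h then ac V h h else 0)"
    unfolding sum_distrib_left using ac_mult[OF V h one_closed] h by (intro sum.cong refl) auto
  also have "\<dots> = ac V h h" using h finite_carrier by simp
  finally show ?thesis by simp
qed

text \<open>This compares the twist of a tensor product with the twists of its factors; for
  commuting h and k it is the pentagon at h, k, h, k.\<close>

lemma beta_twist:
  assumes m: "h \<in> carrier G" "k \<in> carrier G" and hk: "h \<otimes> k = k \<otimes> h"
  shows "\<gamma> (h \<otimes> k) h k = \<beta> h h k * \<beta> k k h"
proof -
  have c: "cj (h \<otimes> k) h = h" "cj (h \<otimes> k) k = k" "cj (k \<otimes> h) k = k" "cj k h = h" "cj h k = k"
    using m hk by (auto intro!: cj_unique simp: m_assoc) (simp add: m_assoc[symmetric])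
  have "\<gamma> (h \<otimes> k) h k = w h k (h \<otimes> k) * w (h \<otimes> k) h k / w h (h \<otimes> k) k" by (simp add: gamma_eq c)
  moreover have "\<beta> h h k = w h k h" using m by (simp add: beta_eq c)
  moreover have "\<beta> k k h = w k h k" using m by (simp add: beta_eq c)
  moreover have "w k h k * w h (h \<otimes> k) k * w h k h = w (h \<otimes> k) h k * w h k (h \<otimes> k)"
    using pentagon[of h k h k] m hk by simp
  ultimately have "\<gamma> (h \<otimes> k) h k = \<beta> k k h * w h (h \<otimes> k) k * \<beta> h h k / w h (h \<otimes> k) k"
    by (simp add: mult.commute)
  then show ?thesis using m by simp
qed

text \<open>Triviality of the twist on \<open>V \<otimes> W\<close> says that the double braiding of \<open>V\<close> and \<open>W\<close> is trivial.\<close>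

lemma isotropic_pair:
  assumes V: "V \<in> Rep" and W: "W \<in> Rep" and tw: "twist G V = 1\<^sub>m (vdim V)" "twist G W = 1\<^sub>m (vdim W)"
      "twist G (tensor_rep G w V W) = 1\<^sub>m (vdim (tensor_rep G w V W))"
    and m: "h \<in> carrier G" "k \<in> carrier G" and nz: "ac V h \<one> \<noteq> 0" "ac W k \<one> \<noteq> 0"
  shows "h \<otimes> k = k \<otimes> h"
    "\<exists>c. c \<noteq> 0 \<and> ac V h k = scal c * ac V h \<one> \<and> ac W k h = scal (inverse c) * ac W k \<one>"
proof -
  define g where "g = h \<otimes> k"
  have g: "g \<in> carrier G" using m by (simp add: g_def)
  note RT = tensor_Rep[OF V W]
  \<comment> \<open>The idempotent e(h) \<otimes> e(k) cuts the term of h and k out of the coproduct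
    of e(g)x.\<close>
  have red: "kr V W h \<one> k \<one> * ac (tensor_rep G w V W) g x = scal (\<gamma> x h k) * kr V W h x k x" if x: "x \<in> carrier G" for x
  proof -
    have t: "kr V W h \<one> k \<one> * (scal (\<gamma> x h' k') * kr V W h' x k' x) =
       (if (h', k') = (h, k) then scal (\<gamma> x h k) * kr V W h x k x else 0)" if "(h', k') \<in> pairs g" for h' k'
      using kr_mult[OF V W m(1) one_closed m(2) one_closed _ x _ x, of h' k'] pairs_D[OF that] m x
      by (auto simp: scal_left_commute[of "kr V W h \<one> k \<one>"])
    have "kr V W h \<one> k \<one> * ac (tensor_rep G w V W) g x =
      (\<Sum>(h', k')\<in>pairs g. if (h', k') = (h, k) then scal (\<gamma> x h k) * kr V W h x k x else 0)"
      unfolding ac_tensor[OF V W x] sum_distrib_left by (rule sum.cong[OF refl]) (use t in \<open>auto split: prod.splits\<close>)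
    also have "\<dots> = scal (\<gamma> x h k) * kr V W h x k x"
      unfolding sum_pair_delta[OF finite_pairs] using m by (simp add: pairs_def g_def)
    finally show ?thesis .
  qed
  have A: "scal (\<gamma> g h k) * kr V W h g k g = kr V W h \<one> k \<one>"
    using red[OF g] red[OF one_closed] twist_ac[OF RT tw(3) g] m by simp
  note c1 = Rep_carrier[OF V m(1) one_closed] Rep_carrier[OF W m(2) one_closed]
  have knz: "kr V W h \<one> k \<one> \<noteq> 0"
    using kronecker_nonzero[OF c1] fm_zero_iff[OF kronecker_carrier[OF c1]] nz
    by (simp add: kr_def ac_nz_iff[OF V m(1) one_closed] ac_nz_iff[OF W m(2) one_closed])
  have "kr V W h \<one> k \<one> * kr V W h \<one> k \<one> = kr V W h \<one> k \<one>"
    using kr_mult[OF V W m(1) one_closed m(2) one_closed m(1) one_closed m(2) one_closed] m by simp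
  \<comment> \<open>Multiplying \<open>A\<close> by e(h) \<otimes> e(k) on the right leaves a
    nonzero operator, whereas the product would vanish unless g = h k centralises h and k.\<close>
  then have "scal (\<gamma> g h k) * (kr V W h g k g * kr V W h \<one> k \<one>) \<noteq> 0"
    using knz unfolding A[symmetric] mult.assoc[symmetric] by (simp add: A)
  then have "cj g h = h"
    using kr_mult[OF V W m(1) g m(2) g m(1) one_closed m(2) one_closed] by (auto split: if_splits)
  then have "cj k h = h" using m by (simp add: g_def cj_mult)
  then show hk: "h \<otimes> k = k \<otimes> h" using mult_cj[of k h] m by simp
  \<comment> \<open>Since e(a)a = e(a), the factor a can be removed from e(a)ab up to
    \<open>\<beta>\<close>. Applied to both factors, this turns the twist of V \<otimes> W into
    e(h)k \<otimes> e(k)h, the double braiding.\<close>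
  have act_g: "act U a (a \<otimes> b) = inverse (\<beta> a a b) \<cdot>\<^sub>m act U a b"
    if U: "U \<in> Rep" "twist G U = 1\<^sub>m (vdim U)" and ab: "a \<in> carrier G" "b \<in> carrier G" for U a b
  proof (rule fm_inject[of _ "vdim U" "vdim U"])
    have "scal (\<beta> a a b) * ac U a (a \<otimes> b) = ac U a a * ac U a b" using ac_mult[OF U(1) ab(1) ab(1) ab] ab by simp
    also have "\<dots> = ac U a b" using twist_ac[OF U ab(1)] ac_mult[OF U(1) ab(1) one_closed ab] ab by simp
    finally have "ac U a b = scal (\<beta> a a b) * ac U a (a \<otimes> b)" ..
    then have "scal (inverse (\<beta> a a b)) * ac U a b = ac U a (a \<otimes> b)" using ab by (simp add: scal_scal)
    then show "fm (act U a (a \<otimes> b)) = fm (inverse (\<beta> a a b) \<cdot>\<^sub>m act U a b)" by (simp add: fm_smult ac_def)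
  qed (use Rep_carrier[OF U(1) ab(1)] ab in auto)
  have "kr V W h g k g = scal (inverse (\<beta> h h k) * inverse (\<beta> k k h)) * kr V W h k k h"
    unfolding kr_def using act_g[OF V tw(1) m] act_g[OF W tw(2) m(2,1)] hk
    by (simp add: g_def kronecker_smult fm_smult scal_scal mult.commute)
  then have "scal (\<beta> h h k * \<beta> k k h * (inverse (\<beta> h h k) * inverse (\<beta> k k h))) * kr V W h k k h = kr V W h \<one> k \<one>"
    using A by (simp only: g_def beta_twist[OF m hk] scal_scal)
  moreover have "\<beta> h h k * \<beta> k k h * (inverse (\<beta> h h k) * inverse (\<beta> k k h)) = 1"
    using m by (simp add: field_simps)
  ultimately have "kr V W h k k h = kr V W h \<one> k \<one>" by simp
  moreover have cc: "act V h k \<in> carrier_mat (vdim V) (vdim V)" "act W k h \<in> carrier_mat (vdim W) (vdim W)"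
    using Rep_carrier[OF V m] Rep_carrier[OF W m(2,1)] by auto
  ultimately have "kronecker (act V h k) (act W k h) = kronecker (act V h \<one>) (act W k \<one>)"
    using fm_inject[OF kronecker_carrier[OF cc] kronecker_carrier[OF c1]] by (simp add: kr_def)
  from kronecker_proportional[OF cc(1) c1(1) cc(2) c1(2) this]
  obtain c where "c \<noteq> 0" "act V h k = c \<cdot>\<^sub>m act V h \<one>" "act W k h = inverse c \<cdot>\<^sub>m act W k \<one>"
    using nz ac_nz_iff[OF V m(1) one_closed] ac_nz_iff[OF W m(2) one_closed] by blast
  then show "\<exists>c. c \<noteq> 0 \<and> ac V h k = scal c * ac V h \<one> \<and> ac W k h = scal (inverse c) * ac W k \<one>"
    by (auto simp: ac_def fm_smult)
qed

text \<open>\<open>H\<close> is the common support of the objects of \<open>D\<close>. The scalar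
  b(a, h) is read off a chosen object f a with e(a) nonzero; that it serves all objects follows by
  pairing each of them with f h, because trivial double braiding yields inverse scalars.\<close>

lemma lagrangian_ex_bicharacter:
  assumes D: "lagrangian G w D" and R: "class_representatives G R"
  shows "\<exists>H B. normal_abelian_subgroup G H \<and> cohomologically_trivial_on G H w \<and>
     alternating_bicharacter G w H B \<and> G_invariant G w R H B \<and>
     (\<forall>V\<in>D. (\<forall>g\<in>carrier G - H. ac V g \<one> = 0) \<and> (\<forall>a\<in>H. \<forall>h\<in>H. ac V a h = scal (B (a, h)) * ac V a \<one>))"
proof -
  have fus: "fusion_subcategory G w D" and tw: "\<And>V. V \<in> D \<Longrightarrow> twist G V = 1\<^sub>m (vdim V)"
    using D by (auto simp: lagrangian_def isotropic_def)
  have DR: "\<And>V. V \<in> D \<Longrightarrow> V \<in> Rep" and DT: "\<And>V W. V \<in> D \<Longrightarrow> W \<in> D \<Longrightarrow> tensor_rep G w V W \<in> D" and DU: "unit_rep G \<in> D"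
    using fus unfolding fusion_subcategory_def by blast+
  define H where "H = {a \<in> carrier G. \<exists>V\<in>D. ac V a \<one> \<noteq> 0}"
  have HG: "a \<in> carrier G" if "a \<in> H" for a using that by (simp add: H_def)
  have pair: "h \<otimes> k = k \<otimes> h" "\<exists>c. c \<noteq> 0 \<and> ac V h k = scal c * ac V h \<one> \<and> ac W k h = scal (inverse c) * ac W k \<one>"
    if "V \<in> D" "W \<in> D" "h \<in> carrier G" "k \<in> carrier G" "ac V h \<one> \<noteq> 0" "ac W k \<one> \<noteq> 0" for V W h k
    using isotropic_pair[OF DR DR tw tw tw[OF DT]] that by blast+
  have comm: "h \<otimes> k = k \<otimes> h" if "h \<in> H" "k \<in> H" for h k
    using that pair(1) unfolding H_def by blast
  have cjH: "cj h a = a" if "h \<in> H" "a \<in> H" for h a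
    using comm[OF that] HG that by (intro cj_unique) auto
  have H_mult: "h \<otimes> k \<in> H" if hk: "h \<in> H" "k \<in> H" for h k
  proof -
    obtain V W where VW: "V \<in> D" "W \<in> D" "ac V h \<one> \<noteq> 0" "ac W k \<one> \<noteq> 0" using hk unfolding H_def by blast
    note RV = DR[OF VW(1)] and RW = DR[OF VW(2)]
    note m = HG[OF hk(1)] HG[OF hk(2)]
    note c1 = Rep_carrier[OF RV m(1) one_closed] Rep_carrier[OF RW m(2) one_closed]
    have "kr V W h \<one> k \<one> \<noteq> 0"
      using kronecker_nonzero[OF c1] fm_zero_iff[OF kronecker_carrier[OF c1]] VW
      by (simp add: kr_def ac_nz_iff[OF RV m(1) one_closed] ac_nz_iff[OF RW m(2) one_closed])
    \<comment> \<open>e(h) \<otimes> e(k) is a summand of the action of e(h k) on the tensor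
      product, so h k lies in the support of the latter.\<close>
    moreover have "kr V W h \<one> k \<one> * ac (tensor_rep G w V W) (h \<otimes> k) \<one> = kr V W h \<one> k \<one>"
    proof -
      have t: "kr V W h \<one> k \<one> * (scal (\<gamma> \<one> h' k') * kr V W h' \<one> k' \<one>) =
         (if (h', k') = (h, k) then kr V W h \<one> k \<one> else 0)" if "(h', k') \<in> pairs (h \<otimes> k)" for h' k'
        using kr_mult[OF RV RW m(1) one_closed m(2) one_closed _ one_closed _ one_closed, of h' k'] pairs_D[OF that] m
        by (auto simp: scal_left_commute[of "kr V W h \<one> k \<one>"])
      have "kr V W h \<one> k \<one> * ac (tensor_rep G w V W) (h \<otimes> k) \<one> =
        (\<Sum>(h', k')\<in>pairs (h \<otimes> k). if (h', k') = (h, k) then kr V W h \<one> k \<one> else 0)"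
        unfolding ac_tensor[OF RV RW one_closed] sum_distrib_left by (rule sum.cong[OF refl]) (use t in \<open>auto split: prod.splits\<close>)
      then show ?thesis unfolding sum_pair_delta[OF finite_pairs] using m by (simp add: pairs_def)
    qed
    ultimately have "ac (tensor_rep G w V W) (h \<otimes> k) \<one> \<noteq> 0" by auto
    then show ?thesis using DT[OF VW(1,2)] m unfolding H_def by blast
  qed
  have one_nz: "fm (1\<^sub>m 1) \<noteq> (0 :: 'k lop)"
  proof
    assume "fm (1\<^sub>m 1) = (0 :: 'k lop)"
    then have "1\<^sub>m 1 = (0\<^sub>m 1 1 :: 'k mat)" using fm_zero_iff[OF one_carrier_mat] by blast
    then have "(1\<^sub>m 1 :: 'k mat) $$ (0, 0) = 0\<^sub>m 1 1 $$ (0, 0)" by simp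
    then show False by simp
  qed
  have oneH: "\<one> \<in> H"
  proof -
    have "ac (unit_rep G) \<one> \<one> \<noteq> 0" unfolding ac_unit[OF refl] using one_nz by simp
    then show ?thesis using DU unfolding H_def by blast
  qed
  have sub: "subgroup H G"
    by (rule finite_subgroupI[OF finite_carrier]) (use HG oneH H_mult in auto)
  interpret H: subgroup H G by (rule sub)
  have H_cj: "cj y a \<in> H" if a: "a \<in> H" and y: "y \<in> carrier G" for a y
  proof -
    obtain V where V: "V \<in> D" "ac V a \<one> \<noteq> 0" using a unfolding H_def by blast
    have "ac V (cj y a) \<one> \<noteq> 0"
      using ac_conj_zero[OF DR[OF V(1)] cj_closed[OF y HG[OF a]] inv_closed[OF y]] V(2) cj_inv(1)[OF y HG[OF a]]
      by metis
    then show ?thesis using V(1) cj_closed[OF y HG[OF a]] unfolding H_def by blast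
  qed
  have "H \<lhd> G"
    unfolding normal_inv_iff
  proof (intro conjI ballI)
    fix x h assume "x \<in> carrier G" "h \<in> H"
    then show "x \<otimes> h \<otimes> inv x \<in> H" using H_cj[of h "inv x"] by (simp add: cj_def)
  qed (rule sub)
  then have nas: "normal_abelian_subgroup G H" using comm by (auto simp: normal_abelian_subgroup_def)
  have "\<forall>a\<in>H. \<exists>V. V \<in> D \<and> ac V a \<one> \<noteq> 0" unfolding H_def by blast
  then obtain f where "\<forall>a\<in>H. f a \<in> D \<and> ac (f a) a \<one> \<noteq> 0" by (rule bchoice[THEN exE])
  then have f: "\<And>a. a \<in> H \<Longrightarrow> f a \<in> D" "\<And>a. a \<in> H \<Longrightarrow> ac (f a) a \<one> \<noteq> 0" by blast+
  define b where "b a h = (SOME c. ac (f a) a h = scal c * ac (f a) a \<one>)" for a h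
  have b: "ac (f a) a h = scal (b a h) * ac (f a) a \<one>" if ah: "a \<in> H" "h \<in> H" for a h
    unfolding b_def by (rule someI_ex) (use pair(2)[OF f(1)[OF ah(1)] f(1)[OF ah(2)] HG[OF ah(1)] HG[OF ah(2)] f(2)[OF ah(1)] f(2)[OF ah(2)]] in blast)
  have key: "ac V a h = scal (b a h) * ac V a \<one>" "b a h * b h a = 1"
    if V: "V \<in> D" and ah: "a \<in> H" "h \<in> H" for V a h
  proof -
    note m = HG[OF ah(1)] HG[OF ah(2)]
    have inv_c: "b h a = inverse c \<and> b a h = c"
      if "c \<noteq> 0" "ac (f a) a h = scal c * ac (f a) a \<one>" "ac (f h) h a = scal (inverse c) * ac (f h) h \<one>" for c
      using scal_ac_cancel[OF DR[OF f(1)[OF ah(1)]] m(1) one_closed f(2)[OF ah(1)], of "b a h" c] b[OF ah] that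
        scal_ac_cancel[OF DR[OF f(1)[OF ah(2)]] m(2) one_closed f(2)[OF ah(2)], of "b h a" "inverse c"] b[OF ah(2,1)] by metis
    obtain c where c: "c \<noteq> 0" "ac (f a) a h = scal c * ac (f a) a \<one>" "ac (f h) h a = scal (inverse c) * ac (f h) h \<one>"
      using pair(2)[OF f(1)[OF ah(1)] f(1)[OF ah(2)] m f(2)[OF ah(1)] f(2)[OF ah(2)]] by blast
    show bb: "b a h * b h a = 1" using inv_c[OF c] c(1) by simp
    show "ac V a h = scal (b a h) * ac V a \<one>"
    proof (cases "ac V a \<one> = 0")
      case True
      then show ?thesis using ac_mult[OF DR[OF V] m(1) one_closed m(1) m(2)] m by simp
    next
      case False
      \<comment> \<open>Pairing \<open>V\<close> with f h gives a scalar d on \<open>V\<close> and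
        its inverse on f h; the latter is b(h, a), so d is b(a, h).\<close>
      obtain d where d: "d \<noteq> 0" "ac V a h = scal d * ac V a \<one>" "ac (f h) h a = scal (inverse d) * ac (f h) h \<one>"
        using pair(2)[OF V f(1)[OF ah(2)] m False f(2)[OF ah(2)]] by blast
      have "b h a = inverse d"
        using scal_ac_cancel[OF DR[OF f(1)[OF ah(2)]] m(2) one_closed f(2)[OF ah(2)], of "b h a" "inverse d"] b[OF ah(2,1)] d by metis
      then have "b a h = d" using bb d(1) by (simp add: nonzero_divide_eq_eq flip: divide_inverse)
      then show ?thesis using d by simp
    qed
  qed
  have b_nz: "b a h \<noteq> 0" if "a \<in> H" "h \<in> H" for a h using key(2)[OF DU that] by auto
  have b_self: "b a a = 1" if a: "a \<in> H" for a
    using scal_ac_cancel[OF DR[OF f(1)[OF a]] HG[OF a] one_closed f(2)[OF a], of "b a a" 1] b[OF a a]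
      twist_ac[OF DR[OF f(1)[OF a]] tw[OF f(1)[OF a]] HG[OF a]] by simp
  have b_mult: "b a h * b a k = \<beta> a h k * b a (h \<otimes> k)" if m: "a \<in> H" "h \<in> H" "k \<in> H" for a h k
  proof -
    note V = DR[OF f(1)[OF m(1)]]
    note c = HG[OF m(1)] HG[OF m(2)] HG[OF m(3)]
    have "ac (f a) a h * ac (f a) a k = scal (\<beta> a h k) * ac (f a) a (h \<otimes> k)"
      using ac_mult[OF V c(1,2,1,3)] cjH[OF m(2,1)] by simp
    then have "scal (b a h) * ac (f a) a \<one> * (scal (b a k) * ac (f a) a \<one>) = scal (\<beta> a h k * b a (h \<otimes> k)) * ac (f a) a \<one>"
      using b[OF m(1,2)] b[OF m(1,3)] b[OF m(1) H_mult[OF m(2,3)]] by (simp add: scal_scal)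
    moreover have "ac (f a) a \<one> * ac (f a) a \<one> = ac (f a) a \<one>"
      using ac_mult[OF V c(1) one_closed c(1) one_closed] c by simp
    ultimately have "scal (b a h * b a k) * ac (f a) a \<one> = scal (\<beta> a h k * b a (h \<otimes> k)) * ac (f a) a \<one>"
      by (simp only: mult.assoc scal_triple)
    then show ?thesis by (rule scal_ac_cancel[OF V c(1) one_closed f(2)[OF m(1)]])
  qed
  have b_inv: "b (cj x a) h = \<beta> a x h * \<beta> a (x \<otimes> h) (inv x) / \<beta> a x (inv x) * b a (x \<otimes> h \<otimes> inv x)"
    if x: "x \<in> carrier G" and ah: "a \<in> H" "h \<in> H" for x a h
  proof -
    note V = DR[OF f(1)[OF ah(1)]]
    note c = HG[OF ah(1)] HG[OF ah(2)]
    define k where "k = x \<otimes> h \<otimes> inv x"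
    have k: "k \<in> H" "k \<in> carrier G" using H_cj[OF ah(2), of "inv x"] HG x by (auto simp: k_def cj_def)
    have cx: "cj x a \<in> H" by (rule H_cj[OF ah(1) x])
    \<comment> \<open>The product of e(a)x, e(cj x a)h and e(cj x a)x^-1 is evaluated twice: by the
      product rule it is a multiple of e(a)k, and by letting h act as a scalar first it is a
      multiple of e(a).\<close>
    have e1: "ac (f a) a x * ac (f a) (cj x a) h * ac (f a) (cj x a) (inv x) =
      scal (\<beta> a x h * \<beta> a (x \<otimes> h) (inv x)) * ac (f a) a k"
    proof -
      have "cj (x \<otimes> h) a = cj x a" using cj_mult[OF x c(2,1)] cjH[OF ah(2) cx] by simp
      then show ?thesis
        using ac_mult[OF V c(1) x cj_closed[OF x c(1)] c(2)] x c
          ac_mult[OF V c(1), of "x \<otimes> h" "cj x a" "inv x"]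
        by (simp add: mult.assoc scal_scal k_def)
    qed
    have "ac (f a) a x * ac (f a) (cj x a) h * ac (f a) (cj x a) (inv x) =
      scal (b (cj x a) h) * (ac (f a) a x * ac (f a) (cj x a) \<one> * ac (f a) (cj x a) (inv x))"
      by (simp add: key(1)[OF f(1)[OF ah(1)] cx ah(2)] scal_left_commute[of "ac (f a) a x"] mult.assoc)
    also have "ac (f a) a x * ac (f a) (cj x a) \<one> * ac (f a) (cj x a) (inv x) = scal (\<beta> a x (inv x)) * ac (f a) a \<one>"
      using ac_mult[OF V c(1) x, of "cj x a" \<one>] ac_mult[OF V c(1) x, of "cj x a" "inv x"] x c by simp
    finally have "scal (b (cj x a) h * \<beta> a x (inv x)) * ac (f a) a \<one> =
      scal (\<beta> a x h * \<beta> a (x \<otimes> h) (inv x) * b a k) * ac (f a) a \<one>"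
      unfolding e1 b[OF ah(1) k(1)] by (simp only: scal_scal)
    then have "b (cj x a) h * \<beta> a x (inv x) = \<beta> a x h * \<beta> a (x \<otimes> h) (inv x) * b a k"
      by (rule scal_ac_cancel[OF V c(1) one_closed f(2)[OF ah(1)]])
    then show ?thesis using x c unfolding k_def[symmetric] by (simp add: field_simps)
  qed
  \<comment> \<open>The values of \<open>b\<close> outside \<open>H\<close> are arbitrary; cutting
    off makes \<open>B\<close> extensional, as a bicharacter has to be.\<close>
  define B where "B = restrict (\<lambda>(a, h). b a h) (H \<times> H)"
  have Bb: "B (a, h) = b a h" if "a \<in> H" "h \<in> H" for a h using that by (simp add: B_def)
  have alt: "alternating_bicharacter G w H B"
    unfolding alternating_bicharacter_def
  proof (intro conjI ballI)
    show "B \<in> H \<times> H \<rightarrow>\<^sub>E UNIV - {0}" using b_nz by (auto simp: B_def)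
    fix h h1 assume h: "h \<in> H" "h1 \<in> H"
    show "B (h, h1) = inverse (B (h1, h))" using key(2)[OF DU h] b_nz[OF h(2,1)] h by (simp add: Bb field_simps)
    fix h2 assume h2: "h2 \<in> H"
    show "B (h, h1) * B (h, h2) / B (h, h1 \<otimes> h2) = \<beta> h h1 h2"
      using b_mult[OF h h2] b_nz[of h "h1 \<otimes> h2"] h h2 H_mult[OF h(2) h2] by (simp add: Bb field_simps)
  next
    show "B (h, h) = 1" if "h \<in> H" for h using b_self that by (simp add: Bb)
  qed
  have ginv: "G_invariant G w R H B"
    unfolding G_invariant_def
  proof (intro ballI)
    fix x a h assume m: "x \<in> carrier G" "a \<in> H \<inter> R" "h \<in> H"
    have "x \<otimes> h \<otimes> inv x \<in> H" using H_cj[OF m(3), of "inv x"] m(1) by (simp add: cj_def)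
    then show "B (inv x \<otimes> a \<otimes> x, h) = \<beta> a x h * \<beta> a (x \<otimes> h) (inv x) / \<beta> a x (inv x) * B (a, x \<otimes> h \<otimes> inv x)"
      using b_inv[of x a h] H_cj[of a x] m by (simp add: Bb cj_def)
  qed
  have triv: "cohomologically_trivial_on G H w"
  proof -
    have grp: "group (G\<lparr>carrier := H\<rparr>)" by (rule subgroup_imp_group[OF sub])
    have cg: "comm_group (G\<lparr>carrier := H\<rparr>)"
      by (rule group.group_comm_groupI[OF grp]) (use comm in simp)
    \<comment> \<open>Conjugation is trivial on \<open>H\<close>, so \<open>\<beta>\<close> is a
      monomial in three values of \<open>w\<close>, and the multiplicative law \<open>b_mult\<close>
      becomes the hexagon with \<open>b\<close> as braiding.\<close>
    have hex: "b g1 g2 * b g1 g3 * w g2 g1 g3 = b g1 (g2 \<otimes> g3) * (w g1 g2 g3 * w g2 g3 g1)"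
      if g: "g1 \<in> H" "g2 \<in> H" "g3 \<in> H" for g1 g2 g3
    proof -
      have "\<beta> g1 g2 g3 = w g1 g2 g3 * inverse (w g2 g1 g3) * w g2 g3 g1"
        using cjH[OF g(2,1)] cjH[OF H_mult[OF g(2,3)] g(1)] by (simp add: beta_eq)
      then show ?thesis using b_mult[OF g] HG g by (simp add: field_simps)
    qed
    have on_H: "carrier (G\<lparr>carrier := H\<rparr>) = H" "\<one>\<^bsub>G\<lparr>carrier := H\<rparr>\<^esub> = \<one>"
      "\<And>x y. x \<otimes>\<^bsub>G\<lparr>carrier := H\<rparr>\<^esub> y = x \<otimes> y" by simp_all
    interpret EM: abelian_cocycle "G\<lparr>carrier := H\<rparr>" w b
      by (intro abelian_cocycle.intro cg abelian_cocycle_axioms.intro; unfold on_H;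
        rule w_nz pentagon w_one(1) hex b_nz b_self key(2)[OF DU]; blast intro: HG)
    have "finite H" using finite_carrier H.subset finite_subset by blast
    then obtain \<eta> where "EM.trivialises H \<eta>" using EM.trivialises_carrier unfolding on_H by blast
    then have nz: "\<And>a c. a \<in> H \<Longrightarrow> c \<in> H \<Longrightarrow> \<eta> a c \<noteq> 0"
      and co: "\<And>a c d. a \<in> H \<Longrightarrow> c \<in> H \<Longrightarrow> d \<in> H \<Longrightarrow> \<eta> c d * \<eta> a (c \<otimes> d) = w a c d * (\<eta> (a \<otimes> c) d * \<eta> a c)"
      unfolding EM.trivialises_def on_H by blast+
    have "w a c d = \<eta> c d * \<eta> a (c \<otimes> d) / (\<eta> (a \<otimes> c) d * \<eta> a c)" if "a \<in> H" "c \<in> H" "d \<in> H" for a c d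
      using co[OF that] nz[OF that(1,2)] nz[OF H_mult[OF that(1,2)] that(3)] by (simp add: field_simps)
    then show ?thesis unfolding cohomologically_trivial_on_def using nz by blast
  qed
  have supp: "ac V g \<one> = 0" if "V \<in> D" "g \<in> carrier G - H" for V g
    using that unfolding H_def by blast
  have acB: "ac V a h = scal (B (a, h)) * ac V a \<one>" if "V \<in> D" "a \<in> H" "h \<in> H" for V a h
    unfolding Bb[OF that(2,3)] by (rule key(1)[OF that])
  show ?thesis using nas triv alt ginv supp acB by blast
qed

end

section \<open>Lagrangian subcategories contained in L\<close>

context invariant_bicharacter
begin

text \<open>Both categories have dimension |G|, and in one decomposition of \<open>Reg\<close> each
  dimension is the sum over the constituents contained in the category. So the same constituents lie
  in both; every simple object occurs in \<open>Reg\<close>, and every object is a sum of simple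
  ones.\<close>

lemma lagrangian_subset_L:
  assumes D: "lagrangian G w D" and sub: "D \<subseteq> L"
  shows "D = L"
proof -
  have fus: "fusion_subcategory G w D" and dim: "(cat_dim G w D)\<^sup>2 = (card (carrier G))\<^sup>2"
    using D by (auto simp: lagrangian_def isotropic_def cat_dim_Rep)
  have DR: "D \<subseteq> Rep" and Diso: "\<And>V W. V \<in> D \<Longrightarrow> W \<in> Rep \<Longrightarrow> iso_rep G V W \<Longrightarrow> W \<in> D"
    and Dsum: "\<And>Vs. set Vs \<subseteq> D \<Longrightarrow> direct_sum Vs \<in> D"
    using fus unfolding fusion_subcategory_def by blast+
  have dD: "cat_dim G w D = card (carrier G)" using dim by simp
  obtain Ws where Ws: "\<forall>W\<in>set Ws. simple_rep G w W" "decomp Reg Ws"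
    using complete_reducibility[OF Reg_Rep] by blast
  define I J where "I = {i. i < length Ws \<and> Ws ! i \<in> D}" and "J = {i. i < length Ws \<and> Ws ! i \<in> L}"
  have IJ: "I \<subseteq> J" using sub by (auto simp: I_def J_def)
  have "(\<Sum>i\<in>I. vdim (Ws ! i)) = card (carrier G)"
    using cat_dim_eq[OF DR Diso Ws] dD by (simp add: I_def)
  moreover have "(\<Sum>i\<in>J. vdim (Ws ! i)) = card (carrier G)"
    using cat_dim_eq[OF subsetI[OF L_D(1)] L_iso Ws] cat_dim_L by (simp add: J_def)
  moreover have "finite J" by (simp add: J_def)
  ultimately have "(\<Sum>i\<in>J - I. vdim (Ws ! i)) = 0" using sum.subset_diff[OF IJ, of "\<lambda>i. vdim (Ws ! i)"] by simp
  then have "\<forall>i\<in>J - I. vdim (Ws ! i) = 0" using \<open>finite J\<close> by simp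
  moreover have "0 < vdim (Ws ! i)" if "i \<in> J" for i using Ws(1) simpleD(2) that by (auto simp: J_def)
  ultimately have JI: "J \<subseteq> I" by (metis DiffI less_irrefl subsetI)
  have simD: "S \<in> D" if S: "simple_rep G w S" "S \<in> L" for S
  proof -
    have "card {i. i < length Ws \<and> iso_rep G S (Ws ! i)} \<noteq> 0"
      using multiplicity_Reg[OF Ws S(1)] simpleD(2)[OF S(1)] by simp
    then obtain i where i: "i < length Ws" "iso_rep G S (Ws ! i)"
      by (metis (mono_tags, lifting) card.empty empty_Collect_eq)
    have "Ws ! i \<in> Rep" using Ws(1) simpleD(1) i by auto
    then have "Ws ! i \<in> L" using L_iso S(2) i by blast
    then have "Ws ! i \<in> D" using JI i by (auto simp: I_def J_def)
    then show ?thesis using Diso iso_sym[OF i(2)] simpleD(1)[OF S(1)] by blast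
  qed
  have "V \<in> D" if V: "V \<in> L" for V
  proof -
    note RV = L_D(1)[OF V]
    obtain Us where Us: "\<forall>W\<in>set Us. simple_rep G w W" "decomp V Us" using complete_reducibility[OF RV] by blast
    have UR: "set Us \<subseteq> Rep" using Us simpleD(1) by blast
    have "set Us \<subseteq> L" using L_decomp[OF RV UR Us(2)] V by simp
    then have "direct_sum Us \<in> D" using simD Us by (intro Dsum) blast
    moreover have "iso_rep G V (direct_sum Us)" using iso_direct_sum_iff[OF RV UR] Us by simp
    ultimately show ?thesis using Diso iso_sym RV by blast
  qed
  then show ?thesis using sub by blast
qed

lemma support_L: "H = {a \<in> carrier G. \<exists>V\<in>L. ac V a \<one> \<noteq> 0}"
proof (intro equalityI subsetI)
  fix a assume "a \<in> H"
  then show "a \<in> {a \<in> carrier G. \<exists>V\<in>L. ac V a \<one> \<noteq> 0}" using ex_L_support by auto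
next
  fix a assume "a \<in> {a \<in> carrier G. \<exists>V\<in>L. ac V a \<one> \<noteq> 0}"
  then show "a \<in> H" using L_D(2) by blast
qed

end

section \<open>The bijection\<close>

theorem theorem1p2:
  fixes G :: "('g, 'm) monoid_scheme"
    and \<omega> :: "'g \<Rightarrow> 'g \<Rightarrow> 'g \<Rightarrow> 'k::{alg_closed_field, field_char_0}"
    and R :: "'g set"
  assumes "group G" and "finite (carrier G)"
    and "three_cocycle G \<omega>" and "normalized G \<omega>"
    and "class_representatives G R"
  shows "bij_betw (\<lambda>(H, B). subcat_L G \<omega> R H B)
    {(H, B). normal_abelian_subgroup G H \<and> cohomologically_trivial_on G H \<omega> \<and>
             alternating_bicharacter G \<omega> H B \<and> G_invariant G \<omega> R H B}
    {D. lagrangian G \<omega> D}"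
proof -
  interpret twisted_double G \<omega>
    using assms by (intro twisted_double.intro twisted_double_axioms.intro)
  define X where "X = {(H, B). normal_abelian_subgroup G H \<and> cohomologically_trivial_on G H \<omega> \<and>
             alternating_bicharacter G \<omega> H B \<and> G_invariant G \<omega> R H B}"
  have ib: "invariant_bicharacter G \<omega> R H B" if "(H, B) \<in> X" for H B
    using that assms(5) twisted_double_axioms
    by (auto simp: X_def invariant_bicharacter_def invariant_bicharacter_axioms_def)
  have "inj_on (\<lambda>(H, B). subcat_L G \<omega> R H B) X"
  proof (rule inj_onI, clarify)
    fix H B H' B' assume X: "(H, B) \<in> X" "(H', B') \<in> X" and eq: "subcat_L G \<omega> R H B = subcat_L G \<omega> R H' B'"
    interpret I: invariant_bicharacter G \<omega> R H B by (rule ib[OF X(1)])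
    interpret I': invariant_bicharacter G \<omega> R H' B' by (rule ib[OF X(2)])
    have L: "I.L = I'.L" using eq I.subcat_L_eq I'.subcat_L_eq by simp
    have HH: "H = H'" using I.support_L I'.support_L L by simp
    \<comment> \<open>On an object with e(a) nonzero, both values are the scalar by which e(a)h acts
      relative to e(a).\<close>
    have "B (a, h) = B' (a, h)" if ah: "a \<in> H" "h \<in> H" for a h
    proof -
      obtain V where V: "V \<in> I.L" "ac V a \<one>\<^bsub>G\<^esub> \<noteq> 0" using I.ex_L_support[OF ah(1)] by blast
      have "scal (B (a, h)) * ac V a \<one>\<^bsub>G\<^esub> = scal (B' (a, h)) * ac V a \<one>\<^bsub>G\<^esub>"
        using I.L_D(3)[OF V(1) ah] I'.L_D(3)[of V a h] V(1) ah L HH by simp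
      then show ?thesis using scal_ac_cancel[OF I.L_D(1)[OF V(1)] _ _ V(2)] ah by simp
    qed
    moreover have "B \<in> H \<times> H \<rightarrow>\<^sub>E UNIV - {0}" "B' \<in> H \<times> H \<rightarrow>\<^sub>E UNIV - {0}"
      using I.alt I'.alt HH by (simp_all add: alternating_bicharacter_def)
    ultimately have "B = B'" by (intro PiE_ext[of B "H \<times> H" "\<lambda>_. UNIV - {0}" B']) auto
    then show "H = H' \<and> B = B'" using HH by simp
  qed
  moreover have "(\<lambda>(H, B). subcat_L G \<omega> R H B) ` X = {D. lagrangian G \<omega> D}"
  proof (intro equalityI subsetI)
    fix D assume "D \<in> (\<lambda>(H, B). subcat_L G \<omega> R H B) ` X"
    then obtain H B where X: "(H, B) \<in> X" and D: "D = subcat_L G \<omega> R H B" by auto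
    interpret I: invariant_bicharacter G \<omega> R H B by (rule ib[OF X])
    show "D \<in> {D. lagrangian G \<omega> D}" using D I.subcat_L_eq I.L_lagrangian by simp
  next
    fix D assume "D \<in> {D. lagrangian G \<omega> D}"
    then have D: "lagrangian G \<omega> D" by simp
    obtain H B where HB: "(H, B) \<in> X"
      and DL: "\<forall>V\<in>D. (\<forall>g\<in>carrier G - H. ac V g \<one>\<^bsub>G\<^esub> = 0) \<and> (\<forall>a\<in>H. \<forall>h\<in>H. ac V a h = scal (B (a, h)) * ac V a \<one>\<^bsub>G\<^esub>)"
      using lagrangian_ex_bicharacter[OF D assms(5)] unfolding X_def by blast
    interpret I: invariant_bicharacter G \<omega> R H B by (rule ib[OF HB])
    have DR: "D \<subseteq> Rep_double G \<omega>" using D by (simp add: lagrangian_def isotropic_def fusion_subcategory_def)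
    have "D \<subseteq> I.L"
    proof
      fix V assume V: "V \<in> D"
      show "V \<in> I.L" unfolding I.L_conj using DL V DR by blast
    qed
    then have "D = I.L" by (rule I.lagrangian_subset_L[OF D])
    then have "D = (\<lambda>(H, B). subcat_L G \<omega> R H B) (H, B)" using I.subcat_L_eq by simp
    then show "D \<in> (\<lambda>(H, B). subcat_L G \<omega> R H B) ` X" using HB by (rule image_eqI)
  qed
  ultimately show ?thesis unfolding bij_betw_def X_def by blast
qed

end
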